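(* Let $\Gamma=(\mathbb Z/2\ell)^{\mathbb I}$, with $g_i\in\Gamma$ ($i\in\mathbb I$) generators of the corresponding copies of the cyclic group $\mathbb Z/2\ell$, and let $\mathfrak h$ be the abelian Lie algebra over $\mathcal B$ with basis $(t_i)_{i\in\mathbb I}$, so that $U(\mathfrak h)\simeq \mathcal B[t_i: i\in\mathbb I]$. The assignment $$\Psi(g_i)=K_i,\qquad \Psi(t_i)=h_{i,\ell},\qquad i\in\mathbb I,$$ determines an isomorphism of Hopf algebras $\Psi:\mathcal B\Gamma\otimes U(\mathfrak h)\to V^0_{\mathcal B}$.
   Context: Let $\mathbb N=\{1,2,\dots\}$, $\mathbb N_0=\mathbb N\cup\{0\}$, $\theta\in\mathbb N$, $\mathbb I=\{1,\dots,\theta\}$, $\mathcal A=\mathbb Z[v,v^{-1}]$. Put $[s]_v=\frac{v^s-v^{-s}}{v-v^{-1}}$, $[N]_v^!=\prod_{s=1}^N[s]_v$, $\left[{N\atop i}\right]_v=\frac{[N]_v^!}{[N-i]_v^![i]_v^!}\in\mathcal A$ for $0\le i\le N$, and $\left[{N\atop i}\right]_v=0$ for $i>N$ (with $\left[{N\atop 0}\right]_v=1$ always). $V^0$ is the $\mathcal A$-algebra with generators $K_i$, $K_i^{-1}$, $\left[{K_i;c\atop t}\right]$ ($i\in\mathbb I$, $c\in\mathbb Z$, $t\in\mathbb N_0$) and relations, for all $i\in\mathbb I$: (g5) $(v-v^{-1})\left[{K_i;0\atop 1}\right]=K_i-K_i^{-1}$; (g6) all generators commute with each other; (g7) $K_iK_i^{-1}=1$,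 $\left[{K_i;0\atop 0}\right]=1$; (g8) $\left[{t+t'\atop t}\right]_v\left[{K_i;0\atop t+t'}\right]=\sum_{0\le j\le t'}(-1)^jv^{t(t'-j)}\left[{t+j-1\atop j}\right]_vK_i^j\left[{K_i;0\atop t}\right]\left[{K_i;0\atop t'-j}\right]$ for $t\ge1$, $t'\ge0$; (g9) $\left[{K_i;-c\atop t}\right]=\sum_{0\le j\le t}(-1)^jv^{c(t-j)}\left[{c+j-1\atop j}\right]_vK_i^j\left[{K_i;0\atop t-j}\right]$ for $t\ge0$, $c\ge1$; (g10) $\left[{K_i;c\atop t}\right]=\sum_{0\le j\le t}v^{c(t-j)}\left[{c\atop j}\right]_vK_i^{-j}\left[{K_i;0\atop t-j}\right]$ for $t\ge0$, $c\ge0$. $V^0$ is a Hopf algebra over $\mathcal A$ with comultiplication determined by $\Delta(K_i^{\pm1})=K_i^{\pm1}\otimes K_i^{\pm1}$. Write $k_{i,t}=\left[{K_i;0\atop t}\right]$. Fix $\ell\in\mathbb N$; set $\ell'=\ell$ if $\ell$ is odd and $\ell'=2\ell$ if $\ell$ is even. Let $\phi_{\ell'}\in\mathbb Z[v]$ be the $\ell'$-th cyclotomic polynomial, $\mathcal B$ the field of fractions of $\mathcal A/\langle\phi_{\ell'}\rangle$, and $\xi$ the image of $v$ in $\mathcal B$. Assume $\xi^2\ne1$. Put $V^0_{\mathcal B}=V^0\otimes_{\mathcal A}\mathcal B$, a Hopf algebra over $\mathcal B$; the images of $K_i,k_{i,t}$ in $V^0_{\mathcal B}$ are denoted by the same symbols.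 For $n\in\mathbb N$ let $\phi_n(j)=0$ if $n-j$ is even and $\phi_n(j)=1$ if $n-j$ is odd. Define $p_{n,s}\in\mathbb Z[v,v^{-1}]$, $1\le s\le n$, recursively by $p_{n,1}=v^{-\phi_n(1)}$ and, for $s>1$, $$p_{n,s}=\frac{v^{ns}-v^{-ns}}{v^{\phi_n(s)s}(v^n-v^{-n})}-\sum_{t=1}^{s-1}p_{n,t}\left[{s\atop t}\right]_vv^{(\phi_n(t)-\phi_n(s))s}.$$ Then $h_{i,n}=\frac1n\Big(\sum_{s=1}^np_{n,s}\,k_{i,s}K_i^{\phi_n(s)}\Big)K_i^n$, and $h_{i,\ell}\in V^0_{\mathcal B}$ is the specialization at $v\mapsto\xi$ of this expression for $n=\ell$. (Before specialization, $h_{i,n}=\frac{K_i^{2n}-1}{n(v^n-v^{-n})}$.) In $\mathcal B\Gamma\otimes U(\mathfrak h)$ the $g_i$ are group-like and the $t_i$ are primitive. *)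

theory Defs
  imports
    Complex_Main
    "HOL-Algebra.Module"
    "HOL-Algebra.QuotRing"
    "HOL-Algebra.Product_Groups"
    "HOL-Computational_Algebra.Polynomial"
    "HOL-Computational_Algebra.Polynomial_Factorial"
begin

section \<open>Associative algebras over a commutative ring\<close>

text \<open>
  An algebra over \<open>R\<close> is a record of type \<open>('r, 'a) module\<close> in which the ring operations and
  the scalar multiplication are all meaningful. The locale \<open>algebra\<close> of HOL-Algebra is
  commutative, so the general notion is introduced here.
\<close>

locale assoc_algebra = Module.module R M + M: ring M for R (structure) and M (structure) +
  assumes smult_mult_left:
      "\<lbrakk>a \<in> carrier R; x \<in> carrier M; y \<in> carrier M\<rbrakk>
        \<Longrightarrow> (a \<odot>\<^bsub>M\<^esub> x) \<otimes>\<^bsub>M\<^esub> y = a \<odot>\<^bsub>M\<^esub> (x \<otimes>\<^bsub>M\<^esub> y)"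
    and smult_mult_right:
      "\<lbrakk>a \<in> carrier R; x \<in> carrier M; y \<in> carrier M\<rbrakk>
        \<Longrightarrow> x \<otimes>\<^bsub>M\<^esub> (a \<odot>\<^bsub>M\<^esub> y) = a \<odot>\<^bsub>M\<^esub> (x \<otimes>\<^bsub>M\<^esub> y)"

definition alg_hom ::
  "('r, 'k) ring_scheme \<Rightarrow> ('r, 'a, 'm) module_scheme \<Rightarrow> ('r, 'b, 'n) module_scheme \<Rightarrow> ('a \<Rightarrow> 'b) set"
  where "alg_hom R M N =
    {f \<in> ring_hom M N. \<forall>a\<in>carrier R. \<forall>x\<in>carrier M. f (a \<odot>\<^bsub>M\<^esub> x) = a \<odot>\<^bsub>N\<^esub> f x}"

definition regular_alg :: "('r, 'k) ring_scheme \<Rightarrow> ('r, 'r) module"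
  where "regular_alg R =
    \<lparr>carrier = carrier R, monoid.mult = monoid.mult R, one = one R, zero = zero R, add = add R,
     module.smult = monoid.mult R\<rparr>"

definition restrict_scalars :: "('r \<Rightarrow> 's) \<Rightarrow> ('s, 'a, 'm) module_scheme \<Rightarrow> ('r, 'a) module"
  where "restrict_scalars f M =
    \<lparr>carrier = carrier M, monoid.mult = monoid.mult M, one = one M, zero = zero M, add = add M,
     module.smult = (\<lambda>a x. f a \<odot>\<^bsub>M\<^esub> x)\<rparr>"

subsection \<open>Monoid algebras and presentations\<close>

text \<open>Elements are finitely supported functions on the monoid, with the convolution product.\<close>

definition monoid_algebra ::
  "('r, 'k) ring_scheme \<Rightarrow> ('g, 'm) monoid_scheme \<Rightarrow> ('r, 'g \<Rightarrow> 'r) module"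
  where "monoid_algebra R G =
    \<lparr>carrier = {f. range f \<subseteq> carrier R \<and> (\<forall>x. x \<notin> carrier G \<longrightarrow> f x = \<zero>\<^bsub>R\<^esub>)
                  \<and> finite {x. f x \<noteq> \<zero>\<^bsub>R\<^esub>}},
     monoid.mult = (\<lambda>f g x. \<Oplus>\<^bsub>R\<^esub>p\<in>{(y, z). f y \<noteq> \<zero>\<^bsub>R\<^esub> \<and> g z \<noteq> \<zero>\<^bsub>R\<^esub> \<and> y \<otimes>\<^bsub>G\<^esub> z = x}.
                       f (fst p) \<otimes>\<^bsub>R\<^esub> g (snd p)),
     one = (\<lambda>x. if x = \<one>\<^bsub>G\<^esub> then \<one>\<^bsub>R\<^esub> else \<zero>\<^bsub>R\<^esub>),
     zero = (\<lambda>x. \<zero>\<^bsub>R\<^esub>),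
     add = (\<lambda>f g x. f x \<oplus>\<^bsub>R\<^esub> g x),
     module.smult = (\<lambda>a f x. a \<otimes>\<^bsub>R\<^esub> f x)\<rparr>"

definition basis_elt :: "('r, 'k) ring_scheme \<Rightarrow> 'g \<Rightarrow> 'g \<Rightarrow> 'r"
  where "basis_elt R g = (\<lambda>x. if x = g then \<one>\<^bsub>R\<^esub> else \<zero>\<^bsub>R\<^esub>)"

definition lin_ext ::
  "('r, 'k) ring_scheme \<Rightarrow> ('r, 'a, 'm) module_scheme \<Rightarrow> ('g \<Rightarrow> 'a) \<Rightarrow> ('g \<Rightarrow> 'r) \<Rightarrow> 'a"
  where "lin_ext R P h f = (\<Oplus>\<^bsub>P\<^esub>g\<in>{g. f g \<noteq> \<zero>\<^bsub>R\<^esub>}. f g \<odot>\<^bsub>P\<^esub> h g)"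

definition free_monoid :: "'x set \<Rightarrow> 'x list monoid"
  where "free_monoid X = \<lparr>carrier = lists X, monoid.mult = (@), one = []\<rparr>"

definition free_alg :: "('r, 'k) ring_scheme \<Rightarrow> 'x set \<Rightarrow> ('r, 'x list \<Rightarrow> 'r) module"
  where "free_alg R X = monoid_algebra R (free_monoid X)"

text \<open>The quotient ring by a two-sided ideal, with the induced scalar multiplication.\<close>

definition alg_quot :: "('r, 'a, 'm) module_scheme \<Rightarrow> 'a set \<Rightarrow> ('r, 'a set) module"
  where "alg_quot M I =
    \<lparr>carrier = carrier (M Quot I), monoid.mult = monoid.mult (M Quot I), one = one (M Quot I),
     zero = zero (M Quot I), add = add (M Quot I),
     module.smult = (\<lambda>a C. \<Union>x\<in>C. I +>\<^bsub>M\<^esub> (a \<odot>\<^bsub>M\<^esub> x))\<rparr>"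

definition rel_ideal :: "('r, 'a, 'm) module_scheme \<Rightarrow> ('a \<times> 'a) set \<Rightarrow> 'a set"
  where "rel_ideal M E = Idl\<^bsub>M\<^esub> {x \<ominus>\<^bsub>M\<^esub> y | x y. (x, y) \<in> E}"

text \<open>A pair \<open>(x, y)\<close> in \<open>E\<close> stands for the relation \<open>x = y\<close>.\<close>

definition rel_quot :: "('r, 'a, 'm) module_scheme \<Rightarrow> ('a \<times> 'a) set \<Rightarrow> ('r, 'a set) module"
  where "rel_quot M E = alg_quot M (rel_ideal M E)"

definition rel_class :: "('r, 'a, 'm) module_scheme \<Rightarrow> ('a \<times> 'a) set \<Rightarrow> 'a \<Rightarrow> 'a set"
  where "rel_class M E x = rel_ideal M E +>\<^bsub>M\<^esub> x"

text \<open>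
  The linear map induced by \<open>lin_ext R P h\<close> on a quotient of a monoid algebra. It is used only
  where the image of each coset is a singleton.
\<close>

definition coset_lift ::
  "('r, 'k) ring_scheme \<Rightarrow> ('r, 'a, 'm) module_scheme \<Rightarrow> ('g \<Rightarrow> 'a) \<Rightarrow> ('g \<Rightarrow> 'r) set \<Rightarrow> 'a"
  where "coset_lift R P h C = the_elem (lin_ext R P h ` C)"

subsection \<open>Tensor products\<close>

text \<open>
  The free module on \<open>M \<times> N\<close> is an algebra with product \<open>(x, y) (x', y') = (x x', y y')\<close>. The
  submodule spanned by the bilinearity relations is stable under multiplication by pairs, so it
  coincides with the ideal that these relations generate.
\<close>

inductive_set tensor_rel ::
  "('r, 'k) ring_scheme \<Rightarrow> ('r, 'a, 'm) module_scheme \<Rightarrow> ('r, 'b, 'n) module_scheme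
    \<Rightarrow> (('a \<times> 'b \<Rightarrow> 'r) \<times> ('a \<times> 'b \<Rightarrow> 'r)) set"
  for R :: "('r, 'k) ring_scheme" and M :: "('r, 'a, 'm) module_scheme"
    and N :: "('r, 'b, 'n) module_scheme"
  where
    add_left: "\<lbrakk>x \<in> carrier M; x' \<in> carrier M; y \<in> carrier N\<rbrakk> \<Longrightarrow>
      (basis_elt R (x \<oplus>\<^bsub>M\<^esub> x', y),
       basis_elt R (x, y) \<oplus>\<^bsub>monoid_algebra R (M \<times>\<times> N)\<^esub> basis_elt R (x', y)) \<in> tensor_rel R M N"
  | add_right: "\<lbrakk>x \<in> carrier M; y \<in> carrier N; y' \<in> carrier N\<rbrakk> \<Longrightarrow>
      (basis_elt R (x, y \<oplus>\<^bsub>N\<^esub> y'),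
       basis_elt R (x, y) \<oplus>\<^bsub>monoid_algebra R (M \<times>\<times> N)\<^esub> basis_elt R (x, y')) \<in> tensor_rel R M N"
  | smult_left: "\<lbrakk>a \<in> carrier R; x \<in> carrier M; y \<in> carrier N\<rbrakk> \<Longrightarrow>
      (basis_elt R (a \<odot>\<^bsub>M\<^esub> x, y),
       a \<odot>\<^bsub>monoid_algebra R (M \<times>\<times> N)\<^esub> basis_elt R (x, y)) \<in> tensor_rel R M N"
  | smult_right: "\<lbrakk>a \<in> carrier R; x \<in> carrier M; y \<in> carrier N\<rbrakk> \<Longrightarrow>
      (basis_elt R (x, a \<odot>\<^bsub>N\<^esub> y),
       a \<odot>\<^bsub>monoid_algebra R (M \<times>\<times> N)\<^esub> basis_elt R (x, y)) \<in> tensor_rel R M N"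

definition tensor ::
  "('r, 'k) ring_scheme \<Rightarrow> ('r, 'a, 'm) module_scheme \<Rightarrow> ('r, 'b, 'n) module_scheme
    \<Rightarrow> ('r, ('a \<times> 'b \<Rightarrow> 'r) set) module"
  where "tensor R M N = rel_quot (monoid_algebra R (M \<times>\<times> N)) (tensor_rel R M N)"

definition tens ::
  "('r, 'k) ring_scheme \<Rightarrow> ('r, 'a, 'm) module_scheme \<Rightarrow> ('r, 'b, 'n) module_scheme
    \<Rightarrow> 'a \<Rightarrow> 'b \<Rightarrow> ('a \<times> 'b \<Rightarrow> 'r) set"
  where "tens R M N x y = rel_class (monoid_algebra R (M \<times>\<times> N)) (tensor_rel R M N) (basis_elt R (x, y))"

definition tensor_map ::
  "('r, 'k) ring_scheme \<Rightarrow> ('r, 'c, 'm) module_scheme \<Rightarrow> ('r, 'd, 'n) module_scheme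
    \<Rightarrow> ('a \<Rightarrow> 'c) \<Rightarrow> ('b \<Rightarrow> 'd) \<Rightarrow> ('a \<times> 'b \<Rightarrow> 'r) set \<Rightarrow> ('c \<times> 'd \<Rightarrow> 'r) set"
  where "tensor_map R M' N' f g =
    coset_lift R (tensor R M' N') (\<lambda>(x, y). tens R M' N' (f x) (g y))"

definition tensor_assoc ::
  "('r, 'k) ring_scheme \<Rightarrow> ('r, 'a, 'm) module_scheme
    \<Rightarrow> (('a \<times> 'a \<Rightarrow> 'r) set \<times> 'a \<Rightarrow> 'r) set \<Rightarrow> ('a \<times> ('a \<times> 'a \<Rightarrow> 'r) set \<Rightarrow> 'r) set"
  where "tensor_assoc R M =
    coset_lift R (tensor R M (tensor R M M))
      (\<lambda>(u, z). coset_lift R (tensor R M (tensor R M M))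
         (\<lambda>(x, y). tens R M (tensor R M M) x (tens R M M y z)) u)"

text \<open>The algebra \<open>M \<otimes> B\<close> over \<open>B\<close>, for a ring homomorphism \<open>f\<close> from \<open>R\<close> to \<open>B\<close>.\<close>

definition base_change ::
  "('r, 'k) ring_scheme \<Rightarrow> ('r, 'a, 'm) module_scheme \<Rightarrow> ('b, 'l) ring_scheme \<Rightarrow> ('r \<Rightarrow> 'b)
    \<Rightarrow> ('b, ('a \<times> 'b \<Rightarrow> 'r) set) module"
  where "base_change R M B f =
    (let BR = restrict_scalars f (regular_alg B); T = tensor R M BR in
     \<lparr>carrier = carrier T, monoid.mult = monoid.mult T, one = one T, zero = zero T, add = add T,
      module.smult = (\<lambda>b z. tens R M BR \<one>\<^bsub>M\<^esub> b \<otimes>\<^bsub>T\<^esub> z)\<rparr>)"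

definition base_change_incl ::
  "('r, 'k) ring_scheme \<Rightarrow> ('r, 'a, 'm) module_scheme \<Rightarrow> ('b, 'l) ring_scheme \<Rightarrow> ('r \<Rightarrow> 'b)
    \<Rightarrow> 'a \<Rightarrow> ('a \<times> 'b \<Rightarrow> 'r) set"
  where "base_change_incl R M B f x = tens R M (restrict_scalars f (regular_alg B)) x \<one>\<^bsub>B\<^esub>"

section \<open>Hopf algebras\<close>

record ('r, 'a) hopf = "('r, 'a) module" +
  comult :: "'a \<Rightarrow> ('a \<times> 'a \<Rightarrow> 'r) set"
  counit :: "'a \<Rightarrow> 'r"
  antipode :: "'a \<Rightarrow> 'a"

definition with_hopf ::
  "('r, 'a, 'm) module_scheme \<Rightarrow> ('a \<Rightarrow> ('a \<times> 'a \<Rightarrow> 'r) set) \<Rightarrow> ('a \<Rightarrow> 'r) \<Rightarrow> ('a \<Rightarrow> 'a)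
    \<Rightarrow> ('r, 'a) hopf"
  where "with_hopf M d e s =
    \<lparr>carrier = carrier M, monoid.mult = monoid.mult M, one = one M, zero = zero M, add = add M,
     module.smult = module.smult M, comult = d, counit = e, antipode = s\<rparr>"

locale hopf_algebra = assoc_algebra R H
  for R (structure) and H :: "('r, 'a, 'm) hopf_scheme" (structure) +
  assumes comult_hom: "comult H \<in> alg_hom R H (tensor R H H)"
    and counit_hom: "counit H \<in> alg_hom R H (regular_alg R)"
    and antipode_closed: "antipode H \<in> carrier H \<rightarrow> carrier H"
    and antipode_add: "\<lbrakk>x \<in> carrier H; y \<in> carrier H\<rbrakk>
      \<Longrightarrow> antipode H (x \<oplus>\<^bsub>H\<^esub> y) = antipode H x \<oplus>\<^bsub>H\<^esub> antipode H y"
    and antipode_smult: "\<lbrakk>a \<in> carrier R; x \<in> carrier H\<rbrakk>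
      \<Longrightarrow> antipode H (a \<odot>\<^bsub>H\<^esub> x) = a \<odot>\<^bsub>H\<^esub> antipode H x"
    and coassoc: "x \<in> carrier H \<Longrightarrow>
      tensor_assoc R H (tensor_map R (tensor R H H) H (comult H) (\<lambda>y. y) (comult H x))
      = tensor_map R H (tensor R H H) (\<lambda>y. y) (comult H) (comult H x)"
    and counit_left: "x \<in> carrier H \<Longrightarrow>
      coset_lift R H (\<lambda>(y, z). counit H y \<odot>\<^bsub>H\<^esub> z) (comult H x) = x"
    and counit_right: "x \<in> carrier H \<Longrightarrow>
      coset_lift R H (\<lambda>(y, z). counit H z \<odot>\<^bsub>H\<^esub> y) (comult H x) = x"
    and antipode_left: "x \<in> carrier H \<Longrightarrow>
      coset_lift R H (\<lambda>(y, z). antipode H y \<otimes>\<^bsub>H\<^esub> z) (comult H x) = counit H x \<odot>\<^bsub>H\<^esub> \<one>\<^bsub>H\<^esub>"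
    and antipode_right: "x \<in> carrier H \<Longrightarrow>
      coset_lift R H (\<lambda>(y, z). y \<otimes>\<^bsub>H\<^esub> antipode H z) (comult H x) = counit H x \<odot>\<^bsub>H\<^esub> \<one>\<^bsub>H\<^esub>"

definition hopf_iso ::
  "('r, 'k) ring_scheme \<Rightarrow> ('r, 'a, 'm) hopf_scheme \<Rightarrow> ('r, 'b, 'n) hopf_scheme \<Rightarrow> ('a \<Rightarrow> 'b) set"
  where "hopf_iso R H H' =
    {f \<in> alg_hom R H H'. bij_betw f (carrier H) (carrier H') \<and>
       (\<forall>x\<in>carrier H. comult H' (f x) = tensor_map R H' H' f f (comult H x)
                    \<and> counit H' (f x) = counit H x
                    \<and> antipode H' (f x) = f (antipode H x))}"

definition group_hopf ::
  "('r, 'k) ring_scheme \<Rightarrow> ('g, 'm) monoid_scheme \<Rightarrow> ('r, 'g \<Rightarrow> 'r) hopf"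
  where "group_hopf R G =
    (let M = monoid_algebra R G in
     with_hopf M
       (lin_ext R (tensor R M M) (\<lambda>g. tens R M M (basis_elt R g) (basis_elt R g)))
       (lin_ext R (regular_alg R) (\<lambda>g. \<one>\<^bsub>R\<^esub>))
       (lin_ext R M (\<lambda>g. basis_elt R (inv\<^bsub>G\<^esub> g))))"

text \<open>
  A Lie algebra \<open>L\<close> is encoded as a module record whose \<open>mult\<close> field is the bracket and whose
  \<open>one\<close> field is meaningless. Its enveloping algebra is the tensor algebra modulo
  \<open>x y - y x = [x, y]\<close>; the first two relations below present the tensor algebra as a
  quotient of the free algebra on the set of all elements of \<open>L\<close>.
\<close>

inductive_set env_rel ::
  "('r, 'k) ring_scheme \<Rightarrow> ('r, 'a, 'm) module_scheme \<Rightarrow> (('a list \<Rightarrow> 'r) \<times> ('a list \<Rightarrow> 'r)) set"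
  for R :: "('r, 'k) ring_scheme" and L :: "('r, 'a, 'm) module_scheme"
  where
    add: "\<lbrakk>x \<in> carrier L; y \<in> carrier L\<rbrakk> \<Longrightarrow>
      (basis_elt R [x \<oplus>\<^bsub>L\<^esub> y],
       basis_elt R [x] \<oplus>\<^bsub>free_alg R (carrier L)\<^esub> basis_elt R [y]) \<in> env_rel R L"
  | smult: "\<lbrakk>a \<in> carrier R; x \<in> carrier L\<rbrakk> \<Longrightarrow>
      (basis_elt R [a \<odot>\<^bsub>L\<^esub> x],
       a \<odot>\<^bsub>free_alg R (carrier L)\<^esub> basis_elt R [x]) \<in> env_rel R L"
  | bracket: "\<lbrakk>x \<in> carrier L; y \<in> carrier L\<rbrakk> \<Longrightarrow>
      (basis_elt R [x] \<otimes>\<^bsub>free_alg R (carrier L)\<^esub> basis_elt R [y]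
         \<ominus>\<^bsub>free_alg R (carrier L)\<^esub> basis_elt R [y] \<otimes>\<^bsub>free_alg R (carrier L)\<^esub> basis_elt R [x],
       basis_elt R [x \<otimes>\<^bsub>L\<^esub> y]) \<in> env_rel R L"

definition env_alg ::
  "('r, 'k) ring_scheme \<Rightarrow> ('r, 'a, 'm) module_scheme \<Rightarrow> ('r, ('a list \<Rightarrow> 'r) set) module"
  where "env_alg R L = rel_quot (free_alg R (carrier L)) (env_rel R L)"

definition env_incl ::
  "('r, 'k) ring_scheme \<Rightarrow> ('r, 'a, 'm) module_scheme \<Rightarrow> 'a \<Rightarrow> ('a list \<Rightarrow> 'r) set"
  where "env_incl R L x = rel_class (free_alg R (carrier L)) (env_rel R L) (basis_elt R [x])"

definition word_prod :: "('a, 'm) monoid_scheme \<Rightarrow> ('x \<Rightarrow> 'a) \<Rightarrow> 'x list \<Rightarrow> 'a"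
  where "word_prod M f w = foldr (\<lambda>x y. f x \<otimes>\<^bsub>M\<^esub> y) w \<one>\<^bsub>M\<^esub>"

text \<open>Elements of \<open>L\<close> are primitive, and the antipode is the anti-automorphism negating them.\<close>

definition env_hopf ::
  "('r, 'k) ring_scheme \<Rightarrow> ('r, 'a, 'm) module_scheme \<Rightarrow> ('r, ('a list \<Rightarrow> 'r) set) hopf"
  where "env_hopf R L =
    (let U = env_alg R L; i = env_incl R L; UU = tensor R U U in
     with_hopf U
       (coset_lift R UU (word_prod UU (\<lambda>x. tens R U U (i x) \<one>\<^bsub>U\<^esub> \<oplus>\<^bsub>UU\<^esub> tens R U U \<one>\<^bsub>U\<^esub> (i x))))
       (coset_lift R (regular_alg R) (word_prod R (\<lambda>x. \<zero>\<^bsub>R\<^esub>)))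
       (coset_lift R U (\<lambda>w. word_prod U (\<lambda>x. \<ominus>\<^bsub>U\<^esub> i x) (rev w))))"

text \<open>
  The comultiplication sends \<open>x \<otimes> y\<close> to the sum of the elements
  \<open>(x1 \<otimes> y1) \<otimes> (x2 \<otimes> y2)\<close> in Sweedler notation.
\<close>

definition tensor_hopf ::
  "('r, 'k) ring_scheme \<Rightarrow> ('r, 'a, 'm) hopf_scheme \<Rightarrow> ('r, 'b, 'n) hopf_scheme
    \<Rightarrow> ('r, ('a \<times> 'b \<Rightarrow> 'r) set) hopf"
  where "tensor_hopf R H H' =
    (let T = tensor R H H'; TT = tensor R T T in
     with_hopf T
       (coset_lift R TT (\<lambda>(x, y).
          coset_lift R TT (\<lambda>(x1, x2).
            coset_lift R TT (\<lambda>(y1, y2). tens R T T (tens R H H' x1 y1) (tens R H H' x2 y2))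
              (comult H' y)) (comult H x)))
       (coset_lift R (regular_alg R) (\<lambda>(x, y). counit H x \<otimes>\<^bsub>R\<^esub> counit H' y))
       (tensor_map R H H' (antipode H) (antipode H')))"

definition base_change_hopf ::
  "('r, 'k) ring_scheme \<Rightarrow> ('r, 'a, 'm) hopf_scheme \<Rightarrow> ('b, 'l) ring_scheme \<Rightarrow> ('r \<Rightarrow> 'b)
    \<Rightarrow> ('b, ('a \<times> 'b \<Rightarrow> 'r) set) hopf"
  where "base_change_hopf R H B f =
    (let BR = restrict_scalars f (regular_alg B);
         T = base_change R H B f; TT = tensor B T T; j = base_change_incl R H B f in
     with_hopf T
       (coset_lift R (restrict_scalars f TT) (\<lambda>(x, b).
          b \<odot>\<^bsub>TT\<^esub> coset_lift R (restrict_scalars f TT) (\<lambda>(y, z). tens B T T (j y) (j z)) (comult H x)))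
       (coset_lift R BR (\<lambda>(x, b). f (counit H x) \<otimes>\<^bsub>B\<^esub> b))
       (tensor_map R H BR (antipode H) (\<lambda>b. b)))"

section \<open>Laurent polynomials and quantum numbers\<close>

text \<open>
  The ring of integral Laurent polynomials is realised as the subring of the field of rational
  functions consisting of the fractions \<open>p / v ^ n\<close> with \<open>p\<close> a polynomial.
\<close>

type_synonym qfun = "int poly fract"

definition qv :: qfun
  where "qv = to_fract [:0, 1:]"

definition laurent :: "qfun ring"
  where "laurent =
    \<lparr>carrier = {to_fract p / qv ^ n | p n. True}, monoid.mult = (*), one = 1, zero = 0, add = (+)\<rparr>"

definition qint :: "nat \<Rightarrow> qfun"
  where "qint s = (qv ^ s - inverse qv ^ s) / (qv - inverse qv)"

definition qfact :: "nat \<Rightarrow> qfun"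
  where "qfact N = (\<Prod>s = 1..N. qint s)"

definition qbinom :: "nat \<Rightarrow> nat \<Rightarrow> qfun"
  where "qbinom N i = (if i \<le> N then qfact N / (qfact (N - i) * qfact i) else 0)"

definition cyclotomic :: "nat \<Rightarrow> int poly"
  where "cyclotomic n =
    (THE p. map_poly of_int p
          = (\<Prod>k\<in>{k\<in>{1..n}. coprime k n}. [:- cis (2 * pi * real k / real n), 1:]))"

section \<open>The algebra \<open>V\<^sup>0\<close>\<close>

text \<open>\<open>Kbin i c t\<close> is the generator written as a bracket with entries \<open>K\<^sub>i; c\<close> above \<open>t\<close>.\<close>

datatype V0_gen = Kgen nat | Kinv nat | Kbin nat int nat

definition V0_gens :: "nat \<Rightarrow> V0_gen set"
  where "V0_gens \<theta> = (\<Union>i\<in>{1..\<theta>}. {Kgen i, Kinv i} \<union> {Kbin i c t | c t. True})"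

abbreviation V0_free :: "nat \<Rightarrow> (qfun, V0_gen list \<Rightarrow> qfun) module"
  where "V0_free \<theta> \<equiv> free_alg laurent (V0_gens \<theta>)"

abbreviation V0_var :: "V0_gen \<Rightarrow> V0_gen list \<Rightarrow> qfun"
  where "V0_var x \<equiv> basis_elt laurent [x]"

inductive_set V0_rel :: "nat \<Rightarrow> ((V0_gen list \<Rightarrow> qfun) \<times> (V0_gen list \<Rightarrow> qfun)) set"
  for \<theta> :: nat
  where
    bin_one: "i \<in> {1..\<theta>} \<Longrightarrow>
      ((qv - inverse qv) \<odot>\<^bsub>V0_free \<theta>\<^esub> V0_var (Kbin i 0 1),
       V0_var (Kgen i) \<ominus>\<^bsub>V0_free \<theta>\<^esub> V0_var (Kinv i)) \<in> V0_rel \<theta>"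
  | commute: "\<lbrakk>x \<in> V0_gens \<theta>; y \<in> V0_gens \<theta>\<rbrakk> \<Longrightarrow>
      (V0_var x \<otimes>\<^bsub>V0_free \<theta>\<^esub> V0_var y, V0_var y \<otimes>\<^bsub>V0_free \<theta>\<^esub> V0_var x) \<in> V0_rel \<theta>"
  | inverse: "i \<in> {1..\<theta>} \<Longrightarrow>
      (V0_var (Kgen i) \<otimes>\<^bsub>V0_free \<theta>\<^esub> V0_var (Kinv i), \<one>\<^bsub>V0_free \<theta>\<^esub>) \<in> V0_rel \<theta>"
  | bin_zero: "i \<in> {1..\<theta>} \<Longrightarrow> (V0_var (Kbin i 0 0), \<one>\<^bsub>V0_free \<theta>\<^esub>) \<in> V0_rel \<theta>"
  | bin_mult: "\<lbrakk>i \<in> {1..\<theta>}; t \<ge> 1\<rbrakk> \<Longrightarrow>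
      (qbinom (t + t') t \<odot>\<^bsub>V0_free \<theta>\<^esub> V0_var (Kbin i 0 (t + t')),
       \<Oplus>\<^bsub>V0_free \<theta>\<^esub>j\<in>{0..t'}. ((-1) ^ j * qv ^ (t * (t' - j)) * qbinom (t + j - 1) j) \<odot>\<^bsub>V0_free \<theta>\<^esub>
         (V0_var (Kgen i) [^]\<^bsub>V0_free \<theta>\<^esub> j \<otimes>\<^bsub>V0_free \<theta>\<^esub> V0_var (Kbin i 0 t)
            \<otimes>\<^bsub>V0_free \<theta>\<^esub> V0_var (Kbin i 0 (t' - j)))) \<in> V0_rel \<theta>"
  | bin_neg: "\<lbrakk>i \<in> {1..\<theta>}; c \<ge> 1\<rbrakk> \<Longrightarrow>
      (V0_var (Kbin i (- int c) t),
       \<Oplus>\<^bsub>V0_free \<theta>\<^esub>j\<in>{0..t}. ((-1) ^ j * qv ^ (c * (t - j)) * qbinom (c + j - 1) j) \<odot>\<^bsub>V0_free \<theta>\<^esub>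
         (V0_var (Kgen i) [^]\<^bsub>V0_free \<theta>\<^esub> j \<otimes>\<^bsub>V0_free \<theta>\<^esub> V0_var (Kbin i 0 (t - j)))) \<in> V0_rel \<theta>"
  | bin_nonneg: "i \<in> {1..\<theta>} \<Longrightarrow>
      (V0_var (Kbin i (int c) t),
       \<Oplus>\<^bsub>V0_free \<theta>\<^esub>j\<in>{0..t}. (qv ^ (c * (t - j)) * qbinom c j) \<odot>\<^bsub>V0_free \<theta>\<^esub>
         (V0_var (Kinv i) [^]\<^bsub>V0_free \<theta>\<^esub> j \<otimes>\<^bsub>V0_free \<theta>\<^esub> V0_var (Kbin i 0 (t - j)))) \<in> V0_rel \<theta>"

definition V0 :: "nat \<Rightarrow> (qfun, (V0_gen list \<Rightarrow> qfun) set) module"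
  where "V0 \<theta> = rel_quot (V0_free \<theta>) (V0_rel \<theta>)"

definition V0_elt :: "nat \<Rightarrow> V0_gen \<Rightarrow> (V0_gen list \<Rightarrow> qfun) set"
  where "V0_elt \<theta> x = rel_class (V0_free \<theta>) (V0_rel \<theta>) (V0_var x)"

section \<open>Specialization at a root of unity\<close>

definition lprime :: "nat \<Rightarrow> nat"
  where "lprime l = (if odd l then l else 2 * l)"

definition cyc_ideal :: "nat \<Rightarrow> qfun set"
  where "cyc_ideal l = Idl\<^bsub>laurent\<^esub> {to_fract (cyclotomic (lprime l))}"

definition is_fraction_field ::
  "('a, 'm) ring_scheme \<Rightarrow> ('b, 'n) ring_scheme \<Rightarrow> ('a \<Rightarrow> 'b) \<Rightarrow> bool"
  where "is_fraction_field D F \<iota> \<longleftrightarrow>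
    field F \<and> \<iota> \<in> ring_hom D F \<and> inj_on \<iota> (carrier D) \<and>
    (\<forall>x\<in>carrier F. \<exists>a\<in>carrier D. \<exists>b\<in>carrier D - {\<zero>\<^bsub>D\<^esub>}. x = \<iota> a \<otimes>\<^bsub>F\<^esub> inv\<^bsub>F\<^esub> (\<iota> b))"

text \<open>
  A field of fractions is determined only up to isomorphism, so it is given by a field together
  with the embedding \<open>\<iota>\<close> of the domain \<open>laurent Quot cyc_ideal l\<close>; \<open>spec l \<iota>\<close> is the
  resulting homomorphism on \<open>laurent\<close>, with \<open>spec l \<iota> qv\<close> the chosen root of unity.
\<close>

definition spec :: "nat \<Rightarrow> (qfun set \<Rightarrow> 'b) \<Rightarrow> qfun \<Rightarrow> 'b"
  where "spec l \<iota> a = \<iota> (cyc_ideal l +>\<^bsub>laurent\<^esub> a)"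

text \<open>
  \<open>pcoef n s\<close> is the coefficient in
  \<open>(K\<^sup>n - K\<^sup>-\<^sup>n) / (v\<^sup>n - v\<^sup>-\<^sup>n) = (\<Sum>s = 1..n. pcoef n s k\<^sub>s K ^ phi n s)\<close>,
  where \<open>k\<^sub>s\<close> is \<open>Kbin\<close> with \<open>c = 0\<close>; the recursion results from evaluating at
  \<open>K = v ^ s\<close>, where \<open>k\<^sub>t\<close> takes the value \<open>qbinom s t\<close>. Only \<open>s \<ge> 1\<close> is meaningful.
\<close>

definition phi :: "nat \<Rightarrow> nat \<Rightarrow> nat"
  where "phi n j = (if even (int n - int j) then 0 else 1)"

fun pcoef :: "nat \<Rightarrow> nat \<Rightarrow> qfun"
  where "pcoef n s =
    (if s \<le> 1 then qv powi (- int (phi n 1))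
     else (qv ^ (n * s) - inverse qv ^ (n * s)) / (qv ^ (phi n s * s) * (qv ^ n - inverse qv ^ n))
          - (\<Sum>t = 1..s - 1. pcoef n t * qbinom s t * qv powi ((int (phi n t) - int (phi n s)) * int s)))"

definition V0B_elt ::
  "nat \<Rightarrow> ('b, 'l) ring_scheme \<Rightarrow> (qfun \<Rightarrow> 'b) \<Rightarrow> V0_gen
    \<Rightarrow> ((V0_gen list \<Rightarrow> qfun) set \<times> 'b \<Rightarrow> qfun) set"
  where "V0B_elt \<theta> B f x = base_change_incl laurent (V0 \<theta>) B f (V0_elt \<theta> x)"

definition h_elt ::
  "nat \<Rightarrow> ('b, 'l) ring_scheme \<Rightarrow> (qfun \<Rightarrow> 'b) \<Rightarrow> nat \<Rightarrow> nat
    \<Rightarrow> ((V0_gen list \<Rightarrow> qfun) set \<times> 'b \<Rightarrow> qfun) set"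
  where "h_elt \<theta> B f l i =
    (let W = base_change laurent (V0 \<theta>) B f; K = V0B_elt \<theta> B f (Kgen i) in
     inv\<^bsub>B\<^esub> ([l] \<cdot>\<^bsub>B\<^esub> \<one>\<^bsub>B\<^esub>) \<odot>\<^bsub>W\<^esub>
       ((\<Oplus>\<^bsub>W\<^esub>s\<in>{1..l}. f (pcoef l s) \<odot>\<^bsub>W\<^esub> (V0B_elt \<theta> B f (Kbin i 0 s) \<otimes>\<^bsub>W\<^esub> K [^]\<^bsub>W\<^esub> phi l s))
         \<otimes>\<^bsub>W\<^esub> K [^]\<^bsub>W\<^esub> l))"

abbreviation V0_hopf where "V0_hopf \<theta> d e S \<equiv> with_hopf (V0 \<theta>) d e S"

abbreviation V0B_hopf where
  "V0B_hopf \<theta> d e S B f \<equiv> base_change_hopf laurent (V0_hopf \<theta> d e S) B f"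

section \<open>The Hopf algebra \<open>B \<Gamma> \<otimes> U(h)\<close>\<close>

definition Gam :: "nat \<Rightarrow> nat \<Rightarrow> (nat \<Rightarrow> int) monoid"
  where "Gam \<theta> l = product_group {1..\<theta>} (\<lambda>_. integer_mod_group (2 * l))"

definition Gam_gen :: "nat \<Rightarrow> nat \<Rightarrow> nat \<Rightarrow> int"
  where "Gam_gen \<theta> i = (\<lambda>j\<in>{1..\<theta>}. if j = i then 1 else 0)"

definition abelian_lie :: "('b, 'l) ring_scheme \<Rightarrow> 'i set \<Rightarrow> ('b, 'i \<Rightarrow> 'b) module"
  where "abelian_lie B I =
    \<lparr>carrier = I \<rightarrow>\<^sub>E carrier B, monoid.mult = (\<lambda>x y. \<lambda>i\<in>I. \<zero>\<^bsub>B\<^esub>), one = undefined,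
     zero = (\<lambda>i\<in>I. \<zero>\<^bsub>B\<^esub>), add = (\<lambda>x y. \<lambda>i\<in>I. x i \<oplus>\<^bsub>B\<^esub> y i),
     module.smult = (\<lambda>a x. \<lambda>i\<in>I. a \<otimes>\<^bsub>B\<^esub> x i)\<rparr>"

definition lie_basis :: "('b, 'l) ring_scheme \<Rightarrow> 'i set \<Rightarrow> 'i \<Rightarrow> 'i \<Rightarrow> 'b"
  where "lie_basis B I i = (\<lambda>j\<in>I. if j = i then \<one>\<^bsub>B\<^esub> else \<zero>\<^bsub>B\<^esub>)"

abbreviation GamU ::
  "nat \<Rightarrow> nat \<Rightarrow> ('b, 'l) ring_scheme
    \<Rightarrow> ('b, (((nat \<Rightarrow> int) \<Rightarrow> 'b) \<times> ((nat \<Rightarrow> 'b) list \<Rightarrow> 'b) set \<Rightarrow> 'b) set) hopf"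
  where "GamU \<theta> l B \<equiv>
    tensor_hopf B (group_hopf B (Gam \<theta> l)) (env_hopf B (abelian_lie B {1..\<theta>}))"

definition g_elt ::
  "nat \<Rightarrow> nat \<Rightarrow> ('b, 'l) ring_scheme \<Rightarrow> nat
    \<Rightarrow> (((nat \<Rightarrow> int) \<Rightarrow> 'b) \<times> ((nat \<Rightarrow> 'b) list \<Rightarrow> 'b) set \<Rightarrow> 'b) set"
  where "g_elt \<theta> l B i =
    (let G = group_hopf B (Gam \<theta> l); U = env_hopf B (abelian_lie B {1..\<theta>}) in
     tens B G U (basis_elt B (Gam_gen \<theta> i)) \<one>\<^bsub>U\<^esub>)"

definition t_elt ::
  "nat \<Rightarrow> nat \<Rightarrow> ('b, 'l) ring_scheme \<Rightarrow> nat
    \<Rightarrow> (((nat \<Rightarrow> int) \<Rightarrow> 'b) \<times> ((nat \<Rightarrow> 'b) list \<Rightarrow> 'b) set \<Rightarrow> 'b) set"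
  where "t_elt \<theta> l B i =
    (let G = group_hopf B (Gam \<theta> l); L = abelian_lie B {1..\<theta>}; U = env_hopf B L in
     tens B G U \<one>\<^bsub>G\<^esub> (env_incl B L (lie_basis B {1..\<theta>} i)))"

end

theory Submission
  imports Defs
begin

text \<open>
  The proof makes every identity in \<open>V\<^sup>0\<close> visible through evaluations. A point assigns to each index \<open>i\<close>
  a pair \<open>(s, m)\<close>, and evaluation at it sends \<open>K\<^sub>i\<close> to \<open>(-1)\<^sup>s v\<^sup>m\<close> and the generator \<open>k\<^sub>i\<^sub>,\<^sub>t\<close> to the Gaussian binomial
  coefficient of \<open>m\<close> and \<open>t\<close>, up to a sign. The products over \<open>i\<close> of the elements \<open>K\<^sub>i\<^sup>\<delta> k\<^sub>i\<^sub>,\<^sub>t\<close> with \<open>\<delta> \<le> 1\<close> span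
  \<open>V\<^sup>0\<close> (\<open>mono_span\<close>), and their values are linearly independent (\<open>indep_bval\<close>). Hence evaluations separate
  the elements of \<open>V\<^sup>0\<close> (\<open>ev_inj\<close>) and of \<open>V\<^sup>0 \<otimes> V\<^sup>0\<close> (\<open>ev2_inj\<close>), and identities reduce to Laurent polynomials.

  In this way the element \<open>Hel\<close>, which specializes to \<open>l h\<close>, is seen to satisfy
  \<open>(v\<^sup>l - v\<^sup>-\<^sup>l) Hel + 1 = K\<^sup>2\<^sup>l\<close> (\<open>Hel_rel\<close>). The structure maps of \<open>V\<^sup>0\<close> are determined by the group-like elements
  \<open>K\<^sub>i\<close>, since \<open>V\<^sup>0\<close> is torsion-free and these generate it over the fraction field (\<open>torsion_induct\<close>); they take
  \<open>Hel\<close> to \<open>Hel \<otimes> 1 + K\<^sup>2\<^sup>l \<otimes> Hel\<close> under the comultiplication (\<open>d_Hel\<close>), and correspondingly for the counit and the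
  antipode. At the root of unity \<open>v\<^sup>l - v\<^sup>-\<^sup>l\<close> vanishes. Therefore \<open>K\<^sup>2\<^sup>l = 1\<close>, which defines the homomorphism \<open>\<Psi>\<close>, and
  \<open>h\<close> becomes primitive, which makes \<open>\<Psi>\<close> compatible with the Hopf structures.

  For injectivity, the field \<open>B\<close> is embedded in the complex numbers by sending \<open>v\<close> to a primitive root of unity
  \<open>\<zeta>\<close> of order \<open>l'\<close> (\<open>f_evL\<close>, \<open>jC_hom\<close>). Specialized evaluations take \<open>g\<^sub>i\<close> to \<open>(-1)\<^sup>s \<zeta>\<^sup>m\<close> and \<open>t\<^sub>i\<close> to
  \<open>\<zeta>\<^sup>l m / l\<close>. The first value runs through all \<open>2 l\<close>-th roots of unity and depends on \<open>m\<close> only modulo \<open>l'\<close>, while \<open>m\<close>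
  is unbounded. So the monomials in the \<open>g\<^sub>i\<close>, with exponents less than \<open>2 l\<close>, and the \<open>t\<^sub>i\<close> have independent
  values (\<open>indep_gval\<close>), and none of their nonzero combinations is mapped to zero.

  For surjectivity, the image is shown to contain \<open>k\<^sub>i\<^sub>,\<^sub>t\<close> by induction on \<open>t\<close> (\<open>Q_k\<close>). If \<open>l\<close> does not divide \<open>t\<close>, the
  quantum integer of \<open>t\<close> is invertible and \<open>k\<^sub>i\<^sub>,\<^sub>t\<close> is obtained from \<open>k\<^sub>i\<^sub>,\<^sub>t\<^sub>-\<^sub>1\<close>. For \<open>t = l\<close> it is obtained from \<open>h\<close>, whose
  leading coefficient is invertible (\<open>f_pcoef\<close>). For \<open>t = l q\<close> with \<open>q > 1\<close> it is obtained from the product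
  relation, in which the Gaussian binomial coefficient of \<open>l q\<close> and \<open>l\<close> specializes to a nonzero multiple of \<open>q\<close>
  (\<open>f_qbinom\<close>).
\<close>

section \<open>Linear maps and algebra homomorphisms\<close>

lemma (in assoc_algebra) is_module: "Module.module R M"
  by (rule module_axioms)

locale comm_alg = assoc_algebra R M + M: cring M for R (structure) and M (structure)

lemma comm_algI:
  assumes "assoc_algebra R M"
    and "\<And>x y. x \<in> carrier M \<Longrightarrow> y \<in> carrier M \<Longrightarrow> x \<otimes>\<^bsub>M\<^esub> y = y \<otimes>\<^bsub>M\<^esub> x"
  shows "comm_alg R M"
proof -
  interpret assoc_algebra R M by fact
  interpret M: cring M
    by (intro cring.intro comm_monoid.intro comm_monoid_axioms.intro M.ring_axioms M.monoid_axioms assms(2))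
  show ?thesis by unfold_locales
qed

definition lin_map ::
  "('r, 'k) ring_scheme \<Rightarrow> ('r, 'a, 'm) module_scheme \<Rightarrow> ('r, 'b, 'n) module_scheme \<Rightarrow> ('a \<Rightarrow> 'b) set"
  where "lin_map R M N = {f \<in> carrier M \<rightarrow> carrier N.
    (\<forall>x\<in>carrier M. \<forall>y\<in>carrier M. f (x \<oplus>\<^bsub>M\<^esub> y) = f x \<oplus>\<^bsub>N\<^esub> f y) \<and>
    (\<forall>a\<in>carrier R. \<forall>x\<in>carrier M. f (a \<odot>\<^bsub>M\<^esub> x) = a \<odot>\<^bsub>N\<^esub> f x)}"

lemma lin_mapI:
  assumes "\<And>x. x \<in> carrier M \<Longrightarrow> f x \<in> carrier N"
    and "\<And>x y. x \<in> carrier M \<Longrightarrow> y \<in> carrier M \<Longrightarrow> f (x \<oplus>\<^bsub>M\<^esub> y) = f x \<oplus>\<^bsub>N\<^esub> f y"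
    and "\<And>a x. a \<in> carrier R \<Longrightarrow> x \<in> carrier M \<Longrightarrow> f (a \<odot>\<^bsub>M\<^esub> x) = a \<odot>\<^bsub>N\<^esub> f x"
  shows "f \<in> lin_map R M N"
  using assms by (auto simp: lin_map_def)

lemma lin_mapD:
  assumes "f \<in> lin_map R M N"
  shows "x \<in> carrier M \<Longrightarrow> f x \<in> carrier N"
    and "x \<in> carrier M \<Longrightarrow> y \<in> carrier M \<Longrightarrow> f (x \<oplus>\<^bsub>M\<^esub> y) = f x \<oplus>\<^bsub>N\<^esub> f y"
    and "a \<in> carrier R \<Longrightarrow> x \<in> carrier M \<Longrightarrow> f (a \<odot>\<^bsub>M\<^esub> x) = a \<odot>\<^bsub>N\<^esub> f x"
  using assms by (auto simp: lin_map_def)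

lemma lin_map_zero:
  assumes "f \<in> lin_map R M N" "Module.module R M" "Module.module R N"
  shows "f \<zero>\<^bsub>M\<^esub> = \<zero>\<^bsub>N\<^esub>"
proof -
  interpret M: Module.module R M by fact
  interpret N: Module.module R N by fact
  have "f (\<zero>\<^bsub>R\<^esub> \<odot>\<^bsub>M\<^esub> \<zero>\<^bsub>M\<^esub>) = \<zero>\<^bsub>R\<^esub> \<odot>\<^bsub>N\<^esub> f \<zero>\<^bsub>M\<^esub>"
    by (rule lin_mapD(3)[OF assms(1)]) simp_all
  then show ?thesis using lin_mapD(1)[OF assms(1)] by simp
qed

lemma lin_map_finsum:
  assumes "f \<in> lin_map R M N" "Module.module R M" "Module.module R N"
    and "finite S" "u \<in> S \<rightarrow> carrier M"
  shows "f (\<Oplus>\<^bsub>M\<^esub>s\<in>S. u s) = (\<Oplus>\<^bsub>N\<^esub>s\<in>S. f (u s))"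
proof -
  interpret M: Module.module R M by fact
  interpret N: Module.module R N by fact
  show ?thesis using assms(4,5)
  proof (induction S rule: finite_induct)
    case empty
    then show ?case using lin_map_zero[OF assms(1-3)] by simp
  next
    case (insert x F)
    then have "u x \<in> carrier M" "u \<in> F \<rightarrow> carrier M" by auto
    with insert show ?case
      by (simp add: lin_mapD[OF assms(1)] M.finsum_closed Pi_iff)
  qed
qed

lemma lin_map_comp:
  assumes "f \<in> lin_map R M N" "g \<in> lin_map R N P"
  shows "(\<lambda>x. g (f x)) \<in> lin_map R M P"
  by (rule lin_mapI) (simp_all add: lin_mapD[OF assms(1)] lin_mapD[OF assms(2)])

lemma alg_homI:
  assumes "\<And>x. x \<in> carrier M \<Longrightarrow> f x \<in> carrier N"
    and "\<And>x y. x \<in> carrier M \<Longrightarrow> y \<in> carrier M \<Longrightarrow> f (x \<oplus>\<^bsub>M\<^esub> y) = f x \<oplus>\<^bsub>N\<^esub> f y"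
    and "\<And>x y. x \<in> carrier M \<Longrightarrow> y \<in> carrier M \<Longrightarrow> f (x \<otimes>\<^bsub>M\<^esub> y) = f x \<otimes>\<^bsub>N\<^esub> f y"
    and "f \<one>\<^bsub>M\<^esub> = \<one>\<^bsub>N\<^esub>"
    and "\<And>a x. a \<in> carrier R \<Longrightarrow> x \<in> carrier M \<Longrightarrow> f (a \<odot>\<^bsub>M\<^esub> x) = a \<odot>\<^bsub>N\<^esub> f x"
  shows "f \<in> alg_hom R M N"
  using assms by (auto simp: alg_hom_def ring_hom_def)

lemma alg_homD:
  assumes "f \<in> alg_hom R M N"
  shows "x \<in> carrier M \<Longrightarrow> f x \<in> carrier N"
    and "x \<in> carrier M \<Longrightarrow> y \<in> carrier M \<Longrightarrow> f (x \<oplus>\<^bsub>M\<^esub> y) = f x \<oplus>\<^bsub>N\<^esub> f y"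
    and "x \<in> carrier M \<Longrightarrow> y \<in> carrier M \<Longrightarrow> f (x \<otimes>\<^bsub>M\<^esub> y) = f x \<otimes>\<^bsub>N\<^esub> f y"
    and "f \<one>\<^bsub>M\<^esub> = \<one>\<^bsub>N\<^esub>"
    and "a \<in> carrier R \<Longrightarrow> x \<in> carrier M \<Longrightarrow> f (a \<odot>\<^bsub>M\<^esub> x) = a \<odot>\<^bsub>N\<^esub> f x"
  using assms by (auto simp: alg_hom_def ring_hom_def)

lemma alg_hom_lin_map: "f \<in> alg_hom R M N \<Longrightarrow> f \<in> lin_map R M N"
  by (rule lin_mapI) (simp_all add: alg_homD)

text \<open>
  The antipode of a Hopf algebra is given as a linear map only; its multiplicativity is proved
  separately.
\<close>

lemma lin_map_alg_homI:
  assumes "f \<in> lin_map R M N"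
    and "\<And>x y. x \<in> carrier M \<Longrightarrow> y \<in> carrier M \<Longrightarrow> f (x \<otimes>\<^bsub>M\<^esub> y) = f x \<otimes>\<^bsub>N\<^esub> f y"
    and "f \<one>\<^bsub>M\<^esub> = \<one>\<^bsub>N\<^esub>"
  shows "f \<in> alg_hom R M N"
  using assms lin_mapD[OF assms(1)] by (intro alg_homI) auto

lemma alg_hom_comp:
  assumes "f \<in> alg_hom R M N" "g \<in> alg_hom R N P"
  shows "(\<lambda>x. g (f x)) \<in> alg_hom R M P"
  by (rule alg_homI) (simp_all add: alg_homD[OF assms(1)] alg_homD[OF assms(2)])

lemma lin_map_minus:
  assumes "f \<in> lin_map R M N" "Module.module R M" "Module.module R N" "x \<in> carrier M"
  shows "f (\<ominus>\<^bsub>M\<^esub> x) = \<ominus>\<^bsub>N\<^esub> f x"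
proof -
  interpret M: Module.module R M by fact
  interpret N: Module.module R N by fact
  have "f (\<ominus>\<^bsub>M\<^esub> x) \<oplus>\<^bsub>N\<^esub> f x = \<zero>\<^bsub>N\<^esub>"
    using assms(4) lin_map_zero[OF assms(1-3)]
    by (simp add: lin_mapD(2)[OF assms(1), symmetric] M.M.l_neg)
  then show ?thesis
    using lin_mapD(1)[OF assms(1)] assms(4) by (simp add: N.M.minus_equality)
qed

lemma lin_map_diff:
  assumes "f \<in> lin_map R M N" "Module.module R M" "Module.module R N" "x \<in> carrier M" "y \<in> carrier M"
  shows "f (x \<ominus>\<^bsub>M\<^esub> y) = f x \<ominus>\<^bsub>N\<^esub> f y"
proof -
  interpret M: Module.module R M by fact
  show ?thesis using assms(4,5)
    by (simp add: a_minus_def lin_mapD(2)[OF assms(1)] lin_map_minus[OF assms(1-3)])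
qed

lemma alg_hom_pow:
  assumes "f \<in> alg_hom R M N" "Group.monoid M" "Group.monoid N" "x \<in> carrier M"
  shows "f (x [^]\<^bsub>M\<^esub> (n::nat)) = f x [^]\<^bsub>N\<^esub> n"
proof -
  interpret M: Group.monoid M by fact
  interpret N: Group.monoid N by fact
  show ?thesis
    using assms(4) by (induction n) (simp_all add: alg_homD[OF assms(1)] M.nat_pow_Suc)
qed

lemma (in cring) regular_alg_comm_alg: "comm_alg R (regular_alg R)"
proof -
  have cr: "cring (regular_alg R)"
    by (rule cringI; (rule abelian_groupI comm_monoidI)?)
       (auto simp: regular_alg_def a_ac m_ac r_distr intro: exI bexI[of _ "\<ominus> _"] l_neg)
  have md: "Module.module R (regular_alg R)"
    by (rule moduleI[OF is_cring])
       (use cr in \<open>auto simp: regular_alg_def l_distr r_distr m_assoc cring_def ring_def\<close>)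
  interpret C: cring "regular_alg R" by fact
  interpret M: Module.module R "regular_alg R" by fact
  have "assoc_algebra R (regular_alg R)"
    by (unfold_locales) (auto simp: regular_alg_def m_assoc m_lcomm)
  then show ?thesis by (rule comm_algI) (auto simp: regular_alg_def m_comm)
qed

lemma (in abelian_monoid) finsum_swap:
  assumes "finite A" "finite B" "\<And>a b. a \<in> A \<Longrightarrow> b \<in> B \<Longrightarrow> f a b \<in> carrier G"
  shows "(\<Oplus>a\<in>A. \<Oplus>b\<in>B. f a b) = (\<Oplus>b\<in>B. \<Oplus>a\<in>A. f a b)"
  using assms
proof (induction A rule: finite_induct)
  case empty
  then show ?case by simp
next
  case (insert x F)
  have "(\<Oplus>a\<in>insert x F. \<Oplus>b\<in>B. f a b) = (\<Oplus>b\<in>B. f x b) \<oplus> (\<Oplus>a\<in>F. \<Oplus>b\<in>B. f a b)"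
    using insert by (subst finsum_insert) (auto intro!: finsum_closed)
  also have "\<dots> = (\<Oplus>b\<in>B. f x b) \<oplus> (\<Oplus>b\<in>B. \<Oplus>a\<in>F. f a b)"
    using insert by simp
  also have "\<dots> = (\<Oplus>b\<in>B. f x b \<oplus> (\<Oplus>a\<in>F. f a b))"
    using insert by (subst finsum_addf) (auto intro!: finsum_closed)
  also have "\<dots> = (\<Oplus>b\<in>B. \<Oplus>a\<in>insert x F. f a b)"
    using insert by (intro finsum_cong') (auto intro!: finsum_closed)
  finally show ?case .
qed

lemma (in abelian_monoid) finsum_cartesian:
  assumes "finite A" "finite B" "\<And>a b. a \<in> A \<Longrightarrow> b \<in> B \<Longrightarrow> f (a, b) \<in> carrier G"
  shows "(\<Oplus>p\<in>A \<times> B. f p) = (\<Oplus>a\<in>A. \<Oplus>b\<in>B. f (a, b))"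
  using assms
proof (induction A rule: finite_induct)
  case empty
  then show ?case by simp
next
  case (insert x F)
  have "insert x F \<times> B = Pair x ` B \<union> F \<times> B" by auto
  then have "(\<Oplus>p\<in>insert x F \<times> B. f p) = (\<Oplus>p\<in>Pair x ` B. f p) \<oplus> (\<Oplus>p\<in>F \<times> B. f p)"
    using insert by (simp only:) (rule finsum_Un_disjoint, auto)
  also have "(\<Oplus>p\<in>Pair x ` B. f p) = (\<Oplus>b\<in>B. f (x, b))"
    using insert by (subst finsum_reindex) (auto simp: inj_on_def)
  finally show ?case
    using insert by (subst finsum_insert) (auto intro!: finsum_closed)
qed

section \<open>Monoid algebras\<close>

locale monoid_alg = R: cring R + G: Group.monoid G for R (structure) and G (structure)
begin

abbreviation A where "A \<equiv> monoid_algebra R G"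

abbreviation supp :: "('c \<Rightarrow> 'a) \<Rightarrow> 'c set" where "supp f \<equiv> {g. f g \<noteq> \<zero>\<^bsub>R\<^esub>}"

lemma carrier_iff:
  "f \<in> carrier A \<longleftrightarrow> (\<forall>x. f x \<in> carrier R) \<and> supp f \<subseteq> carrier G \<and> finite (supp f)"
  by (auto simp: monoid_algebra_def)

lemma A_simps:
  "\<zero>\<^bsub>A\<^esub> = (\<lambda>x. \<zero>\<^bsub>R\<^esub>)" "f \<oplus>\<^bsub>A\<^esub> g = (\<lambda>x. f x \<oplus>\<^bsub>R\<^esub> g x)" "a \<odot>\<^bsub>A\<^esub> f = (\<lambda>x. a \<otimes>\<^bsub>R\<^esub> f x)"
  by (auto simp: monoid_algebra_def)

lemma one_A: "\<one>\<^bsub>A\<^esub> = basis_elt R \<one>\<^bsub>G\<^esub>"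
  by (simp add: monoid_algebra_def basis_elt_def)

lemma closed [simp]:
  "f \<in> carrier A \<Longrightarrow> f x \<in> carrier R"
  "\<zero>\<^bsub>A\<^esub> \<in> carrier A"
  "f \<in> carrier A \<Longrightarrow> g \<in> carrier A \<Longrightarrow> f \<oplus>\<^bsub>A\<^esub> g \<in> carrier A"
  "a \<in> carrier R \<Longrightarrow> f \<in> carrier A \<Longrightarrow> a \<odot>\<^bsub>A\<^esub> f \<in> carrier A"
  "x \<in> carrier G \<Longrightarrow> basis_elt R x \<in> carrier A"
proof -
  show "f \<oplus>\<^bsub>A\<^esub> g \<in> carrier A" if "f \<in> carrier A" "g \<in> carrier A"
  proof -
    have "supp (f \<oplus>\<^bsub>A\<^esub> g) \<subseteq> supp f \<union> supp g" by (auto simp: A_simps)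
    moreover have "finite (supp f \<union> supp g)" "supp f \<union> supp g \<subseteq> carrier G"
      using that by (auto simp: carrier_iff)
    ultimately have "supp (f \<oplus>\<^bsub>A\<^esub> g) \<subseteq> carrier G" "finite (supp (f \<oplus>\<^bsub>A\<^esub> g))"
      using finite_subset by blast+
    then show ?thesis using that by (simp add: carrier_iff A_simps)
  qed
  show "a \<odot>\<^bsub>A\<^esub> f \<in> carrier A" if "a \<in> carrier R" "f \<in> carrier A"
  proof -
    have "supp (a \<odot>\<^bsub>A\<^esub> f) \<subseteq> supp f" using that by (auto simp: A_simps carrier_iff)
    moreover have "finite (supp f)" "supp f \<subseteq> carrier G" using that by (auto simp: carrier_iff)
    ultimately have "supp (a \<odot>\<^bsub>A\<^esub> f) \<subseteq> carrier G" "finite (supp (a \<odot>\<^bsub>A\<^esub> f))"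
      using finite_subset by blast+
    then show ?thesis using that by (simp add: carrier_iff A_simps)
  qed
  show "basis_elt R x \<in> carrier A" if "x \<in> carrier G"
  proof -
    have "supp (basis_elt R x) \<subseteq> {x}" by (auto simp: basis_elt_def)
    then have "finite (supp (basis_elt R x))" by (rule finite_subset) simp
    then show ?thesis using that unfolding carrier_iff by (auto simp: basis_elt_def)
  qed
qed (auto simp: carrier_iff A_simps)

text \<open>Computing a linear extension over a larger finite set makes its linearity visible.\<close>

lemma lin_ext_eq:
  assumes "Module.module R P" "h \<in> carrier G \<rightarrow> carrier P" "f \<in> carrier A"
    and "finite F" "supp f \<subseteq> F" "F \<subseteq> carrier G"
  shows "lin_ext R P h f = (\<Oplus>\<^bsub>P\<^esub>g\<in>F. f g \<odot>\<^bsub>P\<^esub> h g)"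
proof -
  interpret P: Module.module R P by fact
  show ?thesis unfolding lin_ext_def
    using assms by (intro P.add.finprod_mono_neutral_cong_left) (auto simp: Pi_iff subset_iff)
qed

lemma lin_ext_lin_map:
  assumes "Module.module R P" "h \<in> carrier G \<rightarrow> carrier P"
  shows "lin_ext R P h \<in> lin_map R A P"
proof (rule lin_mapI)
  interpret P: Module.module R P by fact
  have c: "supp x \<subseteq> carrier G" "finite (supp x)" if "x \<in> carrier A" for x
    using that by (auto simp: carrier_iff)
  show "lin_ext R P h x \<in> carrier P" if "x \<in> carrier A" for x
    using c[OF that] that assms unfolding lin_ext_def
    by (intro P.finsum_closed) (auto simp: Pi_iff subset_iff)
  show "lin_ext R P h (x \<oplus>\<^bsub>A\<^esub> y) = lin_ext R P h x \<oplus>\<^bsub>P\<^esub> lin_ext R P h y"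
    if xy: "x \<in> carrier A" "y \<in> carrier A" for x y
  proof -
    let ?F = "supp x \<union> supp y"
    have F: "finite ?F" "?F \<subseteq> carrier G" using c xy by auto
    have h: "h g \<in> carrier P" if "g \<in> ?F" for g using that F assms(2) by auto
    have "lin_ext R P h (x \<oplus>\<^bsub>A\<^esub> y) = (\<Oplus>\<^bsub>P\<^esub>g\<in>?F. (x \<oplus>\<^bsub>A\<^esub> y) g \<odot>\<^bsub>P\<^esub> h g)"
      by (rule lin_ext_eq[OF assms closed(3)[OF xy] F(1) _ F(2)]) (use xy in \<open>auto simp: A_simps\<close>)
    also have "\<dots> = (\<Oplus>\<^bsub>P\<^esub>g\<in>?F. x g \<odot>\<^bsub>P\<^esub> h g \<oplus>\<^bsub>P\<^esub> y g \<odot>\<^bsub>P\<^esub> h g)"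
      by (rule P.finsum_cong') (use xy h in \<open>auto simp: P.smult_l_distr A_simps\<close>)
    also have "\<dots> = (\<Oplus>\<^bsub>P\<^esub>g\<in>?F. x g \<odot>\<^bsub>P\<^esub> h g) \<oplus>\<^bsub>P\<^esub> (\<Oplus>\<^bsub>P\<^esub>g\<in>?F. y g \<odot>\<^bsub>P\<^esub> h g)"
      by (rule P.finsum_addf) (use xy h in auto)
    finally show ?thesis
      by (simp add: lin_ext_eq[OF assms _ F(1) _ F(2)] xy)
  qed
  show "lin_ext R P h (a \<odot>\<^bsub>A\<^esub> x) = a \<odot>\<^bsub>P\<^esub> lin_ext R P h x"
    if ax: "a \<in> carrier R" "x \<in> carrier A" for a x
  proof -
    have F: "finite (supp x)" "supp x \<subseteq> carrier G" using c ax by auto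
    have h: "h g \<in> carrier P" if "g \<in> supp x" for g using that F assms(2) by auto
    have "lin_ext R P h (a \<odot>\<^bsub>A\<^esub> x) = (\<Oplus>\<^bsub>P\<^esub>g\<in>supp x. (a \<odot>\<^bsub>A\<^esub> x) g \<odot>\<^bsub>P\<^esub> h g)"
      by (rule lin_ext_eq[OF assms closed(4)[OF ax] F(1) _ F(2)]) (use ax in \<open>auto simp: A_simps\<close>)
    also have "\<dots> = (\<Oplus>\<^bsub>P\<^esub>g\<in>supp x. a \<odot>\<^bsub>P\<^esub> (x g \<odot>\<^bsub>P\<^esub> h g))"
      by (rule P.finsum_cong') (use ax h in \<open>auto simp: P.smult_assoc1 A_simps\<close>)
    also have "\<dots> = a \<odot>\<^bsub>P\<^esub> lin_ext R P h x"
      unfolding lin_ext_def by (subst P.finsum_smult_ldistr) (use F ax h in auto)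
    finally show ?thesis .
  qed
qed

lemmas lin_ext_closed = lin_mapD(1)[OF lin_ext_lin_map]
lemmas lin_ext_add = lin_mapD(2)[OF lin_ext_lin_map]
lemmas lin_ext_smult = lin_mapD(3)[OF lin_ext_lin_map]

lemma lin_ext_cong:
  assumes "Module.module R P" "h' \<in> carrier G \<rightarrow> carrier P" "f \<in> carrier A"
    and "\<And>g. g \<in> carrier G \<Longrightarrow> h g = h' g"
  shows "lin_ext R P h f = lin_ext R P h' f"
proof -
  interpret P: Module.module R P by fact
  show ?thesis unfolding lin_ext_def
    by (rule P.finsum_cong') (use assms in \<open>auto simp: carrier_iff subset_iff Pi_iff\<close>)
qed

lemma lin_ext_basis:
  assumes "Module.module R P" "h \<in> carrier G \<rightarrow> carrier P" "x \<in> carrier G"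
  shows "lin_ext R P h (basis_elt R x) = h x"
proof -
  interpret P: Module.module R P by fact
  have "lin_ext R P h (basis_elt R x) = (\<Oplus>\<^bsub>P\<^esub>g\<in>{x}. basis_elt R x g \<odot>\<^bsub>P\<^esub> h g)"
    by (rule lin_ext_eq) (use assms closed(5) in \<open>auto simp: basis_elt_def[of R x, THEN fun_cong]\<close>)
  moreover have "h x \<in> carrier P" using assms by auto
  ultimately show ?thesis by (simp add: basis_elt_def)
qed

text \<open>
  Composition of a linear extension with a linear map, the source of the scalar multiplication law
  and of the multiplicativity of linear extensions.
\<close>

lemma lin_map_lin_ext:
  assumes "Module.module R P" "Module.module R Q" "h \<in> carrier G \<rightarrow> carrier P" "f \<in> carrier A"
    and "\<phi> \<in> lin_map R P Q"
  shows "\<phi> (lin_ext R P h f) = lin_ext R Q (\<lambda>g. \<phi> (h g)) f"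
proof -
  interpret P: Module.module R P by fact
  interpret Q: Module.module R Q by fact
  have F: "finite (supp f)" "supp f \<subseteq> carrier G" using assms by (auto simp: carrier_iff)
  have h: "h g \<in> carrier P" if "g \<in> supp f" for g using that F assms(3) by auto
  show ?thesis unfolding lin_ext_def
    using F h assms(4)
    by (subst lin_map_finsum[OF assms(5,1,2)])
       (auto intro!: Q.finsum_cong' simp: lin_mapD[OF assms(5)])
qed

lemma lin_ext_add_fun:
  assumes "Module.module R P" "h \<in> carrier G \<rightarrow> carrier P" "h' \<in> carrier G \<rightarrow> carrier P"
    and "f \<in> carrier A"
  shows "lin_ext R P (\<lambda>g. h g \<oplus>\<^bsub>P\<^esub> h' g) f = lin_ext R P h f \<oplus>\<^bsub>P\<^esub> lin_ext R P h' f"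
proof -
  interpret P: Module.module R P by fact
  have F: "finite (supp f)" "supp f \<subseteq> carrier G" using assms by (auto simp: carrier_iff)
  have h: "h g \<in> carrier P" "h' g \<in> carrier P" if "g \<in> supp f" for g using that F assms(2,3) by auto
  have "lin_ext R P (\<lambda>g. h g \<oplus>\<^bsub>P\<^esub> h' g) f
      = (\<Oplus>\<^bsub>P\<^esub>g\<in>supp f. f g \<odot>\<^bsub>P\<^esub> h g \<oplus>\<^bsub>P\<^esub> f g \<odot>\<^bsub>P\<^esub> h' g)"
    unfolding lin_ext_def
    by (rule P.finsum_cong') (use h assms(4) in \<open>auto simp: P.smult_r_distr\<close>)
  also have "\<dots> = lin_ext R P h f \<oplus>\<^bsub>P\<^esub> lin_ext R P h' f"
    unfolding lin_ext_def by (rule P.finsum_addf) (use h assms(4) in auto)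
  finally show ?thesis .
qed

lemma mult_apply:
  assumes "f \<in> carrier A" "g \<in> carrier A"
  shows "(f \<otimes>\<^bsub>A\<^esub> g) x = (\<Oplus>\<^bsub>R\<^esub>p\<in>supp f \<times> supp g.
    if fst p \<otimes>\<^bsub>G\<^esub> snd p = x then f (fst p) \<otimes>\<^bsub>R\<^esub> g (snd p) else \<zero>\<^bsub>R\<^esub>)"
proof -
  have "finite (supp f \<times> supp g)" using assms by (auto simp: carrier_iff)
  then show ?thesis
    unfolding monoid_algebra_def
    by (simp, intro R.add.finprod_mono_neutral_cong_left) (use assms in auto)
qed

lemma mult_closed [simp]:
  assumes "f \<in> carrier A" "g \<in> carrier A"
  shows "f \<otimes>\<^bsub>A\<^esub> g \<in> carrier A"
    and "supp (f \<otimes>\<^bsub>A\<^esub> g) \<subseteq> (\<lambda>p. fst p \<otimes>\<^bsub>G\<^esub> snd p) ` (supp f \<times> supp g)"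
proof -
  have fin: "finite (supp f \<times> supp g)" using assms by (auto simp: carrier_iff)
  show s: "supp (f \<otimes>\<^bsub>A\<^esub> g) \<subseteq> (\<lambda>p. fst p \<otimes>\<^bsub>G\<^esub> snd p) ` (supp f \<times> supp g)"
  proof (rule subsetI, rule ccontr)
    fix x assume x: "x \<in> supp (f \<otimes>\<^bsub>A\<^esub> g)" "x \<notin> (\<lambda>p. fst p \<otimes>\<^bsub>G\<^esub> snd p) ` (supp f \<times> supp g)"
    have "(f \<otimes>\<^bsub>A\<^esub> g) x = \<zero>\<^bsub>R\<^esub>"
      unfolding mult_apply[OF assms] by (rule R.add.finprod_one_eqI) (use x(2) in auto)
    then show False using x(1) by simp
  qed
  have "(\<lambda>p. fst p \<otimes>\<^bsub>G\<^esub> snd p) ` (supp f \<times> supp g) \<subseteq> carrier G"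
    using assms by (auto simp: carrier_iff subset_iff)
  moreover have "(f \<otimes>\<^bsub>A\<^esub> g) x \<in> carrier R" for x
    unfolding mult_apply[OF assms] by (rule R.finsum_closed) (use assms in auto)
  ultimately show "f \<otimes>\<^bsub>A\<^esub> g \<in> carrier A"
    using s fin unfolding carrier_iff by (meson finite_imageI finite_subset subset_trans)
qed

text \<open>
  A linear extension evaluated on a convolution product is an iterated linear extension. All ring
  axioms of the monoid algebra follow from this formula.
\<close>

lemma lin_ext_mult:
  assumes "Module.module R P" "h \<in> carrier G \<rightarrow> carrier P" "f \<in> carrier A" "g \<in> carrier A"
  shows "lin_ext R P h (f \<otimes>\<^bsub>A\<^esub> g) = lin_ext R P (\<lambda>y. lin_ext R P (\<lambda>z. h (y \<otimes>\<^bsub>G\<^esub> z)) g) f"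
proof -
  interpret P: Module.module R P by fact
  define S where "S = supp f \<times> supp g"
  define \<mu> where "\<mu> = (\<lambda>p::'c \<times> 'c. fst p \<otimes>\<^bsub>G\<^esub> snd p)"
  define c where "c = (\<lambda>p::'c \<times> 'c. f (fst p) \<otimes>\<^bsub>R\<^esub> g (snd p))"
  have fin: "finite (supp f)" "finite (supp g)" "finite S" and
    sub: "supp f \<subseteq> carrier G" "supp g \<subseteq> carrier G"
    using assms by (auto simp: carrier_iff S_def)
  have \<mu>: "\<mu> p \<in> carrier G" if "p \<in> S" for p using that sub by (auto simp: S_def \<mu>_def subset_iff)
  have c: "c p \<in> carrier R" for p using assms by (auto simp: c_def)
  have h: "h x \<in> carrier P" if "x \<in> carrier G" for x using that assms by auto
  have "lin_ext R P h (f \<otimes>\<^bsub>A\<^esub> g) = (\<Oplus>\<^bsub>P\<^esub>x\<in>\<mu> ` S. (f \<otimes>\<^bsub>A\<^esub> g) x \<odot>\<^bsub>P\<^esub> h x)"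
    by (rule lin_ext_eq[OF assms(1,2)])
       (use mult_closed[OF assms(3,4)] fin \<mu> in \<open>auto simp: S_def \<mu>_def\<close>)
  also have "\<dots> = (\<Oplus>\<^bsub>P\<^esub>x\<in>\<mu> ` S. \<Oplus>\<^bsub>P\<^esub>p\<in>S. if \<mu> p = x then c p \<odot>\<^bsub>P\<^esub> h (\<mu> p) else \<zero>\<^bsub>P\<^esub>)"
  proof (rule P.finsum_cong')
    show "(\<lambda>x. \<Oplus>\<^bsub>P\<^esub>p\<in>S. if \<mu> p = x then c p \<odot>\<^bsub>P\<^esub> h (\<mu> p) else \<zero>\<^bsub>P\<^esub>) \<in> \<mu> ` S \<rightarrow> carrier P"
      using c h \<mu> by (auto intro!: P.finsum_closed)
    fix x assume "x \<in> \<mu> ` S"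
    then have x: "x \<in> carrier G" using \<mu> by auto
    let ?\<phi> = "\<lambda>a. a \<odot>\<^bsub>P\<^esub> h x"
    interpret Q: comm_alg R "regular_alg R" by (rule R.regular_alg_comm_alg)
    have lm: "?\<phi> \<in> lin_map R (regular_alg R) P"
      by (rule lin_mapI) (use h x in \<open>auto simp: regular_alg_def P.smult_l_distr P.smult_assoc1\<close>)
    have fs: "finsum R u S = finsum (regular_alg R) u S" for u :: "'c \<times> 'c \<Rightarrow> 'a"
      by (simp add: finsum_def finprod_def regular_alg_def)
    have "(f \<otimes>\<^bsub>A\<^esub> g) x \<odot>\<^bsub>P\<^esub> h x = ?\<phi> (\<Oplus>\<^bsub>regular_alg R\<^esub>p\<in>S. if \<mu> p = x then c p else \<zero>\<^bsub>R\<^esub>)"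
      unfolding mult_apply[OF assms(3,4)] S_def[symmetric] \<mu>_def c_def fs ..
    also have "\<dots> = (\<Oplus>\<^bsub>P\<^esub>p\<in>S. ?\<phi> (if \<mu> p = x then c p else \<zero>\<^bsub>R\<^esub>))"
      by (rule lin_map_finsum[OF lm Q.is_module assms(1) fin(3)])
         (use c in \<open>auto simp: regular_alg_def\<close>)
    also have "\<dots> = (\<Oplus>\<^bsub>P\<^esub>p\<in>S. if \<mu> p = x then c p \<odot>\<^bsub>P\<^esub> h (\<mu> p) else \<zero>\<^bsub>P\<^esub>)"
      by (rule P.finsum_cong') (use c h x in auto)
    finally show "(f \<otimes>\<^bsub>A\<^esub> g) x \<odot>\<^bsub>P\<^esub> h x = \<dots>" .
  qed simp
  also have "\<dots> = (\<Oplus>\<^bsub>P\<^esub>p\<in>S. \<Oplus>\<^bsub>P\<^esub>x\<in>\<mu> ` S. if \<mu> p = x then c p \<odot>\<^bsub>P\<^esub> h (\<mu> p) else \<zero>\<^bsub>P\<^esub>)"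
    by (rule P.finsum_swap) (use fin c h \<mu> in auto)
  also have "\<dots> = (\<Oplus>\<^bsub>P\<^esub>p\<in>S. c p \<odot>\<^bsub>P\<^esub> h (\<mu> p))"
  proof (rule P.finsum_cong')
    fix p assume p: "p \<in> S"
    show "(\<Oplus>\<^bsub>P\<^esub>x\<in>\<mu> ` S. if \<mu> p = x then c p \<odot>\<^bsub>P\<^esub> h (\<mu> p) else \<zero>\<^bsub>P\<^esub>) = c p \<odot>\<^bsub>P\<^esub> h (\<mu> p)"
      by (rule P.add.finprod_singleton[where f = "\<lambda>x. c p \<odot>\<^bsub>P\<^esub> h (\<mu> p)"])
         (use p fin c h \<mu> in auto)
  qed (use c h \<mu> in auto)
  also have "\<dots> = (\<Oplus>\<^bsub>P\<^esub>y\<in>supp f. \<Oplus>\<^bsub>P\<^esub>z\<in>supp g. (f y \<otimes>\<^bsub>R\<^esub> g z) \<odot>\<^bsub>P\<^esub> h (y \<otimes>\<^bsub>G\<^esub> z))"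
    unfolding S_def
    by (subst P.finsum_cartesian) (use fin sub c h in \<open>auto simp: c_def \<mu>_def subset_iff\<close>)
  also have "\<dots> = lin_ext R P (\<lambda>y. lin_ext R P (\<lambda>z. h (y \<otimes>\<^bsub>G\<^esub> z)) g) f"
    unfolding lin_ext_def
  proof (rule P.finsum_cong')
    fix y assume y: "y \<in> supp f"
    have "(\<Oplus>\<^bsub>P\<^esub>z\<in>supp g. (f y \<otimes>\<^bsub>R\<^esub> g z) \<odot>\<^bsub>P\<^esub> h (y \<otimes>\<^bsub>G\<^esub> z))
      = (\<Oplus>\<^bsub>P\<^esub>z\<in>supp g. f y \<odot>\<^bsub>P\<^esub> (g z \<odot>\<^bsub>P\<^esub> h (y \<otimes>\<^bsub>G\<^esub> z)))"
      by (rule P.finsum_cong')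
         (use y assms sub h in \<open>auto simp: P.smult_assoc1 subset_iff\<close>)
    also have "\<dots> = f y \<odot>\<^bsub>P\<^esub> (\<Oplus>\<^bsub>P\<^esub>z\<in>supp g. g z \<odot>\<^bsub>P\<^esub> h (y \<otimes>\<^bsub>G\<^esub> z))"
      by (subst P.finsum_smult_ldistr) (use fin y assms sub h in \<open>auto simp: subset_iff\<close>)
    finally show "(\<Oplus>\<^bsub>P\<^esub>z\<in>supp g. (f y \<otimes>\<^bsub>R\<^esub> g z) \<odot>\<^bsub>P\<^esub> h (y \<otimes>\<^bsub>G\<^esub> z)) = \<dots>" .
  qed (use assms sub h in \<open>auto intro!: P.smult_closed P.finsum_closed simp: subset_iff\<close>)
  finally show ?thesis .
qed

text \<open>
  The coordinate functions are themselves linear extensions, with values in the regular module. So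
  an equation in the monoid algebra may be tested by linear extensions, where products unfold.
\<close>

lemma lin_ext_eqI:
  assumes "f \<in> carrier A" "g \<in> carrier A"
    and "\<And>h. h \<in> carrier G \<rightarrow> carrier R \<Longrightarrow>
      lin_ext R (regular_alg R) h f = lin_ext R (regular_alg R) h g"
  shows "f = g"
proof
  fix x
  interpret Q: comm_alg R "regular_alg R" by (rule R.regular_alg_comm_alg)
  let ?h = "\<lambda>y::'c. if y = x then \<one>\<^bsub>R\<^esub> else \<zero>\<^bsub>R\<^esub>"
  have *: "lin_ext R (regular_alg R) ?h k = k x" if k: "k \<in> carrier A" for k
  proof (cases "x \<in> carrier G")
    case True
    have "lin_ext R (regular_alg R) ?h k
      = (\<Oplus>\<^bsub>regular_alg R\<^esub>g\<in>insert x (supp k). k g \<odot>\<^bsub>regular_alg R\<^esub> ?h g)"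
      by (rule lin_ext_eq[OF Q.is_module _ k]) (use k True in \<open>auto simp: carrier_iff regular_alg_def\<close>)
    also have "\<dots> = (\<Oplus>\<^bsub>regular_alg R\<^esub>g\<in>insert x (supp k). if x = g then k g else \<zero>\<^bsub>regular_alg R\<^esub>)"
      by (rule Q.M.finsum_cong') (use k in \<open>auto simp: regular_alg_def\<close>)
    also have "\<dots> = k x"
      by (rule Q.M.add.finprod_singleton) (use k in \<open>auto simp: carrier_iff regular_alg_def\<close>)
    finally show ?thesis .
  next
    case False
    then have "k x = \<zero>\<^bsub>R\<^esub>" using k by (auto simp: carrier_iff)
    moreover have "lin_ext R (regular_alg R) ?h k = \<zero>\<^bsub>regular_alg R\<^esub>"
      unfolding lin_ext_def
      by (rule Q.M.add.finprod_one_eqI) (use k False in \<open>auto simp: carrier_iff regular_alg_def\<close>)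
    ultimately show ?thesis by (simp add: regular_alg_def)
  qed
  show "f x = g x"
    using assms(3)[of ?h] by (simp add: * assms(1,2))
qed

lemma assoc_alg: "assoc_algebra R A"
proof -
  interpret Q: comm_alg R "regular_alg R" by (rule R.regular_alg_comm_alg)
  note m = Q.is_module
  have cr: "carrier (regular_alg R) = carrier R" by (simp add: regular_alg_def)
  note L = lin_ext_mult[OF m, unfolded cr] lin_ext_add[OF m, unfolded cr]
    lin_ext_smult[OF m, unfolded cr] lin_ext_basis[OF m, unfolded cr]
    lin_ext_add_fun[OF m, unfolded cr] lin_ext_closed[OF m, unfolded cr]
  have h1: "(\<lambda>z. h (y \<otimes>\<^bsub>G\<^esub> z)) \<in> carrier G \<rightarrow> carrier R" if "h \<in> carrier G \<rightarrow> carrier R" "y \<in> carrier G" for h y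
    using that by auto
  have h2: "(\<lambda>y. lin_ext R (regular_alg R) (\<lambda>z. h (y \<otimes>\<^bsub>G\<^esub> z)) g) \<in> carrier G \<rightarrow> carrier R"
    if "h \<in> carrier G \<rightarrow> carrier R" "g \<in> carrier A" for h g
    using L(6) h1 that by auto
  have assoc: "(f \<otimes>\<^bsub>A\<^esub> g) \<otimes>\<^bsub>A\<^esub> k = f \<otimes>\<^bsub>A\<^esub> (g \<otimes>\<^bsub>A\<^esub> k)"
    if "f \<in> carrier A" "g \<in> carrier A" "k \<in> carrier A" for f g k
  proof (rule lin_ext_eqI)
    fix h assume h: "h \<in> carrier G \<rightarrow> carrier R"
    have "lin_ext R (regular_alg R) h ((f \<otimes>\<^bsub>A\<^esub> g) \<otimes>\<^bsub>A\<^esub> k)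
      = lin_ext R (regular_alg R) (\<lambda>y. lin_ext R (regular_alg R)
          (\<lambda>z. lin_ext R (regular_alg R) (\<lambda>w. h ((y \<otimes>\<^bsub>G\<^esub> z) \<otimes>\<^bsub>G\<^esub> w)) k) g) f"
      using that h by (simp add: L h2)
    also have "\<dots> = lin_ext R (regular_alg R) (\<lambda>y. lin_ext R (regular_alg R)
          (\<lambda>z. h (y \<otimes>\<^bsub>G\<^esub> z)) (g \<otimes>\<^bsub>A\<^esub> k)) f"
    proof (rule lin_ext_cong[OF m, unfolded cr])
      fix y assume y: "y \<in> carrier G"
      show "lin_ext R (regular_alg R)
          (\<lambda>z. lin_ext R (regular_alg R) (\<lambda>w. h ((y \<otimes>\<^bsub>G\<^esub> z) \<otimes>\<^bsub>G\<^esub> w)) k) g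
        = lin_ext R (regular_alg R) (\<lambda>z. h (y \<otimes>\<^bsub>G\<^esub> z)) (g \<otimes>\<^bsub>A\<^esub> k)"
        using that h y
        by (subst L(1)[OF h1]) (auto intro!: lin_ext_cong[OF m, unfolded cr] L(6) simp: G.m_assoc Pi_iff)
    qed (use that h h2 in auto)
    finally show "lin_ext R (regular_alg R) h ((f \<otimes>\<^bsub>A\<^esub> g) \<otimes>\<^bsub>A\<^esub> k)
      = lin_ext R (regular_alg R) h (f \<otimes>\<^bsub>A\<^esub> (g \<otimes>\<^bsub>A\<^esub> k))"
      using that h by (simp add: L)
  qed (use that in simp_all)
  have one: "\<one>\<^bsub>A\<^esub> \<otimes>\<^bsub>A\<^esub> f = f" "f \<otimes>\<^bsub>A\<^esub> \<one>\<^bsub>A\<^esub> = f" if f: "f \<in> carrier A" for f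
  proof -
    show "\<one>\<^bsub>A\<^esub> \<otimes>\<^bsub>A\<^esub> f = f"
    proof (rule lin_ext_eqI)
      fix h assume h: "h \<in> carrier G \<rightarrow> carrier R"
      show "lin_ext R (regular_alg R) h (\<one>\<^bsub>A\<^esub> \<otimes>\<^bsub>A\<^esub> f) = lin_ext R (regular_alg R) h f"
        unfolding one_A using f h
        by (subst L(1)) (auto simp: L(4) h2 cr intro!: lin_ext_cong[OF m])
    qed (use f in \<open>simp_all add: one_A\<close>)
    show "f \<otimes>\<^bsub>A\<^esub> \<one>\<^bsub>A\<^esub> = f"
    proof (rule lin_ext_eqI)
      fix h assume h: "h \<in> carrier G \<rightarrow> carrier R"
      show "lin_ext R (regular_alg R) h (f \<otimes>\<^bsub>A\<^esub> \<one>\<^bsub>A\<^esub>) = lin_ext R (regular_alg R) h f"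
        unfolding one_A using f h
        by (subst L(1)) (auto simp: L(4) h1 cr intro!: lin_ext_cong[OF m])
    qed (use f in \<open>simp_all add: one_A\<close>)
  qed
  have ld: "(f \<oplus>\<^bsub>A\<^esub> g) \<otimes>\<^bsub>A\<^esub> k = f \<otimes>\<^bsub>A\<^esub> k \<oplus>\<^bsub>A\<^esub> g \<otimes>\<^bsub>A\<^esub> k"
    if "f \<in> carrier A" "g \<in> carrier A" "k \<in> carrier A" for f g k
  proof (rule lin_ext_eqI)
    fix h assume h: "h \<in> carrier G \<rightarrow> carrier R"
    show "lin_ext R (regular_alg R) h ((f \<oplus>\<^bsub>A\<^esub> g) \<otimes>\<^bsub>A\<^esub> k)
      = lin_ext R (regular_alg R) h (f \<otimes>\<^bsub>A\<^esub> k \<oplus>\<^bsub>A\<^esub> g \<otimes>\<^bsub>A\<^esub> k)"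
      using that h by (simp add: L h2)
  qed (use that in \<open>simp_all\<close>)
  have rd: "k \<otimes>\<^bsub>A\<^esub> (f \<oplus>\<^bsub>A\<^esub> g) = k \<otimes>\<^bsub>A\<^esub> f \<oplus>\<^bsub>A\<^esub> k \<otimes>\<^bsub>A\<^esub> g"
    if "f \<in> carrier A" "g \<in> carrier A" "k \<in> carrier A" for f g k
  proof (rule lin_ext_eqI)
    fix h assume h: "h \<in> carrier G \<rightarrow> carrier R"
    show "lin_ext R (regular_alg R) h (k \<otimes>\<^bsub>A\<^esub> (f \<oplus>\<^bsub>A\<^esub> g))
      = lin_ext R (regular_alg R) h (k \<otimes>\<^bsub>A\<^esub> f \<oplus>\<^bsub>A\<^esub> k \<otimes>\<^bsub>A\<^esub> g)"
      using that h by (simp add: L(1-4,6) h2 L(5)[symmetric])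
         (rule lin_ext_cong[OF m], auto simp: cr L(1-4,6) h1 h2 Pi_iff
            intro!: Q.M.a_closed[unfolded cr] L(6))
  qed (use that in \<open>simp_all\<close>)
  have sl: "(a \<odot>\<^bsub>A\<^esub> f) \<otimes>\<^bsub>A\<^esub> g = a \<odot>\<^bsub>A\<^esub> (f \<otimes>\<^bsub>A\<^esub> g)"
    if "a \<in> carrier R" "f \<in> carrier A" "g \<in> carrier A" for a f g
  proof (rule lin_ext_eqI)
    fix h assume h: "h \<in> carrier G \<rightarrow> carrier R"
    show "lin_ext R (regular_alg R) h ((a \<odot>\<^bsub>A\<^esub> f) \<otimes>\<^bsub>A\<^esub> g)
      = lin_ext R (regular_alg R) h (a \<odot>\<^bsub>A\<^esub> (f \<otimes>\<^bsub>A\<^esub> g))"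
      using that h by (simp add: L h2)
  qed (use that in \<open>simp_all\<close>)
  have sr: "f \<otimes>\<^bsub>A\<^esub> (a \<odot>\<^bsub>A\<^esub> g) = a \<odot>\<^bsub>A\<^esub> (f \<otimes>\<^bsub>A\<^esub> g)"
    if "a \<in> carrier R" "f \<in> carrier A" "g \<in> carrier A" for a f g
  proof (rule lin_ext_eqI)
    fix h assume h: "h \<in> carrier G \<rightarrow> carrier R"
    have sm: "(\<lambda>x. a \<odot>\<^bsub>regular_alg R\<^esub> x) \<in> lin_map R (regular_alg R) (regular_alg R)"
      by (rule lin_mapI) (use that in \<open>auto simp: regular_alg_def R.r_distr R.m_lcomm\<close>)
    show "lin_ext R (regular_alg R) h (f \<otimes>\<^bsub>A\<^esub> (a \<odot>\<^bsub>A\<^esub> g))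
      = lin_ext R (regular_alg R) h (a \<odot>\<^bsub>A\<^esub> (f \<otimes>\<^bsub>A\<^esub> g))"
      using that h by (simp add: L h2 lin_map_lin_ext[OF m m _ _ sm, unfolded cr])
         (rule lin_ext_cong[OF m], auto simp: cr L h1 h2 Pi_iff
            intro!: Q.smult_closed[unfolded cr] L(6))
  qed (use that in \<open>simp_all\<close>)
  have ab: "abelian_group A"
  proof (rule abelian_groupI)
    fix f assume f: "f \<in> carrier A"
    have "(\<lambda>x. \<ominus>\<^bsub>R\<^esub> \<one>\<^bsub>R\<^esub> \<otimes>\<^bsub>R\<^esub> f x) \<in> carrier A"
      using closed(4)[of "\<ominus>\<^bsub>R\<^esub> \<one>\<^bsub>R\<^esub>" f] f by (simp add: A_simps)
    moreover have "(\<lambda>x. (\<ominus>\<^bsub>R\<^esub> \<one>\<^bsub>R\<^esub> \<otimes>\<^bsub>R\<^esub> f x) \<oplus>\<^bsub>R\<^esub> f x) = (\<lambda>x. \<zero>\<^bsub>R\<^esub>)"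
      using f by (simp add: R.l_minus R.l_neg)
    ultimately show "\<exists>g\<in>carrier A. g \<oplus>\<^bsub>A\<^esub> f = \<zero>\<^bsub>A\<^esub>" by (auto simp: A_simps)
  next
    show "x \<oplus>\<^bsub>A\<^esub> y \<in> carrier A" if "x \<in> carrier A" "y \<in> carrier A" for x y
      using that by (rule closed(3))
    show "\<zero>\<^bsub>A\<^esub> \<in> carrier A" by (rule closed(2))
  qed (auto simp: R.a_ac A_simps)
  have mon: "Group.monoid A"
    by (rule monoidI) (use assoc one in \<open>auto simp: one_A\<close>)
  have rg: "ring A"
    by (intro ring.intro ab mon ring_axioms.intro ld rd)
  have md: "Module.module R A"
    by (rule moduleI[OF R.is_cring ab]) (use closed(4) in \<open>auto simp: A_simps R.l_distr R.r_distr R.m_assoc\<close>)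
  show ?thesis
    by (intro assoc_algebra.intro md rg assoc_algebra_axioms.intro sl sr)
qed

sublocale A: assoc_algebra R A
  by (rule assoc_alg)

lemma basis_mult:
  assumes "x \<in> carrier G" "y \<in> carrier G"
  shows "basis_elt R x \<otimes>\<^bsub>A\<^esub> basis_elt R y = basis_elt R (x \<otimes>\<^bsub>G\<^esub> y)"
proof (rule lin_ext_eqI)
  fix h assume h: "h \<in> carrier G \<rightarrow> carrier R"
  interpret Q: comm_alg R "regular_alg R" by (rule R.regular_alg_comm_alg)
  note m = Q.is_module
  have cr: "carrier (regular_alg R) = carrier R" by (simp add: regular_alg_def)
  have h1: "(\<lambda>z. h (y \<otimes>\<^bsub>G\<^esub> z)) \<in> carrier G \<rightarrow> carrier R" if "y \<in> carrier G" for y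
    using that h by auto
  show "lin_ext R (regular_alg R) h (basis_elt R x \<otimes>\<^bsub>A\<^esub> basis_elt R y)
    = lin_ext R (regular_alg R) h (basis_elt R (x \<otimes>\<^bsub>G\<^esub> y))"
    using assms h
    by (simp add: lin_ext_mult[OF m, unfolded cr] lin_ext_basis[OF m, unfolded cr] h1
        lin_ext_closed[OF m, unfolded cr] Pi_iff)
qed (use assms in simp_all)

lemma monoid_algebra_induct [consumes 1, case_names zero add smult]:
  assumes f: "f \<in> carrier A"
    and zero: "Q \<zero>\<^bsub>A\<^esub>"
    and add: "\<And>f g. f \<in> carrier A \<Longrightarrow> g \<in> carrier A \<Longrightarrow> Q f \<Longrightarrow> Q g \<Longrightarrow> Q (f \<oplus>\<^bsub>A\<^esub> g)"
    and basis: "\<And>a x. a \<in> carrier R \<Longrightarrow> x \<in> carrier G \<Longrightarrow> Q (a \<odot>\<^bsub>A\<^esub> basis_elt R x)"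
  shows "Q f"
proof -
  have "finite F \<Longrightarrow> f \<in> carrier A \<Longrightarrow> supp f \<subseteq> F \<Longrightarrow> Q f" for F f
  proof (induction F arbitrary: f rule: finite_induct)
    case empty
    then have "f = \<zero>\<^bsub>A\<^esub>" by (auto simp: A_simps)
    then show ?case using zero by simp
  next
    case (insert x F)
    show ?case
    proof (cases "f x = \<zero>\<^bsub>R\<^esub>")
      case True
      then show ?thesis using insert by auto
    next
      case False
      then have x: "x \<in> carrier G" using insert.prems by (auto simp: carrier_iff)
      let ?g = "f(x := \<zero>\<^bsub>R\<^esub>)"
      have "supp ?g \<subseteq> supp f" by auto
      then have g: "?g \<in> carrier A"
        using insert.prems finite_subset[of "supp ?g" "supp f"] by (auto simp: carrier_iff)
      have "supp ?g \<subseteq> F" using insert by auto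
      then have "Q ?g" using insert g by blast
      moreover have "f = f x \<odot>\<^bsub>A\<^esub> basis_elt R x \<oplus>\<^bsub>A\<^esub> ?g"
        using insert.prems by (auto simp: basis_elt_def A_simps)
      moreover have "Q (f x \<odot>\<^bsub>A\<^esub> basis_elt R x)" using basis x insert.prems by simp
      ultimately show ?thesis
        using add[of "f x \<odot>\<^bsub>A\<^esub> basis_elt R x" ?g] g x insert.prems
        by (metis closed(1,4,5))
    qed
  qed
  then show ?thesis using f by (auto simp: carrier_iff)
qed

text \<open>
  The universal property of the monoid algebra.
\<close>

lemma lin_ext_alg_hom:
  assumes "assoc_algebra R P" "h \<in> carrier G \<rightarrow> carrier P"
    and "\<And>x y. x \<in> carrier G \<Longrightarrow> y \<in> carrier G \<Longrightarrow> h (x \<otimes>\<^bsub>G\<^esub> y) = h x \<otimes>\<^bsub>P\<^esub> h y"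
    and "h \<one>\<^bsub>G\<^esub> = \<one>\<^bsub>P\<^esub>"
  shows "lin_ext R P h \<in> alg_hom R A P"
proof -
  interpret P: assoc_algebra R P by fact
  note m = P.is_module
  show ?thesis
  proof (rule lin_map_alg_homI[OF lin_ext_lin_map[OF m assms(2)]])
    show "lin_ext R P h \<one>\<^bsub>A\<^esub> = \<one>\<^bsub>P\<^esub>"
      by (simp add: one_A lin_ext_basis[OF m assms(2)] assms(4))
    fix f g assume fg: "f \<in> carrier A" "g \<in> carrier A"
    have L: "(\<lambda>x. y \<otimes>\<^bsub>P\<^esub> x) \<in> lin_map R P P" "(\<lambda>x. x \<otimes>\<^bsub>P\<^esub> y) \<in> lin_map R P P"
      if "y \<in> carrier P" for y
      using that by (auto intro!: lin_mapI simp: P.M.r_distr P.M.l_distr P.smult_mult_right P.smult_mult_left)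
    have g: "lin_ext R P h g \<in> carrier P" using fg lin_ext_closed[OF m assms(2)] by simp
    have "lin_ext R P h (f \<otimes>\<^bsub>A\<^esub> g) = lin_ext R P (\<lambda>y. lin_ext R P (\<lambda>z. h (y \<otimes>\<^bsub>G\<^esub> z)) g) f"
      by (rule lin_ext_mult[OF m assms(2) fg])
    also have "\<dots> = lin_ext R P (\<lambda>y. h y \<otimes>\<^bsub>P\<^esub> lin_ext R P h g) f"
    proof (rule lin_ext_cong[OF m _ fg(1)])
      fix y assume y: "y \<in> carrier G"
      have "lin_ext R P (\<lambda>z. h (y \<otimes>\<^bsub>G\<^esub> z)) g = lin_ext R P (\<lambda>z. h y \<otimes>\<^bsub>P\<^esub> h z) g"
        by (rule lin_ext_cong[OF m _ fg(2)]) (use y assms in auto)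
      also have "\<dots> = h y \<otimes>\<^bsub>P\<^esub> lin_ext R P h g"
        by (rule lin_map_lin_ext[OF m m assms(2) fg(2) L(1), symmetric]) (use y assms in auto)
      finally show "lin_ext R P (\<lambda>z. h (y \<otimes>\<^bsub>G\<^esub> z)) g = h y \<otimes>\<^bsub>P\<^esub> lin_ext R P h g" .
    qed (use g assms(2) in auto)
    also have "\<dots> = lin_ext R P h f \<otimes>\<^bsub>P\<^esub> lin_ext R P h g"
      by (rule lin_map_lin_ext[OF m m assms(2) fg(1) L(2), symmetric, OF g])
    finally show "lin_ext R P h (f \<otimes>\<^bsub>A\<^esub> g) = lin_ext R P h f \<otimes>\<^bsub>P\<^esub> lin_ext R P h g" .
  qed
qed

lemma comm_alg:
  assumes "\<And>x y. x \<in> carrier G \<Longrightarrow> y \<in> carrier G \<Longrightarrow> x \<otimes>\<^bsub>G\<^esub> y = y \<otimes>\<^bsub>G\<^esub> x"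
  shows "comm_alg R A"
proof (rule comm_algI[OF assoc_alg])
  fix f g assume "f \<in> carrier A" "g \<in> carrier A"
  then show "f \<otimes>\<^bsub>A\<^esub> g = g \<otimes>\<^bsub>A\<^esub> f"
  proof (induction f rule: monoid_algebra_induct)
    case (smult a x)
    have "basis_elt R x \<otimes>\<^bsub>A\<^esub> g = g \<otimes>\<^bsub>A\<^esub> basis_elt R x"
      using smult(3)
    proof (induction g rule: monoid_algebra_induct)
      case (smult b y)
      then show ?case using \<open>x \<in> carrier G\<close>
        by (simp add: A.smult_mult_left A.smult_mult_right basis_mult assms)
    qed (use \<open>x \<in> carrier G\<close> in \<open>simp_all add: A.M.l_distr A.M.r_distr\<close>)
    then show ?case using smult by (simp add: A.smult_mult_left A.smult_mult_right)
  qed (simp_all add: A.M.l_distr A.M.r_distr)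
qed

end

section \<open>Quotients by relations\<close>

lemma ring_cong:
  assumes "ring R" "carrier S = carrier R" "monoid.mult S = monoid.mult R" "one S = one R"
    "zero S = zero R" "add S = add R"
  shows "ring S"
proof -
  interpret R: ring R by fact
  show ?thesis
    by (rule ringI; (rule abelian_groupI monoidI)?)
       (auto simp: assms R.a_ac R.m_assoc R.l_distr R.r_distr intro: bexI[of _ "\<ominus>\<^bsub>R\<^esub> _"] R.l_neg)
qed

lemma assoc_algebra_cong:
  assumes "assoc_algebra R M" "carrier N = carrier M" "monoid.mult N = monoid.mult M" "one N = one M"
    "zero N = zero M" "add N = add M" "module.smult N = module.smult M"
  shows "assoc_algebra R N"
proof -
  interpret M: assoc_algebra R M by fact
  interpret N: ring N by (rule ring_cong[OF M.M.ring_axioms]) (use assms in simp_all)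
  show ?thesis
    by (intro assoc_algebra.intro moduleI assoc_algebra_axioms.intro N.ring_axioms
          M.R.is_cring N.is_abelian_group)
       (auto simp: assms M.smult_l_distr M.smult_r_distr M.smult_assoc1 M.smult_mult_left M.smult_mult_right)
qed

lemma comm_alg_cong:
  assumes "comm_alg R M" "carrier N = carrier M" "monoid.mult N = monoid.mult M" "one N = one M"
    "zero N = zero M" "add N = add M" "module.smult N = module.smult M"
  shows "comm_alg R N"
proof -
  interpret M: comm_alg R M by fact
  show ?thesis
    by (rule comm_algI[OF assoc_algebra_cong[OF M.assoc_algebra_axioms assms(2-7)]])
       (simp add: assms M.M.m_comm)
qed

text \<open>
  The quotient of an algebra by the ideal that a set of pairs generates. Tensor products, enveloping
  algebras and \<open>V\<^sup>0\<close> are all of this form, so that their maps come from one lifting principle.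
\<close>

locale presented = assoc_algebra R M for R (structure) and M (structure) +
  fixes E :: "('c \<times> 'c) set"
  assumes E: "E \<subseteq> carrier M \<times> carrier M"
begin

abbreviation I where "I \<equiv> rel_ideal M E"
abbreviation Q where "Q \<equiv> rel_quot M E"
abbreviation cls where "cls \<equiv> rel_class M E"

lemma rel_diff_closed: "{x \<ominus>\<^bsub>M\<^esub> y | x y. (x, y) \<in> E} \<subseteq> carrier M"
  using E by auto

sublocale I: ideal I M
  unfolding rel_ideal_def by (rule M.genideal_ideal[OF rel_diff_closed])

text \<open>
  A ring ideal of a unital algebra is a submodule, because \<open>a \<odot> i = (a \<odot> 1) \<otimes> i\<close>.
\<close>

lemma smult_ideal: "a \<in> carrier R \<Longrightarrow> i \<in> I \<Longrightarrow> a \<odot>\<^bsub>M\<^esub> i \<in> I"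
  using I.I_l_closed[of i "a \<odot>\<^bsub>M\<^esub> \<one>\<^bsub>M\<^esub>"] by (simp add: smult_mult_left I.Icarr)

lemma cls_eq_iff: "x \<in> carrier M \<Longrightarrow> y \<in> carrier M \<Longrightarrow> cls x = cls y \<longleftrightarrow> x \<ominus>\<^bsub>M\<^esub> y \<in> I"
  unfolding rel_class_def
  by (metis M.quotient_eq_iff_same_a_r_cos I.ideal_axioms)

lemma cls_rel: "(x, y) \<in> E \<Longrightarrow> cls x = cls y"
proof -
  assume xy: "(x, y) \<in> E"
  then have "x \<ominus>\<^bsub>M\<^esub> y \<in> I"
    unfolding rel_ideal_def using M.genideal_self[OF rel_diff_closed] by blast
  then show ?thesis using xy E cls_eq_iff by auto
qed

lemma mem_cls: "x \<in> carrier M \<Longrightarrow> z \<in> cls x \<Longrightarrow> z \<in> carrier M \<and> cls z = cls x"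
proof -
  assume x: "x \<in> carrier M" and z: "z \<in> cls x"
  have zc: "z \<in> carrier M" using x z M.a_r_coset_subset_G[OF I.a_subset x] by (auto simp: rel_class_def)
  have "cls x = cls z"
    unfolding rel_class_def using z x
    by (intro M.a_repr_independence) (auto simp: rel_class_def intro: I.a_subgroup)
  then show ?thesis using zc by simp
qed

lemma cls_self: "x \<in> carrier M \<Longrightarrow> x \<in> cls x"
  unfolding rel_class_def by (rule I.a_rcos_self)

lemma carrier_Q: "carrier Q = cls ` carrier M"
  by (auto simp: rel_quot_def alg_quot_def FactRing_def A_RCOSETS_def' rel_class_def)

lemma carrier_QE:
  assumes "z \<in> carrier Q" obtains x where "x \<in> carrier M" "z = cls x"
  using assms by (auto simp: carrier_Q)

lemma Q_ops:
  "x \<in> carrier M \<Longrightarrow> y \<in> carrier M \<Longrightarrow> cls x \<otimes>\<^bsub>Q\<^esub> cls y = cls (x \<otimes>\<^bsub>M\<^esub> y)"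
  "x \<in> carrier M \<Longrightarrow> y \<in> carrier M \<Longrightarrow> cls x \<oplus>\<^bsub>Q\<^esub> cls y = cls (x \<oplus>\<^bsub>M\<^esub> y)"
  "\<one>\<^bsub>Q\<^esub> = cls \<one>\<^bsub>M\<^esub>"
  by (auto simp: rel_quot_def alg_quot_def FactRing_def rel_class_def I.rcoset_mult_add I.a_rcos_sum)

text \<open>
  The union that defines the scalar multiplication of cosets is over equal sets.
\<close>

lemma Q_smult:
  assumes "a \<in> carrier R" "x \<in> carrier M"
  shows "a \<odot>\<^bsub>Q\<^esub> cls x = cls (a \<odot>\<^bsub>M\<^esub> x)"
proof -
  have "cls (a \<odot>\<^bsub>M\<^esub> y) = cls (a \<odot>\<^bsub>M\<^esub> x)" if "y \<in> cls x" for y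
  proof -
    have y: "y \<in> carrier M" "cls y = cls x" using mem_cls[OF assms(2) that] by auto
    then have "a \<odot>\<^bsub>M\<^esub> (y \<ominus>\<^bsub>M\<^esub> x) \<in> I"
      using smult_ideal assms cls_eq_iff by blast
    then have "a \<odot>\<^bsub>M\<^esub> y \<ominus>\<^bsub>M\<^esub> a \<odot>\<^bsub>M\<^esub> x \<in> I"
      using y assms by (simp add: a_minus_def smult_r_distr smult_r_minus)
    then show ?thesis using cls_eq_iff y assms by auto
  qed
  then have "(\<Union>y\<in>cls x. cls (a \<odot>\<^bsub>M\<^esub> y)) = (\<Union>y\<in>cls x. cls (a \<odot>\<^bsub>M\<^esub> x))"
    by (intro SUP_cong refl)
  moreover have "a \<odot>\<^bsub>Q\<^esub> cls x = (\<Union>y\<in>cls x. cls (a \<odot>\<^bsub>M\<^esub> y))"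
    by (simp add: rel_quot_def alg_quot_def rel_class_def)
  ultimately show ?thesis using cls_self[OF assms(2)] by auto
qed

lemma Q_ring: "ring Q"
  by (rule ring_cong[OF I.quotient_is_ring]) (simp_all add: rel_quot_def alg_quot_def)

lemma Q_assoc_alg: "assoc_algebra R Q"
proof -
  interpret Q: ring Q by (rule Q_ring)
  show ?thesis
    by (intro assoc_algebra.intro moduleI assoc_algebra_axioms.intro Q_ring R.is_cring Q.is_abelian_group)
       (auto elim!: carrier_QE simp: Q_ops Q_smult carrier_Q smult_l_distr smult_r_distr smult_assoc1
          smult_mult_left smult_mult_right)
qed

lemma cls_alg_hom: "cls \<in> alg_hom R M Q"
  by (rule alg_homI) (auto simp: carrier_Q Q_ops Q_smult)

text \<open>
  A linear map factors through the quotient as soon as it identifies all two-sided multiples of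
  the two sides of each relation: its kernel then contains an ideal containing the relators.
\<close>

lemma lift_the_elem:
  assumes P: "Module.module R P" and \<phi>: "\<phi> \<in> lin_map R M P"
    and rel: "\<And>x y p q. (x, y) \<in> E \<Longrightarrow> p \<in> carrier M \<Longrightarrow> q \<in> carrier M \<Longrightarrow>
      \<phi> (p \<otimes>\<^bsub>M\<^esub> x \<otimes>\<^bsub>M\<^esub> q) = \<phi> (p \<otimes>\<^bsub>M\<^esub> y \<otimes>\<^bsub>M\<^esub> q)"
    and x: "x \<in> carrier M"
  shows "the_elem (\<phi> ` cls x) = \<phi> x"
proof -
  interpret P: Module.module R P by fact
  define J where "J = {u \<in> carrier M. \<forall>p\<in>carrier M. \<forall>q\<in>carrier M. \<phi> (p \<otimes>\<^bsub>M\<^esub> u \<otimes>\<^bsub>M\<^esub> q) = \<zero>\<^bsub>P\<^esub>}"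
  note L = lin_mapD[OF \<phi>] lin_map_zero[OF \<phi> is_module P] lin_map_minus[OF \<phi> is_module P]
    lin_map_diff[OF \<phi> is_module P]
  have J: "ideal J M"
  proof (rule idealI)
    show "subgroup J (add_monoid M)"
    proof (rule M.add.subgroupI)
      show "J \<noteq> {}" unfolding J_def using L(4) by (auto intro!: exI[of _ "\<zero>\<^bsub>M\<^esub>"])
    qed (auto simp: J_def M.l_distr M.r_distr L M.l_minus M.r_minus)
    fix a u assume "a \<in> J" "u \<in> carrier M"
    then show "u \<otimes>\<^bsub>M\<^esub> a \<in> J" "a \<otimes>\<^bsub>M\<^esub> u \<in> J"
      unfolding J_def
      by (auto simp: M.m_assoc[symmetric]) (simp add: M.m_assoc)
  qed (rule M.ring_axioms)
  have "{x \<ominus>\<^bsub>M\<^esub> y | x y. (x, y) \<in> E} \<subseteq> J"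
    using E rel by (auto simp: J_def a_minus_def M.l_distr M.r_distr M.l_minus M.r_minus L P.M.r_neg)
  then have sub: "I \<subseteq> J" unfolding rel_ideal_def by (rule M.genideal_minimal[OF J])
  have "\<phi> y = \<phi> x" if "y \<in> cls x" for y
  proof -
    have y: "y \<in> carrier M" "y \<ominus>\<^bsub>M\<^esub> x \<in> I" using mem_cls[OF x that] cls_eq_iff[of y x] x by auto
    then have "\<phi> (\<one>\<^bsub>M\<^esub> \<otimes>\<^bsub>M\<^esub> (y \<ominus>\<^bsub>M\<^esub> x) \<otimes>\<^bsub>M\<^esub> \<one>\<^bsub>M\<^esub>) = \<zero>\<^bsub>P\<^esub>"
      using sub M.one_closed unfolding J_def by blast
    then have "\<phi> y \<ominus>\<^bsub>P\<^esub> \<phi> x = \<zero>\<^bsub>P\<^esub>" using x y by (simp add: L)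
    then show ?thesis using L(1) x y
      by (metis P.M.minus_equality P.M.minus_minus P.M.a_inv_closed a_minus_def)
  qed
  then have "\<phi> ` cls x = (\<lambda>_. \<phi> x) ` cls x" by (rule image_cong[OF refl])
  then have "\<phi> ` cls x = {\<phi> x}" using cls_self[OF x] by auto
  then show ?thesis by simp
qed

lemma lift_lin_map:
  assumes P: "Module.module R P" and \<phi>: "\<phi> \<in> lin_map R M P"
    and rel: "\<And>x y p q. (x, y) \<in> E \<Longrightarrow> p \<in> carrier M \<Longrightarrow> q \<in> carrier M \<Longrightarrow>
      \<phi> (p \<otimes>\<^bsub>M\<^esub> x \<otimes>\<^bsub>M\<^esub> q) = \<phi> (p \<otimes>\<^bsub>M\<^esub> y \<otimes>\<^bsub>M\<^esub> q)"
  shows "(\<lambda>C. the_elem (\<phi> ` C)) \<in> lin_map R Q P"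
  by (rule lin_mapI) (auto elim!: carrier_QE simp: Q_ops Q_smult lift_the_elem[OF assms] lin_mapD[OF \<phi>])

lemma lift_alg_hom:
  assumes P: "assoc_algebra R P" and \<phi>: "\<phi> \<in> alg_hom R M P"
    and rel: "\<And>x y. (x, y) \<in> E \<Longrightarrow> \<phi> x = \<phi> y"
  shows "(\<lambda>C. the_elem (\<phi> ` C)) \<in> alg_hom R Q P"
    and "x \<in> carrier M \<Longrightarrow> the_elem (\<phi> ` cls x) = \<phi> x"
proof -
  interpret P: assoc_algebra R P by fact
  have *: "the_elem (\<phi> ` cls x) = \<phi> x" if "x \<in> carrier M" for x
    by (rule lift_the_elem[OF P.is_module alg_hom_lin_map[OF \<phi>] _ that])
       (use E rel in \<open>auto simp: alg_homD[OF \<phi>]\<close>)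
  then show "x \<in> carrier M \<Longrightarrow> the_elem (\<phi> ` cls x) = \<phi> x" .
  show "(\<lambda>C. the_elem (\<phi> ` C)) \<in> alg_hom R Q P"
    by (rule alg_homI) (auto elim!: carrier_QE simp: Q_ops Q_smult * alg_homD[OF \<phi>])
qed

end

section \<open>Tensor products\<close>

definition bilin ::
  "('r, 'k) ring_scheme \<Rightarrow> ('r, 'a, 'm) module_scheme \<Rightarrow> ('r, 'b, 'n) module_scheme
    \<Rightarrow> ('r, 'c, 'p) module_scheme \<Rightarrow> ('a \<times> 'b \<Rightarrow> 'c) set"
  where "bilin R M N P = {h.
    (\<forall>x\<in>carrier M. (\<lambda>y. h (x, y)) \<in> lin_map R N P) \<and>
    (\<forall>y\<in>carrier N. (\<lambda>x. h (x, y)) \<in> lin_map R M P)}"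

lemma bilinI:
  assumes "\<And>x. x \<in> carrier M \<Longrightarrow> (\<lambda>y. h (x, y)) \<in> lin_map R N P"
    and "\<And>y. y \<in> carrier N \<Longrightarrow> (\<lambda>x. h (x, y)) \<in> lin_map R M P"
  shows "h \<in> bilin R M N P"
  using assms by (auto simp: bilin_def)

lemma bilinD:
  assumes "h \<in> bilin R M N P"
  shows "x \<in> carrier M \<Longrightarrow> (\<lambda>y. h (x, y)) \<in> lin_map R N P"
    and "y \<in> carrier N \<Longrightarrow> (\<lambda>x. h (x, y)) \<in> lin_map R M P"
  using assms by (auto simp: bilin_def)

locale tensor_alg = M: assoc_algebra R M + N: assoc_algebra R N
  for R (structure) and M (structure) and N (structure)
begin

sublocale F: monoid_alg R "M \<times>\<times> N"
  by (intro monoid_alg.intro M.R.is_cring DirProd_monoid M.M.monoid_axioms N.M.monoid_axioms)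

lemma tensor_rel_carrier: "tensor_rel R M N \<subseteq> carrier F.A \<times> carrier F.A"
  by (auto elim!: tensor_rel.cases intro!: F.closed)

sublocale T: presented R F.A "tensor_rel R M N"
  by (intro presented.intro F.assoc_alg presented_axioms.intro tensor_rel_carrier)

abbreviation T where "T \<equiv> tensor R M N"

lemma assoc_alg: "assoc_algebra R T"
  unfolding tensor_def by (rule T.Q_assoc_alg)

sublocale TA: assoc_algebra R T
  by (rule assoc_alg)

lemma tens_closed [simp]: "x \<in> carrier M \<Longrightarrow> y \<in> carrier N \<Longrightarrow> tens R M N x y \<in> carrier T"
  by (auto simp: tens_def tensor_def T.carrier_Q)

lemma tens_ops:
  shows tens_add_left: "\<lbrakk>x \<in> carrier M; x' \<in> carrier M; y \<in> carrier N\<rbrakk> \<Longrightarrow>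
      tens R M N (x \<oplus>\<^bsub>M\<^esub> x') y = tens R M N x y \<oplus>\<^bsub>T\<^esub> tens R M N x' y"
    and tens_add_right: "\<lbrakk>x \<in> carrier M; y \<in> carrier N; y' \<in> carrier N\<rbrakk> \<Longrightarrow>
      tens R M N x (y \<oplus>\<^bsub>N\<^esub> y') = tens R M N x y \<oplus>\<^bsub>T\<^esub> tens R M N x y'"
    and tens_smult_left: "\<lbrakk>a \<in> carrier R; x \<in> carrier M; y \<in> carrier N\<rbrakk> \<Longrightarrow>
      tens R M N (a \<odot>\<^bsub>M\<^esub> x) y = a \<odot>\<^bsub>T\<^esub> tens R M N x y"
    and tens_smult_right: "\<lbrakk>a \<in> carrier R; x \<in> carrier M; y \<in> carrier N\<rbrakk> \<Longrightarrow>
      tens R M N x (a \<odot>\<^bsub>N\<^esub> y) = a \<odot>\<^bsub>T\<^esub> tens R M N x y"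
    and tens_mult: "\<lbrakk>x \<in> carrier M; x' \<in> carrier M; y \<in> carrier N; y' \<in> carrier N\<rbrakk> \<Longrightarrow>
      tens R M N x y \<otimes>\<^bsub>T\<^esub> tens R M N x' y' = tens R M N (x \<otimes>\<^bsub>M\<^esub> x') (y \<otimes>\<^bsub>N\<^esub> y')"
    and tens_one: "\<one>\<^bsub>T\<^esub> = tens R M N \<one>\<^bsub>M\<^esub> \<one>\<^bsub>N\<^esub>"
  unfolding tens_def tensor_def
  by (simp_all add: T.Q_ops T.Q_smult T.cls_rel[OF tensor_rel.add_left] T.cls_rel[OF tensor_rel.add_right]
      T.cls_rel[OF tensor_rel.smult_left] T.cls_rel[OF tensor_rel.smult_right] F.basis_mult F.one_A)

lemma tensor_induct [consumes 1, case_names add tens]: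
  assumes z: "z \<in> carrier T"
    and add: "\<And>u w. u \<in> carrier T \<Longrightarrow> w \<in> carrier T \<Longrightarrow> S u \<Longrightarrow> S w \<Longrightarrow> S (u \<oplus>\<^bsub>T\<^esub> w)"
    and tens: "\<And>x y. x \<in> carrier M \<Longrightarrow> y \<in> carrier N \<Longrightarrow> S (tens R M N x y)"
  shows "S z"
proof -
  have "S (T.cls f)" if "f \<in> carrier F.A" for f
    using that
  proof (induction f rule: F.monoid_algebra_induct)
    case zero
    have "T.cls \<zero>\<^bsub>F.A\<^esub> = \<zero>\<^bsub>T\<^esub>"
      using lin_map_zero[OF alg_hom_lin_map[OF T.cls_alg_hom] F.A.is_module] TA.is_module
      by (simp add: tensor_def)
    also have "\<dots> = \<zero>\<^bsub>R\<^esub> \<odot>\<^bsub>T\<^esub> tens R M N \<zero>\<^bsub>M\<^esub> \<zero>\<^bsub>N\<^esub>" by simp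
    also have "\<dots> = tens R M N \<zero>\<^bsub>M\<^esub> \<zero>\<^bsub>N\<^esub>" by (simp add: tens_smult_left[symmetric])
    finally show ?case using tens by simp
  next
    case (add f g)
    then show ?case
      using assms(2)[of "T.cls f" "T.cls g"] by (simp add: tensor_def T.Q_ops T.carrier_Q)
  next
    case (smult a x)
    then obtain y z where x: "x = (y, z)" "y \<in> carrier M" "z \<in> carrier N" by auto
    have "T.cls (a \<odot>\<^bsub>F.A\<^esub> basis_elt R x) = a \<odot>\<^bsub>T\<^esub> tens R M N y z"
      using smult x by (simp add: tens_def tensor_def T.Q_smult)
    also have "\<dots> = tens R M N (a \<odot>\<^bsub>M\<^esub> y) z" using smult x by (simp add: tens_smult_left)
    finally show ?case using tens x smult by simp
  qed
  then show ?thesis using z by (auto simp: tensor_def T.carrier_Q)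
qed

lemma lin_map_eqI:
  assumes "f \<in> lin_map R T P" "g \<in> lin_map R T P"
    and "\<And>x y. x \<in> carrier M \<Longrightarrow> y \<in> carrier N \<Longrightarrow> f (tens R M N x y) = g (tens R M N x y)"
    and "z \<in> carrier T"
  shows "f z = g z"
  using assms(4)
  by (induction z rule: tensor_induct)
     (simp_all add: lin_mapD[OF assms(1)] lin_mapD[OF assms(2)] assms(3))

text \<open>
  The universal property of the tensor product. The relators generate an ideal rather than a
  submodule, so the relations are also needed after multiplication by arbitrary elements on both
  sides. On basis elements such a product is again a bilinearity relation, up to a scalar.
\<close>

lemma lift_bilin:
  assumes P: "Module.module R P" and h: "h \<in> bilin R M N P"
  shows lift_bilin_lin: "coset_lift R P h \<in> lin_map R T P"
    and lift_tens: "x \<in> carrier M \<Longrightarrow> y \<in> carrier N \<Longrightarrow> coset_lift R P h (tens R M N x y) = h (x, y)"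
proof -
  interpret P: Module.module R P by fact
  note hl = lin_mapD[OF bilinD(2)[OF h]] lin_mapD[OF bilinD(1)[OF h]]
  have hc: "h \<in> carrier (M \<times>\<times> N) \<rightarrow> carrier P" using hl by auto
  note L = F.lin_ext_lin_map[OF P hc]
  note LD = lin_mapD[OF L]
  have rel: "lin_ext R P h (p \<otimes>\<^bsub>F.A\<^esub> u \<otimes>\<^bsub>F.A\<^esub> q) = lin_ext R P h (p \<otimes>\<^bsub>F.A\<^esub> w \<otimes>\<^bsub>F.A\<^esub> q)"
    if uw: "(u, w) \<in> tensor_rel R M N" and pq: "p \<in> carrier F.A" "q \<in> carrier F.A" for u w p q
  proof -
    have uw': "u \<in> carrier F.A" "w \<in> carrier F.A" using uw tensor_rel_carrier by auto
    note bm = F.basis_mult F.A.M.l_distr F.A.M.r_distr F.A.smult_mult_left F.A.smult_mult_right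
    show ?thesis using pq(1)
    proof (induction p rule: F.monoid_algebra_induct)
      case (smult a g)
      have "lin_ext R P h (basis_elt R g \<otimes>\<^bsub>F.A\<^esub> u \<otimes>\<^bsub>F.A\<^esub> q) = lin_ext R P h (basis_elt R g \<otimes>\<^bsub>F.A\<^esub> w \<otimes>\<^bsub>F.A\<^esub> q)"
        using pq(2)
      proof (induction q rule: F.monoid_algebra_induct)
        case zero
        show ?case using uw' smult by simp
      next
        case (add q q')
        then show ?case using uw' smult by (simp add: bm LD)
      next
        case (smult b g')
        obtain g1 g2 where g: "g = (g1, g2)" "g1 \<in> carrier M" "g2 \<in> carrier N"
          using \<open>g \<in> carrier (M \<times>\<times> N)\<close> by auto
        obtain g1' g2' where g': "g' = (g1', g2')" "g1' \<in> carrier M" "g2' \<in> carrier N"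
          using smult(2) by auto
        have "lin_ext R P h (basis_elt R g \<otimes>\<^bsub>F.A\<^esub> u \<otimes>\<^bsub>F.A\<^esub> basis_elt R g')
          = lin_ext R P h (basis_elt R g \<otimes>\<^bsub>F.A\<^esub> w \<otimes>\<^bsub>F.A\<^esub> basis_elt R g')"
          using uw g g'
          by (cases rule: tensor_rel.cases)
             (simp_all add: bm LD F.lin_ext_basis[OF P hc] hl M.M.l_distr M.M.r_distr N.M.l_distr N.M.r_distr
               M.smult_mult_left M.smult_mult_right N.smult_mult_left N.smult_mult_right)
        then show ?case using uw' smult \<open>g \<in> carrier (M \<times>\<times> N)\<close> by (simp add: bm LD)
      qed
      then show ?case using uw' smult pq by (simp add: bm LD)
    qed (use uw' pq in \<open>simp_all add: bm LD\<close>)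
  qed
  show "coset_lift R P h \<in> lin_map R T P"
    unfolding tensor_def coset_lift_def by (rule T.lift_lin_map[OF P L rel])
  show "coset_lift R P h (tens R M N x y) = h (x, y)" if "x \<in> carrier M" "y \<in> carrier N"
    unfolding tens_def coset_lift_def using that
    by (simp add: T.lift_the_elem[OF P L rel] F.lin_ext_basis[OF P hc])
qed

lemma lift_bilin_alg_hom:
  assumes P: "assoc_algebra R P" and h: "h \<in> bilin R M N P"
    and m: "\<And>x x' y y'. \<lbrakk>x \<in> carrier M; x' \<in> carrier M; y \<in> carrier N; y' \<in> carrier N\<rbrakk> \<Longrightarrow>
      h (x \<otimes>\<^bsub>M\<^esub> x', y \<otimes>\<^bsub>N\<^esub> y') = h (x, y) \<otimes>\<^bsub>P\<^esub> h (x', y')"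
    and one: "h (\<one>\<^bsub>M\<^esub>, \<one>\<^bsub>N\<^esub>) = \<one>\<^bsub>P\<^esub>"
  shows "coset_lift R P h \<in> alg_hom R T P"
proof -
  interpret P: assoc_algebra R P by fact
  note L = lift_bilin[OF P.is_module h]
  note LD = lin_mapD[OF L(1)]
  show ?thesis
  proof (rule lin_map_alg_homI[OF L(1)])
    show "coset_lift R P h \<one>\<^bsub>T\<^esub> = \<one>\<^bsub>P\<^esub>" by (simp add: tens_one L(2) one)
    fix u w assume u: "u \<in> carrier T" and w: "w \<in> carrier T"
    show "coset_lift R P h (u \<otimes>\<^bsub>T\<^esub> w) = coset_lift R P h u \<otimes>\<^bsub>P\<^esub> coset_lift R P h w"
      using u
    proof (induction u rule: tensor_induct)
      case (tens x y)
      show ?case using w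
        by (induction w rule: tensor_induct)
           (use tens lin_mapD(1)[OF bilinD(1)[OF h]] in
            \<open>simp_all add: TA.M.r_distr P.M.r_distr LD tens_mult L(2) m\<close>)
    qed (use w in \<open>simp add: TA.M.l_distr P.M.l_distr LD\<close>)
  qed
qed

text \<open>The coproduct property of the tensor product of commutative algebras.\<close>

lemma lift_coproduct:
  assumes P: "comm_alg R P" and \<phi>: "\<phi> \<in> alg_hom R M P" and \<psi>: "\<psi> \<in> alg_hom R N P"
    and h: "\<And>x y. x \<in> carrier M \<Longrightarrow> y \<in> carrier N \<Longrightarrow> h (x, y) = \<phi> x \<otimes>\<^bsub>P\<^esub> \<psi> y"
  shows "coset_lift R P h \<in> alg_hom R T P"
    and "x \<in> carrier M \<Longrightarrow> y \<in> carrier N \<Longrightarrow> coset_lift R P h (tens R M N x y) = \<phi> x \<otimes>\<^bsub>P\<^esub> \<psi> y"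
proof -
  interpret P: comm_alg R P by fact
  note D = alg_homD[OF \<phi>] alg_homD[OF \<psi>]
  have b: "h \<in> bilin R M N P"
    by (rule bilinI; rule lin_mapI)
       (simp_all add: h D P.M.l_distr P.M.r_distr P.smult_mult_left P.smult_mult_right)
  show "coset_lift R P h \<in> alg_hom R T P"
    by (rule lift_bilin_alg_hom[OF P.assoc_algebra_axioms b]) (simp_all add: h D P.M.m_ac)
  show "x \<in> carrier M \<Longrightarrow> y \<in> carrier N \<Longrightarrow> coset_lift R P h (tens R M N x y) = \<phi> x \<otimes>\<^bsub>P\<^esub> \<psi> y"
    by (simp add: lift_tens[OF P.is_module b] h)
qed

lemma comm_alg:
  assumes "comm_alg R M" "comm_alg R N"
  shows "comm_alg R T"
proof (rule comm_algI[OF assoc_alg])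
  interpret CM: comm_alg R M by fact
  interpret CN: comm_alg R N by fact
  fix u w assume u: "u \<in> carrier T" and w: "w \<in> carrier T"
  show "u \<otimes>\<^bsub>T\<^esub> w = w \<otimes>\<^bsub>T\<^esub> u"
    using u
  proof (induction u rule: tensor_induct)
    case (tens x y)
    show ?case using w
      by (induction w rule: tensor_induct)
         (use tens in \<open>simp_all add: TA.M.r_distr TA.M.l_distr tens_mult CM.M.m_comm CN.M.m_comm\<close>)
  qed (use w in \<open>simp add: TA.M.l_distr TA.M.r_distr\<close>)
qed

lemma incl_left: "(\<lambda>x. tens R M N x \<one>\<^bsub>N\<^esub>) \<in> alg_hom R M T"
  by (rule alg_homI) (simp_all add: tens_ops)

lemma incl_right: "(\<lambda>y. tens R M N \<one>\<^bsub>M\<^esub> y) \<in> alg_hom R N T"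
  by (rule alg_homI) (simp_all add: tens_ops)

end

lemma tensor_algI: "assoc_algebra R M \<Longrightarrow> assoc_algebra R N \<Longrightarrow> tensor_alg R M N"
  by (rule tensor_alg.intro)

text \<open>
  The maps \<open>coset_lift\<close> in the definitions of Hopf structures are identified by their values on pure
  tensors.
\<close>

lemma (in tensor_alg) coset_lift_eq:
  assumes P: "Module.module R P" and \<phi>: "\<phi> \<in> lin_map R T P"
    and h: "\<And>x y. x \<in> carrier M \<Longrightarrow> y \<in> carrier N \<Longrightarrow> h (x, y) = \<phi> (tens R M N x y)"
    and z: "z \<in> carrier T"
  shows "coset_lift R P h z = \<phi> z"
proof -
  note D = lin_mapD[OF \<phi>]
  have "h \<in> bilin R M N P"
    by (rule bilinI; rule lin_mapI) (simp_all add: h D tens_ops)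
  then show ?thesis
    by (intro lin_map_eqI[OF lift_bilin_lin[OF P] \<phi> _ z]) (simp_all add: lift_tens[OF P] h)
qed

lemma (in tensor_alg) tensor_map_alg_hom:
  assumes "assoc_algebra R M'" "assoc_algebra R N'"
    and \<phi>: "\<phi> \<in> alg_hom R M M'" and \<psi>: "\<psi> \<in> alg_hom R N N'"
  shows "tensor_map R M' N' \<phi> \<psi> \<in> alg_hom R T (tensor R M' N')"
    and "x \<in> carrier M \<Longrightarrow> y \<in> carrier N \<Longrightarrow>
      tensor_map R M' N' \<phi> \<psi> (tens R M N x y) = tens R M' N' (\<phi> x) (\<psi> y)"
proof -
  interpret T': tensor_alg R M' N' by (rule tensor_algI) fact+
  note D = alg_homD[OF \<phi>] alg_homD[OF \<psi>]
  have b: "(\<lambda>(x, y). tens R M' N' (\<phi> x) (\<psi> y)) \<in> bilin R M N (tensor R M' N')"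
    by (rule bilinI; rule lin_mapI) (simp_all add: D T'.tens_ops)
  show "tensor_map R M' N' \<phi> \<psi> \<in> alg_hom R T (tensor R M' N')"
    unfolding tensor_map_def
    by (rule lift_bilin_alg_hom[OF T'.assoc_alg b]) (simp_all add: D T'.tens_ops)
  show "x \<in> carrier M \<Longrightarrow> y \<in> carrier N \<Longrightarrow>
      tensor_map R M' N' \<phi> \<psi> (tens R M N x y) = tens R M' N' (\<phi> x) (\<psi> y)"
    unfolding tensor_map_def by (simp add: lift_tens[OF T'.TA.is_module b])
qed

text \<open>
  Only the carrier, the operations and the scalar multiplication of the factors enter a tensor
  product, so Hopf algebra structure on the factors may be added or forgotten.
\<close>

lemma tensor_rel_cong:
  assumes "carrier M' = carrier M" "add M' = add M" "module.smult M' = module.smult M"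
    "monoid.mult M' = monoid.mult M" "one M' = one M"
    "carrier N' = carrier N" "add N' = add N" "module.smult N' = module.smult N"
    "monoid.mult N' = monoid.mult N" "one N' = one N"
  shows "monoid_algebra R (M' \<times>\<times> N') = monoid_algebra R (M \<times>\<times> N)"
    and "tensor_rel R M' N' = tensor_rel R M N"
proof -
  have D: "M' \<times>\<times> N' = M \<times>\<times> N" using assms by (simp add: DirProd_def)
  then show A: "monoid_algebra R (M' \<times>\<times> N') = monoid_algebra R (M \<times>\<times> N)" by simp
  have "(u, w) \<in> tensor_rel R M N" if "(u, w) \<in> tensor_rel R M' N'" for u w
    using that
    by (cases rule: tensor_rel.cases)
       (auto simp: assms A intro: tensor_rel.intros[where M = M and N = N])
  moreover have "(u, w) \<in> tensor_rel R M' N'" if "(u, w) \<in> tensor_rel R M N" for u w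
    using that
    by (cases rule: tensor_rel.cases)
       (auto simp: assms[symmetric] A[symmetric] intro: tensor_rel.intros[where M = M' and N = N'])
  ultimately show "tensor_rel R M' N' = tensor_rel R M N" by auto
qed

lemma tensor_cong:
  assumes "carrier M' = carrier M" "add M' = add M" "module.smult M' = module.smult M"
    "monoid.mult M' = monoid.mult M" "one M' = one M"
    "carrier N' = carrier N" "add N' = add N" "module.smult N' = module.smult N"
    "monoid.mult N' = monoid.mult N" "one N' = one N"
  shows "tensor R M' N' = tensor R M N" "tens R M' N' = tens R M N"
  unfolding tensor_def tens_def fun_eq_iff tensor_rel_cong[OF assms] by simp_all

lemma with_hopf_sel [simp]:
  "carrier (with_hopf M d e s) = carrier M" "add (with_hopf M d e s) = add M"
  "zero (with_hopf M d e s) = zero M" "one (with_hopf M d e s) = one M"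
  "monoid.mult (with_hopf M d e s) = monoid.mult M"
  "module.smult (with_hopf M d e s) = module.smult M"
  "comult (with_hopf M d e s) = d" "counit (with_hopf M d e s) = e" "antipode (with_hopf M d e s) = s"
  by (simp_all add: with_hopf_def)

lemma tensor_with_hopf [simp]:
  "tensor R (with_hopf M d e s) N = tensor R M N"
  "tensor R N' (with_hopf M d e s) = tensor R N' M"
  "tens R (with_hopf M d e s) N = tens R M N"
  "tens R N' (with_hopf M d e s) = tens R N' M"
  by (rule tensor_cong; simp)+

lemma lin_map_with_hopf [simp]:
  "lin_map R (with_hopf M d e s) N = lin_map R M N" "lin_map R N' (with_hopf M d e s) = lin_map R N' M"
  by (simp_all add: lin_map_def)

lemma alg_hom_with_hopf [simp]:
  "alg_hom R (with_hopf M d e s) N = alg_hom R M N" "alg_hom R N' (with_hopf M d e s) = alg_hom R N' M"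
  by (simp_all add: alg_hom_def ring_hom_def)

lemma coset_lift_with_hopf [simp]: "coset_lift R (with_hopf M d e s) h = coset_lift R M h"
  by (simp add: coset_lift_def lin_ext_def finsum_def finprod_def fun_eq_iff)

lemma tensor_map_with_hopf1 [simp]:
  "tensor_map R (with_hopf M d e s) N f g = tensor_map R M N f g"
  by (simp add: tensor_map_def)

lemma tensor_map_with_hopf2 [simp]:
  "tensor_map R N (with_hopf M d e s) f g = tensor_map R N M f g"
  by (simp add: tensor_map_def)

lemma comm_alg_with_hopf: "comm_alg R M \<Longrightarrow> comm_alg R (with_hopf M d e s)"
  by (erule comm_alg_cong) simp_all

section \<open>Algebras given by generators and relations\<close>

lemma word_prod_simps [simp]:
  "word_prod P g [] = \<one>\<^bsub>P\<^esub>" "word_prod P g (x # w) = g x \<otimes>\<^bsub>P\<^esub> word_prod P g w"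
  by (simp_all add: word_prod_def)

lemma (in Group.monoid) word_prod_closed:
  "g \<in> X \<rightarrow> carrier G \<Longrightarrow> w \<in> lists X \<Longrightarrow> word_prod G g w \<in> carrier G"
  by (induction w) auto

lemma (in Group.monoid) word_prod_append:
  "g \<in> X \<rightarrow> carrier G \<Longrightarrow> w \<in> lists X \<Longrightarrow> w' \<in> lists X \<Longrightarrow>
    word_prod G g (w @ w') = word_prod G g w \<otimes> word_prod G g w'"
  by (induction w) (auto simp: word_prod_closed[where X = X] m_assoc Pi_iff)

text \<open>
  The antipode of an enveloping algebra is defined through reversed words; in the commutative case
  the order is immaterial.
\<close>

lemma (in comm_monoid) word_prod_rev:
  "g \<in> X \<rightarrow> carrier G \<Longrightarrow> w \<in> lists X \<Longrightarrow> word_prod G g (rev w) = word_prod G g w"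
proof (induction w)
  case (Cons x w)
  then have "word_prod G g (rev (x # w)) = word_prod G g (rev w) \<otimes> word_prod G g [x]"
    by (simp only: rev.simps) (rule word_prod_append, auto)
  with Cons show ?case by (auto simp: m_comm word_prod_closed[where X = X] Pi_iff)
qed simp

text \<open>
  The algebra with generators \<open>X\<close> and relations \<open>E\<close>.
\<close>

locale free_pres = R: cring R for R (structure) +
  fixes X :: "'x set" and E :: "(('x list \<Rightarrow> 'a) \<times> ('x list \<Rightarrow> 'a)) set"
  assumes E: "E \<subseteq> carrier (free_alg R X) \<times> carrier (free_alg R X)"
begin

lemma free_monoid: "Group.monoid (free_monoid X)"
  by (rule monoidI) (auto simp: free_monoid_def)

sublocale F: monoid_alg R "free_monoid X"
  rewrites "monoid_algebra R (free_monoid X) = free_alg R X"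
  by (intro monoid_alg.intro R.is_cring free_monoid) (simp add: free_alg_def)

sublocale Q: presented R "free_alg R X" E
  by (intro presented.intro F.assoc_alg presented_axioms.intro E)

sublocale QA: assoc_algebra R "rel_quot (free_alg R X) E"
  by (rule Q.Q_assoc_alg)

abbreviation gen where "gen x \<equiv> rel_class (free_alg R X) E (basis_elt R [x])"

lemma free_monoid_simps [simp]:
  "carrier (free_monoid X) = lists X" "x \<otimes>\<^bsub>free_monoid X\<^esub> y = x @ y" "\<one>\<^bsub>free_monoid X\<^esub> = []"
  by (simp_all add: free_monoid_def)

lemma var_closed [simp]: "x \<in> X \<Longrightarrow> basis_elt R [x] \<in> carrier (free_alg R X)"
  by (rule F.closed) simp

lemma gen_closed [simp]: "x \<in> X \<Longrightarrow> gen x \<in> carrier Q.Q"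
  by (auto simp: Q.carrier_Q)

text \<open>
  Words are handled by multiplying generators from the left, so closure under products is replaced
  by closure under left multiplication by generators.
\<close>

lemma induct [consumes 1, case_names one add smult gen]:
  assumes z: "z \<in> carrier Q.Q"
    and one: "S \<one>\<^bsub>Q.Q\<^esub>"
    and add: "\<And>u w. u \<in> carrier Q.Q \<Longrightarrow> w \<in> carrier Q.Q \<Longrightarrow> S u \<Longrightarrow> S w \<Longrightarrow> S (u \<oplus>\<^bsub>Q.Q\<^esub> w)"
    and smult: "\<And>a u. a \<in> carrier R \<Longrightarrow> u \<in> carrier Q.Q \<Longrightarrow> S u \<Longrightarrow> S (a \<odot>\<^bsub>Q.Q\<^esub> u)"
    and gen: "\<And>x u. x \<in> X \<Longrightarrow> u \<in> carrier Q.Q \<Longrightarrow> S u \<Longrightarrow> S (gen x \<otimes>\<^bsub>Q.Q\<^esub> u)"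
  shows "S z"
proof -
  have cl: "Q.cls f \<in> carrier Q.Q" if "f \<in> carrier (free_alg R X)" for f
    using that by (simp add: Q.carrier_Q)
  have b: "S (Q.cls (basis_elt R w))" if "w \<in> lists X" for w
    using that
  proof (induction w)
    case Nil
    then show ?case using one by (simp add: Q.Q_ops F.one_A)
  next
    case (Cons x w)
    have "Q.cls (basis_elt R (x # w)) = gen x \<otimes>\<^bsub>Q.Q\<^esub> Q.cls (basis_elt R w)"
      using Cons by (simp add: Q.Q_ops F.basis_mult F.closed)
    then show ?case using Cons gen[of x "Q.cls (basis_elt R w)"]
      by (simp add: Q.carrier_Q F.closed)
  qed
  have "S (Q.cls f)" if "f \<in> carrier (free_alg R X)" for f
    using that
  proof (induction f rule: F.monoid_algebra_induct)
    case zero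
    have "Q.cls \<zero>\<^bsub>free_alg R X\<^esub> = \<zero>\<^bsub>R\<^esub> \<odot>\<^bsub>Q.Q\<^esub> \<one>\<^bsub>Q.Q\<^esub>"
      by (simp add: Q.Q_ops Q.Q_smult)
    then show ?case using smult[OF R.zero_closed QA.M.one_closed one] by simp
  next
    case (add f g)
    then show ?case using assms(3)[of "Q.cls f" "Q.cls g"] by (simp add: Q.Q_ops Q.carrier_Q)
  next
    case (smult a x)
    then show ?case using assms(4)[of a "Q.cls (basis_elt R x)"] b[of x]
      by (simp add: Q.Q_smult Q.carrier_Q F.closed)
  qed
  then show ?thesis using z by (auto simp: Q.carrier_Q)
qed

lemma free_eval:
  assumes P: "assoc_algebra R P" and g: "g \<in> X \<rightarrow> carrier P"
    and h: "\<And>w. w \<in> lists X \<Longrightarrow> h w = word_prod P g w"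
  shows "lin_ext R P h \<in> alg_hom R (free_alg R X) P"
    and "x \<in> X \<Longrightarrow> lin_ext R P h (basis_elt R [x]) = g x"
proof -
  interpret P: assoc_algebra R P by fact
  have hc: "h \<in> carrier (free_monoid X) \<rightarrow> carrier P"
    using P.M.word_prod_closed[OF g] h by simp
  show "lin_ext R P h \<in> alg_hom R (free_alg R X) P"
    by (rule F.lin_ext_alg_hom[OF P hc]) (simp_all add: h P.M.word_prod_append[OF g])
  show "x \<in> X \<Longrightarrow> lin_ext R P h (basis_elt R [x]) = g x"
    using g by (subst F.lin_ext_basis[OF P.is_module hc]) (auto simp: h Pi_iff)
qed

lemma pres_lift:
  assumes P: "assoc_algebra R P" and g: "g \<in> X \<rightarrow> carrier P"
    and h: "\<And>w. w \<in> lists X \<Longrightarrow> h w = word_prod P g w"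
    and rel: "\<And>x y. (x, y) \<in> E \<Longrightarrow> lin_ext R P h x = lin_ext R P h y"
  shows "coset_lift R P h \<in> alg_hom R Q.Q P"
    and "x \<in> X \<Longrightarrow> coset_lift R P h (gen x) = g x"
proof -
  note L = free_eval[OF P g h]
  show "coset_lift R P h \<in> alg_hom R Q.Q P"
    unfolding coset_lift_def by (rule Q.lift_alg_hom(1)[OF P L(1) rel])
  show "x \<in> X \<Longrightarrow> coset_lift R P h (gen x) = g x"
    unfolding coset_lift_def using Q.lift_alg_hom(2)[OF P L(1) rel] L(2) by simp
qed

lemma comm_alg:
  assumes "\<And>x y. x \<in> X \<Longrightarrow> y \<in> X \<Longrightarrow> gen x \<otimes>\<^bsub>Q.Q\<^esub> gen y = gen y \<otimes>\<^bsub>Q.Q\<^esub> gen x"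
  shows "comm_alg R Q.Q"
proof (rule comm_algI[OF Q.Q_assoc_alg])
  fix z w assume z: "z \<in> carrier Q.Q" and w: "w \<in> carrier Q.Q"
  have g: "gen x \<otimes>\<^bsub>Q.Q\<^esub> w = w \<otimes>\<^bsub>Q.Q\<^esub> gen x" if x: "x \<in> X" and w: "w \<in> carrier Q.Q" for x w
    using w
  proof (induction w rule: induct)
    case (gen y u)
    then have "gen x \<otimes>\<^bsub>Q.Q\<^esub> (gen y \<otimes>\<^bsub>Q.Q\<^esub> u) = (gen y \<otimes>\<^bsub>Q.Q\<^esub> gen x) \<otimes>\<^bsub>Q.Q\<^esub> u"
      using x assms by (simp add: QA.M.m_assoc[symmetric])
    then show ?case using gen x by (simp add: QA.M.m_assoc)
  qed (use x in \<open>simp_all add: QA.M.l_distr QA.M.r_distr QA.smult_mult_left QA.smult_mult_right\<close>)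
  show "z \<otimes>\<^bsub>Q.Q\<^esub> w = w \<otimes>\<^bsub>Q.Q\<^esub> z"
    using z
  proof (induction z rule: induct)
    case (gen x u)
    then have "(gen x \<otimes>\<^bsub>Q.Q\<^esub> u) \<otimes>\<^bsub>Q.Q\<^esub> w = (gen x \<otimes>\<^bsub>Q.Q\<^esub> w) \<otimes>\<^bsub>Q.Q\<^esub> u"
      using w by (simp add: QA.M.m_assoc)
    then show ?case using gen w g by (simp add: QA.M.m_assoc)
  qed (use w in \<open>simp_all add: QA.M.l_distr QA.M.r_distr QA.smult_mult_left QA.smult_mult_right\<close>)
qed

end

section \<open>Extension of scalars\<close>

lemma restrict_scalars_sel [simp]:
  "carrier (restrict_scalars f M) = carrier M" "add (restrict_scalars f M) = add M"
  "zero (restrict_scalars f M) = zero M" "one (restrict_scalars f M) = one M"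
  "monoid.mult (restrict_scalars f M) = monoid.mult M"
  "module.smult (restrict_scalars f M) = (\<lambda>a x. f a \<odot>\<^bsub>M\<^esub> x)"
  by (simp_all add: restrict_scalars_def)

lemma regular_alg_sel [simp]:
  "carrier (regular_alg R) = carrier R" "add (regular_alg R) = add R"
  "zero (regular_alg R) = zero R" "one (regular_alg R) = one R"
  "monoid.mult (regular_alg R) = monoid.mult R"
  "module.smult (regular_alg R) = monoid.mult R"
  by (simp_all add: regular_alg_def)

lemma restrict_scalars_comm_alg:
  assumes "comm_alg B P" "cring R" "f \<in> ring_hom R B"
  shows "comm_alg R (restrict_scalars f P)"
proof -
  interpret P: comm_alg B P by fact
  interpret R: cring R by fact
  note f = ring_hom_memE[OF assms(3)]
  have rg: "ring (restrict_scalars f P)" by (rule ring_cong[OF P.M.ring_axioms]) simp_all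
  then interpret Q: ring "restrict_scalars f P" .
  have "assoc_algebra R (restrict_scalars f P)"
    by (intro assoc_algebra.intro moduleI assoc_algebra_axioms.intro rg R.is_cring Q.is_abelian_group)
       (auto simp: f P.smult_l_distr P.smult_r_distr P.smult_assoc1 P.smult_mult_left P.smult_mult_right)
  then show ?thesis by (rule comm_algI) (simp add: P.M.m_comm)
qed

text \<open>
  Extension of scalars along \<open>f\<close>. For commutative \<open>M\<close> it is the coproduct of \<open>M\<close> and \<open>B\<close> over \<open>R\<close>, which
  gives its universal property.
\<close>

locale scalar_ext = R: cring R + B: cring B + M: comm_alg R M
  for R (structure) and B (structure) and M (structure) and f +
  assumes f: "f \<in> ring_hom R B"
begin

abbreviation BR where "BR \<equiv> restrict_scalars f (regular_alg B)"
abbreviation W where "W \<equiv> base_change R M B f"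
abbreviation j where "j \<equiv> base_change_incl R M B f"

sublocale BR: comm_alg R BR
  by (rule restrict_scalars_comm_alg[OF B.regular_alg_comm_alg R.is_cring f])

sublocale T: tensor_alg R M BR
  by (rule tensor_algI) unfold_locales

lemmas f_simps = ring_hom_memE[OF f]

sublocale TC: comm_alg R T.T
  by (rule T.comm_alg) unfold_locales

lemma W_sel [simp]:
  "carrier W = carrier T.T" "add W = add T.T" "zero W = zero T.T" "one W = one T.T"
  "monoid.mult W = monoid.mult T.T"
  "b \<odot>\<^bsub>W\<^esub> z = tens R M BR \<one>\<^bsub>M\<^esub> b \<otimes>\<^bsub>T.T\<^esub> z"
  by (simp_all add: base_change_def Let_def)

lemma W_comm_alg: "comm_alg B W"
proof -
  have rg: "ring W" by (rule ring_cong[OF T.TA.M.ring_axioms]) simp_all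
  then interpret W: ring W .
  have s: "tens R M BR \<one>\<^bsub>M\<^esub> (b \<otimes>\<^bsub>B\<^esub> c) = tens R M BR \<one>\<^bsub>M\<^esub> b \<otimes>\<^bsub>T.T\<^esub> tens R M BR \<one>\<^bsub>M\<^esub> c"
    if "b \<in> carrier B" "c \<in> carrier B" for b c
    using that by (simp add: T.tens_mult)
  have a: "tens R M BR \<one>\<^bsub>M\<^esub> (b \<oplus>\<^bsub>B\<^esub> c) = tens R M BR \<one>\<^bsub>M\<^esub> b \<oplus>\<^bsub>T.T\<^esub> tens R M BR \<one>\<^bsub>M\<^esub> c"
    if "b \<in> carrier B" "c \<in> carrier B" for b c
    using T.tens_add_right[of "\<one>\<^bsub>M\<^esub>" b c] that by simp
  have o: "tens R M BR \<one>\<^bsub>M\<^esub> \<one>\<^bsub>B\<^esub> = \<one>\<^bsub>T.T\<^esub>" by (simp add: T.tens_one)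
  have c: "tens R M BR \<one>\<^bsub>M\<^esub> b \<in> carrier T.T" if "b \<in> carrier B" for b
    using that by (intro T.tens_closed) simp_all
  have "assoc_algebra B W"
    by (intro assoc_algebra.intro moduleI assoc_algebra_axioms.intro rg B.is_cring W.is_abelian_group)
       (auto simp: s a o c T.TA.M.l_distr T.TA.M.r_distr TC.M.m_ac)
  then show ?thesis by (rule comm_algI) (simp add: TC.M.m_comm)
qed

sublocale W: comm_alg B W
  by (rule W_comm_alg)

text \<open>
  Every pure tensor is a \<open>B\<close>-multiple of an element of \<open>M\<close>; hence \<open>W\<close> is spanned over \<open>B\<close> by the image of
  \<open>j\<close>, and it suffices to know maps on that image.
\<close>

lemma tens_eq: "x \<in> carrier M \<Longrightarrow> b \<in> carrier B \<Longrightarrow> tens R M BR x b = b \<odot>\<^bsub>W\<^esub> j x"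
  by (simp add: base_change_incl_def T.tens_mult)

lemma j_alg_hom: "j \<in> alg_hom R M (restrict_scalars f W)"
proof (rule alg_homI)
  fix a x assume ax: "a \<in> carrier R" "x \<in> carrier M"
  have "j (a \<odot>\<^bsub>M\<^esub> x) = tens R M BR x (a \<odot>\<^bsub>BR\<^esub> \<one>\<^bsub>BR\<^esub>)"
    unfolding base_change_incl_def using ax by (simp only: T.tens_smult_left T.tens_smult_right BR.M.one_closed) (simp add: T.tens_smult_left T.tens_smult_right[symmetric] f_simps)
  also have "\<dots> = f a \<odot>\<^bsub>W\<^esub> j x"
    using ax tens_eq[of x "f a"] by (simp add: f_simps)
  finally show "j (a \<odot>\<^bsub>M\<^esub> x) = a \<odot>\<^bsub>restrict_scalars f W\<^esub> j x" by simp
qed (simp_all add: base_change_incl_def T.tens_ops T.tens_one)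

lemma W_induct [consumes 1, case_names add smult]:
  assumes "z \<in> carrier W"
    and "\<And>u w. u \<in> carrier W \<Longrightarrow> w \<in> carrier W \<Longrightarrow> S u \<Longrightarrow> S w \<Longrightarrow> S (u \<oplus>\<^bsub>W\<^esub> w)"
    and "\<And>b x. b \<in> carrier B \<Longrightarrow> x \<in> carrier M \<Longrightarrow> S (b \<odot>\<^bsub>W\<^esub> j x)"
  shows "S z"
  using assms(1) unfolding W_sel(1)
  by (induction z rule: T.tensor_induct)
     (use assms(2,3) tens_eq in \<open>simp_all del: W_sel(6)\<close>)

text \<open>
  The adjunction between extension and restriction of scalars.
\<close>

lemma base_change_lift:
  assumes P: "comm_alg B P" and \<phi>: "\<phi> \<in> alg_hom R M (restrict_scalars f P)"
    and h: "\<And>x b. x \<in> carrier M \<Longrightarrow> b \<in> carrier B \<Longrightarrow> h (x, b) = b \<odot>\<^bsub>P\<^esub> \<phi> x"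
  shows "coset_lift R (restrict_scalars f P) h \<in> alg_hom B W P"
    and "x \<in> carrier M \<Longrightarrow> coset_lift R (restrict_scalars f P) h (j x) = \<phi> x"
proof -
  interpret P: comm_alg B P by fact
  interpret RP: comm_alg R "restrict_scalars f P"
    by (rule restrict_scalars_comm_alg[OF P R.is_cring f])
  have \<psi>: "(\<lambda>b. b \<odot>\<^bsub>P\<^esub> \<one>\<^bsub>P\<^esub>) \<in> alg_hom R BR (restrict_scalars f P)"
    by (rule alg_homI) (simp_all add: P.smult_l_distr P.smult_assoc1 P.smult_mult_left f_simps)
  note D = alg_homD[OF \<phi>, simplified]
  have h': "h (x, b) = \<phi> x \<otimes>\<^bsub>restrict_scalars f P\<^esub> (b \<odot>\<^bsub>P\<^esub> \<one>\<^bsub>P\<^esub>)"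
    if "x \<in> carrier M" "b \<in> carrier BR" for x b
    using that by (simp add: h D P.smult_mult_right)
  note L = T.lift_coproduct[OF RP.comm_alg_axioms \<phi> \<psi> h']
  note LD = alg_homD[OF L(1), simplified]
  show v: "coset_lift R (restrict_scalars f P) h (j x) = \<phi> x" if "x \<in> carrier M" for x
    using that L(2)[of x "\<one>\<^bsub>B\<^esub>"] by (simp add: base_change_incl_def D)
  show "coset_lift R (restrict_scalars f P) h \<in> alg_hom B W P"
  proof (rule alg_homI)
    fix b z assume b: "b \<in> carrier B" and z: "z \<in> carrier W"
    have "coset_lift R (restrict_scalars f P) h (tens R M BR \<one>\<^bsub>M\<^esub> b) = b \<odot>\<^bsub>P\<^esub> \<one>\<^bsub>P\<^esub>"
      using L(2)[of "\<one>\<^bsub>M\<^esub>" b] b by (simp add: D)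
    then show "coset_lift R (restrict_scalars f P) h (b \<odot>\<^bsub>W\<^esub> z)
        = b \<odot>\<^bsub>P\<^esub> coset_lift R (restrict_scalars f P) h z"
      using b z LD(3)[of "tens R M BR \<one>\<^bsub>M\<^esub> b" z] LD(1)[of z] by (simp add: P.smult_mult_left)
  qed (simp_all add: LD)
qed

end

section \<open>Hopf structure on an extension of scalars\<close>

lemma base_change_with_hopf [simp]:
  "base_change R (with_hopf M d e s) B f = base_change R M B f"
  "base_change_incl R (with_hopf M d e s) B f = base_change_incl R M B f"
  by (simp_all add: base_change_def base_change_incl_def Let_def fun_eq_iff)

context scalar_ext
begin

abbreviation WW where "WW \<equiv> tensor B W W"

definition ext_comult where
  "ext_comult d = coset_lift R (restrict_scalars f WW) (\<lambda>(x, b). b \<odot>\<^bsub>WW\<^esub>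
     coset_lift R (restrict_scalars f WW) (\<lambda>(y, z). tens B W W (j y) (j z)) (d x))"

definition ext_counit where
  "ext_counit e = coset_lift R BR (\<lambda>(x, b). f (e x) \<otimes>\<^bsub>B\<^esub> b)"

definition ext_antipode where
  "ext_antipode s = tensor_map R M BR s (\<lambda>b. b)"

lemma base_change_hopf_eq:
  "base_change_hopf R (with_hopf M d e s) B f
    = with_hopf W (ext_comult d) (ext_counit e) (ext_antipode s)"
  by (simp add: base_change_hopf_def Let_def ext_comult_def ext_counit_def ext_antipode_def)

sublocale WW: tensor_alg B W W
  by (rule tensor_algI) unfold_locales

lemma WW_comm_alg: "comm_alg B WW"
  by (rule WW.comm_alg) unfold_locales

text \<open>
  The passage from \<open>M \<otimes> M\<close> to \<open>W \<otimes> W\<close> that carries the comultiplication of \<open>M\<close> to that of \<open>W\<close>.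
\<close>

lemma ext_tensor_map:
  shows "coset_lift R (restrict_scalars f WW) (\<lambda>(y, z). tens B W W (j y) (j z))
      \<in> alg_hom R (tensor R M M) (restrict_scalars f WW)"
    and "x \<in> carrier M \<Longrightarrow> y \<in> carrier M \<Longrightarrow>
      coset_lift R (restrict_scalars f WW) (\<lambda>(y, z). tens B W W (j y) (j z)) (tens R M M x y)
      = tens B W W (j x) (j y)"
proof -
  interpret TM: tensor_alg R M M by (rule tensor_algI) unfold_locales
  interpret P: comm_alg R "restrict_scalars f WW"
    by (rule restrict_scalars_comm_alg[OF WW_comm_alg R.is_cring f])
  note D = alg_homD[OF j_alg_hom, unfolded restrict_scalars_sel]
  have b: "(\<lambda>(y, z). tens B W W (j y) (j z)) \<in> bilin R M M (restrict_scalars f WW)"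
    by (rule bilinI; rule lin_mapI) (simp_all add: D WW.tens_ops f_simps del: W_sel)
  show "coset_lift R (restrict_scalars f WW) (\<lambda>(y, z). tens B W W (j y) (j z))
      \<in> alg_hom R (tensor R M M) (restrict_scalars f WW)"
    by (rule TM.lift_bilin_alg_hom[OF P.assoc_algebra_axioms b]) (simp_all add: D WW.tens_ops del: W_sel)
  show "x \<in> carrier M \<Longrightarrow> y \<in> carrier M \<Longrightarrow>
      coset_lift R (restrict_scalars f WW) (\<lambda>(y, z). tens B W W (j y) (j z)) (tens R M M x y)
      = tens B W W (j x) (j y)"
    by (simp add: TM.lift_tens[OF P.is_module b])
qed

lemma ext_comult:
  assumes d: "d \<in> alg_hom R M (tensor R M M)"
  shows "ext_comult d \<in> alg_hom B W WW"
    and "x \<in> carrier M \<Longrightarrow> ext_comult d (j x)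
      = coset_lift R (restrict_scalars f WW) (\<lambda>(y, z). tens B W W (j y) (j z)) (d x)"
proof -
  note c = alg_hom_comp[OF d ext_tensor_map(1)]
  show "ext_comult d \<in> alg_hom B W WW"
    unfolding ext_comult_def by (rule base_change_lift(1)[OF WW_comm_alg c]) simp
  show "x \<in> carrier M \<Longrightarrow> ext_comult d (j x)
      = coset_lift R (restrict_scalars f WW) (\<lambda>(y, z). tens B W W (j y) (j z)) (d x)"
    unfolding ext_comult_def by (rule base_change_lift(2)[OF WW_comm_alg c]) simp_all
qed

lemma ext_counit:
  assumes e: "e \<in> alg_hom R M (regular_alg R)"
  shows "ext_counit e \<in> alg_hom B W (regular_alg B)"
    and "x \<in> carrier M \<Longrightarrow> ext_counit e (j x) = f (e x)"
proof -
  note D = alg_homD[OF e, simplified]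
  have c: "(\<lambda>x. f (e x)) \<in> alg_hom R M BR"
    by (rule alg_homI) (simp_all add: D f_simps)
  show "ext_counit e \<in> alg_hom B W (regular_alg B)"
    unfolding ext_counit_def
    by (rule base_change_lift(1)[OF B.regular_alg_comm_alg c]) (simp add: B.m_comm D f_simps)
  show "x \<in> carrier M \<Longrightarrow> ext_counit e (j x) = f (e x)"
    unfolding ext_counit_def
    by (rule base_change_lift(2)[OF B.regular_alg_comm_alg c]) (simp_all add: B.m_comm D f_simps)
qed

lemma ext_antipode:
  assumes s: "s \<in> alg_hom R M M"
  shows "ext_antipode s \<in> alg_hom B W W"
    and "x \<in> carrier M \<Longrightarrow> ext_antipode s (j x) = j (s x)"
proof -
  have i: "(\<lambda>b. b) \<in> alg_hom R BR BR" by (rule alg_homI) simp_all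
  note L = T.tensor_map_alg_hom[OF M.assoc_algebra_axioms BR.assoc_algebra_axioms s i,
      folded ext_antipode_def]
  note D = alg_homD[OF L(1)] alg_homD[OF s]
  show "x \<in> carrier M \<Longrightarrow> ext_antipode s (j x) = j (s x)"
    by (simp add: base_change_incl_def L(2))
  show "ext_antipode s \<in> alg_hom B W W"
  proof (rule alg_homI)
    fix b z assume b: "b \<in> carrier B" and z: "z \<in> carrier W"
    have c: "tens R M BR \<one>\<^bsub>M\<^esub> b \<in> carrier T.T" using b by (intro T.tens_closed) simp_all
    show "ext_antipode s (b \<odot>\<^bsub>W\<^esub> z) = b \<odot>\<^bsub>W\<^esub> ext_antipode s z"
      using b z D(3)[OF c] L(2)[of "\<one>\<^bsub>M\<^esub>" b] by (simp add: D)
  qed (simp_all add: D)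
qed

end

section \<open>Hopf structure on a tensor product\<close>

text \<open>
  For commutative factors the tensor product is their coproduct, so its Hopf structure maps are
  determined by their values on the two factors, which are embedded by \<open>\<iota>\<close> and \<open>\<iota>'\<close>.
\<close>

locale tensor_hopf_alg = H: comm_alg R H + H': comm_alg R H'
  for R (structure) and H :: "('a, 'd, 'm) hopf_scheme" and H' :: "('a, 'e, 'n) hopf_scheme" +
  assumes comult_H: "comult H \<in> alg_hom R H (tensor R H H)"
    and comult_H': "comult H' \<in> alg_hom R H' (tensor R H' H')"
    and counit_H: "counit H \<in> alg_hom R H (regular_alg R)"
    and counit_H': "counit H' \<in> alg_hom R H' (regular_alg R)"
    and antipode_H: "antipode H \<in> alg_hom R H H"
    and antipode_H': "antipode H' \<in> alg_hom R H' H'"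
begin

abbreviation T where "T \<equiv> tensor R H H'"
abbreviation TT where "TT \<equiv> tensor R T T"
abbreviation \<iota> where "\<iota> x \<equiv> tens R H H' x \<one>\<^bsub>H'\<^esub>"
abbreviation \<iota>' where "\<iota>' y \<equiv> tens R H H' \<one>\<^bsub>H\<^esub> y"

sublocale T: tensor_alg R H H'
  by (rule tensor_algI) unfold_locales

lemma T_comm: "comm_alg R T"
  by (rule T.comm_alg) unfold_locales

sublocale TT: tensor_alg R T T
  by (rule tensor_algI) unfold_locales

lemma TT_comm: "comm_alg R TT"
  by (rule TT.comm_alg[OF T_comm T_comm])

sublocale HH: tensor_alg R H H
  by (rule tensor_algI) unfold_locales

sublocale HH': tensor_alg R H' H'
  by (rule tensor_algI) unfold_locales

lemma sel [simp]:
  "carrier (tensor_hopf R H H') = carrier T" "add (tensor_hopf R H H') = add T"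
  "zero (tensor_hopf R H H') = zero T" "one (tensor_hopf R H H') = one T"
  "monoid.mult (tensor_hopf R H H') = monoid.mult T"
  "module.smult (tensor_hopf R H H') = module.smult T"
  "alg_hom R (tensor_hopf R H H') P = alg_hom R T P"
  by (simp_all add: tensor_hopf_def Let_def)

abbreviation \<alpha> where "\<alpha> \<equiv> tensor_map R T T \<iota> \<iota>"
abbreviation \<beta> where "\<beta> \<equiv> tensor_map R T T \<iota>' \<iota>'"

lemmas \<alpha> = HH.tensor_map_alg_hom[OF T.assoc_alg T.assoc_alg T.incl_left T.incl_left]
lemmas \<beta> = HH'.tensor_map_alg_hom[OF T.assoc_alg T.assoc_alg T.incl_right T.incl_right]

text \<open>
  The defining double sum over Sweedler components factors into the images of the two
  comultiplications, which makes its multiplicativity visible.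
\<close>

lemma tensor_comult:
  shows "comult (tensor_hopf R H H') \<in> alg_hom R T TT"
    and "x \<in> carrier H \<Longrightarrow> comult (tensor_hopf R H H') (\<iota> x) = \<alpha> (comult H x)"
    and "y \<in> carrier H' \<Longrightarrow> comult (tensor_hopf R H H') (\<iota>' y) = \<beta> (comult H' y)"
proof -
  interpret TT': comm_alg R TT by (rule TT_comm)
  note \<alpha>D = alg_homD[OF \<alpha>(1)] and \<beta>D = alg_homD[OF \<beta>(1)]
  note cD = alg_homD[OF comult_H] and cD' = alg_homD[OF comult_H']
  have inner: "coset_lift R TT (\<lambda>(y1, y2). tens R T T (tens R H H' x1 y1) (tens R H H' x2 y2)) w
      = \<alpha> (tens R H H x1 x2) \<otimes>\<^bsub>TT\<^esub> \<beta> w"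
    if x: "x1 \<in> carrier H" "x2 \<in> carrier H" and w: "w \<in> carrier (tensor R H' H')" for x1 x2 w
    by (rule HH'.coset_lift_eq[OF TT.TA.is_module _ _ w])
       (use x in \<open>auto intro!: lin_mapI simp: \<alpha>D \<beta>D \<alpha>(2) \<beta>(2) TT.TA.M.r_distr TT.TA.smult_mult_right
          T.tens_ops TT.tens_ops\<close>)
  have middle: "coset_lift R TT (\<lambda>(x1, x2).
        coset_lift R TT (\<lambda>(y1, y2). tens R T T (tens R H H' x1 y1) (tens R H H' x2 y2)) w) u
      = \<alpha> u \<otimes>\<^bsub>TT\<^esub> \<beta> w"
    if w: "w \<in> carrier (tensor R H' H')" and u: "u \<in> carrier (tensor R H H)" for u w
    by (rule HH.coset_lift_eq[OF TT.TA.is_module _ _ u])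
       (use w in \<open>auto intro!: lin_mapI simp: inner \<alpha>D \<beta>D TT.TA.M.l_distr TT.TA.smult_mult_left\<close>)
  note L = T.lift_coproduct[OF TT_comm alg_hom_comp[OF comult_H \<alpha>(1)] alg_hom_comp[OF comult_H' \<beta>(1)]]
  let ?c = "\<lambda>(x, y). coset_lift R TT (\<lambda>(x1, x2).
        coset_lift R TT (\<lambda>(y1, y2). tens R T T (tens R H H' x1 y1) (tens R H H' x2 y2))
          (comult H' y)) (comult H x)"
  have c: "comult (tensor_hopf R H H') = coset_lift R TT ?c"
    by (simp add: tensor_hopf_def Let_def)
  have h: "?c (x, y) = \<alpha> (comult H x) \<otimes>\<^bsub>TT\<^esub> \<beta> (comult H' y)"
    if "x \<in> carrier H" "y \<in> carrier H'" for x y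
    using that by (simp add: middle cD cD')
  show "comult (tensor_hopf R H H') \<in> alg_hom R T TT"
    unfolding c by (rule L(1)[OF h])
  show "x \<in> carrier H \<Longrightarrow> comult (tensor_hopf R H H') (\<iota> x) = \<alpha> (comult H x)"
    unfolding c by (subst L(2)[OF h]) (simp_all add: cD cD' \<alpha>D \<beta>D)
  show "y \<in> carrier H' \<Longrightarrow> comult (tensor_hopf R H H') (\<iota>' y) = \<beta> (comult H' y)"
    unfolding c by (subst L(2)[OF h]) (simp_all add: cD cD' \<alpha>D \<beta>D)
qed

lemma tensor_counit:
  shows "counit (tensor_hopf R H H') \<in> alg_hom R T (regular_alg R)"
    and "x \<in> carrier H \<Longrightarrow> counit (tensor_hopf R H H') (\<iota> x) = counit H x"
    and "y \<in> carrier H' \<Longrightarrow> counit (tensor_hopf R H H') (\<iota>' y) = counit H' y"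
proof -
  note D = alg_homD[OF counit_H, simplified] alg_homD[OF counit_H', simplified]
  note L = T.lift_coproduct[OF H.R.regular_alg_comm_alg counit_H counit_H',
      where h = "\<lambda>(x, y). counit H x \<otimes>\<^bsub>R\<^esub> counit H' y", simplified]
  have c: "counit (tensor_hopf R H H')
      = coset_lift R (regular_alg R) (\<lambda>(x, y). counit H x \<otimes>\<^bsub>R\<^esub> counit H' y)"
    by (simp add: tensor_hopf_def Let_def)
  show "counit (tensor_hopf R H H') \<in> alg_hom R T (regular_alg R)"
    unfolding c by (rule L(1))
  show "x \<in> carrier H \<Longrightarrow> counit (tensor_hopf R H H') (\<iota> x) = counit H x"
    unfolding c by (simp add: L(2) D)
  show "y \<in> carrier H' \<Longrightarrow> counit (tensor_hopf R H H') (\<iota>' y) = counit H' y"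
    unfolding c by (simp add: L(2) D)
qed

lemma tensor_antipode:
  shows "antipode (tensor_hopf R H H') \<in> alg_hom R T T"
    and "x \<in> carrier H \<Longrightarrow> antipode (tensor_hopf R H H') (\<iota> x) = \<iota> (antipode H x)"
    and "y \<in> carrier H' \<Longrightarrow> antipode (tensor_hopf R H H') (\<iota>' y) = \<iota>' (antipode H' y)"
proof -
  note L = T.tensor_map_alg_hom[OF H.assoc_algebra_axioms H'.assoc_algebra_axioms antipode_H antipode_H']
  have c: "antipode (tensor_hopf R H H') = tensor_map R H H' (antipode H) (antipode H')"
    by (simp add: tensor_hopf_def Let_def)
  show "antipode (tensor_hopf R H H') \<in> alg_hom R T T"
    unfolding c by (rule L(1))
  show "x \<in> carrier H \<Longrightarrow> antipode (tensor_hopf R H H') (\<iota> x) = \<iota> (antipode H x)"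
    "y \<in> carrier H' \<Longrightarrow> antipode (tensor_hopf R H H') (\<iota>' y) = \<iota>' (antipode H' y)"
    unfolding c by (simp_all add: L(2) alg_homD[OF antipode_H] alg_homD[OF antipode_H'])
qed

end

section \<open>Group algebras and enveloping algebras of abelian Lie algebras\<close>

locale group_alg = R: cring R + G: comm_group G for R (structure) and G (structure)
begin

sublocale A: monoid_alg R G
  by unfold_locales

sublocale AC: comm_alg R A.A
  by (rule A.comm_alg) (rule G.m_comm)

sublocale AA: tensor_alg R A.A A.A
  by (rule tensor_algI) unfold_locales

lemma group_hopf_sel [simp]:
  "carrier (group_hopf R G) = carrier A.A" "one (group_hopf R G) = one A.A"
  "alg_hom R (group_hopf R G) P = alg_hom R A.A P"
  "alg_hom R Q (group_hopf R G) = alg_hom R Q A.A"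
  "tensor R (group_hopf R G) N = tensor R A.A N"
  "tens R (group_hopf R G) N = tens R A.A N"
  "tensor R N' (group_hopf R G) = tensor R N' A.A"
  by (simp_all add: group_hopf_def Let_def)

lemma group_hopf_comm: "comm_alg R (group_hopf R G)"
  by (simp add: group_hopf_def Let_def comm_alg_with_hopf AC.comm_alg_axioms)

lemma group_comult:
  shows "comult (group_hopf R G) \<in> alg_hom R A.A (tensor R A.A A.A)"
    and "g \<in> carrier G \<Longrightarrow> comult (group_hopf R G) (basis_elt R g)
      = tens R A.A A.A (basis_elt R g) (basis_elt R g)"
proof -
  have h: "(\<lambda>g. tens R A.A A.A (basis_elt R g) (basis_elt R g)) \<in> carrier G \<rightarrow> carrier (tensor R A.A A.A)"
    by (simp add: A.closed)
  show "comult (group_hopf R G) \<in> alg_hom R A.A (tensor R A.A A.A)"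
    unfolding group_hopf_def Let_def with_hopf_sel
    by (rule A.lin_ext_alg_hom[OF AA.assoc_alg h]) (simp_all add: AA.tens_ops A.basis_mult A.one_A A.closed)
  show "g \<in> carrier G \<Longrightarrow> comult (group_hopf R G) (basis_elt R g)
      = tens R A.A A.A (basis_elt R g) (basis_elt R g)"
    by (simp add: group_hopf_def Let_def A.lin_ext_basis[OF AA.TA.is_module h])
qed

lemma group_counit:
  shows "counit (group_hopf R G) \<in> alg_hom R A.A (regular_alg R)"
    and "g \<in> carrier G \<Longrightarrow> counit (group_hopf R G) (basis_elt R g) = \<one>\<^bsub>R\<^esub>"
proof -
  interpret Q: comm_alg R "regular_alg R" by (rule R.regular_alg_comm_alg)
  have h: "(\<lambda>g. \<one>\<^bsub>R\<^esub>) \<in> carrier G \<rightarrow> carrier (regular_alg R)" by simp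
  show "counit (group_hopf R G) \<in> alg_hom R A.A (regular_alg R)"
    unfolding group_hopf_def Let_def with_hopf_sel
    by (rule A.lin_ext_alg_hom[OF Q.assoc_algebra_axioms h]) simp_all
  show "g \<in> carrier G \<Longrightarrow> counit (group_hopf R G) (basis_elt R g) = \<one>\<^bsub>R\<^esub>"
    by (simp add: group_hopf_def Let_def A.lin_ext_basis[OF Q.is_module h])
qed

lemma group_antipode:
  shows "antipode (group_hopf R G) \<in> alg_hom R A.A A.A"
    and "g \<in> carrier G \<Longrightarrow> antipode (group_hopf R G) (basis_elt R g) = basis_elt R (inv\<^bsub>G\<^esub> g)"
proof -
  have h: "(\<lambda>g. basis_elt R (inv\<^bsub>G\<^esub> g)) \<in> carrier G \<rightarrow> carrier A.A" by (simp add: A.closed)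
  show "antipode (group_hopf R G) \<in> alg_hom R A.A A.A"
    unfolding group_hopf_def Let_def with_hopf_sel
    by (rule A.lin_ext_alg_hom[OF A.assoc_alg h]) (simp_all add: A.basis_mult A.one_A G.inv_mult)
  show "g \<in> carrier G \<Longrightarrow> antipode (group_hopf R G) (basis_elt R g) = basis_elt R (inv\<^bsub>G\<^esub> g)"
    by (simp add: group_hopf_def Let_def A.lin_ext_basis[OF A.A.is_module h])
qed

end

text \<open>
  The enveloping algebra of an abelian Lie algebra, which is a symmetric algebra.
\<close>

locale abelian_env = L: Module.module R L for R (structure) and L (structure) +
  assumes bracket: "x \<in> carrier L \<Longrightarrow> y \<in> carrier L \<Longrightarrow> x \<otimes>\<^bsub>L\<^esub> y = \<zero>\<^bsub>L\<^esub>"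
begin

abbreviation U where "U \<equiv> env_alg R L"

lemma free_mon: "monoid_alg R (free_monoid (carrier L))"
  by (intro monoid_alg.intro L.R.is_cring monoidI) (auto simp: free_monoid_def)

lemma env_rel_closed: "env_rel R L \<subseteq> carrier (free_alg R (carrier L)) \<times> carrier (free_alg R (carrier L))"
proof -
  interpret F: monoid_alg R "free_monoid (carrier L)" by (rule free_mon)
  have v: "basis_elt R [x] \<in> carrier (free_alg R (carrier L))" if "x \<in> carrier L" for x
    unfolding free_alg_def by (rule F.closed) (use that in \<open>simp add: free_monoid_def\<close>)
  note c = v F.closed(3,4)[folded free_alg_def] F.mult_closed(1)[folded free_alg_def]
    F.A.M.minus_closed[folded free_alg_def]
  show ?thesis
    by (auto elim!: env_rel.cases simp: c bracket)
qed

sublocale F: free_pres R "carrier L" "env_rel R L"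
  by (intro free_pres.intro L.R.is_cring free_pres_axioms.intro env_rel_closed)

lemma U_eq: "F.Q.Q = U"
  by (simp add: env_alg_def)

lemma gen_eq: "F.gen x = env_incl R L x"
  by (simp add: env_incl_def)

lemma incl_lin_map: "env_incl R L \<in> lin_map R L U"
  by (rule lin_mapI)
     (use F.gen_closed in \<open>simp_all add: gen_eq[symmetric] U_eq[symmetric] F.Q.cls_rel[OF env_rel.add]
        F.Q.cls_rel[OF env_rel.smult] F.Q.Q_ops F.Q.Q_smult\<close>)

lemma U_assoc: "assoc_algebra R U"
  using F.Q.Q_assoc_alg by (simp add: U_eq)

lemma U_comm: "comm_alg R U"
proof -
  interpret U: assoc_algebra R U by (rule U_assoc)
  note i = lin_mapD(1)[OF incl_lin_map]
  have "F.gen x \<otimes>\<^bsub>F.Q.Q\<^esub> F.gen y = F.gen y \<otimes>\<^bsub>F.Q.Q\<^esub> F.gen x" if xy: "x \<in> carrier L" "y \<in> carrier L" for x y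
  proof -
    let ?F = "free_alg R (carrier L)"
    have "F.gen x \<otimes>\<^bsub>U\<^esub> F.gen y \<ominus>\<^bsub>U\<^esub> F.gen y \<otimes>\<^bsub>U\<^esub> F.gen x
        = F.Q.cls (basis_elt R [x] \<otimes>\<^bsub>?F\<^esub> basis_elt R [y] \<ominus>\<^bsub>?F\<^esub> basis_elt R [y] \<otimes>\<^bsub>?F\<^esub> basis_elt R [x])"
      using xy lin_map_diff[OF alg_hom_lin_map[OF F.Q.cls_alg_hom] assoc_algebra.is_module[OF F.F.assoc_alg] F.QA.is_module]
      by (simp add: F.Q.Q_ops U_eq[symmetric])
    also have "\<dots> = F.gen (x \<otimes>\<^bsub>L\<^esub> y)"
      using xy by (intro F.Q.cls_rel env_rel.bracket)
    also have "\<dots> = \<zero>\<^bsub>U\<^esub>"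
      using xy lin_map_zero[OF incl_lin_map L.module_axioms U.is_module] by (simp add: bracket gen_eq)
    finally show ?thesis
      using xy i by (simp add: U_eq gen_eq)
        (metis U.M.m_closed U.M.minus_equality U.M.minus_minus U.M.a_inv_closed a_minus_def)
  qed
  then show ?thesis using F.comm_alg by (simp add: U_eq)
qed

lemma env_lift:
  assumes P: "comm_alg R P" and g: "g \<in> lin_map R L P"
    and h: "\<And>w. w \<in> lists (carrier L) \<Longrightarrow> h w = word_prod P g w"
  shows "coset_lift R P h \<in> alg_hom R U P"
    and "x \<in> carrier L \<Longrightarrow> coset_lift R P h (env_incl R L x) = g x"
proof -
  interpret P: comm_alg R P by fact
  have gc: "g \<in> carrier L \<rightarrow> carrier P" using lin_mapD(1)[OF g] by simp
  note E = F.free_eval[OF P.assoc_algebra_axioms gc h]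
  note D = alg_homD[OF E(1)] lin_map_minus[OF alg_hom_lin_map[OF E(1)] assoc_algebra.is_module[OF F.F.assoc_alg] P.is_module]
  have rel: "lin_ext R P h x = lin_ext R P h y" if "(x, y) \<in> env_rel R L" for x y
    using that
  proof (cases rule: env_rel.cases)
    case (bracket x y)
    then have "g x \<in> carrier P" "g y \<in> carrier P" using gc by auto
    then show ?thesis using bracket abelian_env.bracket[OF abelian_env_axioms, of x y]
      by (simp add: D E(2) P.M.m_comm lin_map_zero[OF g L.module_axioms P.is_module] P.M.r_neg a_minus_def)
  qed (simp_all add: D E(2) lin_mapD[OF g])
  show "coset_lift R P h \<in> alg_hom R U P"
    using F.pres_lift(1)[OF P.assoc_algebra_axioms gc h rel] by (simp add: U_eq)
  show "x \<in> carrier L \<Longrightarrow> coset_lift R P h (env_incl R L x) = g x"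
    using F.pres_lift(2)[OF P.assoc_algebra_axioms gc h rel] by (simp add: gen_eq)
qed

lemma env_hopf_sel [simp]:
  "carrier (env_hopf R L) = carrier U" "one (env_hopf R L) = one U"
  "alg_hom R (env_hopf R L) P = alg_hom R U P"
  "alg_hom R Q (env_hopf R L) = alg_hom R Q U"
  "tensor R (env_hopf R L) N = tensor R U N"
  "tensor R N' (env_hopf R L) = tensor R N' U"
  "tens R N' (env_hopf R L) = tens R N' U"
  by (simp_all add: env_hopf_def Let_def)

lemma env_hopf_comm: "comm_alg R (env_hopf R L)"
  by (simp add: env_hopf_def Let_def comm_alg_with_hopf U_comm)

lemma env_comult:
  shows "comult (env_hopf R L) \<in> alg_hom R U (tensor R U U)"
    and "x \<in> carrier L \<Longrightarrow> comult (env_hopf R L) (env_incl R L x)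
      = tens R U U (env_incl R L x) \<one>\<^bsub>U\<^esub> \<oplus>\<^bsub>tensor R U U\<^esub> tens R U U \<one>\<^bsub>U\<^esub> (env_incl R L x)"
proof -
  interpret U: comm_alg R U by (rule U_comm)
  interpret UU: tensor_alg R U U by (rule tensor_algI) unfold_locales
  interpret UC: comm_alg R "tensor R U U" by (rule UU.comm_alg[OF U_comm U_comm])
  note i = lin_mapD[OF incl_lin_map]
  have g: "(\<lambda>x. tens R U U (env_incl R L x) \<one>\<^bsub>U\<^esub> \<oplus>\<^bsub>tensor R U U\<^esub> tens R U U \<one>\<^bsub>U\<^esub> (env_incl R L x))
      \<in> lin_map R L (tensor R U U)"
    by (rule lin_mapI) (simp_all add: i UU.tens_ops UU.TA.M.a_ac UU.TA.smult_r_distr)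
  show "comult (env_hopf R L) \<in> alg_hom R U (tensor R U U)"
    unfolding env_hopf_def Let_def with_hopf_sel by (rule env_lift(1)[OF UC.comm_alg_axioms g refl])
  show "x \<in> carrier L \<Longrightarrow> comult (env_hopf R L) (env_incl R L x)
      = tens R U U (env_incl R L x) \<one>\<^bsub>U\<^esub> \<oplus>\<^bsub>tensor R U U\<^esub> tens R U U \<one>\<^bsub>U\<^esub> (env_incl R L x)"
    unfolding env_hopf_def Let_def with_hopf_sel by (rule env_lift(2)[OF UC.comm_alg_axioms g refl])
qed

lemma env_counit:
  shows "counit (env_hopf R L) \<in> alg_hom R U (regular_alg R)"
    and "x \<in> carrier L \<Longrightarrow> counit (env_hopf R L) (env_incl R L x) = \<zero>\<^bsub>R\<^esub>"
proof -
  have g: "(\<lambda>x. \<zero>\<^bsub>R\<^esub>) \<in> lin_map R L (regular_alg R)" by (rule lin_mapI) simp_all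
  have h: "word_prod R (\<lambda>x. \<zero>\<^bsub>R\<^esub>) w = word_prod (regular_alg R) (\<lambda>x. \<zero>\<^bsub>R\<^esub>) w" for w :: "'c list"
    by (simp add: word_prod_def)
  show "counit (env_hopf R L) \<in> alg_hom R U (regular_alg R)"
    unfolding env_hopf_def Let_def with_hopf_sel by (rule env_lift(1)[OF L.R.regular_alg_comm_alg g h])
  show "x \<in> carrier L \<Longrightarrow> counit (env_hopf R L) (env_incl R L x) = \<zero>\<^bsub>R\<^esub>"
    unfolding env_hopf_def Let_def with_hopf_sel by (rule env_lift(2)[OF L.R.regular_alg_comm_alg g h])
qed

lemma env_antipode:
  shows "antipode (env_hopf R L) \<in> alg_hom R U U"
    and "x \<in> carrier L \<Longrightarrow> antipode (env_hopf R L) (env_incl R L x) = \<ominus>\<^bsub>U\<^esub> env_incl R L x"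
proof -
  interpret U: comm_alg R U by (rule U_comm)
  note i = lin_mapD[OF incl_lin_map]
  have g: "(\<lambda>x. \<ominus>\<^bsub>U\<^esub> env_incl R L x) \<in> lin_map R L U"
    by (rule lin_mapI) (simp_all add: i U.M.minus_add U.smult_r_minus)
  have h: "word_prod U (\<lambda>x. \<ominus>\<^bsub>U\<^esub> env_incl R L x) (rev w) = word_prod U (\<lambda>x. \<ominus>\<^bsub>U\<^esub> env_incl R L x) w"
    if "w \<in> lists (carrier L)" for w
    using that by (rule U.M.word_prod_rev[rotated]) (simp add: i)
  show "antipode (env_hopf R L) \<in> alg_hom R U U"
    unfolding env_hopf_def Let_def with_hopf_sel by (rule env_lift(1)[OF U_comm g h])
  show "x \<in> carrier L \<Longrightarrow> antipode (env_hopf R L) (env_incl R L x) = \<ominus>\<^bsub>U\<^esub> env_incl R L x"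
    unfolding env_hopf_def Let_def with_hopf_sel by (rule env_lift(2)[OF U_comm g h])
qed

end

section \<open>Laurent polynomials and Gaussian binomial coefficients\<close>

lemma qv_nonzero [simp]: "qv \<noteq> 0"
  by (simp add: qv_def)

lemma qv_power: "qv ^ n = to_fract (monom 1 n)"
  by (induction n) (simp_all add: qv_def monom_Suc monom_0 one_pCons[symmetric] mult.commute
      flip: to_fract_mult)

lemma qv_power_eq_iff: "qv ^ m = qv ^ n \<longleftrightarrow> m = n"
proof
  assume "qv ^ m = qv ^ n"
  then have "degree (monom (1::int) m) = degree (monom (1::int) n)" by (simp add: qv_power)
  then show "m = n" by (simp add: degree_monom_eq)
qed simp

abbreviation L :: "qfun set" where "L \<equiv> carrier laurent"

lemma laurent_sel [simp]:
  "monoid.mult laurent = (*)" "one laurent = 1" "zero laurent = 0" "add laurent = (+)"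
  by (simp_all add: laurent_def)

lemma L_iff: "a \<in> L \<longleftrightarrow> (\<exists>p n. a = to_fract p / qv ^ n)"
  by (auto simp: laurent_def)

lemma L_fract [simp]: "to_fract p \<in> L"
  unfolding L_iff by (rule exI[of _ p], rule exI[of _ 0]) simp

lemma L_closed [simp]:
  shows L_one: "1 \<in> L" and L_zero: "0 \<in> L" and L_qv: "qv \<in> L"
    and L_add: "a \<in> L \<Longrightarrow> b \<in> L \<Longrightarrow> a + b \<in> L"
    and L_mult: "a \<in> L \<Longrightarrow> b \<in> L \<Longrightarrow> a * b \<in> L"
    and L_minus: "a \<in> L \<Longrightarrow> - a \<in> L"
    and L_div: "a \<in> L \<Longrightarrow> a / qv ^ n \<in> L"
proof -
  show "1 \<in> L" using L_fract[of 1] by simp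
  show "0 \<in> L" using L_fract[of 0] by simp
  show "qv \<in> L" unfolding qv_def by simp
  show "a + b \<in> L" if "a \<in> L" "b \<in> L"
  proof -
    obtain p n q m where ab: "a = to_fract p / qv ^ n" "b = to_fract q / qv ^ m"
      using \<open>a \<in> L\<close> \<open>b \<in> L\<close> unfolding L_iff by blast
    have "a + b = to_fract (p * monom 1 m + q * monom 1 n) / qv ^ (n + m)"
      by (simp add: ab field_simps power_add flip: qv_power)
    then show ?thesis unfolding L_iff by blast
  qed
  show "a * b \<in> L" if "a \<in> L" "b \<in> L"
  proof -
    obtain p n q m where ab: "a = to_fract p / qv ^ n" "b = to_fract q / qv ^ m"
      using \<open>a \<in> L\<close> \<open>b \<in> L\<close> unfolding L_iff by blast
    have "a * b = to_fract (p * q) / qv ^ (n + m)" by (simp add: ab power_add)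
    then show ?thesis unfolding L_iff by blast
  qed
  show "- a \<in> L" if "a \<in> L"
  proof -
    obtain p n where "a = to_fract p / qv ^ n" using \<open>a \<in> L\<close> unfolding L_iff by blast
    then have "- a = to_fract (- p) / qv ^ n" by simp
    then show ?thesis unfolding L_iff by blast
  qed
  show "a / qv ^ n \<in> L" if "a \<in> L"
  proof -
    obtain p m where "a = to_fract p / qv ^ m" using \<open>a \<in> L\<close> unfolding L_iff by blast
    then have "a / qv ^ n = to_fract p / qv ^ (m + n)" by (simp add: power_add)
    then show ?thesis unfolding L_iff by blast
  qed
qed

lemma L_diff [simp]: "a \<in> L \<Longrightarrow> b \<in> L \<Longrightarrow> a - b \<in> L"
  using L_add[of a "- b"] by simp

lemma L_inv [simp]: "inverse qv \<in> L"
  using L_div[of 1 1] by (simp add: inverse_eq_divide)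

lemma L_power [simp]: "a \<in> L \<Longrightarrow> a ^ n \<in> L"
  by (induction n) simp_all

lemma L_powi [simp]: "qv powi k \<in> L"
  by (cases "k \<ge> 0") (simp_all add: power_int_def)

lemma L_sum [simp]: "(\<And>x. x \<in> A \<Longrightarrow> u x \<in> L) \<Longrightarrow> sum u A \<in> L"
  by (induction A rule: infinite_finite_induct) simp_all

lemma L_prod [simp]: "(\<And>x. x \<in> A \<Longrightarrow> u x \<in> L) \<Longrightarrow> prod u A \<in> L"
  by (induction A rule: infinite_finite_induct) simp_all

lemma L_of_nat [simp]: "of_nat n \<in> L"
  by (induction n) simp_all

lemma laurent_cring: "cring laurent"
  by (rule cringI; (rule abelian_groupI comm_monoidI)?)
     (auto simp: algebra_simps intro!: bexI[of _ "- _"])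

interpretation Lr: cring laurent
  by (rule laurent_cring)

lemma laurent_minus [simp]: "a \<in> L \<Longrightarrow> \<ominus>\<^bsub>laurent\<^esub> a = - a"
  by (rule Lr.minus_equality) simp_all

lemma laurent_diff [simp]: "a \<in> L \<Longrightarrow> b \<in> L \<Longrightarrow> a \<ominus>\<^bsub>laurent\<^esub> b = a - b"
  by (simp add: a_minus_def)

lemma laurent_pow [simp]: "a [^]\<^bsub>laurent\<^esub> (n::nat) = a ^ n"
  by (induction n) (simp_all add: mult.commute)

lemma laurent_finsum: "u \<in> A \<rightarrow> L \<Longrightarrow> finsum laurent u A = sum u A"
  by (induction A rule: infinite_finite_induct) (auto simp: Pi_iff)

text \<open>\<open>qdiff n\<close> is the numerator of \<open>qint n\<close>.\<close>

definition qdiff :: "nat \<Rightarrow> qfun" where "qdiff n = qv ^ n - inverse qv ^ n"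

lemma qdiff_eq_0_iff [simp]: "qdiff n = 0 \<longleftrightarrow> n = 0"
proof -
  have "qdiff n = (qv ^ (n + n) - qv ^ 0) / qv ^ n"
    by (simp add: qdiff_def field_simps power_add)
  then show ?thesis by (simp add: qv_power_eq_iff del: power_0)
qed

lemma qdiff_0 [simp]: "qdiff 0 = 0" by simp

lemma qdiff_1 [simp]: "qdiff 1 = qv - inverse qv" "qdiff (Suc 0) = qv - inverse qv"
  by (simp_all add: qdiff_def)

lemma L_qdiff [simp]: "qdiff n \<in> L"
  by (simp add: qdiff_def)

lemma qdiff_add:
  "qdiff (a + b) = qv ^ b * qdiff a + inverse qv ^ a * qdiff b"
  "qdiff (a + b) = inverse qv ^ b * qdiff a + qv ^ a * qdiff b"
  by (simp_all add: qdiff_def power_add algebra_simps)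

lemma qint_qdiff: "qint n = qdiff n / qdiff 1"
  by (simp add: qint_def qdiff_def)

lemma qint_nonzero [simp]: "qint n = 0 \<longleftrightarrow> n = 0"
  using qdiff_eq_0_iff[of n] qdiff_eq_0_iff[of 1] by (simp add: qint_qdiff)

lemma qfact_Suc: "qfact (Suc n) = qfact n * qint (Suc n)"
  by (simp add: qfact_def mult.commute)

lemma qfact_nonzero [simp]: "qfact n \<noteq> 0"
  by (induction n) (simp_all add: qfact_Suc, simp add: qfact_def)

lemma qbinom_0 [simp]: "qbinom n 0 = 1"
  by (simp add: qbinom_def, simp add: qfact_def)

lemma qbinom_self [simp]: "qbinom n n = 1"
  by (simp add: qbinom_def, simp add: qfact_def)

lemma qbinom_gt: "n < k \<Longrightarrow> qbinom n k = 0"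
  by (simp add: qbinom_def)

lemma qdiff_Suc_nonzero: "qdiff (Suc n) \<noteq> 0"
  by simp

text \<open>
  All recursions are stated without division: multiplication by \<open>qdiff\<close> clears the denominators.
\<close>

lemma qbinom_absorb: "qbinom (Suc m) (Suc t) * qdiff (Suc t) = qdiff (Suc m) * qbinom m t"
proof (cases "t \<le> m")
  case True
  have "qdiff (Suc 0) \<noteq> 0" by (rule qdiff_Suc_nonzero)
  then show ?thesis
    using True qdiff_Suc_nonzero[of t] qdiff_Suc_nonzero[of m]
    by (simp add: qbinom_def qfact_Suc qint_qdiff[of "Suc _"] field_simps del: qdiff_1 qdiff_eq_0_iff)
qed (simp add: qbinom_gt)

lemma qbinom_step: "qbinom m (Suc t) * qdiff (Suc t) = qbinom m t * qdiff (m - t)"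
proof (cases "t < m")
  case True
  then obtain d where m: "m = t + Suc d" using less_imp_Suc_add by auto
  have "qdiff (Suc 0) \<noteq> 0" by (rule qdiff_Suc_nonzero)
  then show ?thesis
    using qdiff_Suc_nonzero[of t] qdiff_Suc_nonzero[of d]
    by (simp add: m qbinom_def qfact_Suc qint_qdiff[of "Suc _"] field_simps del: qdiff_1 qdiff_eq_0_iff)
qed (simp add: qbinom_gt)

lemma qbinom_pascal:
  assumes "t \<le> m"
  shows "qbinom (Suc m) (Suc t) = inverse qv ^ Suc t * qbinom m (Suc t) + qv ^ (m - t) * qbinom m t"
    and "qbinom (Suc m) (Suc t) = qv ^ Suc t * qbinom m (Suc t) + inverse qv ^ (m - t) * qbinom m t"
proof -
  have e: "Suc m = (m - t) + Suc t" using assms by simp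
  have "qdiff (Suc t) * qbinom (Suc m) (Suc t)
      = (inverse qv ^ Suc t * qdiff (m - t) + qv ^ (m - t) * qdiff (Suc t)) * qbinom m t"
    using qbinom_absorb[of m t] qdiff_add(2)[of "m - t" "Suc t"] e by (simp only: mult.commute)
  also have "\<dots> = qdiff (Suc t) * (inverse qv ^ Suc t * qbinom m (Suc t) + qv ^ (m - t) * qbinom m t)"
    using qbinom_step[of m t] by (simp add: algebra_simps del: qdiff_1 power_Suc)
  finally show "qbinom (Suc m) (Suc t) = inverse qv ^ Suc t * qbinom m (Suc t) + qv ^ (m - t) * qbinom m t"
    using qdiff_Suc_nonzero[of t] by (simp only: mult_cancel_left) simp
  have "qdiff (Suc t) * qbinom (Suc m) (Suc t)
      = (qv ^ Suc t * qdiff (m - t) + inverse qv ^ (m - t) * qdiff (Suc t)) * qbinom m t"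
    using qbinom_absorb[of m t] qdiff_add(1)[of "m - t" "Suc t"] e by (simp only: mult.commute)
  also have "\<dots> = qdiff (Suc t) * (qv ^ Suc t * qbinom m (Suc t) + inverse qv ^ (m - t) * qbinom m t)"
    using qbinom_step[of m t] by (simp add: algebra_simps del: qdiff_1 power_Suc)
  finally show "qbinom (Suc m) (Suc t) = qv ^ Suc t * qbinom m (Suc t) + inverse qv ^ (m - t) * qbinom m t"
    using qdiff_Suc_nonzero[of t] by (simp only: mult_cancel_left) simp
qed

lemma L_qbinom [simp]: "qbinom m t \<in> L"
proof (induction m arbitrary: t)
  case 0
  show ?case by (cases t) (simp_all add: qbinom_gt)
next
  case (Suc m)
  show ?case
  proof (cases t)
    case (Suc s)
    then show ?thesis using Suc.IH
      by (cases "s \<le> m") (simp_all add: qbinom_pascal(1) qbinom_gt del: power_Suc)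
  qed simp
qed

lemma qbinom_1: "qbinom m 1 = qint m"
  using qbinom_step[of m 0] qdiff_Suc_nonzero[of 0]
  by (simp add: qint_qdiff field_simps del: qdiff_1)

lemma L_qint [simp]: "qint m \<in> L"
  using L_qbinom[of m 1] by (simp only: qbinom_1)

text \<open>
  The expansion of \<open>qbinom n t\<close> in the coefficients \<open>qbinom (n + c) s\<close>, by induction on \<open>c\<close> with
  one Pascal identity for \<open>n + c\<close> and one for the coefficients.
\<close>

lemma qbinom_shift:
  "qbinom n t = qv ^ (c * t) * (\<Sum>j\<le>t. (-1) ^ j * qv ^ (n * j) * qbinom (c + j - 1) j * qbinom (n + c) (t - j))"
proof (induction c)
  case 0
  have "(\<Sum>j\<le>t. (-1) ^ j * qv ^ (n * j) * qbinom (0 + j - 1) j * qbinom (n + 0) (t - j))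
    = (\<Sum>j\<le>t. if j = 0 then qbinom n t else 0)"
    by (rule sum.cong) (auto simp: qbinom_gt)
  then show ?case by simp
next
  case (Suc c)
  define a where "a j = (-1) ^ j * qv ^ (n * j) * qbinom (c + j) j" for j
  define b where "b s = qbinom (n + c) s" for s
  have P1: "qv ^ (Suc c * t) * qbinom (n + Suc c) (t - j) =
      qv ^ (c * t + j) * b (t - j) + (if j < t then qv ^ (c * t + n + c + 1 + j) * b (t - Suc j) else 0)"
    if "j \<le> t" for j
  proof (cases "j < t")
    case True
    then obtain s where s: "t = j + Suc s" using less_imp_Suc_add by auto
    show ?thesis
    proof (cases "s \<le> n + c")
      case True
      have e: "qv ^ (Suc c * t) * inverse qv ^ Suc s = qv ^ (c * t + j)"
        unfolding s by (simp add: power_add field_simps)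
      have e2: "qv ^ (Suc c * t) * qv ^ (n + c - s) = qv ^ (c * t + n + c + 1 + j)"
        using True unfolding s by (simp flip: power_add) (simp add: algebra_simps)
      have "qv ^ (Suc c * t) * qbinom (n + Suc c) (t - j)
        = (qv ^ (Suc c * t) * inverse qv ^ Suc s) * b (Suc s) + (qv ^ (Suc c * t) * qv ^ (n + c - s)) * b s"
        using qbinom_pascal(1)[OF True] by (simp add: s b_def distrib_left mult.assoc del: power_Suc mult_Suc)
      then show ?thesis unfolding e e2 by (simp add: s)
    next
      case False
      then show ?thesis by (simp add: s b_def qbinom_gt)
    qed
  next
    case False
    with that have "j = t" by simp
    then show ?thesis by (simp add: b_def power_add mult.commute)
  qed
  have "qv ^ (Suc c * t) * (\<Sum>j\<le>t. (-1) ^ j * qv ^ (n * j) * qbinom (Suc c + j - 1) j * qbinom (n + Suc c) (t - j))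
    = (\<Sum>j\<le>t. a j * (qv ^ (Suc c * t) * qbinom (n + Suc c) (t - j)))"
    by (simp add: sum_distrib_left a_def mult_ac)
  also have "\<dots> = (\<Sum>j\<le>t. a j * (qv ^ (c * t + j) * b (t - j) +
      (if j < t then qv ^ (c * t + n + c + 1 + j) * b (t - Suc j) else 0)))"
    by (rule sum.cong) (simp_all only: P1 atMost_iff)
  also have "\<dots> = (\<Sum>j\<le>t. a j * qv ^ (c * t + j) * b (t - j))
      + (\<Sum>j\<le>t. if j < t then a j * qv ^ (c * t + n + c + 1 + j) * b (t - Suc j) else 0)"
    by (simp add: distrib_left sum.distrib mult.assoc if_distrib[of "\<lambda>x. a _ * x"] cong: if_cong)
  also have "(\<Sum>j\<le>t. if j < t then a j * qv ^ (c * t + n + c + 1 + j) * b (t - Suc j) else 0)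
      = (\<Sum>j<t. a j * qv ^ (c * t + n + c + 1 + j) * b (t - Suc j))"
    by (rule sum.mono_neutral_cong_right) auto
  also have "\<dots> = (\<Sum>j\<in>{1..t}. a (j - 1) * qv ^ (c * t + n + c + j) * b (t - j))"
    by (rule sum.reindex_bij_witness[of _ "\<lambda>j. j - 1" Suc]) auto
  also have "\<dots> = (\<Sum>j\<le>t. if j = 0 then 0 else a (j - 1) * qv ^ (c * t + n + c + j) * b (t - j))"
    by (rule sum.mono_neutral_cong_left) auto
  also have "(\<Sum>j\<le>t. a j * qv ^ (c * t + j) * b (t - j)) + \<dots>
      = (\<Sum>j\<le>t. qv ^ (c * t) * ((-1) ^ j * qv ^ (n * j) * qbinom (c + j - 1) j * b (t - j)))"
    unfolding sum.distrib[symmetric]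
  proof (rule sum.cong)
    fix j assume "j \<in> {..t}"
    show "a j * qv ^ (c * t + j) * b (t - j)
        + (if j = 0 then 0 else a (j - 1) * qv ^ (c * t + n + c + j) * b (t - j))
      = qv ^ (c * t) * ((-1) ^ j * qv ^ (n * j) * qbinom (c + j - 1) j * b (t - j))"
    proof (cases j)
      case (Suc i)
      have "qbinom (c + j) j = inverse qv ^ Suc i * qbinom (c + i) (Suc i) + qv ^ c * qbinom (c + i) i"
        using qbinom_pascal(1)[of i "c + i"] by (simp add: Suc)
      then have "qv ^ Suc i * qbinom (c + j) j
          = qbinom (c + i) (Suc i) + qv ^ (Suc i + c) * qbinom (c + i) i"
        by (simp add: field_simps power_add)
      then have P: "qv ^ j * qbinom (c + j) j = qbinom (c + i) j + qv ^ (j + c) * qbinom (c + i) i"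
        by (simp only: Suc)
      define A where "A = (-1) ^ j * qv ^ (n * j) * qv ^ (c * t) * b (t - j)"
      define Y where "Y = qv ^ (j + c) * qbinom (c + i) i"
      have "a j * qv ^ (c * t + j) * b (t - j) = A * (qv ^ j * qbinom (c + j) j)"
        by (simp add: a_def A_def power_add mult_ac)
      also have "\<dots> = A * qbinom (c + i) j + A * Y"
        by (simp only: P Y_def distrib_left)
      finally have 1: "a j * qv ^ (c * t + j) * b (t - j) = A * qbinom (c + i) j + A * Y" .
      have 2: "a (j - 1) * qv ^ (c * t + n + c + j) * b (t - j) = - (A * Y)"
        by (simp add: a_def A_def Y_def Suc power_add mult_ac)
      show ?thesis unfolding 1 2 using Suc by (simp add: A_def mult_ac)
    qed (simp add: a_def)
  qed simp
  also have "\<dots> = qbinom n t" using Suc.IH by (simp add: sum_distrib_left b_def)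
  finally show ?case by simp
qed

text \<open>
  The relation that defines the product of two \<open>k\<close> generators, evaluated at \<open>K = qv ^ m\<close>. The left
  side is \<open>qbinom m t * qbinom (m - t) t'\<close>, and the second factor is expanded by \<open>qbinom_shift\<close>.
\<close>

lemma qbinom_mult:
  assumes "t \<ge> 1"
  shows "qbinom (t + t') t * qbinom m (t + t') = (\<Sum>j\<in>{0..t'}.
    ((-1) ^ j * qv ^ (t * (t' - j)) * qbinom (t + j - 1) j) * (qv ^ (m * j) * qbinom m t * qbinom m (t' - j)))"
proof (cases "t \<le> m")
  case True
  then obtain n where m: "m = n + t" by (metis add.commute le_iff_add)
  have "qbinom (t + t') t * qbinom m (t + t') = qbinom m t * qbinom n t'"
    by (cases "t' \<le> n") (simp_all add: m qbinom_def field_simps)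
  also have "\<dots> = (\<Sum>j\<le>t'. qbinom m t * (qv ^ (t * t') * ((-1) ^ j * qv ^ (n * j) * qbinom (t + j - 1) j * qbinom m (t' - j))))"
    by (subst qbinom_shift[of n t' t]) (simp add: sum_distrib_left m)
  also have "\<dots> = (\<Sum>j\<in>{0..t'}.
    ((-1) ^ j * qv ^ (t * (t' - j)) * qbinom (t + j - 1) j) * (qv ^ (m * j) * qbinom m t * qbinom m (t' - j)))"
  proof (rule sum.cong)
    fix j assume "j \<in> {0..t'}"
    then have "t * (t' - j) + m * j = t * t' + n * j"
      by (simp add: m algebra_simps)
    then have "qv ^ (t * (t' - j)) * qv ^ (m * j) = qv ^ (t * t') * qv ^ (n * j)"
      by (simp flip: power_add)
    then have e: "qv ^ (t * t') * qv ^ (n * j) = qv ^ (t * (t' - j)) * qv ^ (m * j)" by simp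
    have "qbinom m t * (qv ^ (t * t') * ((-1) ^ j * qv ^ (n * j) * qbinom (t + j - 1) j * qbinom m (t' - j)))
      = (qv ^ (t * t') * qv ^ (n * j)) * ((-1) ^ j * qbinom (t + j - 1) j * qbinom m t * qbinom m (t' - j))"
      by (simp only: mult_ac)
    then show "qbinom m t * (qv ^ (t * t') * ((-1) ^ j * qv ^ (n * j) * qbinom (t + j - 1) j * qbinom m (t' - j)))
      = ((-1) ^ j * qv ^ (t * (t' - j)) * qbinom (t + j - 1) j) * (qv ^ (m * j) * qbinom m t * qbinom m (t' - j))"
      unfolding e by (simp only: mult_ac)
  qed auto
  finally show ?thesis .
qed (simp add: qbinom_gt)

section \<open>The coefficients of \<open>h\<close>\<close>

text \<open>
  The recursion defining \<open>pcoef\<close>, solved for its last summand: at \<open>K = qv ^ s\<close> the expression for \<open>h\<close>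
  takes the value that it should have.
\<close>

lemma pcoef_eval:
  assumes "n \<ge> 1" "s \<ge> 1"
  shows "(\<Sum>t\<in>{1..s}. pcoef n t * qbinom s t * qv ^ (phi n t * s)) = qdiff (n * s) / qdiff n"
proof -
  have n: "qdiff n \<noteq> 0" using assms by simp
  show ?thesis
  proof (cases "s = 1")
    case True
    then show ?thesis using n by (simp add: power_int_minus)
  next
    case False
    with assms have s: "\<not> s \<le> 1" by simp
    have ins: "{1..s} = insert s {1..s - 1}" using assms by auto
    have e: "qv powi ((int (phi n t) - int (phi n s)) * int s) * qv ^ (phi n s * s) = qv ^ (phi n t * s)" for t
    proof -
      have "qv powi ((int (phi n t) - int (phi n s)) * int s) * qv powi (int (phi n s * s)) = qv powi (int (phi n t * s))"
        by (simp flip: power_int_add) (simp add: algebra_simps)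
      then show ?thesis by (simp only: power_int_of_nat)
    qed
    define \<Sigma> where "\<Sigma> = (\<Sum>t = 1..s - 1. pcoef n t * qbinom s t * qv powi ((int (phi n t) - int (phi n s)) * int s))"
    have "pcoef n s = qdiff (n * s) / (qv ^ (phi n s * s) * qdiff n) - \<Sigma>"
      using s by (subst pcoef.simps) (simp add: qdiff_def \<Sigma>_def del: pcoef.simps)
    then have "pcoef n s * qv ^ (phi n s * s) = qdiff (n * s) / qdiff n - \<Sigma> * qv ^ (phi n s * s)"
      by (simp add: left_diff_distrib del: pcoef.simps)
    also have "\<dots> = qdiff (n * s) / qdiff n
        - (\<Sum>t = 1..s - 1. pcoef n t * qbinom s t * (qv powi ((int (phi n t) - int (phi n s)) * int s) * qv ^ (phi n s * s)))"
      by (simp add: \<Sigma>_def sum_distrib_right mult.assoc del: pcoef.simps)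
    also have "\<dots> = qdiff (n * s) / qdiff n - (\<Sum>t = 1..s - 1. pcoef n t * qbinom s t * qv ^ (phi n t * s))"
      by (simp only: e)
    finally show ?thesis
      unfolding ins using s by (subst sum.insert) (simp_all del: pcoef.simps)
  qed
qed

declare pcoef.simps [simp del]

text \<open>
  The quotient \<open>qdiff (n * s) / qdiff n\<close> is a Laurent polynomial, with value \<open>\<plusminus>s\<close> where \<open>qv ^ n = \<plusminus>1\<close>.
\<close>

lemma qdiff_mult: "qdiff (n * s) = qdiff n * (\<Sum>k<s. (inverse qv ^ n) ^ (s - Suc k) * (qv ^ n) ^ k)"
  unfolding qdiff_def power_mult by (rule power_diff_sumr2)

lemma L_pcoef [simp]: "n \<ge> 1 \<Longrightarrow> pcoef n s \<in> L"
proof (induction s rule: less_induct)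
  case (less s)
  have n: "qdiff n \<noteq> 0" using less.prems by simp
  show ?case
  proof (cases "s \<le> 1")
    case False
    have "(qv ^ (n * s) - inverse qv ^ (n * s)) / (qv ^ (phi n s * s) * (qv ^ n - inverse qv ^ n))
      = (qdiff (n * s) / qdiff n) / qv ^ (phi n s * s)"
      by (simp add: qdiff_def mult.commute)
    also have "\<dots> = (\<Sum>k<s. (inverse qv ^ n) ^ (s - Suc k) * (qv ^ n) ^ k) / qv ^ (phi n s * s)"
      using n by (simp add: qdiff_mult)
    also have "\<dots> \<in> L" by (intro L_div L_sum L_mult L_power) simp_all
    finally show ?thesis
      using False less by (subst pcoef.simps) (auto intro!: L_diff L_sum L_mult)
  qed (simp add: pcoef.simps)
qed

text \<open>In the variable \<open>X = K\<^sup>2\<close>, the polynomial \<open>kpoly t\<close> is \<open>K ^ t\<close> times the function \<open>k t\<close>.\<close>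

definition kpoly :: "nat \<Rightarrow> qfun poly"
  where "kpoly t = (\<Prod>r\<in>{1..t}. smult (1 / qdiff r) [:- (qv ^ (r - 1)), inverse qv ^ (r - 1):])"

lemma kpoly_Suc: "kpoly (Suc t) = kpoly t * smult (1 / qdiff (Suc t)) [:- (qv ^ t), inverse qv ^ t:]"
  by (simp add: kpoly_def)

lemma poly_kpoly: "poly (kpoly t) (qv ^ (2 * m)) = qbinom m t * qv ^ (m * t)"
proof (induction t)
  case 0
  then show ?case by (simp add: kpoly_def)
next
  case (Suc t)
  have z: "qdiff (Suc t) \<noteq> 0" by simp
  have "poly (kpoly (Suc t)) X * qdiff (Suc t) = poly (kpoly t) X * (X * inverse qv ^ t - qv ^ t)" for X
    using z by (simp add: kpoly_Suc algebra_simps)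
  then have "poly (kpoly (Suc t)) (qv ^ (2 * m)) * qdiff (Suc t)
      = qbinom m t * qv ^ (m * t) * (qv ^ (2 * m) * inverse qv ^ t - qv ^ t)"
    by (simp only: Suc)
  also have "\<dots> = qbinom m t * qdiff (m - t) * qv ^ (m * Suc t)"
  proof (cases "t \<le> m")
    case True
    then obtain d where m: "m = t + d" using le_iff_add by auto
    have "qv ^ (2 * m) * inverse qv ^ t - qv ^ t = qdiff d * qv ^ m"
    proof -
      have "qv ^ (2 * m) = (qv ^ t * qv ^ d) * (qv ^ t * qv ^ d)"
        by (simp add: m mult_2 power_add)
      then show ?thesis by (simp add: m qdiff_def power_add field_simps)
    qed
    then show ?thesis by (simp add: m power_add mult_ac)
  qed (simp add: qbinom_gt)
  also have "\<dots> = qbinom m (Suc t) * qv ^ (m * Suc t) * qdiff (Suc t)"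
    by (simp only: qbinom_step[symmetric] mult_ac)
  finally show ?case using z by (simp only: mult_cancel_right) simp
qed

lemma degree_kpoly: "degree (kpoly t) \<le> t"
proof (induction t)
  case (Suc t)
  have "degree (kpoly (Suc t)) \<le> degree (kpoly t) + degree (smult (1 / qdiff (Suc t)) [:- (qv ^ t), inverse qv ^ t:])"
    unfolding kpoly_Suc by (rule degree_mult_le)
  also have "\<dots> \<le> t + 1"
    using Suc by (intro add_mono order_trans[OF degree_smult_le]) auto
  finally show ?case by simp
qed (simp add: kpoly_def)

lemma phi_parity: "t \<le> n \<Longrightarrow> \<exists>e. n + phi n t = t + 2 * e \<and> (e = 0 \<longleftrightarrow> t = n)"
proof -
  assume t: "t \<le> n"
  then have phi: "phi n t = (if even (n - t) then 0 else 1)"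
    by (simp add: phi_def even_diff_nat)
  show ?thesis
  proof (cases "even (n - t)")
    case True
    then obtain e where "n - t = 2 * e" by (elim evenE)
    then show ?thesis using t True by (intro exI[of _ e]) (auto simp: phi)
  next
    case False
    then obtain e where "n - t = 2 * e + 1" by (elim oddE)
    then show ?thesis using t False by (intro exI[of _ "Suc e"]) (auto simp: phi)
  qed
qed

text \<open>
  Half of the even difference \<open>n + phi n t - t\<close>, the power of \<open>K\<^sup>2\<close> that homogenizes the summand of index \<open>t\<close>.
\<close>

definition expo :: "nat \<Rightarrow> nat \<Rightarrow> nat" where "expo n t = (n + phi n t - t) div 2"

lemma expo: "t \<le> n \<Longrightarrow> n + phi n t = t + 2 * expo n t" "t \<le> n \<Longrightarrow> expo n t = 0 \<longleftrightarrow> t = n"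
  using phi_parity[of t n] by (auto simp: expo_def)

text \<open>
  Both sides have degree at most \<open>n\<close> in \<open>X = K\<^sup>2\<close>. The recursion makes them agree at the \<open>n + 1\<close> points
  \<open>X = qv ^ (2 * m)\<close> with \<open>m \<le> n\<close>, hence they are equal and agree at all \<open>m\<close>.
\<close>

lemma pcoef_poly:
  assumes n: "n \<ge> 1"
  shows "(\<Sum>t\<in>{1..n}. smult (pcoef n t) (kpoly t * monom 1 (expo n t)))
    = smult (1 / qdiff n) (monom 1 n - 1)" (is "?P = ?Q")
proof (rule ccontr)
  assume neq: "?P \<noteq> ?Q"
  have qn: "qdiff n \<noteq> 0" using n by simp
  have "degree (smult (pcoef n t) (kpoly t * monom 1 (expo n t))) \<le> n" if "t \<in> {1..n}" for t
  proof -
    have "degree (kpoly t * monom 1 (expo n t)) \<le> t + expo n t"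
      using degree_mult_le[of "kpoly t" "monom 1 (expo n t)"] degree_kpoly[of t]
        degree_monom_le[of "1::qfun" "expo n t"] by linarith
    also have "\<dots> \<le> n"
    proof (cases "t = n")
      case True
      then show ?thesis using expo(2)[of t n] by simp
    next
      case False
      moreover have "phi n t \<le> 1" by (simp add: phi_def)
      ultimately show ?thesis using expo(1)[of t n] that by auto
    qed
    finally show ?thesis using degree_smult_le order_trans by blast
  qed
  then have dP: "degree ?P \<le> n" by (intro degree_sum_le) auto
  have dQ: "degree ?Q \<le> n"
    by (intro order_trans[OF degree_smult_le] degree_diff_le degree_monom_le) simp
  have ev: "poly ?P (qv ^ (2 * m)) = poly ?Q (qv ^ (2 * m))" if m: "m \<le> n" for m
  proof -
    have "poly ?P (qv ^ (2 * m)) = (\<Sum>t\<in>{1..n}. pcoef n t * qbinom m t * qv ^ (phi n t * m)) * qv ^ (m * n)"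
      unfolding poly_sum sum_distrib_right
    proof (rule sum.cong)
      fix t assume t: "t \<in> {1..n}"
      then have "m * t + 2 * m * expo n t = phi n t * m + m * n"
        using expo(1)[of t n] by (auto simp: algebra_simps dest: arg_cong[of _ _ "\<lambda>x. m * x"])
      then have "qv ^ (m * t) * (qv ^ (2 * m)) ^ expo n t = qv ^ (phi n t * m) * qv ^ (m * n)"
        by (simp flip: power_add power_mult)
      then show "poly (smult (pcoef n t) (kpoly t * monom 1 (expo n t))) (qv ^ (2 * m))
          = pcoef n t * qbinom m t * qv ^ (phi n t * m) * qv ^ (m * n)"
        by (simp add: poly_kpoly poly_monom mult.assoc)
    qed simp
    also have "(\<Sum>t\<in>{1..n}. pcoef n t * qbinom m t * qv ^ (phi n t * m))
        = (\<Sum>t\<in>{1..m}. pcoef n t * qbinom m t * qv ^ (phi n t * m))"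
      using m by (intro sum.mono_neutral_right) (auto simp: qbinom_gt)
    also have "\<dots> = qdiff (n * m) / qdiff n"
      by (cases "m = 0") (use pcoef_eval[OF n, of m] in auto)
    also have "\<dots> * qv ^ (m * n) = poly ?Q (qv ^ (2 * m))"
    proof -
      define x where "x = qv ^ (m * n)"
      have "(qv ^ (2 * m)) ^ n = x * x"
        unfolding x_def by (simp add: power_mult[symmetric] power_add[symmetric] mult_2 distrib_right)
      moreover have "qdiff (n * m) = x - inverse x"
        by (simp add: qdiff_def x_def mult.commute power_inverse)
      moreover have "x \<noteq> 0" by (simp add: x_def)
      ultimately show ?thesis
        by (simp add: poly_monom left_diff_distrib flip: x_def)
    qed
    finally show ?thesis .
  qed
  have "(\<lambda>m. qv ^ (2 * m)) ` {..n} \<subseteq> {x. poly (?P - ?Q) x = 0}" using ev by auto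
  moreover have "finite {x. poly (?P - ?Q) x = 0}" using neq by (intro poly_roots_finite) simp
  ultimately have "card ((\<lambda>m. qv ^ (2 * m)) ` {..n}) \<le> card {x. poly (?P - ?Q) x = 0}"
    by (rule card_mono[rotated])
  also have "\<dots> \<le> degree (?P - ?Q)" using neq by (intro card_poly_roots_bound) simp
  also have "\<dots> \<le> n" using dP dQ by (rule degree_diff_le)
  finally have "card ((\<lambda>m. qv ^ (2 * m)) ` {..n}) \<le> n" .
  moreover have "inj_on (\<lambda>m. qv ^ (2 * m)) {..n}" by (auto simp: inj_on_def qv_power_eq_iff)
  ultimately show False by (simp add: card_image)
qed

lemma pcoef_identity:
  assumes n: "n \<ge> 1"
  shows "(\<Sum>t\<in>{1..n}. pcoef n t * qbinom m t * qv ^ (phi n t * m)) * qv ^ (m * n) * qdiff n = qv ^ (2 * m * n) - 1"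
proof -
  have qn: "qdiff n \<noteq> 0" using n by simp
  have "(\<Sum>t\<in>{1..n}. pcoef n t * qbinom m t * qv ^ (phi n t * m)) * qv ^ (m * n)
    = poly (\<Sum>t\<in>{1..n}. smult (pcoef n t) (kpoly t * monom 1 (expo n t))) (qv ^ (2 * m))"
    unfolding poly_sum sum_distrib_right
  proof (rule sum.cong)
    fix t assume t: "t \<in> {1..n}"
    then have "m * t + 2 * m * expo n t = phi n t * m + m * n"
      using expo(1)[of t n] by (auto simp: algebra_simps dest: arg_cong[of _ _ "\<lambda>x. m * x"])
    then have "qv ^ (m * t) * (qv ^ (2 * m)) ^ expo n t = qv ^ (phi n t * m) * qv ^ (m * n)"
      by (simp flip: power_add power_mult)
    then show "pcoef n t * qbinom m t * qv ^ (phi n t * m) * qv ^ (m * n) =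
        poly (smult (pcoef n t) (kpoly t * monom 1 (expo n t))) (qv ^ (2 * m))"
      by (simp add: poly_kpoly poly_monom mult.assoc)
  qed simp
  also have "\<dots> = poly (smult (1 / qdiff n) (monom 1 n - 1)) (qv ^ (2 * m))"
    by (simp only: pcoef_poly[OF n])
  finally show ?thesis using qn by (simp add: poly_monom flip: power_mult)
qed

text \<open>
  The constant coefficient of the preceding identity: only the summand \<open>t = n\<close> has no factor \<open>X\<close>. The
  right side is a product of quantities that stay invertible after specialization.
\<close>

lemma pcoef_top:
  assumes n: "n \<ge> 1"
  shows "pcoef n n * (\<Prod>r\<in>{1..n}. - (qv ^ (r - 1))) = - (\<Prod>r\<in>{1..<n}. qdiff r)"
proof -
  have qn: "qdiff n \<noteq> 0" using n by simp
  have "(\<Sum>t\<in>{1..n}. pcoef n t * poly (kpoly t) 0 * 0 ^ expo n t) = - (1 / qdiff n)"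
    using arg_cong[OF pcoef_poly[OF n], of "\<lambda>p. poly p 0"] n
    by (simp add: poly_sum poly_monom mult.assoc power_0_left)
  moreover have "(\<Sum>t\<in>{1..n}. pcoef n t * poly (kpoly t) 0 * 0 ^ expo n t)
      = (\<Sum>t\<in>{1..n}. if t = n then pcoef n n * poly (kpoly n) 0 else 0)"
  proof (rule sum.cong)
    fix t assume "t \<in> {1..n}"
    then have "expo n t = 0 \<longleftrightarrow> t = n" using expo(2)[of t n] by simp
    then show "pcoef n t * poly (kpoly t) 0 * 0 ^ expo n t = (if t = n then pcoef n n * poly (kpoly n) 0 else 0)"
      by (cases "t = n") (simp_all add: power_0_left)
  qed simp
  ultimately have "pcoef n n * poly (kpoly n) 0 = - (1 / qdiff n)" using n by simp
  then have "pcoef n n * poly (kpoly n) 0 * qdiff n = - 1" using n by simp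
  moreover have "poly (kpoly n) 0 = (\<Prod>r\<in>{1..n}. - (qv ^ (r - 1))) / (\<Prod>r\<in>{1..n}. qdiff r)"
    by (simp add: kpoly_def poly_prod flip: prod_dividef)
  moreover have "(\<Prod>r\<in>{1..n}. qdiff r) = (\<Prod>r\<in>{1..<n}. qdiff r) * qdiff n"
    using n by (simp add: atLeastLessThanSuc_atLeastAtMost[symmetric])
  ultimately have "pcoef n n * ((\<Prod>r\<in>{1..n}. - (qv ^ (r - 1))) / ((\<Prod>r\<in>{1..<n}. qdiff r) * qdiff n)) * qdiff n = - 1"
    by simp
  moreover have "x * a = - b" if "x * (a / (b * c)) * c = - 1" "b \<noteq> 0" "c \<noteq> 0" for x a b c :: qfun
    using that by (simp add: field_simps)
  moreover have "(\<Prod>r\<in>{1..<n}. qdiff r) \<noteq> 0" by auto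
  ultimately show ?thesis using qn by blast
qed

text \<open>
  The factor \<open>qdiff (n * q) / qdiff n\<close> of \<open>qbinom (n * q) n\<close> is written as a Laurent polynomial, so that
  the coefficient can be specialized where \<open>qdiff n\<close> vanishes.
\<close>

lemma qbinom_top:
  assumes "q \<ge> 1" "n \<ge> 1"
  shows "qbinom (n * q) n * (\<Prod>r\<in>{1..<n}. qdiff r)
    = (\<Sum>k<q. (inverse qv ^ n) ^ (q - Suc k) * (qv ^ n) ^ k) * (\<Prod>r\<in>{1..<n}. qdiff (n * q - r))"
proof -
  have qn: "qdiff n \<noteq> 0" using assms by simp
  have *: "qbinom m t * (\<Prod>r\<in>{1..t}. qdiff r) = (\<Prod>r\<in>{0..<t}. qdiff (m - r))" for m t
  proof (induction t)
    case (Suc t)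
    have "qbinom m (Suc t) * (\<Prod>r\<in>{1..Suc t}. qdiff r)
      = (qbinom m (Suc t) * qdiff (Suc t)) * (\<Prod>r\<in>{1..t}. qdiff r)"
      by (simp add: mult_ac)
    also have "\<dots> = (qbinom m t * qdiff (m - t)) * (\<Prod>r\<in>{1..t}. qdiff r)"
      by (simp only: qbinom_step)
    also have "\<dots> = (qbinom m t * (\<Prod>r\<in>{1..t}. qdiff r)) * qdiff (m - t)"
      by (simp only: mult_ac)
    finally show ?case by (simp only: Suc prod.atLeast0_lessThan_Suc)
  qed simp
  have "(\<Prod>r\<in>{1..n}. qdiff r) = (\<Prod>r\<in>{1..<n}. qdiff r) * qdiff n"
    using assms by (simp add: atLeastLessThanSuc_atLeastAtMost[symmetric])
  moreover have "(\<Prod>r\<in>{0..<n}. qdiff (n * q - r)) = qdiff (n * q) * (\<Prod>r\<in>{1..<n}. qdiff (n * q - r))"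
    using assms by (subst prod.atLeast_Suc_lessThan) auto
  ultimately show ?thesis
    using *[of "n * q" n] qn by (simp add: qdiff_mult)
qed

section \<open>Linear spans and linearly independent functions\<close>

text \<open>
  Spans of indexed families. The inductive form serves the closure properties; the expansion as a
  finite linear combination is \<open>span_expand\<close>.
\<close>

inductive_set lin_span :: "('r, 'k) ring_scheme \<Rightarrow> ('r, 'a, 'm) module_scheme \<Rightarrow> ('j \<Rightarrow> 'a) \<Rightarrow> 'j set \<Rightarrow> 'a set"
  for R :: "('r, 'k) ring_scheme" and M :: "('r, 'a, 'm) module_scheme" and u :: "'j \<Rightarrow> 'a" and J :: "'j set"
  where
    zero: "\<zero>\<^bsub>M\<^esub> \<in> lin_span R M u J"
  | add: "a \<in> carrier R \<Longrightarrow> j \<in> J \<Longrightarrow> z \<in> lin_span R M u J \<Longrightarrow> a \<odot>\<^bsub>M\<^esub> u j \<oplus>\<^bsub>M\<^esub> z \<in> lin_span R M u J"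

context Module.module
begin

context
  fixes u :: "'j \<Rightarrow> 'c" and J :: "'j set"
  assumes u: "u \<in> J \<rightarrow> carrier M"
begin

lemma span_closed: "z \<in> lin_span R M u J \<Longrightarrow> z \<in> carrier M"
  by (induction rule: lin_span.induct) (use u in auto)

lemma span_base: "j \<in> J \<Longrightarrow> u j \<in> lin_span R M u J"
  using lin_span.add[OF R.one_closed _ lin_span.zero, of j J M u] u by (auto simp: Pi_iff)

lemma span_add: "z \<in> lin_span R M u J \<Longrightarrow> w \<in> lin_span R M u J \<Longrightarrow> z \<oplus>\<^bsub>M\<^esub> w \<in> lin_span R M u J"
proof (induction rule: lin_span.induct)
  case (add a j z)
  then have "(a \<odot>\<^bsub>M\<^esub> u j \<oplus>\<^bsub>M\<^esub> z) \<oplus>\<^bsub>M\<^esub> w = a \<odot>\<^bsub>M\<^esub> u j \<oplus>\<^bsub>M\<^esub> (z \<oplus>\<^bsub>M\<^esub> w)"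
    using u span_closed by (intro M.a_assoc) (auto simp: Pi_iff)
  then show ?case using add lin_span.add[of a R j J "z \<oplus>\<^bsub>M\<^esub> w" M u] by simp
qed (simp add: span_closed)

lemma span_smult:
  assumes a: "a \<in> carrier R" and z: "z \<in> lin_span R M u J"
  shows "a \<odot>\<^bsub>M\<^esub> z \<in> lin_span R M u J"
  using z
proof (induction rule: lin_span.induct)
  case zero
  then show ?case using a by (simp add: lin_span.zero)
next
  case (add b j z)
  then have "a \<odot>\<^bsub>M\<^esub> (b \<odot>\<^bsub>M\<^esub> u j \<oplus>\<^bsub>M\<^esub> z) = (a \<otimes> b) \<odot>\<^bsub>M\<^esub> u j \<oplus>\<^bsub>M\<^esub> a \<odot>\<^bsub>M\<^esub> z"
    using u a span_closed[of z] by (auto simp: Pi_iff smult_r_distr smult_assoc1)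
  then show ?case using add a by (simp add: lin_span.add)
qed

lemma span_finsum: "finite S \<Longrightarrow> (\<And>s. s \<in> S \<Longrightarrow> w s \<in> lin_span R M u J) \<Longrightarrow> (\<Oplus>\<^bsub>M\<^esub>s\<in>S. w s) \<in> lin_span R M u J"
proof (induction S rule: finite_induct)
  case (insert x F)
  then have "w \<in> F \<rightarrow> carrier M" "w x \<in> carrier M" using span_closed by auto
  then show ?case using insert by (simp add: span_add)
qed (simp add: lin_span.zero)

lemma span_expand:
  assumes "z \<in> lin_span R M u J"
  obtains A c where "finite A" "A \<subseteq> J" "c \<in> J \<rightarrow> carrier R" "z = (\<Oplus>\<^bsub>M\<^esub>j\<in>A. c j \<odot>\<^bsub>M\<^esub> u j)"
proof -
  have "\<exists>A c. finite A \<and> A \<subseteq> J \<and> c \<in> J \<rightarrow> carrier R \<and> z = (\<Oplus>\<^bsub>M\<^esub>j\<in>A. c j \<odot>\<^bsub>M\<^esub> u j)"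
    using assms
  proof (induction rule: lin_span.induct)
    case zero
    show ?case by (rule exI[of _ "{}"], rule exI[of _ "\<lambda>_. \<zero>"]) auto
  next
    case (add a j z)
    then obtain A c where A: "finite A" "A \<subseteq> J" and c: "c \<in> J \<rightarrow> carrier R"
      and z: "z = (\<Oplus>\<^bsub>M\<^esub>j\<in>A. c j \<odot>\<^bsub>M\<^esub> u j)" by auto
    let ?c = "\<lambda>i. if i = j then (if j \<in> A then a \<oplus> c j else a) else c i"
    have cl: "(\<lambda>i. c i \<odot>\<^bsub>M\<^esub> u i) \<in> B \<rightarrow> carrier M" "(\<lambda>i. ?c i \<odot>\<^bsub>M\<^esub> u i) \<in> B \<rightarrow> carrier M" if "B \<subseteq> J" for B
      using c u add that by (auto simp: Pi_iff subset_iff)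
    have sb: "A - {j} \<subseteq> J" using A by auto
    have rest: "(\<Oplus>\<^bsub>M\<^esub>i\<in>A - {j}. ?c i \<odot>\<^bsub>M\<^esub> u i) = (\<Oplus>\<^bsub>M\<^esub>i\<in>A - {j}. c i \<odot>\<^bsub>M\<^esub> u i)" (is "?r' = ?r")
      by (rule M.finsum_cong') (use A cl[of "A - {j}"] in auto)
    have r: "?r \<in> carrier M" using cl[of "A - {j}"] A by (intro M.finsum_closed) auto
    have uj: "u j \<in> carrier M" "c j \<in> carrier R" using u c add by auto
    have "(\<Oplus>\<^bsub>M\<^esub>i\<in>insert j (A - {j}). ?c i \<odot>\<^bsub>M\<^esub> u i) = ?c j \<odot>\<^bsub>M\<^esub> u j \<oplus>\<^bsub>M\<^esub> ?r'"
      by (rule M.finsum_insert[OF _ _ cl(2)[OF sb]]) (use A uj add in auto)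
    also have "\<dots> = a \<odot>\<^bsub>M\<^esub> u j \<oplus>\<^bsub>M\<^esub> z"
    proof (cases "j \<in> A")
      case True
      then have "z = (\<Oplus>\<^bsub>M\<^esub>i\<in>insert j (A - {j}). c i \<odot>\<^bsub>M\<^esub> u i)" by (simp add: z insert_absorb)
      also have "\<dots> = c j \<odot>\<^bsub>M\<^esub> u j \<oplus>\<^bsub>M\<^esub> ?r"
        by (rule M.finsum_insert[OF _ _ cl(1)[OF sb]]) (use A uj add in auto)
      finally show ?thesis using True uj r add unfolding rest by (simp add: smult_l_distr M.a_assoc)
    next
      case False
      then have "A - {j} = A" by auto
      then show ?thesis using False unfolding rest by (simp add: z)
    qed
    finally have "a \<odot>\<^bsub>M\<^esub> u j \<oplus>\<^bsub>M\<^esub> z = (\<Oplus>\<^bsub>M\<^esub>i\<in>insert j (A - {j}). ?c i \<odot>\<^bsub>M\<^esub> u i)" ..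
    moreover have "finite (insert j (A - {j}))" "insert j (A - {j}) \<subseteq> J" "?c \<in> J \<rightarrow> carrier R"
      using A add c uj by auto
    ultimately show ?case by blast
  qed
  then show ?thesis using that by blast
qed

end

end

lemma lin_map_span:
  assumes "Module.module R M" "Module.module R N" "\<phi> \<in> lin_map R M N"
    and u: "u \<in> J \<rightarrow> carrier M" and w: "w \<in> J' \<rightarrow> carrier N"
    and base: "\<And>j. j \<in> J \<Longrightarrow> \<phi> (u j) \<in> lin_span R N w J'"
    and z: "z \<in> lin_span R M u J"
  shows "\<phi> z \<in> lin_span R N w J'"
proof -
  interpret M: Module.module R M by fact
  interpret N: Module.module R N by fact
  show ?thesis using z
  proof (induction rule: lin_span.induct)
    case zero
    then show ?case by (simp add: lin_map_zero[OF assms(3,1,2)] lin_span.zero)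
  next
    case (add a j z)
    have "u j \<in> carrier M" "z \<in> carrier M" using add u M.span_closed[OF u] by auto
    then show ?case
      using add base by (simp add: lin_mapD[OF assms(3)] N.span_add[OF w] N.span_smult[OF w])
  qed
qed

text \<open>
  Linear independence of an indexed family of functions, phrased with coefficients so that repeated
  members are excluded.
\<close>

definition indep_funs :: "('j \<Rightarrow> 'x \<Rightarrow> 'f::field) \<Rightarrow> 'j set \<Rightarrow> bool"
  where "indep_funs u J \<longleftrightarrow> (\<forall>A c. finite A \<longrightarrow> A \<subseteq> J \<longrightarrow>
    (\<forall>x. (\<Sum>j\<in>A. c j * u j x) = 0) \<longrightarrow> (\<forall>j\<in>A. c j = 0))"

lemma indep_funsD:
  "indep_funs u J \<Longrightarrow> finite A \<Longrightarrow> A \<subseteq> J \<Longrightarrow> (\<And>x. (\<Sum>j\<in>A. c j * u j x) = 0) \<Longrightarrow> j \<in> A \<Longrightarrow> c j = 0"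
  by (auto simp: indep_funs_def)

text \<open>
  Products of functions in separate variables: fix one variable, use independence in the other.
\<close>

lemma indep_funs_pair:
  assumes u: "indep_funs u J" and w: "indep_funs w J'"
  shows "indep_funs (\<lambda>p x. u (fst p) (fst x) * w (snd p) (snd x)) (J \<times> J')"
  unfolding indep_funs_def
proof (intro allI impI ballI)
  fix A c p
  assume A: "finite A" "A \<subseteq> J \<times> J'" and p: "p \<in> A"
    and eq: "\<forall>x. (\<Sum>p\<in>A. c p * (u (fst p) (fst x) * w (snd p) (snd x))) = 0"
  define c' where "c' p = (if p \<in> A then c p else 0)" for p
  have fin: "finite (fst ` A)" "finite (snd ` A)" and sub: "fst ` A \<subseteq> J" "snd ` A \<subseteq> J'"
    using A by auto
  have 0: "(\<Sum>j\<in>fst ` A. (\<Sum>k\<in>snd ` A. c' (j, k) * w k y) * u j x) = 0" for x y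
  proof -
    have "(\<Sum>p\<in>A. c p * (u (fst p) x * w (snd p) y)) = (\<Sum>p\<in>fst ` A \<times> snd ` A. c' p * (u (fst p) x * w (snd p) y))"
      using fin by (intro sum.mono_neutral_cong_left) (auto simp: c'_def intro: rev_image_eqI)
    also have "\<dots> = (\<Sum>j\<in>fst ` A. (\<Sum>k\<in>snd ` A. c' (j, k) * w k y) * u j x)"
      by (simp add: sum.cartesian_product' sum_distrib_left sum_distrib_right mult_ac)
    finally show ?thesis using eq by (auto dest: spec[of _ "(x, y)"])
  qed
  have "(\<Sum>k\<in>snd ` A. c' (j, k) * w k y) = 0" if "j \<in> fst ` A" for j y
    using indep_funsD[OF u fin(1) sub(1), where c = "\<lambda>j. \<Sum>k\<in>snd ` A. c' (j, k) * w k y"] 0 that by blast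
  then have "c' (j, k) = 0" if "j \<in> fst ` A" "k \<in> snd ` A" for j k
    using indep_funsD[OF w fin(2) sub(2), where c = "\<lambda>k. c' (j, k)"] that by blast
  from this[of "fst p" "snd p"] p show "c p = 0" by (simp add: c'_def)
qed

lemma indep_funs_PiE:
  fixes u :: "'j \<Rightarrow> 'x \<Rightarrow> 'f::field" and I :: "'i set"
  assumes u: "indep_funs u J" and I: "finite I"
  shows "indep_funs (\<lambda>b x. \<Prod>i\<in>I. u (b i) (x i)) (PiE I (\<lambda>_. J))"
  using I
proof (induction I rule: finite_induct)
  case empty
  show ?case
    unfolding indep_funs_def
  proof (intro allI impI ballI)
    fix A c j assume "finite A" "A \<subseteq> PiE {} (\<lambda>_. J)" "j \<in> A"
      and *: "\<forall>x. (\<Sum>b\<in>A. c b * (\<Prod>i\<in>{}. u (b i) (x i))) = 0"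
    then have "A = {j}" by auto
    then show "c j = 0" using * by simp
  qed
next
  case (insert i I)
  show ?case
    unfolding indep_funs_def
  proof (intro allI impI ballI)
    fix A c b assume A: "finite A" "A \<subseteq> PiE (insert i I) (\<lambda>_. J)" and b: "b \<in> A"
      and eq: "\<forall>x. (\<Sum>b\<in>A. c b * (\<Prod>i\<in>insert i I. u (b i) (x i))) = 0"
    define \<rho> where "\<rho> b = (b i, restrict b I)" for b :: "'i \<Rightarrow> 'j"
    have inv: "(snd (\<rho> b))(i := fst (\<rho> b)) = b" if "b \<in> A" for b
      using that A insert by (fastforce simp: \<rho>_def PiE_iff extensional_def)
    then have inj: "inj_on \<rho> A" by (metis inj_onI)
    have "\<rho> ` A \<subseteq> J \<times> PiE I (\<lambda>_. J)" using A by (auto simp: \<rho>_def subset_iff PiE_iff)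
    moreover have "(\<Sum>p\<in>\<rho> ` A. c ((snd p)(i := fst p)) *
        (u (fst p) (fst x) * (\<Prod>k\<in>I. u (snd p k) (snd x k)))) = 0" for x
    proof -
      let ?x = "(snd x)(i := fst x)"
      have "(\<Sum>p\<in>\<rho> ` A. c ((snd p)(i := fst p)) * (u (fst p) (fst x) * (\<Prod>k\<in>I. u (snd p k) (snd x k))))
        = (\<Sum>b\<in>A. c b * (\<Prod>k\<in>insert i I. u (b k) (?x k)))"
        unfolding sum.reindex[OF inj] o_def
      proof (rule sum.cong)
        fix b assume "b \<in> A"
        have "(\<Prod>k\<in>I. u (b k) (?x k)) = (\<Prod>k\<in>I. u (snd (\<rho> b) k) (snd x k))"
          by (rule prod.cong) (use insert in \<open>auto simp: \<rho>_def\<close>)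
        then show "c ((snd (\<rho> b))(i := fst (\<rho> b))) * (u (fst (\<rho> b)) (fst x) * (\<Prod>k\<in>I. u (snd (\<rho> b) k) (snd x k)))
          = c b * (\<Prod>k\<in>insert i I. u (b k) (?x k))"
          using insert \<open>b \<in> A\<close> inv by (simp add: \<rho>_def)
      qed simp
      then show ?thesis using eq by simp
    qed
    ultimately have "c ((snd (\<rho> b))(i := fst (\<rho> b))) = 0"
      using indep_funsD[OF indep_funs_pair[OF u insert.IH], of "\<rho> ` A" "\<lambda>p. c ((snd p)(i := fst p))" "\<rho> b"] A b
      by auto
    then show "c b = 0" using inv[OF b] by simp
  qed
qed

section \<open>The algebra \<open>V\<^sup>0\<close>: relations and evaluations\<close>

lemma finsum_regular [simp]: "finsum (regular_alg R) = finsum R"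
  by (simp add: finsum_def finprod_def regular_alg_def fun_eq_iff)

lemma pow_regular [simp]: "x [^]\<^bsub>regular_alg R\<^esub> (n::nat) = x [^]\<^bsub>R\<^esub> n"
  by (simp add: nat_pow_def)

lemma word_prod_regular [simp]: "word_prod (regular_alg R) = word_prod R"
  by (simp add: word_prod_def fun_eq_iff)

lemma V0_gens_iff [simp]:
  "Kgen i \<in> V0_gens \<theta> \<longleftrightarrow> i \<in> {1..\<theta>}" "Kinv i \<in> V0_gens \<theta> \<longleftrightarrow> i \<in> {1..\<theta>}"
  "Kbin i c t \<in> V0_gens \<theta> \<longleftrightarrow> i \<in> {1..\<theta>}"
  by (auto simp: V0_gens_def)

text \<open>
  A point assigns to each index a pair \<open>(s, m)\<close>; evaluation at it sends \<open>K\<close> to \<open>(-1) ^ s * qv ^ m\<close>.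
  The sign is needed because the powers of \<open>qv\<close> alone would not separate \<open>1\<close> from
  \<open>K ^ l\<close> after specialization when \<open>l\<close> is odd.
\<close>

definition Kval :: "nat \<times> nat \<Rightarrow> qfun" where "Kval p = (-1) ^ fst p * qv ^ snd p"
definition Kival :: "nat \<times> nat \<Rightarrow> qfun" where "Kival p = (-1) ^ fst p * inverse qv ^ snd p"
definition kval :: "nat \<times> nat \<Rightarrow> nat \<Rightarrow> qfun" where "kval p t = (-1) ^ (fst p * t) * qbinom (snd p) t"

fun gen_val :: "(nat \<Rightarrow> nat \<times> nat) \<Rightarrow> V0_gen \<Rightarrow> qfun" where
  "gen_val p (Kgen i) = Kval (p i)"
| "gen_val p (Kinv i) = Kival (p i)"
| "gen_val p (Kbin i c t) = (if c < 0
    then \<Sum>j\<in>{0..t}. ((-1) ^ j * qv ^ (nat (- c) * (t - j)) * qbinom (nat (- c) + j - 1) j) * (Kval (p i) ^ j * kval (p i) (t - j))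
    else \<Sum>j\<in>{0..t}. (qv ^ (nat c * (t - j)) * qbinom (nat c) j) * (Kival (p i) ^ j * kval (p i) (t - j)))"

lemma val_L [simp]: "Kval p \<in> L" "Kival p \<in> L" "kval p t \<in> L" "gen_val q x \<in> L"
proof -
  show 1: "Kval p \<in> L" "Kival p \<in> L" "kval p t \<in> L" for p t
    by (simp_all add: Kval_def Kival_def kval_def)
  show "gen_val q x \<in> L" by (cases x) (simp_all add: 1)
qed

lemma gen_val_0 [simp]: "gen_val p (Kbin i 0 t) = kval (p i) t"
proof -
  have "gen_val p (Kbin i 0 t) = (\<Sum>j\<in>{0..t}. if j = 0 then kval (p i) t else 0)"
    unfolding gen_val.simps by (subst if_not_P, simp, rule sum.cong) (auto simp: qbinom_gt)
  then show ?thesis by simp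
qed

lemma Kval_Kival: "Kval p * Kival p = 1"
  by (simp add: Kval_def Kival_def mult_ac) (simp flip: power_mult_distrib)

lemma kval_0 [simp]: "kval p 0 = 1"
  by (simp add: kval_def)

lemma kval_1: "qdiff 1 * kval p 1 = Kval p - Kival p"
proof -
  have "qdiff (Suc 0) \<noteq> 0" by (rule qdiff_Suc_nonzero)
  then have "qdiff 1 * qbinom (snd p) 1 = qdiff (snd p)"
    by (simp add: qbinom_1[simplified] qint_qdiff del: qdiff_1 qdiff_eq_0_iff)
  then have "qdiff 1 * kval p 1 = (-1) ^ fst p * qdiff (snd p)"
    by (simp add: kval_def mult.left_commute del: qdiff_1)
  then show ?thesis by (simp add: Kval_def Kival_def qdiff_def right_diff_distrib)
qed

text \<open>
  The signs on both sides have the exponent \<open>s * (t + t')\<close> up to an even number, so this is \<open>qbinom_mult\<close>.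
\<close>

lemma kval_mult:
  assumes "t \<ge> 1"
  shows "qbinom (t + t') t * kval p (t + t') = (\<Sum>j\<in>{0..t'}.
    ((-1) ^ j * qv ^ (t * (t' - j)) * qbinom (t + j - 1) j) * (Kval p ^ j * kval p t * kval p (t' - j)))"
proof -
  obtain s m where p: "p = (s, m)" by force
  have "qbinom (t + t') t * kval p (t + t') = (-1) ^ (s * (t + t')) * (qbinom (t + t') t * qbinom m (t + t'))"
    by (simp add: p kval_def)
  also have "\<dots> = (\<Sum>j\<in>{0..t'}. (-1) ^ (s * (t + t')) *
    (((-1) ^ j * qv ^ (t * (t' - j)) * qbinom (t + j - 1) j) * (qv ^ (m * j) * qbinom m t * qbinom m (t' - j))))"
    by (simp add: qbinom_mult[OF assms] sum_distrib_left)
  also have "\<dots> = (\<Sum>j\<in>{0..t'}.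
    ((-1) ^ j * qv ^ (t * (t' - j)) * qbinom (t + j - 1) j) * (Kval p ^ j * kval p t * kval p (t' - j)))"
  proof (rule sum.cong)
    fix j assume "j \<in> {0..t'}"
    then have "s * (t + t') = s * j + s * t + s * (t' - j)" by (simp flip: distrib_left)
    then have "(-1::qfun) ^ (s * (t + t')) = ((-1) ^ s) ^ j * (-1) ^ (s * t) * (-1) ^ (s * (t' - j))"
      by (simp only: power_add power_mult)
    then show "(-1) ^ (s * (t + t')) *
      (((-1) ^ j * qv ^ (t * (t' - j)) * qbinom (t + j - 1) j) * (qv ^ (m * j) * qbinom m t * qbinom m (t' - j)))
      = ((-1) ^ j * qv ^ (t * (t' - j)) * qbinom (t + j - 1) j) * (Kval p ^ j * kval p t * kval p (t' - j))"
    proof -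
      assume e: "(-1::qfun) ^ (s * (t + t')) = ((-1) ^ s) ^ j * (-1) ^ (s * t) * (-1) ^ (s * (t' - j))"
      have K: "Kval p ^ j = ((-1) ^ s) ^ j * qv ^ (m * j)"
        by (simp add: p Kval_def power_mult_distrib power_mult[of qv])
      show ?thesis unfolding e K unfolding kval_def p fst_conv snd_conv by (simp only: mult_ac)
    qed
  qed simp
  finally show ?thesis .
qed

locale V0_alg = fixes \<theta> :: nat
begin

abbreviation FA where "FA \<equiv> V0_free \<theta>"
abbreviation V where "V \<equiv> V0 \<theta>"
abbreviation K where "K i \<equiv> V0_elt \<theta> (Kgen i)"
abbreviation K' where "K' i \<equiv> V0_elt \<theta> (Kinv i)"
abbreviation k where "k i t \<equiv> V0_elt \<theta> (Kbin i 0 t)"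

lemma free_mon: "Group.monoid (free_monoid (V0_gens \<theta>))"
  by (rule monoidI) (auto simp: free_monoid_def)

sublocale FM: monoid_alg laurent "free_monoid (V0_gens \<theta>)"
  rewrites "monoid_algebra laurent (free_monoid (V0_gens \<theta>)) = FA"
  by (intro monoid_alg.intro laurent_cring free_mon) (simp add: free_alg_def)

lemma var_in: "x \<in> V0_gens \<theta> \<Longrightarrow> V0_var x \<in> carrier FA"
  by (rule FM.closed) (simp add: free_monoid_def)

lemmas var_closed [simp] = var_in[of "Kgen _", simplified] var_in[of "Kinv _", simplified] var_in[of "Kbin _ _ _", simplified]

lemma V0_rel_closed: "V0_rel \<theta> \<subseteq> carrier FA \<times> carrier FA"
  by (auto elim!: V0_rel.cases intro!: FM.A.M.finsum_closed FM.A.smult_closed FM.A.M.m_closed FM.A.M.nat_pow_closed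
      simp: var_in)

sublocale F: free_pres laurent "V0_gens \<theta>" "V0_rel \<theta>"
  by (intro free_pres.intro laurent_cring free_pres_axioms.intro V0_rel_closed)

lemma V_eq: "F.Q.Q = V" by (simp add: V0_def)
lemma gen_eq: "F.gen x = V0_elt \<theta> x" by (simp add: V0_elt_def)

lemma V_comm_alg: "comm_alg laurent V"
proof -
  have "comm_alg laurent F.Q.Q"
  proof (rule F.comm_alg)
    fix x y assume "x \<in> V0_gens \<theta>" "y \<in> V0_gens \<theta>"
    then show "F.gen x \<otimes>\<^bsub>F.Q.Q\<^esub> F.gen y = F.gen y \<otimes>\<^bsub>F.Q.Q\<^esub> F.gen x"
      using F.Q.cls_rel[OF V0_rel.commute, of x y] by (simp add: F.Q.Q_ops var_in)
  qed
  then show ?thesis by (simp add: V_eq)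
qed

sublocale V: comm_alg laurent V
  by (rule V_comm_alg)

lemma elt_closed: "x \<in> V0_gens \<theta> \<Longrightarrow> V0_elt \<theta> x \<in> carrier V"
  using F.gen_closed by (simp add: V_eq gen_eq)

lemmas K_closed [simp] = elt_closed[of "Kgen _", simplified] elt_closed[of "Kinv _", simplified]
  elt_closed[of "Kbin _ _ _", simplified]

lemma cls_hom: "F.Q.cls \<in> alg_hom laurent FA V"
  using F.Q.cls_alg_hom by (simp add: V_eq)

lemmas cls_simps = alg_homD(2-5)[OF cls_hom] lin_map_diff[OF alg_hom_lin_map[OF cls_hom] FM.A.is_module V.is_module]
  alg_hom_pow[OF cls_hom FM.A.M.monoid_axioms V.M.monoid_axioms] gen_eq

lemma cls_finsum: "finite S \<Longrightarrow> u \<in> S \<rightarrow> carrier FA \<Longrightarrow>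
  F.Q.cls (\<Oplus>\<^bsub>FA\<^esub>s\<in>S. u s) = (\<Oplus>\<^bsub>V\<^esub>s\<in>S. F.Q.cls (u s))"
  by (rule lin_map_finsum[OF alg_hom_lin_map[OF cls_hom] FM.A.is_module V.is_module])

lemma rel_one: "i \<in> {1..\<theta>} \<Longrightarrow> qdiff 1 \<odot>\<^bsub>V\<^esub> k i 1 = K i \<ominus>\<^bsub>V\<^esub> K' i"
  using F.Q.cls_rel[OF V0_rel.bin_one] by (simp add: cls_simps)

lemma rel_inv: "i \<in> {1..\<theta>} \<Longrightarrow> K i \<otimes>\<^bsub>V\<^esub> K' i = \<one>\<^bsub>V\<^esub>"
  using F.Q.cls_rel[OF V0_rel.inverse] by (simp add: cls_simps)

lemma rel_zero: "i \<in> {1..\<theta>} \<Longrightarrow> k i 0 = \<one>\<^bsub>V\<^esub>"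
  using F.Q.cls_rel[OF V0_rel.bin_zero] by (simp add: cls_simps)

lemma rel_mult:
  assumes "i \<in> {1..\<theta>}" "t \<ge> 1"
  shows "qbinom (t + t') t \<odot>\<^bsub>V\<^esub> k i (t + t')
    = (\<Oplus>\<^bsub>V\<^esub>j\<in>{0..t'}. ((-1) ^ j * qv ^ (t * (t' - j)) * qbinom (t + j - 1) j) \<odot>\<^bsub>V\<^esub>
         (K i [^]\<^bsub>V\<^esub> j \<otimes>\<^bsub>V\<^esub> k i t \<otimes>\<^bsub>V\<^esub> k i (t' - j)))"
proof -
  have "qbinom (t + t') t \<odot>\<^bsub>V\<^esub> k i (t + t') = F.Q.cls (qbinom (t + t') t \<odot>\<^bsub>FA\<^esub> V0_var (Kbin i 0 (t + t')))"
    using assms by (simp add: cls_simps)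
  also note F.Q.cls_rel[OF V0_rel.bin_mult[OF assms]]
  also have "F.Q.cls (\<Oplus>\<^bsub>FA\<^esub>j\<in>{0..t'}. ((-1) ^ j * qv ^ (t * (t' - j)) * qbinom (t + j - 1) j) \<odot>\<^bsub>FA\<^esub>
         (V0_var (Kgen i) [^]\<^bsub>FA\<^esub> j \<otimes>\<^bsub>FA\<^esub> V0_var (Kbin i 0 t) \<otimes>\<^bsub>FA\<^esub> V0_var (Kbin i 0 (t' - j))))
    = (\<Oplus>\<^bsub>V\<^esub>j\<in>{0..t'}. F.Q.cls (((-1) ^ j * qv ^ (t * (t' - j)) * qbinom (t + j - 1) j) \<odot>\<^bsub>FA\<^esub>
         (V0_var (Kgen i) [^]\<^bsub>FA\<^esub> j \<otimes>\<^bsub>FA\<^esub> V0_var (Kbin i 0 t) \<otimes>\<^bsub>FA\<^esub> V0_var (Kbin i 0 (t' - j)))))"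
    by (rule cls_finsum) (use assms in auto)
  also have "\<dots> = (\<Oplus>\<^bsub>V\<^esub>j\<in>{0..t'}. ((-1) ^ j * qv ^ (t * (t' - j)) * qbinom (t + j - 1) j) \<odot>\<^bsub>V\<^esub>
         (K i [^]\<^bsub>V\<^esub> j \<otimes>\<^bsub>V\<^esub> k i t \<otimes>\<^bsub>V\<^esub> k i (t' - j)))"
    by (rule V.M.finsum_cong') (use assms in \<open>auto simp: cls_simps\<close>)
  finally show ?thesis .
qed

text \<open>The generators with \<open>c \<noteq> 0\<close> are expressed by the others.\<close>

lemma rel_bin:
  assumes i: "i \<in> {1..\<theta>}"
  shows "\<exists>a. a \<in> {0..t} \<rightarrow> L \<and> (V0_elt \<theta> (Kbin i c t)
      = (\<Oplus>\<^bsub>V\<^esub>j\<in>{0..t}. a j \<odot>\<^bsub>V\<^esub> ((if c < 0 then K i else K' i) [^]\<^bsub>V\<^esub> j \<otimes>\<^bsub>V\<^esub> k i (t - j))))"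
proof (cases "c < 0")
  case True
  define d where "d = nat (- c)"
  have d: "c = - int d" "d \<ge> 1" using True by (auto simp: d_def)
  let ?a = "\<lambda>j. (-1) ^ j * qv ^ (d * (t - j)) * qbinom (d + j - 1) j"
  have "V0_elt \<theta> (Kbin i c t) = F.Q.cls (\<Oplus>\<^bsub>FA\<^esub>j\<in>{0..t}. ?a j \<odot>\<^bsub>FA\<^esub>
         (V0_var (Kgen i) [^]\<^bsub>FA\<^esub> j \<otimes>\<^bsub>FA\<^esub> V0_var (Kbin i 0 (t - j))))"
    using F.Q.cls_rel[OF V0_rel.bin_neg[OF i d(2), of t]] by (simp add: d gen_eq)
  also have "\<dots> = (\<Oplus>\<^bsub>V\<^esub>j\<in>{0..t}. F.Q.cls (?a j \<odot>\<^bsub>FA\<^esub>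
         (V0_var (Kgen i) [^]\<^bsub>FA\<^esub> j \<otimes>\<^bsub>FA\<^esub> V0_var (Kbin i 0 (t - j)))))"
    by (rule cls_finsum) (use i in auto)
  also have "\<dots> = (\<Oplus>\<^bsub>V\<^esub>j\<in>{0..t}. ?a j \<odot>\<^bsub>V\<^esub> (K i [^]\<^bsub>V\<^esub> j \<otimes>\<^bsub>V\<^esub> k i (t - j)))"
    by (rule V.M.finsum_cong') (use i in \<open>auto simp: cls_simps\<close>)
  finally show ?thesis using True by (intro exI[of _ ?a]) simp
next
  case False
  define d where "d = nat c"
  have d: "c = int d" using False by (auto simp: d_def)
  let ?a = "\<lambda>j. qv ^ (d * (t - j)) * qbinom d j"
  have "V0_elt \<theta> (Kbin i c t) = F.Q.cls (\<Oplus>\<^bsub>FA\<^esub>j\<in>{0..t}. ?a j \<odot>\<^bsub>FA\<^esub>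
         (V0_var (Kinv i) [^]\<^bsub>FA\<^esub> j \<otimes>\<^bsub>FA\<^esub> V0_var (Kbin i 0 (t - j))))"
    using F.Q.cls_rel[OF V0_rel.bin_nonneg[OF i, of d t]] by (simp add: d gen_eq)
  also have "\<dots> = (\<Oplus>\<^bsub>V\<^esub>j\<in>{0..t}. F.Q.cls (?a j \<odot>\<^bsub>FA\<^esub>
         (V0_var (Kinv i) [^]\<^bsub>FA\<^esub> j \<otimes>\<^bsub>FA\<^esub> V0_var (Kbin i 0 (t - j)))))"
    by (rule cls_finsum) (use i in auto)
  also have "\<dots> = (\<Oplus>\<^bsub>V\<^esub>j\<in>{0..t}. ?a j \<odot>\<^bsub>V\<^esub> (K' i [^]\<^bsub>V\<^esub> j \<otimes>\<^bsub>V\<^esub> k i (t - j)))"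
    by (rule V.M.finsum_cong') (use i in \<open>auto simp: cls_simps\<close>)
  finally show ?thesis using False by (intro exI[of _ ?a]) simp
qed

text \<open>
  The other generators, those with \<open>c \<noteq> 0\<close>, are redundant by \<open>rel_bin\<close>.
\<close>

lemma V_subalgebra:
  assumes S: "S \<subseteq> carrier V"
    and one: "\<one>\<^bsub>V\<^esub> \<in> S"
    and add: "\<And>x y. x \<in> S \<Longrightarrow> y \<in> S \<Longrightarrow> x \<oplus>\<^bsub>V\<^esub> y \<in> S"
    and smult: "\<And>a x. a \<in> L \<Longrightarrow> x \<in> S \<Longrightarrow> a \<odot>\<^bsub>V\<^esub> x \<in> S"
    and mult: "\<And>x y. x \<in> S \<Longrightarrow> y \<in> S \<Longrightarrow> x \<otimes>\<^bsub>V\<^esub> y \<in> S"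
    and K: "\<And>i. i \<in> {1..\<theta>} \<Longrightarrow> K i \<in> S" and K': "\<And>i. i \<in> {1..\<theta>} \<Longrightarrow> K' i \<in> S"
    and k: "\<And>i t. i \<in> {1..\<theta>} \<Longrightarrow> k i t \<in> S"
  shows "S = carrier V"
proof -
  have zero: "\<zero>\<^bsub>V\<^esub> \<in> S" using smult[OF L_zero one] by (simp add: V.smult_l_null[simplified])
  have pow: "x [^]\<^bsub>V\<^esub> (n::nat) \<in> S" if "x \<in> S" for x n
    by (induction n) (use that one mult in \<open>auto simp: V.M.nat_pow_Suc\<close>)
  have sum: "(\<Oplus>\<^bsub>V\<^esub>j\<in>A. w j) \<in> S" if "finite A" "\<And>j. j \<in> A \<Longrightarrow> w j \<in> S" for A :: "nat set" and w
    using that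
  proof (induction A rule: finite_induct)
    case (insert x F)
    then have "w \<in> F \<rightarrow> carrier V" "w x \<in> carrier V" using S by auto
    then show ?case using insert add by simp
  qed (simp add: zero)
  have gen: "V0_elt \<theta> x \<in> S" if x: "x \<in> V0_gens \<theta>" for x
  proof (cases x)
    case (Kbin i c t)
    then have i: "i \<in> {1..\<theta>}" using x by simp
    obtain a where a: "a \<in> {0..t} \<rightarrow> L" "V0_elt \<theta> (Kbin i c t)
      = (\<Oplus>\<^bsub>V\<^esub>j\<in>{0..t}. a j \<odot>\<^bsub>V\<^esub> ((if c < 0 then K i else K' i) [^]\<^bsub>V\<^esub> j \<otimes>\<^bsub>V\<^esub> k i (t - j)))"
      using rel_bin[OF i] by blast
    show ?thesis unfolding Kbin a(2)
      by (rule sum) (use i a(1) K K' k in \<open>auto intro!: smult mult pow\<close>)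
  qed (use x K K' in auto)
  have "z \<in> S" if z: "z \<in> carrier F.Q.Q" for z
    using z
    by (induction z rule: F.induct) (use one add smult mult gen in \<open>simp_all add: V_eq gen_eq\<close>)
  then show ?thesis using S by (auto simp: V_eq)
qed

definition ev :: "(nat \<Rightarrow> nat \<times> nat) \<Rightarrow> (V0_gen list \<Rightarrow> qfun) set \<Rightarrow> qfun"
  where "ev p = coset_lift laurent (regular_alg laurent) (word_prod laurent (gen_val p))"

text \<open>
  Evaluation at a point respects all defining relations; the one with content is the product
  relation, which holds by \<open>kval_mult\<close>.
\<close>

lemma ev:
  shows ev_hom: "ev p \<in> alg_hom laurent V (regular_alg laurent)"
    and ev_gen: "x \<in> V0_gens \<theta> \<Longrightarrow> ev p (V0_elt \<theta> x) = gen_val p x"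
proof -
  interpret R: comm_alg laurent "regular_alg laurent" by (rule Lr.regular_alg_comm_alg)
  let ?\<phi> = "lin_ext laurent (regular_alg laurent) (word_prod laurent (gen_val p))"
  have g: "gen_val p \<in> V0_gens \<theta> \<rightarrow> carrier (regular_alg laurent)" by simp
  note \<phi> = F.free_eval[OF R.assoc_algebra_axioms g refl, unfolded word_prod_regular]
  note D = alg_homD(2-5)[OF \<phi>(1), simplified]
    lin_map_diff[OF alg_hom_lin_map[OF \<phi>(1)] FM.A.is_module R.is_module]
    alg_hom_pow[OF \<phi>(1) FM.A.M.monoid_axioms R.M.monoid_axioms, simplified] \<phi>(2)
  have fs: "?\<phi> (\<Oplus>\<^bsub>FA\<^esub>s\<in>S. u s) = (\<Sum>s\<in>S. ?\<phi> (u s))"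
    if "finite S" "u \<in> S \<rightarrow> carrier FA" for S and u :: "nat \<Rightarrow> _"
  proof -
    have "?\<phi> (\<Oplus>\<^bsub>FA\<^esub>s\<in>S. u s) = (\<Oplus>\<^bsub>laurent\<^esub>s\<in>S. ?\<phi> (u s))"
      using lin_map_finsum[OF alg_hom_lin_map[OF \<phi>(1)] FM.A.is_module R.is_module that] by simp
    also have "\<dots> = (\<Sum>s\<in>S. ?\<phi> (u s))"
      by (rule laurent_finsum) (use that alg_homD(1)[OF \<phi>(1)] in auto)
    finally show ?thesis .
  qed
  have df: "x \<ominus>\<^bsub>regular_alg laurent\<^esub> y = x - y" if "x \<in> L" "y \<in> L" for x y
  proof -
    have "x \<ominus>\<^bsub>regular_alg laurent\<^esub> y = x \<ominus>\<^bsub>laurent\<^esub> y"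
      by (simp add: a_minus_def a_inv_def m_inv_def)
    then show ?thesis using that by simp
  qed
  have rel: "?\<phi> x = ?\<phi> y" if "(x, y) \<in> V0_rel \<theta>" for x y
    using that
  proof (cases rule: V0_rel.cases)
    case (bin_one i)
    then show ?thesis using kval_1[of "p i"] by (simp add: D df del: gen_val.simps(3))
  next
    case (commute x y)
    then show ?thesis by (simp add: D var_in mult.commute)
  next
    case (inverse i)
    then show ?thesis by (simp add: D Kval_Kival)
  next
    case (bin_zero i)
    then show ?thesis by (simp add: D del: gen_val.simps(3))
  next
    case (bin_mult i t t')
    have "?\<phi> y = (\<Sum>j\<in>{0..t'}. ((-1) ^ j * qv ^ (t * (t' - j)) * qbinom (t + j - 1) j) *
        (Kval (p i) ^ j * kval (p i) t * kval (p i) (t' - j)))"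
      unfolding bin_mult(2)
      by (subst fs) (use bin_mult in \<open>auto intro!: sum.cong simp: D simp del: gen_val.simps(3)\<close>)
    then show ?thesis
      using bin_mult kval_mult[OF bin_mult(4), of t' "p i"] by (simp add: D del: gen_val.simps(3))
  next
    case (bin_neg i c t)
    have "?\<phi> y = (\<Sum>j\<in>{0..t}. ((-1) ^ j * qv ^ (c * (t - j)) * qbinom (c + j - 1) j) *
        (Kval (p i) ^ j * kval (p i) (t - j)))"
      unfolding bin_neg(2)
      by (subst fs) (use bin_neg in \<open>auto intro!: sum.cong simp: D simp del: gen_val.simps(3)\<close>)
    then show ?thesis using bin_neg by (simp add: D)
  next
    case (bin_nonneg i c t)
    have "?\<phi> y = (\<Sum>j\<in>{0..t}. (qv ^ (c * (t - j)) * qbinom c j) *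
        (Kival (p i) ^ j * kval (p i) (t - j)))"
      unfolding bin_nonneg(2)
      by (subst fs) (use bin_nonneg in \<open>auto intro!: sum.cong simp: D simp del: gen_val.simps(3)\<close>)
    then show ?thesis using bin_nonneg by (simp add: D)
  qed
  note PL = F.pres_lift[OF R.assoc_algebra_axioms g refl, unfolded word_prod_regular, OF rel]
  show "ev p \<in> alg_hom laurent V (regular_alg laurent)"
    unfolding ev_def using PL(1) by (simp add: V_eq)
  show "x \<in> V0_gens \<theta> \<Longrightarrow> ev p (V0_elt \<theta> x) = gen_val p x"
    unfolding ev_def using PL(2) by (simp add: gen_eq)
qed

lemmas ev_simps = alg_homD[OF ev_hom, simplified]
  alg_hom_pow[OF ev_hom V.M.monoid_axioms comm_alg.axioms(1)[OF Lr.regular_alg_comm_alg, THEN assoc_algebra.axioms(2), THEN ring.is_monoid], simplified]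

lemma ev_K [simp]:
  "i \<in> {1..\<theta>} \<Longrightarrow> ev p (K i) = Kval (p i)" "i \<in> {1..\<theta>} \<Longrightarrow> ev p (K' i) = Kival (p i)"
  "i \<in> {1..\<theta>} \<Longrightarrow> ev p (k i t) = kval (p i) t"
  by (simp_all add: ev_gen del: gen_val.simps(3))

end

section \<open>A basis of \<open>V\<^sup>0\<close>\<close>

text \<open>
  The elements whose multiplication preserves a span form a subalgebra. To see that a family with \<open>1\<close> in
  its span spans the algebra it is therefore enough to check multiplication by generators.
\<close>

definition stab :: "('r, 'k) ring_scheme \<Rightarrow> ('r, 'a, 'm) module_scheme \<Rightarrow> ('j \<Rightarrow> 'a) \<Rightarrow> 'j set \<Rightarrow> 'a set"
  where "stab R M u J = {x \<in> carrier M. \<forall>z\<in>lin_span R M u J. x \<otimes>\<^bsub>M\<^esub> z \<in> lin_span R M u J}"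

lemma (in comm_alg) mult_lin_map:
  "x \<in> carrier M \<Longrightarrow> (\<lambda>z. x \<otimes>\<^bsub>M\<^esub> z) \<in> lin_map R M M"
  "x \<in> carrier M \<Longrightarrow> (\<lambda>z. z \<otimes>\<^bsub>M\<^esub> x) \<in> lin_map R M M"
  by (auto intro!: lin_mapI simp: M.r_distr M.l_distr smult_mult_right smult_mult_left)

context comm_alg
begin

context
  fixes u :: "'j \<Rightarrow> 'c" and J :: "'j set"
  assumes u: "u \<in> J \<rightarrow> carrier M"
begin

lemma stab_subset: "stab R M u J \<subseteq> carrier M"
  by (auto simp: stab_def)

lemma stab_one: "\<one>\<^bsub>M\<^esub> \<in> stab R M u J"
  using span_closed[OF u] by (auto simp: stab_def)

lemma stab_add: "x \<in> stab R M u J \<Longrightarrow> y \<in> stab R M u J \<Longrightarrow> x \<oplus>\<^bsub>M\<^esub> y \<in> stab R M u J"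
  using span_closed[OF u] span_add[OF u] by (auto simp: stab_def M.l_distr)

lemma stab_smult: "a \<in> carrier R \<Longrightarrow> x \<in> stab R M u J \<Longrightarrow> a \<odot>\<^bsub>M\<^esub> x \<in> stab R M u J"
  using span_closed[OF u] span_smult[OF u] by (auto simp: stab_def smult_mult_left)

lemma stab_mult: "x \<in> stab R M u J \<Longrightarrow> y \<in> stab R M u J \<Longrightarrow> x \<otimes>\<^bsub>M\<^esub> y \<in> stab R M u J"
  using span_closed[OF u] by (auto simp: stab_def M.m_assoc)

lemma stabI:
  assumes "x \<in> carrier M" "\<And>j. j \<in> J \<Longrightarrow> x \<otimes>\<^bsub>M\<^esub> u j \<in> lin_span R M u J"
  shows "x \<in> stab R M u J"
  unfolding stab_def
  using assms lin_map_span[OF is_module is_module mult_lin_map(1)[OF assms(1)] u u] by auto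

end

end

text \<open>
  Multiplication by \<open>x\<close> changes only the \<open>i\<close>-th factor of such a product, and the product is linear in
  that factor.
\<close>

lemma (in comm_alg) stab_products:
  fixes bas :: "'i \<Rightarrow> 'j \<Rightarrow> 'c"
  assumes fin: "finite X" and bas: "\<And>i. i \<in> X \<Longrightarrow> bas i \<in> J \<rightarrow> carrier M"
    and i: "i \<in> X" and x: "x \<in> stab R M (bas i) J"
  shows "x \<in> stab R M (\<lambda>b. finprod M (\<lambda>i. bas i (b i)) X) (PiE X (\<lambda>_. J))"
proof -
  let ?mono = "\<lambda>b. finprod M (\<lambda>i. bas i (b i)) X" and ?PP = "PiE X (\<lambda>_. J)"
  have bc: "bas k (b k) \<in> carrier M" if "b \<in> ?PP" "k \<in> X" for b k
    using bas[OF that(2)] that by auto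
  have u: "?mono \<in> ?PP \<rightarrow> carrier M"
    using bc by (auto intro!: M.finprod_closed)
  show ?thesis
  proof (rule stabI[OF u])
    have ui: "bas i \<in> J \<rightarrow> carrier M" by (rule bas[OF i])
    show xc: "x \<in> carrier M" using x by (simp add: stab_def)
    fix b assume b: "b \<in> ?PP"
    define rest where "rest = finprod M (\<lambda>i. bas i (b i)) (X - {i})"
    have r: "rest \<in> carrier M" unfolding rest_def by (rule M.finprod_closed) (use bc[OF b] in auto)
    have split: "?mono (b(i := y)) = bas i y \<otimes>\<^bsub>M\<^esub> rest" if y: "y \<in> J" for y
    proof -
      have "X = insert i (X - {i})" using i by auto
      then have "?mono (b(i := y)) = finprod M (\<lambda>k. bas k ((b(i := y)) k)) (insert i (X - {i}))" by simp
      also have "\<dots> = bas i y \<otimes>\<^bsub>M\<^esub> finprod M (\<lambda>k. bas k ((b(i := y)) k)) (X - {i})"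
        by (subst M.finprod_insert) (use i fin bc[OF b] ui y in auto)
      also have "finprod M (\<lambda>k. bas k ((b(i := y)) k)) (X - {i}) = rest"
        unfolding rest_def by (rule M.finprod_cong') (use bc[OF b] in auto)
      finally show ?thesis .
    qed
    have bi: "b i \<in> J" by (rule PiE_mem[OF b i])
    have "x \<otimes>\<^bsub>M\<^esub> ?mono b = x \<otimes>\<^bsub>M\<^esub> (bas i (b i) \<otimes>\<^bsub>M\<^esub> rest)" using split[OF bi] by simp
    also have "\<dots> = (x \<otimes>\<^bsub>M\<^esub> bas i (b i)) \<otimes>\<^bsub>M\<^esub> rest"
      using xc r bc[OF b i] by (simp add: M.m_assoc)
    also have "\<dots> \<in> lin_span R M ?mono ?PP"
    proof (rule lin_map_span[OF is_module is_module mult_lin_map(2)[OF r] ui u])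
      show "x \<otimes>\<^bsub>M\<^esub> bas i (b i) \<in> lin_span R M (bas i) J"
        using x span_base[OF ui bi] by (auto simp: stab_def)
      fix y assume y: "y \<in> J"
      have "b(i := y) \<in> ?PP" using b i y by (auto simp: PiE_iff extensional_def)
      from span_base[OF u this] show "bas i y \<otimes>\<^bsub>M\<^esub> rest \<in> lin_span R M ?mono ?PP"
        unfolding split[OF y] .
    qed
    finally show "x \<otimes>\<^bsub>M\<^esub> ?mono b \<in> lin_span R M ?mono ?PP" .
  qed
qed

lemma qint_0 [simp]: "qint 0 = 0" by simp

lemma qint_Suc_qdiff: "qdiff 1 * qint n = qdiff n"
  using qdiff_Suc_nonzero[of 0] by (simp add: qint_qdiff del: qdiff_1 qdiff_eq_0_iff)

context V0_alg
begin

abbreviation bas where "bas i \<equiv> \<lambda>y::nat \<times> nat. K i [^]\<^bsub>V\<^esub> fst y \<otimes>\<^bsub>V\<^esub> k i (snd y)"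
abbreviation JJ :: "(nat \<times> nat) set" where "JJ \<equiv> {..1} \<times> UNIV"

text \<open>
  The product relation with \<open>t' = 1\<close>. It expresses \<open>k t * k 1\<close> by the proposed basis, and conversely
  it yields \<open>k (Suc t)\<close> where the coefficient on the left is invertible.
\<close>

lemma k_step:
  assumes i: "i \<in> {1..\<theta>}"
  shows "qbinom (Suc t) t \<odot>\<^bsub>V\<^esub> k i (Suc t) = qv ^ t \<odot>\<^bsub>V\<^esub> (k i t \<otimes>\<^bsub>V\<^esub> k i 1) \<ominus>\<^bsub>V\<^esub> qint t \<odot>\<^bsub>V\<^esub> (K i \<otimes>\<^bsub>V\<^esub> k i t)"
proof (cases "t = 0")
  case True
  have z: "\<zero>\<^bsub>laurent\<^esub> \<odot>\<^bsub>V\<^esub> K i = \<zero>\<^bsub>V\<^esub>" using i by (intro V.smult_l_null) simp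
  then show ?thesis using True i V.smult_one[of "k i (Suc 0)"]
    by (simp add: rel_zero a_minus_def z[simplified])
next
  case False
  then have t: "t \<ge> 1" by simp
  have e: "{0..1::nat} = insert 0 {1}" by auto
  have n: "(- qint t) \<odot>\<^bsub>V\<^esub> x = \<ominus>\<^bsub>V\<^esub> (qint t \<odot>\<^bsub>V\<^esub> x)" if "x \<in> carrier V" for x
    using V.smult_l_minus[of "qint t" x] that by simp
  have "qbinom (t + 1) t \<odot>\<^bsub>V\<^esub> k i (t + 1) = (\<Oplus>\<^bsub>V\<^esub>j\<in>{0..1}. ((-1) ^ j * qv ^ (t * (1 - j)) * qbinom (t + j - 1) j) \<odot>\<^bsub>V\<^esub>
         (K i [^]\<^bsub>V\<^esub> j \<otimes>\<^bsub>V\<^esub> k i t \<otimes>\<^bsub>V\<^esub> k i (1 - j)))"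
    by (rule rel_mult[OF i t])
  also have "\<dots> = qv ^ t \<odot>\<^bsub>V\<^esub> (k i t \<otimes>\<^bsub>V\<^esub> k i 1) \<oplus>\<^bsub>V\<^esub> (- qint t) \<odot>\<^bsub>V\<^esub> (K i \<otimes>\<^bsub>V\<^esub> k i t)"
    unfolding e using i by (subst V.M.finsum_insert) (auto simp: rel_zero qbinom_1[simplified] Pi_iff)
  finally show ?thesis using i by (simp add: n a_minus_def)
qed

lemma K_square: "i \<in> {1..\<theta>} \<Longrightarrow> K i \<otimes>\<^bsub>V\<^esub> K i = \<one>\<^bsub>V\<^esub> \<oplus>\<^bsub>V\<^esub> qdiff 1 \<odot>\<^bsub>V\<^esub> (K i \<otimes>\<^bsub>V\<^esub> k i 1)"
proof -
  assume i: "i \<in> {1..\<theta>}"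
  have "qdiff 1 \<odot>\<^bsub>V\<^esub> (K i \<otimes>\<^bsub>V\<^esub> k i 1) = K i \<otimes>\<^bsub>V\<^esub> (qdiff 1 \<odot>\<^bsub>V\<^esub> k i 1)"
    by (rule V.smult_mult_right[symmetric]) (use i in auto)
  also have "\<dots> = K i \<otimes>\<^bsub>V\<^esub> K i \<oplus>\<^bsub>V\<^esub> \<ominus>\<^bsub>V\<^esub> \<one>\<^bsub>V\<^esub>"
    unfolding rel_one[OF i] using i by (simp add: a_minus_def V.M.r_distr V.M.r_minus rel_inv)
  finally show ?thesis
    using i V.M.a_lcomm[of "\<one>\<^bsub>V\<^esub>" "K i \<otimes>\<^bsub>V\<^esub> K i" "\<ominus>\<^bsub>V\<^esub> \<one>\<^bsub>V\<^esub>"]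
    by (simp add: V.M.r_neg)
qed

lemma smult_cancel:
  "a \<in> L \<Longrightarrow> b \<in> L \<Longrightarrow> a * b = 1 \<Longrightarrow> x \<in> carrier V \<Longrightarrow> a \<odot>\<^bsub>V\<^esub> (b \<odot>\<^bsub>V\<^esub> x) = x"
  using V.smult_assoc1[of a b x] V.smult_one[of x] by simp

lemma qv_inv_pow [simp]: "inverse qv ^ n * qv ^ n = 1" "qv ^ n * inverse qv ^ n = 1"
  by (simp_all flip: power_mult_distrib)

text \<open>
  Products \<open>k t * k t'\<close> are resolved by the product relation, in which they occur with a power of \<open>qv\<close> as
  coefficient and all other products have a smaller second index. Squares of \<open>K\<close> need \<open>K_square\<close>, which
  introduces a factor \<open>k 1\<close>.
\<close>

lemma bas_stab:
  assumes i: "i \<in> {1..\<theta>}"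
  shows "K i \<in> stab laurent V (bas i) JJ" "K' i \<in> stab laurent V (bas i) JJ"
    "k i t \<in> stab laurent V (bas i) JJ"
proof -
  let ?S = "lin_span laurent V (bas i) JJ"
  have u: "bas i \<in> JJ \<rightarrow> carrier V" using i by auto
  note span = V.span_base[OF u] V.span_add[OF u] V.span_smult[OF u] V.span_closed[OF u]
  note st = V.stab_one[OF u] V.stab_add[OF u] V.stab_smult[OF u] V.stab_mult[OF u]
  have b0: "k i t \<in> ?S" for t using span(1)[of "(0, t)"] i by simp
  have b1: "K i \<otimes>\<^bsub>V\<^esub> k i t \<in> ?S" for t using span(1)[of "(1, t)"] i by simp
  have minus: "x \<ominus>\<^bsub>V\<^esub> y \<in> ?S" if "x \<in> ?S" "y \<in> ?S" for x y
  proof -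
    have "x \<ominus>\<^bsub>V\<^esub> y = x \<oplus>\<^bsub>V\<^esub> (- 1) \<odot>\<^bsub>V\<^esub> y"
      using V.smult_l_minus[of 1 y] V.smult_one[of y] that span(4) by (simp add: a_minus_def)
    then show ?thesis using that span by simp
  qed
  have kk1: "k i t \<otimes>\<^bsub>V\<^esub> k i 1 = inverse qv ^ t \<odot>\<^bsub>V\<^esub> (qbinom (Suc t) t \<odot>\<^bsub>V\<^esub> k i (Suc t) \<oplus>\<^bsub>V\<^esub> qint t \<odot>\<^bsub>V\<^esub> (K i \<otimes>\<^bsub>V\<^esub> k i t))" for t
  proof -
    have "qbinom (Suc t) t \<odot>\<^bsub>V\<^esub> k i (Suc t) \<oplus>\<^bsub>V\<^esub> qint t \<odot>\<^bsub>V\<^esub> (K i \<otimes>\<^bsub>V\<^esub> k i t) = qv ^ t \<odot>\<^bsub>V\<^esub> (k i t \<otimes>\<^bsub>V\<^esub> k i 1)"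
      unfolding k_step[OF i] using i by (simp add: a_minus_def V.M.a_assoc V.M.l_neg)
    then show ?thesis using i by (simp only:) (intro smult_cancel[symmetric], auto)
  qed
  then have kk1s: "k i t \<otimes>\<^bsub>V\<^esub> k i 1 \<in> ?S" for t
    unfolding kk1 by (intro span b0 b1) simp_all
  \<comment> \<open>Reducing \<open>K\<^sup>2\<close> by \<open>K_square\<close> and \<open>k t * k 1\<close> by \<open>kk1\<close> reproduces the element itself, with a
      coefficient \<open>c\<close>; the equation can be solved because \<open>1 - c\<close> is a power of \<open>qv\<close>.\<close>
  have KK: "K i \<otimes>\<^bsub>V\<^esub> (K i \<otimes>\<^bsub>V\<^esub> k i t) \<in> ?S" for t
  proof -
    let ?X = "K i \<otimes>\<^bsub>V\<^esub> (K i \<otimes>\<^bsub>V\<^esub> k i t)"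
    have X: "?X \<in> carrier V" using i by simp
    have "?X = (K i \<otimes>\<^bsub>V\<^esub> K i) \<otimes>\<^bsub>V\<^esub> k i t" using i by (simp add: V.M.m_assoc)
    also have "\<dots> = k i t \<oplus>\<^bsub>V\<^esub> qdiff 1 \<odot>\<^bsub>V\<^esub> (K i \<otimes>\<^bsub>V\<^esub> (k i t \<otimes>\<^bsub>V\<^esub> k i 1))"
      unfolding K_square[OF i] using i by (simp add: V.M.l_distr V.M.r_distr V.smult_mult_left V.smult_mult_right V.M.m_ac del: qdiff_1)
    also have "K i \<otimes>\<^bsub>V\<^esub> (k i t \<otimes>\<^bsub>V\<^esub> k i 1) = inverse qv ^ t \<odot>\<^bsub>V\<^esub> (qbinom (Suc t) t \<odot>\<^bsub>V\<^esub> (K i \<otimes>\<^bsub>V\<^esub> k i (Suc t)) \<oplus>\<^bsub>V\<^esub> qint t \<odot>\<^bsub>V\<^esub> ?X)"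
      unfolding kk1 using i by (simp add: V.smult_mult_right V.M.r_distr)
    finally have "?X = k i t \<oplus>\<^bsub>V\<^esub> qdiff 1 \<odot>\<^bsub>V\<^esub> (inverse qv ^ t \<odot>\<^bsub>V\<^esub> (qbinom (Suc t) t \<odot>\<^bsub>V\<^esub> (K i \<otimes>\<^bsub>V\<^esub> k i (Suc t)) \<oplus>\<^bsub>V\<^esub> qint t \<odot>\<^bsub>V\<^esub> ?X))" .
    also have "\<dots> = (k i t \<oplus>\<^bsub>V\<^esub> qdiff 1 \<odot>\<^bsub>V\<^esub> (inverse qv ^ t \<odot>\<^bsub>V\<^esub> (qbinom (Suc t) t \<odot>\<^bsub>V\<^esub> (K i \<otimes>\<^bsub>V\<^esub> k i (Suc t)))))
        \<oplus>\<^bsub>V\<^esub> (qdiff 1 * inverse qv ^ t * qint t) \<odot>\<^bsub>V\<^esub> ?X" (is "_ = ?Y \<oplus>\<^bsub>V\<^esub> ?c \<odot>\<^bsub>V\<^esub> ?X")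
      using i V.smult_assoc1[of "qdiff 1 * inverse qv ^ t" "qint t" ?X] V.smult_assoc1[of "qdiff 1" "inverse qv ^ t" "qint t \<odot>\<^bsub>V\<^esub> ?X"]
      by (simp add: V.smult_r_distr V.M.a_assoc del: qdiff_1)
    finally have eq: "?X = ?Y \<oplus>\<^bsub>V\<^esub> ?c \<odot>\<^bsub>V\<^esub> ?X" .
    have Y: "?Y \<in> ?S" using b0 b1 by (intro span) simp_all
    have c: "?c \<in> L" by (intro L_mult) simp_all
    have c1: "1 - ?c = inverse qv ^ (2 * t)"
    proof -
      have "?c = inverse qv ^ t * qdiff t" using qint_Suc_qdiff[of t] by (metis mult.assoc mult.commute)
      also have "\<dots> = 1 - inverse qv ^ (2 * t)" by (simp add: qdiff_def right_diff_distrib mult_2 power_add)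
      finally show ?thesis by simp
    qed
    have "(1 - ?c) \<odot>\<^bsub>V\<^esub> ?X = ?X \<ominus>\<^bsub>V\<^esub> ?c \<odot>\<^bsub>V\<^esub> ?X"
      using V.smult_l_distr[of 1 "- ?c" ?X] V.smult_l_minus[of ?c ?X] V.smult_one[of ?X] X c
      by (simp add: a_minus_def del: qdiff_1)
    also have "\<dots> = ?Y"
      by (subst eq) (use X c span(4)[OF Y] in \<open>simp add: a_minus_def V.M.a_assoc V.M.r_neg del: qdiff_1\<close>)
    finally have "inverse qv ^ (2 * t) \<odot>\<^bsub>V\<^esub> ?X = ?Y" unfolding c1 .
    then have "?X = qv ^ (2 * t) \<odot>\<^bsub>V\<^esub> ?Y"
      by (metis smult_cancel[OF _ _ qv_inv_pow(2) X] L_power L_qv L_inv)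
    then show ?thesis using span(3)[OF _ Y, of "qv ^ (2 * t)"] by simp
  qed
  have jj: "j \<in> JJ \<Longrightarrow> bas i j = k i (snd j) \<or> bas i j = K i \<otimes>\<^bsub>V\<^esub> k i (snd j)" for j
    using i by (cases j) (auto simp: le_Suc_eq)
  show Kst: "K i \<in> stab laurent V (bas i) JJ"
  proof (rule V.stabI[OF u])
    fix j assume "j \<in> JJ"
    from jj[OF this] show "K i \<otimes>\<^bsub>V\<^esub> bas i j \<in> ?S"
      by (elim disjE) (simp_all only: KK b1)
  qed (use i in simp)
  have k1st: "k i 1 \<in> stab laurent V (bas i) JJ"
  proof (rule V.stabI[OF u])
    fix j assume j: "j \<in> JJ"
    have "k i 1 \<otimes>\<^bsub>V\<^esub> k i t \<in> ?S" for t using kk1s i by (simp add: V.M.m_comm)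
    moreover have "k i 1 \<otimes>\<^bsub>V\<^esub> (K i \<otimes>\<^bsub>V\<^esub> k i t) = K i \<otimes>\<^bsub>V\<^esub> (k i t \<otimes>\<^bsub>V\<^esub> k i 1)" for t using i by (simp add: V.M.m_ac)
    moreover have "K i \<otimes>\<^bsub>V\<^esub> (k i t \<otimes>\<^bsub>V\<^esub> k i 1) \<in> ?S" for t using Kst kk1s by (auto simp: stab_def)
    ultimately show "k i 1 \<otimes>\<^bsub>V\<^esub> bas i j \<in> ?S" using jj[OF j] by auto
  qed (use i in simp)
  have stm: "x \<ominus>\<^bsub>V\<^esub> y \<in> stab laurent V (bas i) JJ"
    if "x \<in> stab laurent V (bas i) JJ" "y \<in> stab laurent V (bas i) JJ" for x y
  proof -
    have "x \<ominus>\<^bsub>V\<^esub> y = x \<oplus>\<^bsub>V\<^esub> (- 1) \<odot>\<^bsub>V\<^esub> y"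
      using V.smult_l_minus[of 1 y] V.smult_one[of y] that by (simp add: a_minus_def stab_def)
    then show ?thesis using that st by simp
  qed
  have "K' i = K i \<ominus>\<^bsub>V\<^esub> qdiff 1 \<odot>\<^bsub>V\<^esub> k i 1"
    unfolding rel_one[OF i] using i by (simp add: a_minus_def V.M.minus_add V.M.a_assoc[symmetric] V.M.r_neg)
  then show "K' i \<in> stab laurent V (bas i) JJ" using stm[OF Kst st(3)[OF _ k1st, of "qdiff 1"]] by simp
  have Kp: "K i [^]\<^bsub>V\<^esub> (n::nat) \<otimes>\<^bsub>V\<^esub> x \<in> ?S" if "x \<in> ?S" for x n
    using that
  proof (induction n arbitrary: x)
    case (Suc n)
    have "K i [^]\<^bsub>V\<^esub> Suc n \<otimes>\<^bsub>V\<^esub> x = K i [^]\<^bsub>V\<^esub> n \<otimes>\<^bsub>V\<^esub> (K i \<otimes>\<^bsub>V\<^esub> x)"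
      using Suc i span(4) by (simp add: V.M.m_assoc)
    then show ?case using Suc Kst by (simp add: stab_def)
  qed (use span(4) in simp)
  have kk: "k i t \<otimes>\<^bsub>V\<^esub> k i t' \<in> ?S" for t'
  proof (cases "t = 0")
    case True
    then show ?thesis using b0 i by (simp add: rel_zero)
  next
    case False
    then have t: "t \<ge> 1" by simp
    show ?thesis
    proof (induction t' rule: less_induct)
      case (less t')
      let ?T = "\<lambda>j. ((-1) ^ j * qv ^ (t * (t' - j)) * qbinom (t + j - 1) j) \<odot>\<^bsub>V\<^esub>
         (K i [^]\<^bsub>V\<^esub> j \<otimes>\<^bsub>V\<^esub> k i t \<otimes>\<^bsub>V\<^esub> k i (t' - j))"
      have Tc: "?T \<in> A \<rightarrow> carrier V" for A using i by auto
      have "{0..t'} = insert 0 {1..t'}" by auto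
      then have "qbinom (t + t') t \<odot>\<^bsub>V\<^esub> k i (t + t') = ?T 0 \<oplus>\<^bsub>V\<^esub> (\<Oplus>\<^bsub>V\<^esub>j\<in>{1..t'}. ?T j)"
        unfolding rel_mult[OF i t] by (simp only:) (rule V.M.finsum_insert[OF _ _ Tc], use i in auto)
      moreover have rest: "(\<Oplus>\<^bsub>V\<^esub>j\<in>{1..t'}. ?T j) \<in> ?S"
      proof (rule V.span_finsum[OF u])
        fix j assume j: "j \<in> {1..t'}"
        have "K i [^]\<^bsub>V\<^esub> j \<otimes>\<^bsub>V\<^esub> (k i t \<otimes>\<^bsub>V\<^esub> k i (t' - j)) \<in> ?S" using Kp less j by simp
        then show "?T j \<in> ?S" using i by (intro span) (simp_all add: V.M.m_assoc)
      qed simp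
      moreover have "?T 0 = qv ^ (t * t') \<odot>\<^bsub>V\<^esub> (k i t \<otimes>\<^bsub>V\<^esub> k i t')" using i by simp
      ultimately have "qv ^ (t * t') \<odot>\<^bsub>V\<^esub> (k i t \<otimes>\<^bsub>V\<^esub> k i t')
          = qbinom (t + t') t \<odot>\<^bsub>V\<^esub> k i (t + t') \<ominus>\<^bsub>V\<^esub> (\<Oplus>\<^bsub>V\<^esub>j\<in>{1..t'}. ?T j)"
        using i span(4)[OF rest] by (simp add: a_minus_def V.M.a_assoc V.M.r_neg)
      then have "qv ^ (t * t') \<odot>\<^bsub>V\<^esub> (k i t \<otimes>\<^bsub>V\<^esub> k i t') \<in> ?S"
        using minus[OF span(3)[OF _ b0] rest] by simp
      then have "inverse qv ^ (t * t') \<odot>\<^bsub>V\<^esub> (qv ^ (t * t') \<odot>\<^bsub>V\<^esub> (k i t \<otimes>\<^bsub>V\<^esub> k i t')) \<in> ?S"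
        by (rule span(3)[rotated]) simp
      moreover have "inverse qv ^ (t * t') \<odot>\<^bsub>V\<^esub> (qv ^ (t * t') \<odot>\<^bsub>V\<^esub> (k i t \<otimes>\<^bsub>V\<^esub> k i t')) = k i t \<otimes>\<^bsub>V\<^esub> k i t'"
        by (rule smult_cancel) (use i in simp_all)
      ultimately show ?case by (simp only:)
    qed
  qed
  show "k i t \<in> stab laurent V (bas i) JJ"
  proof (rule V.stabI[OF u])
    fix j assume j: "j \<in> JJ"
    have "k i t \<otimes>\<^bsub>V\<^esub> (K i \<otimes>\<^bsub>V\<^esub> k i t') = K i \<otimes>\<^bsub>V\<^esub> (k i t \<otimes>\<^bsub>V\<^esub> k i t')" for t' using i by (simp add: V.M.m_ac)
    moreover have "K i \<otimes>\<^bsub>V\<^esub> (k i t \<otimes>\<^bsub>V\<^esub> k i t') \<in> ?S" for t' using Kst kk by (auto simp: stab_def)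
    ultimately show "k i t \<otimes>\<^bsub>V\<^esub> bas i j \<in> ?S" using jj[OF j] kk by auto
  qed (use i in simp)
qed

abbreviation mono where "mono b \<equiv> finprod V (\<lambda>i. bas i (b i)) {1..\<theta>}"
abbreviation PP :: "(nat \<Rightarrow> nat \<times> nat) set" where "PP \<equiv> PiE {1..\<theta>} (\<lambda>_. JJ)"

lemma mono_closed: "mono \<in> PP \<rightarrow> carrier V"
  by (auto intro!: V.M.finprod_closed)

lemma mono_span: "lin_span laurent V mono PP = carrier V"
proof -
  note u = mono_closed
  note st = V.stab_one[OF u] V.stab_add[OF u] V.stab_smult[OF u] V.stab_mult[OF u]
  have lift: "x \<in> stab laurent V mono PP" if "i \<in> {1..\<theta>}" "x \<in> stab laurent V (bas i) JJ" for i x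
    using V.stab_products[where bas = bas, OF _ _ that] by auto
  have all: "stab laurent V mono PP = carrier V"
    by (rule V_subalgebra[OF V.stab_subset[OF u] st(1,2)])
       (simp_all only: st(3,4) lift[OF _ bas_stab(1)] lift[OF _ bas_stab(2)] lift[OF _ bas_stab(3)])
  have one: "\<one>\<^bsub>V\<^esub> \<in> lin_span laurent V mono PP"
  proof -
    have "mono (\<lambda>i\<in>{1..\<theta>}. (0::nat, 0::nat)) = \<one>\<^bsub>V\<^esub>"
      by (rule V.M.finprod_one_eqI) (simp add: rel_zero)
    moreover have "(\<lambda>i\<in>{1..\<theta>}. (0::nat, 0::nat)) \<in> PP" by auto
    from V.span_base[OF u this] have "mono (\<lambda>i\<in>{1..\<theta>}. (0::nat, 0::nat)) \<in> lin_span laurent V mono PP" .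
    ultimately show ?thesis by (simp only:)
  qed
  have "x \<in> lin_span laurent V mono PP" if "x \<in> carrier V" for x
  proof -
    have "x \<in> stab laurent V mono PP" using that by (simp only: all)
    then have "x \<otimes>\<^bsub>V\<^esub> \<one>\<^bsub>V\<^esub> \<in> lin_span laurent V mono PP"
      using one unfolding stab_def by blast
    then show ?thesis using that by (simp only: V.M.r_one)
  qed
  then show ?thesis
    by (intro equalityI subsetI) (erule V.span_closed[OF u])
qed

text \<open>
  The monomials \<open>K ^ \<delta> * k t\<close> with \<open>\<delta> \<le> 1\<close> have linearly independent values: the sign separates the
  parities of \<open>\<delta> + t\<close>, and within one parity the values at \<open>m = 0, 1, 2, \<dots>\<close> are triangular.
\<close>

definition bval :: "nat \<times> nat \<Rightarrow> nat \<times> nat \<Rightarrow> qfun" where "bval y q = Kval q ^ fst y * kval q (snd y)"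

lemma indep_bval: "indep_funs bval JJ"
  unfolding indep_funs_def
proof (intro allI impI ballI)
  fix A c j assume A: "finite A" "A \<subseteq> JJ" and eq: "\<forall>q. (\<Sum>j\<in>A. c j * bval j q) = 0" and j: "j \<in> A"
  define par where "par y \<longleftrightarrow> even (fst y + snd y)" for y :: "nat \<times> nat"
  define f where "f y m = c y * (qv ^ (m * fst y) * qbinom m (snd y))" for y m
  have sg: "c y * bval y (s, m) = (if par y then 1 else (-1) ^ s) * f y m" for y s m
  proof -
    have "bval y (s, m) = ((-1) ^ s) ^ (fst y + snd y) * (qv ^ (m * fst y) * qbinom m (snd y))"
      by (simp add: bval_def Kval_def kval_def power_mult_distrib power_add power_mult)
    moreover have "((-1::qfun) ^ s) ^ (fst y + snd y) = (if par y then 1 else (-1) ^ s)"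
      by (cases "even s") (auto simp: par_def)
    ultimately show ?thesis by (simp add: f_def)
  qed
  have sum: "(\<Sum>y\<in>A. f y m) = 0" "(\<Sum>y\<in>A. (if par y then 1 else -1) * f y m) = 0" for m
    using eq[rule_format, of "(0, m)"] eq[rule_format, of "(1, m)"] by (simp_all add: sg cong: if_cong)
  have two: "(2::qfun) \<noteq> 0" by simp
  have zero: "(\<Sum>y\<in>{y\<in>A. par y = e}. f y m) = 0" for e m
  proof -
    have "(\<Sum>y\<in>A. f y m) = (\<Sum>y\<in>{y\<in>A. par y}. f y m) + (\<Sum>y\<in>{y\<in>A. \<not> par y}. f y m)"
      using A(1) by (subst sum.union_disjoint[symmetric]) (auto intro!: sum.cong)
    moreover have "(\<Sum>y\<in>A. (if par y then 1 else -1) * f y m)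
        = (\<Sum>y\<in>{y\<in>A. par y}. f y m) - (\<Sum>y\<in>{y\<in>A. \<not> par y}. f y m)"
    proof -
      have "(\<Sum>y\<in>A. (if par y then 1 else -1) * f y m)
        = (\<Sum>y\<in>A. (if par y then f y m else 0) - (if \<not> par y then f y m else 0))"
        by (rule sum.cong) auto
      then show ?thesis using A(1) by (simp add: sum_subtractf sum.inter_filter)
    qed
    ultimately have eq: "(\<Sum>y\<in>{y\<in>A. par y}. f y m) + (\<Sum>y\<in>{y\<in>A. \<not> par y}. f y m) = 0"
      "(\<Sum>y\<in>{y\<in>A. par y}. f y m) = (\<Sum>y\<in>{y\<in>A. \<not> par y}. f y m)"
      using sum[of m] by simp_all
    then have "2 * (\<Sum>y\<in>{y\<in>A. \<not> par y}. f y m) = 0" by (simp only: mult_2)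
    then have "(\<Sum>y\<in>{y\<in>A. par y}. f y m) = 0" "(\<Sum>y\<in>{y\<in>A. \<not> par y}. f y m) = 0"
      using two eq by simp_all
    then show ?thesis by (cases e) simp_all
  qed
  have "\<forall>y\<in>A. snd y = t \<longrightarrow> c y = 0" for t
  proof (induction t rule: less_induct)
    case (less t)
    show ?case
    proof (intro ballI impI)
      fix y assume y: "y \<in> A" "snd y = t"
      have "(\<Sum>x\<in>{x\<in>A. par x = par y}. f x t) = (\<Sum>x\<in>{y}. f x t)"
      proof (rule sum.mono_neutral_right)
        show "\<forall>x\<in>{x \<in> A. par x = par y} - {y}. f x t = 0"
        proof
          fix x assume x: "x \<in> {x \<in> A. par x = par y} - {y}"
          then have xJ: "fst x \<le> 1" "fst y \<le> 1" using A y by auto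
          have "snd x \<noteq> t"
          proof
            assume "snd x = t"
            then have "even (fst x) = even (fst y)" using x y by (auto simp: par_def)
            then have "fst x = fst y" using xJ by (auto simp: le_Suc_eq)
            then show False using x y \<open>snd x = t\<close> by (auto simp: prod_eq_iff)
          qed
          then consider "snd x < t" | "snd x > t" by linarith
          then show "f x t = 0"
            by cases (use less x in \<open>auto simp: f_def qbinom_gt\<close>)
        qed
      qed (use A y in auto)
      then have "f y t = 0" using zero[of t "par y"] by simp
      then show "c y = 0" by (simp add: f_def y)
    qed
  qed
  then show "c j = 0" using j by blast
qed

lemma ev_finprod:
  "finite A \<Longrightarrow> u \<in> A \<rightarrow> carrier V \<Longrightarrow> ev p (finprod V u A) = (\<Prod>a\<in>A. ev p (u a))"
  by (induction A rule: finite_induct) (auto simp: ev_simps Pi_iff V.M.finprod_closed)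

lemma ev_finsum:
  "finite A \<Longrightarrow> u \<in> A \<rightarrow> carrier V \<Longrightarrow> ev p (finsum V u A) = (\<Sum>a\<in>A. ev p (u a))"
  by (induction A rule: finite_induct)
     (auto simp: ev_simps Pi_iff V.M.finsum_closed lin_map_zero[OF alg_hom_lin_map[OF ev_hom] V.is_module
        comm_alg.axioms(1)[OF Lr.regular_alg_comm_alg, THEN assoc_algebra.is_module]])

lemma ev_mono: "b \<in> PP \<Longrightarrow> ev p (mono b) = (\<Prod>i\<in>{1..\<theta>}. bval (b i) (p i))"
  by (subst ev_finprod) (auto simp: ev_simps bval_def intro!: prod.cong)

lemma indep_PP: "indep_funs (\<lambda>b p. \<Prod>i\<in>{1..\<theta>}. bval (b i) (p i)) PP"
  by (rule indep_funs_PiE[OF indep_bval]) simp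

lemma finsum_zero_coeffs:
  assumes M: "Module.module laurent M" and u: "u \<in> A \<rightarrow> carrier M" and c: "\<And>j. j \<in> A \<Longrightarrow> c j = 0"
  shows "(\<Oplus>\<^bsub>M\<^esub>j\<in>A. c j \<odot>\<^bsub>M\<^esub> u j) = \<zero>\<^bsub>M\<^esub>"
proof -
  interpret M: Module.module laurent M by fact
  show ?thesis
  proof (rule M.add.finprod_one_eqI)
    fix j assume j: "j \<in> A"
    then have "u j \<in> carrier M" using u by auto
    then have "\<zero>\<^bsub>laurent\<^esub> \<odot>\<^bsub>M\<^esub> u j = \<zero>\<^bsub>M\<^esub>" by (rule M.smult_l_null)
    then show "c j \<odot>\<^bsub>M\<^esub> u j = \<zero>\<^bsub>M\<^esub>" using c[OF j] by simp
  qed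
qed

text \<open>
  Evaluations separate the elements of \<open>V\<^sup>0\<close>, as they separate linear combinations of a spanning
  family with independent values. So \<open>V\<^sup>0\<close> is a ring of functions, and in particular torsion-free.
\<close>

theorem ev_inj0:
  assumes z: "z \<in> carrier V" and 0: "\<And>p. ev p z = 0"
  shows "z = \<zero>\<^bsub>V\<^esub>"
proof -
  obtain A c where A: "finite A" "A \<subseteq> PP" and c: "c \<in> PP \<rightarrow> L"
    and zz: "z = (\<Oplus>\<^bsub>V\<^esub>b\<in>A. c b \<odot>\<^bsub>V\<^esub> mono b)"
    using V.span_expand[OF mono_closed, of z] z unfolding mono_span by auto
  have m: "mono b \<in> carrier V" "c b \<in> L" if "b \<in> A" for b using mono_closed c A that by auto
  have e: "ev p (c b \<odot>\<^bsub>V\<^esub> mono b) = c b * (\<Prod>i\<in>{1..\<theta>}. bval (b i) (p i))" if "b \<in> A" for b p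
    unfolding ev_simps(5)[OF m(2)[OF that] m(1)[OF that]] ev_mono[OF subsetD[OF A(2) that]] ..
  have ez: "ev p z = (\<Sum>b\<in>A. ev p (c b \<odot>\<^bsub>V\<^esub> mono b))" for p
    unfolding zz by (rule ev_finsum[OF A(1)]) (use m V.smult_closed in auto)
  have "(\<Sum>b\<in>A. c b * (\<Prod>i\<in>{1..\<theta>}. bval (b i) (p i))) = ev p z" for p
    unfolding ez by (rule sum.cong[OF refl e[symmetric]])
  then have "\<And>b. b \<in> A \<Longrightarrow> c b = 0"
    using indep_funsD[OF indep_PP A, of c] 0 by simp
  then show ?thesis unfolding zz using m by (intro finsum_zero_coeffs[OF V.is_module]) auto
qed

lemma ev_inj: "x \<in> carrier V \<Longrightarrow> y \<in> carrier V \<Longrightarrow> (\<And>p. ev p x = ev p y) \<Longrightarrow> x = y"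
proof -
  assume xy: "x \<in> carrier V" "y \<in> carrier V" and eq: "\<And>p. ev p x = ev p y"
  have "ev p (x \<oplus>\<^bsub>V\<^esub> (-1) \<odot>\<^bsub>V\<^esub> y) = 0" for p using xy eq by (simp add: ev_simps)
  then have "x \<oplus>\<^bsub>V\<^esub> (-1) \<odot>\<^bsub>V\<^esub> y = \<zero>\<^bsub>V\<^esub>" using xy by (intro ev_inj0) simp_all
  moreover have "(-1) \<odot>\<^bsub>V\<^esub> y = \<ominus>\<^bsub>V\<^esub> y" using V.smult_l_minus[of 1 y] V.smult_one[of y] xy by simp
  ultimately show ?thesis
    using xy by (metis V.M.minus_equality V.M.minus_minus V.M.a_inv_closed)
qed

end

section \<open>Torsion and the tensor square of \<open>V\<^sup>0\<close>\<close>

context V0_alg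
begin

text \<open>
  Torsion-freeness.
\<close>

lemma smult_eq_0:
  assumes "c \<in> L" "c \<noteq> 0" "x \<in> carrier V" "y \<in> carrier V" "c \<odot>\<^bsub>V\<^esub> x = c \<odot>\<^bsub>V\<^esub> y"
  shows "x = y"
proof (rule ev_inj)
  fix p
  have "ev p (c \<odot>\<^bsub>V\<^esub> x) = ev p (c \<odot>\<^bsub>V\<^esub> y)" by (simp only: assms(5))
  then show "ev p x = ev p y"
    unfolding ev_simps(5)[OF assms(1,3)] ev_simps(5)[OF assms(1,4)] using assms(2) by simp
qed (use assms in auto)

sublocale VT: tensor_alg laurent V V
  by (rule tensor_algI) unfold_locales

abbreviation VV where "VV \<equiv> tensor laurent V V"

abbreviation tmono where "tmono \<equiv> \<lambda>c. tens laurent V V (mono (fst c)) (mono (snd c))"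

lemma tmono_closed: "tmono \<in> PP \<times> PP \<rightarrow> carrier VV"
proof
  fix c assume "c \<in> PP \<times> PP"
  then have "mono (fst c) \<in> carrier V" "mono (snd c) \<in> carrier V" using mono_closed by auto
  then show "tmono c \<in> carrier VV" by (rule VT.tens_closed)
qed

lemma VV_span:
  assumes "z \<in> carrier VV"
  shows "z \<in> lin_span laurent VV tmono (PP \<times> PP)"
  using assms
proof (induction z rule: VT.tensor_induct)
  case (add u w)
  then show ?case using VT.TA.span_add[OF tmono_closed] by blast
next
  case (tens x y)
  have 1: "tens laurent V V x (mono b) \<in> lin_span laurent VV tmono (PP \<times> PP)" if b: "b \<in> PP" for b
  proof (rule lin_map_span[where \<phi> = "\<lambda>x. tens laurent V V x (mono b)" and z = x,
        OF V.is_module VT.TA.is_module _ mono_closed tmono_closed])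
    have mb: "mono b \<in> carrier V" using mono_closed b by auto
    then show "(\<lambda>x. tens laurent V V x (mono b)) \<in> lin_map laurent V VV"
      by (intro lin_mapI) (simp_all only: VT.tens_closed VT.tens_ops)
    show "x \<in> lin_span laurent V mono PP" using tens by (simp only: mono_span)
    fix b' assume "b' \<in> PP"
    then have "(b', b) \<in> PP \<times> PP" using b by auto
    from VT.TA.span_base[OF tmono_closed this]
    show "tens laurent V V (mono b') (mono b) \<in> lin_span laurent VV tmono (PP \<times> PP)" by simp
  qed
  show ?case
  proof (rule lin_map_span[where \<phi> = "\<lambda>y. tens laurent V V x y" and z = y,
        OF V.is_module VT.TA.is_module _ mono_closed tmono_closed 1])
    show "(\<lambda>y. tens laurent V V x y) \<in> lin_map laurent V VV"
      using tens by (intro lin_mapI) (simp_all only: VT.tens_closed VT.tens_ops)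
    show "y \<in> lin_span laurent V mono PP" using tens by (simp only: mono_span)
  qed
qed

definition ev2 where
  "ev2 p q = coset_lift laurent (regular_alg laurent) (\<lambda>(x, y). ev p x * ev q y)"

lemma ev2:
  shows ev2_hom: "ev2 p q \<in> alg_hom laurent VV (regular_alg laurent)"
    and ev2_tens: "x \<in> carrier V \<Longrightarrow> y \<in> carrier V \<Longrightarrow> ev2 p q (tens laurent V V x y) = ev p x * ev q y"
proof -
  note L = VT.lift_coproduct[OF Lr.regular_alg_comm_alg ev_hom[of p] ev_hom[of q],
      where h = "\<lambda>(x, y). ev p x * ev q y", simplified]
  show "ev2 p q \<in> alg_hom laurent VV (regular_alg laurent)" unfolding ev2_def by (rule L(1))
  show "x \<in> carrier V \<Longrightarrow> y \<in> carrier V \<Longrightarrow> ev2 p q (tens laurent V V x y) = ev p x * ev q y"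
    unfolding ev2_def by (rule L(2))
qed

lemmas ev2_simps = alg_homD[OF ev2_hom, simplified]

lemma ev2_finsum:
  "finite A \<Longrightarrow> u \<in> A \<rightarrow> carrier VV \<Longrightarrow> ev2 p q (finsum VV u A) = (\<Sum>a\<in>A. ev2 p q (u a))"
  by (induction A rule: finite_induct)
     (auto simp: ev2_simps Pi_iff VT.TA.M.finsum_closed lin_map_zero[OF alg_hom_lin_map[OF ev2_hom] VT.TA.is_module
        comm_alg.axioms(1)[OF Lr.regular_alg_comm_alg, THEN assoc_algebra.is_module]])

text \<open>
  The argument of \<open>ev_inj0\<close> with the products of two monomials.
\<close>

lemma ev2_inj0:
  assumes z: "z \<in> carrier VV" and 0: "\<And>p q. ev2 p q z = 0"
  shows "z = \<zero>\<^bsub>VV\<^esub>"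
proof -
  obtain A c where A: "finite A" "A \<subseteq> PP \<times> PP" and c: "c \<in> PP \<times> PP \<rightarrow> L"
    and zz: "z = (\<Oplus>\<^bsub>VV\<^esub>b\<in>A. c b \<odot>\<^bsub>VV\<^esub> tmono b)"
    using VT.TA.span_expand[OF tmono_closed VV_span[OF z]] by blast
  have m: "tmono b \<in> carrier VV" "c b \<in> L" if "b \<in> A" for b
    using funcset_mem[OF tmono_closed subsetD[OF A(2) that]] funcset_mem[OF c subsetD[OF A(2) that]] .
  have e: "ev2 p q (c b \<odot>\<^bsub>VV\<^esub> tmono b)
      = c b * ((\<Prod>i\<in>{1..\<theta>}. bval (fst b i) (p i)) * (\<Prod>i\<in>{1..\<theta>}. bval (snd b i) (q i)))" if "b \<in> A" for b p q
  proof -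
    have b: "fst b \<in> PP" "snd b \<in> PP" using subsetD[OF A(2) that] by (simp_all only: mem_Times_iff)
    have "ev2 p q (tmono b) = ev p (mono (fst b)) * ev q (mono (snd b))"
      by (rule ev2_tens) (rule funcset_mem[OF mono_closed b(1)] funcset_mem[OF mono_closed b(2)])+
    then show ?thesis
      unfolding ev2_simps(5)[OF m(2)[OF that] m(1)[OF that]] ev_mono[OF b(1)] ev_mono[OF b(2)] by (simp only:)
  qed
  have "ev2 p q z = (\<Sum>b\<in>A. ev2 p q (c b \<odot>\<^bsub>VV\<^esub> tmono b))" for p q
    unfolding zz by (rule ev2_finsum[OF A(1)]) (use m VT.TA.smult_closed in blast)
  also have "\<dots> p q = (\<Sum>b\<in>A. c b * ((\<Prod>i\<in>{1..\<theta>}. bval (fst b i) (p i)) * (\<Prod>i\<in>{1..\<theta>}. bval (snd b i) (q i))))" for p q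
    by (rule sum.cong[OF refl e])
  finally have s: "(\<Sum>b\<in>A. c b * ((\<Prod>i\<in>{1..\<theta>}. bval (fst b i) (p i)) * (\<Prod>i\<in>{1..\<theta>}. bval (snd b i) (q i)))) = 0" for p q
    using 0 by simp
  have "\<And>b. b \<in> A \<Longrightarrow> c b = 0"
    by (rule indep_funsD[OF indep_funs_pair[OF indep_PP indep_PP] A s])
  then show ?thesis unfolding zz by (intro finsum_zero_coeffs[OF VT.TA.is_module]) (use m in auto)
qed

lemma ev2_inj: "x \<in> carrier VV \<Longrightarrow> y \<in> carrier VV \<Longrightarrow> (\<And>p q. ev2 p q x = ev2 p q y) \<Longrightarrow> x = y"
proof -
  assume xy: "x \<in> carrier VV" "y \<in> carrier VV" and eq: "\<And>p q. ev2 p q x = ev2 p q y"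
  have "ev2 p q (x \<oplus>\<^bsub>VV\<^esub> (-1) \<odot>\<^bsub>VV\<^esub> y) = 0" for p q using xy eq by (simp add: ev2_simps)
  then have "x \<oplus>\<^bsub>VV\<^esub> (-1) \<odot>\<^bsub>VV\<^esub> y = \<zero>\<^bsub>VV\<^esub>" using xy by (intro ev2_inj0) simp_all
  moreover have "(-1) \<odot>\<^bsub>VV\<^esub> y = \<ominus>\<^bsub>VV\<^esub> y" using VT.TA.smult_l_minus[of 1 y] VT.TA.smult_one[of y] xy by simp
  ultimately show ?thesis
    using xy by (metis VT.TA.M.minus_equality VT.TA.M.minus_minus VT.TA.M.a_inv_closed)
qed

text \<open>
  Over the fraction field \<open>V\<^sup>0\<close> is generated by \<open>K\<close> and its inverse. Hence a torsion-closed submodule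
  containing \<open>1\<close> and stable under multiplication by these elements is everything.
\<close>

lemma torsion_induct [consumes 1, case_names one add smult torsion K K']:
  assumes x: "x \<in> carrier V"
    and one: "T \<one>\<^bsub>V\<^esub>"
    and add: "\<And>x y. x \<in> carrier V \<Longrightarrow> y \<in> carrier V \<Longrightarrow> T x \<Longrightarrow> T y \<Longrightarrow> T (x \<oplus>\<^bsub>V\<^esub> y)"
    and smult: "\<And>a x. a \<in> L \<Longrightarrow> x \<in> carrier V \<Longrightarrow> T x \<Longrightarrow> T (a \<odot>\<^bsub>V\<^esub> x)"
    and torsion: "\<And>a x. a \<in> L \<Longrightarrow> a \<noteq> 0 \<Longrightarrow> x \<in> carrier V \<Longrightarrow> T (a \<odot>\<^bsub>V\<^esub> x) \<Longrightarrow> T x"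
    and K: "\<And>i x. i \<in> {1..\<theta>} \<Longrightarrow> x \<in> carrier V \<Longrightarrow> T x \<Longrightarrow> T (K i \<otimes>\<^bsub>V\<^esub> x)"
    and K': "\<And>i x. i \<in> {1..\<theta>} \<Longrightarrow> x \<in> carrier V \<Longrightarrow> T x \<Longrightarrow> T (K' i \<otimes>\<^bsub>V\<^esub> x)"
  shows "T x"
proof -
  define S where "S = {y \<in> carrier V. \<forall>x\<in>carrier V. T x \<longrightarrow> T (y \<otimes>\<^bsub>V\<^esub> x)}"
  have Sadd: "y \<oplus>\<^bsub>V\<^esub> z \<in> S" if "y \<in> S" "z \<in> S" for y z
    using that add by (auto simp: S_def V.M.l_distr)
  have Ssm: "a \<odot>\<^bsub>V\<^esub> y \<in> S" if "a \<in> L" "y \<in> S" for a y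
    using that smult by (auto simp: S_def V.smult_mult_left)
  have Smin: "y \<ominus>\<^bsub>V\<^esub> z \<in> S" if "y \<in> S" "z \<in> S" for y z
  proof -
    have z: "z \<in> carrier V" using that by (simp add: S_def)
    have "y \<ominus>\<^bsub>V\<^esub> z = y \<oplus>\<^bsub>V\<^esub> (- 1) \<odot>\<^bsub>V\<^esub> z"
      using V.smult_l_minus[of 1 z] V.smult_one[OF z] z by (simp add: a_minus_def)
    then show ?thesis using that Sadd Ssm by simp
  qed
  have Smult: "y \<otimes>\<^bsub>V\<^esub> z \<in> S" if "y \<in> S" "z \<in> S" for y z
    using that by (auto simp: S_def V.M.m_assoc)
  have Stor: "y \<in> S" if "a \<in> L" "a \<noteq> 0" "y \<in> carrier V" "a \<odot>\<^bsub>V\<^esub> y \<in> S" for a y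
    unfolding S_def
  proof (intro CollectI conjI ballI impI)
    fix x assume "x \<in> carrier V" "T x"
    then have "T ((a \<odot>\<^bsub>V\<^esub> y) \<otimes>\<^bsub>V\<^esub> x)" using that by (auto simp: S_def)
    then show "T (y \<otimes>\<^bsub>V\<^esub> x)"
      using torsion[OF that(1,2)] that \<open>x \<in> carrier V\<close> by (simp add: V.smult_mult_left)
  qed (use that in auto)
  have SK: "K i \<in> S" "K' i \<in> S" if "i \<in> {1..\<theta>}" for i
    using that K K' by (auto simp: S_def)
  have S1: "\<one>\<^bsub>V\<^esub> \<in> S" by (auto simp: S_def)
  have Sk1: "k i 1 \<in> S" if i: "i \<in> {1..\<theta>}" for i
  proof (rule Stor[of "qdiff 1"])
    show "qdiff 1 \<odot>\<^bsub>V\<^esub> k i 1 \<in> S" unfolding rel_one[OF i] using SK i Smin by blast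
    show "qdiff 1 \<noteq> 0" using qdiff_Suc_nonzero[of 0] by simp
  qed (use i in simp_all)
  have Sk: "k i t \<in> S" if i: "i \<in> {1..\<theta>}" for i t
  proof (induction t)
    case 0
    show ?case using S1 i by (simp add: rel_zero)
  next
    case (Suc t)
    show ?case
    proof (rule Stor[of "qbinom (Suc t) t"])
      show "qbinom (Suc t) t \<odot>\<^bsub>V\<^esub> k i (Suc t) \<in> S"
        unfolding k_step[OF i] using Suc Sk1[OF i] SK[OF i] by (intro Smin Ssm Smult) simp_all
      show "qbinom (Suc t) t \<noteq> 0" by (simp add: qbinom_def)
    qed (use i in simp_all)
  qed
  have "S = carrier V"
    by (rule V_subalgebra) (use S1 Sadd Ssm Smult SK Sk in \<open>auto simp: S_def\<close>)
  then have "T (x \<otimes>\<^bsub>V\<^esub> \<one>\<^bsub>V\<^esub>)" using x one unfolding S_def by blast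
  then show ?thesis using x by simp
qed

section \<open>The element of \<open>V\<^sup>0\<close> specializing to a multiple of \<open>h\<close>\<close>

text \<open>
  The element \<open>Hel n i\<close> of \<open>V\<^sup>0\<close> is \<open>n\<close> times the expression for \<open>h\<close>, so that it has coefficients in the
  Laurent polynomials. After multiplication by \<open>qdiff n\<close> it is \<open>K ^ (2 * n) - 1\<close>, which is proved by
  evaluation.
\<close>

definition Hel where
  "Hel n i = (\<Oplus>\<^bsub>V\<^esub>s\<in>{1..n}. pcoef n s \<odot>\<^bsub>V\<^esub> (k i s \<otimes>\<^bsub>V\<^esub> K i [^]\<^bsub>V\<^esub> phi n s)) \<otimes>\<^bsub>V\<^esub> K i [^]\<^bsub>V\<^esub> n"

lemma Hel_closed [simp]: "n \<ge> 1 \<Longrightarrow> i \<in> {1..\<theta>} \<Longrightarrow> Hel n i \<in> carrier V"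
  unfolding Hel_def by (auto intro!: V.M.m_closed V.M.finsum_closed V.smult_closed)

lemma ev_Hel:
  assumes n: "n \<ge> 1" and i: "i \<in> {1..\<theta>}"
  shows "ev p (Hel n i) * qdiff n = qv ^ (2 * snd (p i) * n) - 1"
proof -
  obtain s m where p: "p i = (s, m)" by force
  have c: "(\<lambda>s. pcoef n s \<odot>\<^bsub>V\<^esub> (k i s \<otimes>\<^bsub>V\<^esub> K i [^]\<^bsub>V\<^esub> phi n s)) \<in> {1..n} \<rightarrow> carrier V"
    using n i by (auto intro!: V.M.m_closed V.smult_closed)
  have "ev p (Hel n i) = (\<Sum>t\<in>{1..n}. pcoef n t * (kval (p i) t * Kval (p i) ^ phi n t)) * Kval (p i) ^ n"
    unfolding Hel_def using n i c
    by (simp add: ev_simps ev_finsum V.M.finsum_closed[OF c])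
  also have "\<dots> = (\<Sum>t\<in>{1..n}. pcoef n t * qbinom m t * qv ^ (phi n t * m)) * qv ^ (m * n)"
    unfolding sum_distrib_right
  proof (rule sum.cong)
    fix t assume "t \<in> {1..n}"
    \<comment> \<open>The signs cancel, because \<open>t + phi n t + n\<close> is even.\<close>
    then obtain e where e: "n + phi n t = t + 2 * e" using phi_parity[of t n] by auto
    have "s * t + s * phi n t + s * n = s * (t + (n + phi n t))" by (simp add: algebra_simps)
    also have "\<dots> = 2 * (s * (t + e))" unfolding e by simp
    finally have "(-1::qfun) ^ (s * t) * (-1) ^ (s * phi n t) * (-1) ^ (s * n) = 1"
      unfolding power_add[symmetric] by simp
    moreover have "kval (p i) t = (-1) ^ (s * t) * qbinom m t"
      "Kval (p i) ^ phi n t = (-1) ^ (s * phi n t) * qv ^ (phi n t * m)"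
      "Kval (p i) ^ n = (-1) ^ (s * n) * qv ^ (m * n)"
      by (simp_all add: p kval_def Kval_def power_mult_distrib mult.commute[of "phi n t"] flip: power_mult)
    moreover have "pcoef n t * ((-1) ^ (s * t) * qbinom m t * ((-1) ^ (s * phi n t) * qv ^ (phi n t * m))) * ((-1) ^ (s * n) * qv ^ (m * n))
      = ((-1::qfun) ^ (s * t) * (-1) ^ (s * phi n t) * (-1) ^ (s * n)) * (pcoef n t * qbinom m t * qv ^ (phi n t * m) * qv ^ (m * n))"
      by (simp only: mult_ac)
    ultimately show "pcoef n t * (kval (p i) t * Kval (p i) ^ phi n t) * Kval (p i) ^ n
      = pcoef n t * qbinom m t * qv ^ (phi n t * m) * qv ^ (m * n)"
      by (simp only: mult_1)
  qed simp
  finally show ?thesis using pcoef_identity[OF n, of m] by (simp add: p)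
qed

lemma sgn_even: "((-1::qfun) ^ a) ^ (2 * n) = 1"
  by (simp add: power_mult power2_eq_square)

lemma Kval_even: "Kval q ^ (2 * n) = qv ^ (2 * snd q * n)"
  by (simp add: Kval_def power_mult_distrib sgn_even) (simp add: mult_ac flip: power_mult)

lemma Kival_even: "Kival q ^ (2 * n) = inverse qv ^ (2 * snd q * n)"
  by (simp add: Kival_def power_mult_distrib sgn_even) (simp add: mult_ac flip: power_mult)

lemma Hel_rel:
  assumes n: "n \<ge> 1" and i: "i \<in> {1..\<theta>}"
  shows "qdiff n \<odot>\<^bsub>V\<^esub> Hel n i \<oplus>\<^bsub>V\<^esub> \<one>\<^bsub>V\<^esub> = K i [^]\<^bsub>V\<^esub> (2 * n)"
  by (rule ev_inj)
     (use assms ev_Hel[OF assms] in \<open>simp_all add: ev_simps Kval_even mult.commute[of "qdiff n"]\<close>)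

end

section \<open>The Hopf structure of \<open>V\<^sup>0\<close>\<close>

locale V0_hopf_alg = V0_alg +
  fixes d :: "(V0_gen list \<Rightarrow> qfun) set
        \<Rightarrow> ((V0_gen list \<Rightarrow> qfun) set \<times> (V0_gen list \<Rightarrow> qfun) set \<Rightarrow> qfun) set"
    and e :: "(V0_gen list \<Rightarrow> qfun) set \<Rightarrow> qfun"
    and S :: "(V0_gen list \<Rightarrow> qfun) set \<Rightarrow> (V0_gen list \<Rightarrow> qfun) set"
  assumes hopf: "hopf_algebra laurent (V0_hopf \<theta> d e S)"
    and d_K: "\<And>i. i \<in> {1..\<theta>} \<Longrightarrow> d (K i) = tens laurent V V (K i) (K i)"
    and d_K': "\<And>i. i \<in> {1..\<theta>} \<Longrightarrow> d (K' i) = tens laurent V V (K' i) (K' i)"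
begin

lemma d_hom: "d \<in> alg_hom laurent V VV"
  using hopf_algebra.comult_hom[OF hopf] by simp

lemma e_hom: "e \<in> alg_hom laurent V (regular_alg laurent)"
  using hopf_algebra.counit_hom[OF hopf] by simp

lemma S_lin: "S \<in> lin_map laurent V V"
  by (rule lin_mapI)
     (use hopf_algebra.antipode_closed[OF hopf] hopf_algebra.antipode_add[OF hopf]
        hopf_algebra.antipode_smult[OF hopf] in auto)

lemmas d_simps = alg_homD[OF d_hom]
lemmas e_simps = alg_homD[OF e_hom, simplified]
lemmas S_simps = lin_mapD[OF S_lin, simplified]

text \<open>
  The product of two points, regarded as characters of the group generated by the \<open>K\<close>.
\<close>

definition padd :: "(nat \<Rightarrow> nat \<times> nat) \<Rightarrow> (nat \<Rightarrow> nat \<times> nat) \<Rightarrow> nat \<Rightarrow> nat \<times> nat"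
  where "padd p q = (\<lambda>i. (fst (p i) + fst (q i), snd (p i) + snd (q i)))"

lemma Kval_padd: "Kval (padd p q i) = Kval (p i) * Kval (q i)" "Kival (padd p q i) = Kival (p i) * Kival (q i)"
  by (simp_all add: padd_def Kval_def Kival_def power_add)

text \<open>
  The comultiplication is multiplication of points. Both sides are algebra homomorphisms to a
  torsion-free ring that agree on \<open>K\<close> and \<open>K'\<close>.
\<close>

lemma ev2_d:
  assumes "x \<in> carrier V"
  shows "ev2 p q (d x) = ev (padd p q) x"
  using assms
proof (induction x rule: torsion_induct)
  case (torsion a x)
  then show ?case by (simp add: d_simps ev2_simps ev_simps)
qed (simp_all add: d_simps ev2_simps ev_simps d_K d_K' ev2_tens Kval_padd)

text \<open>
  Both sides times \<open>qdiff n\<close> are \<open>K ^ (2 * n) \<otimes> K ^ (2 * n) - 1 \<otimes> 1\<close>.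
\<close>

lemma d_Hel:
  assumes n: "n \<ge> 1" and i: "i \<in> {1..\<theta>}"
  shows "d (Hel n i) = tens laurent V V (Hel n i) \<one>\<^bsub>V\<^esub>
    \<oplus>\<^bsub>VV\<^esub> tens laurent V V (K i [^]\<^bsub>V\<^esub> (2 * n)) (Hel n i)"
proof (rule ev2_inj)
  have H: "Hel n i \<in> carrier V" "K i [^]\<^bsub>V\<^esub> (2 * n) \<in> carrier V" using assms by simp_all
  then show "d (Hel n i) \<in> carrier VV" "tens laurent V V (Hel n i) \<one>\<^bsub>V\<^esub>
    \<oplus>\<^bsub>VV\<^esub> tens laurent V V (K i [^]\<^bsub>V\<^esub> (2 * n)) (Hel n i) \<in> carrier VV"
    by (simp_all add: d_simps)
  fix p q
  have "ev2 p q (d (Hel n i)) * qdiff n = qv ^ (2 * snd (p i) * n) * qv ^ (2 * snd (q i) * n) - 1"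
    unfolding ev2_d[OF H(1)] ev_Hel[OF assms] by (simp add: padd_def power_add[symmetric] algebra_simps)
  moreover have "ev2 p q (tens laurent V V (Hel n i) \<one>\<^bsub>V\<^esub>
    \<oplus>\<^bsub>VV\<^esub> tens laurent V V (K i [^]\<^bsub>V\<^esub> (2 * n)) (Hel n i)) * qdiff n
    = ev p (Hel n i) * qdiff n + qv ^ (2 * snd (p i) * n) * (ev q (Hel n i) * qdiff n)"
    using H i by (simp add: ev2_simps ev2_tens ev_simps Kval_even distrib_right)
  moreover have "qdiff n \<noteq> 0" using n by simp
  ultimately have "ev2 p q (d (Hel n i)) * qdiff n = ev2 p q (tens laurent V V (Hel n i) \<one>\<^bsub>V\<^esub>
    \<oplus>\<^bsub>VV\<^esub> tens laurent V V (K i [^]\<^bsub>V\<^esub> (2 * n)) (Hel n i)) * qdiff n"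
    unfolding ev_Hel[OF assms] by (simp add: right_diff_distrib)
  then show "ev2 p q (d (Hel n i)) = ev2 p q (tens laurent V V (Hel n i) \<one>\<^bsub>V\<^esub>
    \<oplus>\<^bsub>VV\<^esub> tens laurent V V (K i [^]\<^bsub>V\<^esub> (2 * n)) (Hel n i))"
    unfolding mult_cancel_right using n by simp
qed

text \<open>
  The counit axiom for the group-like \<open>K\<close> reads \<open>e K \<odot> K = K\<close>.
\<close>

lemma e_K:
  assumes i: "i \<in> {1..\<theta>}"
  shows "e (K i) = 1" "e (K' i) = 1"
proof -
  have b: "(\<lambda>(y, z). e y \<odot>\<^bsub>V\<^esub> z) \<in> bilin laurent V V V"
    by (rule bilinI; rule lin_mapI)
       (simp_all add: e_simps V.smult_l_distr[simplified] V.smult_r_distr V.smult_assoc1[simplified, symmetric] mult.commute)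
  have "coset_lift laurent V (\<lambda>(y, z). e y \<odot>\<^bsub>V\<^esub> z) (d (K i)) = K i"
    using hopf_algebra.counit_left[OF hopf, of "K i"] i by simp
  then have "e (K i) \<odot>\<^bsub>V\<^esub> K i = K i"
    using i by (simp add: d_K VT.lift_tens[OF V.is_module b])
  then have "ev p (e (K i) \<odot>\<^bsub>V\<^esub> K i) = ev p (K i)" for p by simp
  then have "e (K i) * Kval (p i) = Kval (p i)" for p using i by (simp add: ev_simps e_simps)
  from this[of "\<lambda>_. (0, 0)"] show 1: "e (K i) = 1" by (simp add: Kval_def)
  have "e (K i \<otimes>\<^bsub>V\<^esub> K' i) = 1" using i by (simp add: rel_inv e_simps)
  then show "e (K' i) = 1" using i 1 by (simp add: e_simps)
qed

lemma e_Hel: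
  assumes "n \<ge> 1" "i \<in> {1..\<theta>}"
  shows "e (Hel n i) = 0"
proof -
  have p: "e (K i [^]\<^bsub>V\<^esub> (m::nat)) = 1" for m
    using assms(2) by (induction m) (simp_all add: e_simps e_K)
  have "e (qdiff n \<odot>\<^bsub>V\<^esub> Hel n i \<oplus>\<^bsub>V\<^esub> \<one>\<^bsub>V\<^esub>) = 1"
    unfolding Hel_rel[OF assms] by (rule p)
  then have "qdiff n * e (Hel n i) = 0" using assms by (simp add: e_simps)
  then show ?thesis using assms by simp
qed

text \<open>
  Monomials in the \<open>K\<close> and \<open>K'\<close>, paired with their inverses; the antipode axiom determines \<open>S\<close> on them.
\<close>

inductive grouplike :: "(V0_gen list \<Rightarrow> qfun) set \<Rightarrow> (V0_gen list \<Rightarrow> qfun) set \<Rightarrow> bool" where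
  one: "grouplike \<one>\<^bsub>V\<^esub> \<one>\<^bsub>V\<^esub>"
| K: "i \<in> {1..\<theta>} \<Longrightarrow> grouplike g g' \<Longrightarrow> grouplike (K i \<otimes>\<^bsub>V\<^esub> g) (K' i \<otimes>\<^bsub>V\<^esub> g')"
| K': "i \<in> {1..\<theta>} \<Longrightarrow> grouplike g g' \<Longrightarrow> grouplike (K' i \<otimes>\<^bsub>V\<^esub> g) (K i \<otimes>\<^bsub>V\<^esub> g')"

lemma mult_swap: "a \<in> carrier V \<Longrightarrow> b \<in> carrier V \<Longrightarrow> a' \<in> carrier V \<Longrightarrow> b' \<in> carrier V \<Longrightarrow>
    (a \<otimes>\<^bsub>V\<^esub> b) \<otimes>\<^bsub>V\<^esub> (a' \<otimes>\<^bsub>V\<^esub> b') = (a \<otimes>\<^bsub>V\<^esub> a') \<otimes>\<^bsub>V\<^esub> (b \<otimes>\<^bsub>V\<^esub> b')"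
  by (simp add: V.M.m_ac)

lemma grouplike_props:
  "grouplike g g' \<Longrightarrow> g \<in> carrier V \<and> g' \<in> carrier V \<and> g \<otimes>\<^bsub>V\<^esub> g' = \<one>\<^bsub>V\<^esub> \<and> d g = tens laurent V V g g \<and> e g = 1"
proof (induction rule: grouplike.induct)
  case one
  then show ?case by (simp add: d_simps e_simps VT.tens_one)
next
  case (K i g g')
  then have "(K i \<otimes>\<^bsub>V\<^esub> g) \<otimes>\<^bsub>V\<^esub> (K' i \<otimes>\<^bsub>V\<^esub> g') = (K i \<otimes>\<^bsub>V\<^esub> K' i) \<otimes>\<^bsub>V\<^esub> (g \<otimes>\<^bsub>V\<^esub> g')"
    by (intro mult_swap) simp_all
  then show ?case using K by (simp add: d_simps e_simps d_K e_K VT.tens_mult rel_inv)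
next
  case (K' i g g')
  then have "(K' i \<otimes>\<^bsub>V\<^esub> g) \<otimes>\<^bsub>V\<^esub> (K i \<otimes>\<^bsub>V\<^esub> g') = (K' i \<otimes>\<^bsub>V\<^esub> K i) \<otimes>\<^bsub>V\<^esub> (g \<otimes>\<^bsub>V\<^esub> g')"
    by (intro mult_swap) simp_all
  also have "K' i \<otimes>\<^bsub>V\<^esub> K i = K i \<otimes>\<^bsub>V\<^esub> K' i" using K' by (simp add: V.M.m_comm)
  finally have "(K' i \<otimes>\<^bsub>V\<^esub> g) \<otimes>\<^bsub>V\<^esub> (K i \<otimes>\<^bsub>V\<^esub> g') = (K i \<otimes>\<^bsub>V\<^esub> K' i) \<otimes>\<^bsub>V\<^esub> (g \<otimes>\<^bsub>V\<^esub> g')" .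
  then show ?case using K' by (simp add: d_simps e_simps d_K' e_K VT.tens_mult rel_inv)
qed

lemma S_grouplike:
  assumes "grouplike g g'"
  shows "S g = g'"
proof -
  note g = grouplike_props[OF assms]
  have b: "(\<lambda>(y, z). S y \<otimes>\<^bsub>V\<^esub> z) \<in> bilin laurent V V V"
    by (rule bilinI; rule lin_mapI)
       (simp_all add: S_simps V.M.l_distr V.M.r_distr V.smult_mult_left V.smult_mult_right)
  have "coset_lift laurent V (\<lambda>(y, z). S y \<otimes>\<^bsub>V\<^esub> z) (d g) = e g \<odot>\<^bsub>V\<^esub> \<one>\<^bsub>V\<^esub>"
    using hopf_algebra.antipode_left[OF hopf, of g] g by simp
  then have 1: "S g \<otimes>\<^bsub>V\<^esub> g = \<one>\<^bsub>V\<^esub>"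
    using g V.smult_one[OF V.M.one_closed] by (simp add: VT.lift_tens[OF V.is_module b])
  have "S g = S g \<otimes>\<^bsub>V\<^esub> (g \<otimes>\<^bsub>V\<^esub> g')" using g by (simp add: S_simps)
  also have "\<dots> = (S g \<otimes>\<^bsub>V\<^esub> g) \<otimes>\<^bsub>V\<^esub> g'" using g S_simps(1)[of g] by (simp only: V.M.m_assoc)
  finally show ?thesis using g by (simp add: 1)
qed

lemma S_grouplike_mult:
  assumes "x \<in> carrier V"
  shows "grouplike g g' \<Longrightarrow> S (g \<otimes>\<^bsub>V\<^esub> x) = g' \<otimes>\<^bsub>V\<^esub> S x"
proof -
  have "\<forall>g g'. grouplike g g' \<longrightarrow> S (g \<otimes>\<^bsub>V\<^esub> x) = g' \<otimes>\<^bsub>V\<^esub> S x"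
    using assms
  proof (induction x rule: torsion_induct)
    case one
    then show ?case using S_grouplike S_grouplike[OF grouplike.one] grouplike_props by auto
  next
    case (add x y)
    show ?case
    proof (intro allI impI)
      fix g g' assume gg: "grouplike g g'"
      then have "S (g \<otimes>\<^bsub>V\<^esub> x) = g' \<otimes>\<^bsub>V\<^esub> S x" "S (g \<otimes>\<^bsub>V\<^esub> y) = g' \<otimes>\<^bsub>V\<^esub> S y" using add by blast+
      then show "S (g \<otimes>\<^bsub>V\<^esub> (x \<oplus>\<^bsub>V\<^esub> y)) = g' \<otimes>\<^bsub>V\<^esub> S (x \<oplus>\<^bsub>V\<^esub> y)"
        using grouplike_props[OF gg] add(1,2) by (simp add: V.M.r_distr S_simps)
    qed
  next
    case (smult a x)
    show ?case
    proof (intro allI impI)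
      fix g g' assume gg: "grouplike g g'"
      then have "S (g \<otimes>\<^bsub>V\<^esub> x) = g' \<otimes>\<^bsub>V\<^esub> S x" using smult by blast
      then show "S (g \<otimes>\<^bsub>V\<^esub> (a \<odot>\<^bsub>V\<^esub> x)) = g' \<otimes>\<^bsub>V\<^esub> S (a \<odot>\<^bsub>V\<^esub> x)"
        using grouplike_props[OF gg] smult(1,2) by (simp add: V.smult_mult_right S_simps)
    qed
  next
    case (torsion a x)
    show ?case
    proof (intro allI impI)
      fix g g' assume gg: "grouplike g g'"
      note g = grouplike_props[OF gg]
      have "S (g \<otimes>\<^bsub>V\<^esub> (a \<odot>\<^bsub>V\<^esub> x)) = g' \<otimes>\<^bsub>V\<^esub> S (a \<odot>\<^bsub>V\<^esub> x)" using torsion gg by blast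
      then have "a \<odot>\<^bsub>V\<^esub> S (g \<otimes>\<^bsub>V\<^esub> x) = a \<odot>\<^bsub>V\<^esub> (g' \<otimes>\<^bsub>V\<^esub> S x)"
        using g torsion(1,3) by (simp add: V.smult_mult_right S_simps)
      then show "S (g \<otimes>\<^bsub>V\<^esub> x) = g' \<otimes>\<^bsub>V\<^esub> S x"
        by (rule smult_eq_0[OF torsion(1,2)[simplified], rotated 2]) (use g torsion in \<open>simp_all add: S_simps\<close>)
    qed
  next
    case (K i x)
    have "S (K i \<otimes>\<^bsub>V\<^esub> x) = K' i \<otimes>\<^bsub>V\<^esub> S x"
      using K grouplike.K[OF K(1) grouplike.one] by simp
    moreover have "S (g \<otimes>\<^bsub>V\<^esub> (K i \<otimes>\<^bsub>V\<^esub> x)) = g' \<otimes>\<^bsub>V\<^esub> (K' i \<otimes>\<^bsub>V\<^esub> S x)" if gg: "grouplike g g'" for g g'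
    proof -
      note g = grouplike_props[OF gg]
      have "S ((K i \<otimes>\<^bsub>V\<^esub> g) \<otimes>\<^bsub>V\<^esub> x) = (K' i \<otimes>\<^bsub>V\<^esub> g') \<otimes>\<^bsub>V\<^esub> S x" using K grouplike.K[OF K(1) gg] by blast
      then show ?thesis using g K S_simps(1)[of x] by (simp add: V.M.m_ac)
    qed
    ultimately show ?case by simp
  next
    case (K' i x)
    have "S (K' i \<otimes>\<^bsub>V\<^esub> x) = K i \<otimes>\<^bsub>V\<^esub> S x"
      using K' grouplike.K'[OF K'(1) grouplike.one] by simp
    moreover have "S (g \<otimes>\<^bsub>V\<^esub> (K' i \<otimes>\<^bsub>V\<^esub> x)) = g' \<otimes>\<^bsub>V\<^esub> (K i \<otimes>\<^bsub>V\<^esub> S x)" if gg: "grouplike g g'" for g g'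
    proof -
      note g = grouplike_props[OF gg]
      have "S ((K' i \<otimes>\<^bsub>V\<^esub> g) \<otimes>\<^bsub>V\<^esub> x) = (K i \<otimes>\<^bsub>V\<^esub> g') \<otimes>\<^bsub>V\<^esub> S x" using K' grouplike.K'[OF K'(1) gg] by blast
      then show ?thesis using g K' S_simps(1)[of x] by (simp add: V.M.m_ac)
    qed
    ultimately show ?case by simp
  qed
  then show "grouplike g g' \<Longrightarrow> S (g \<otimes>\<^bsub>V\<^esub> x) = g' \<otimes>\<^bsub>V\<^esub> S x" by blast
qed

lemma S_K_mult:
  assumes "i \<in> {1..\<theta>}" "x \<in> carrier V"
  shows "S (K i \<otimes>\<^bsub>V\<^esub> x) = K' i \<otimes>\<^bsub>V\<^esub> S x" "S (K' i \<otimes>\<^bsub>V\<^esub> x) = K i \<otimes>\<^bsub>V\<^esub> S x"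
  using S_grouplike_mult[OF assms(2) grouplike.K[OF assms(1) grouplike.one]]
    S_grouplike_mult[OF assms(2) grouplike.K'[OF assms(1) grouplike.one]] assms by simp_all

lemma S_one: "S \<one>\<^bsub>V\<^esub> = \<one>\<^bsub>V\<^esub>"
  by (rule S_grouplike[OF grouplike.one])

lemma S_K: "i \<in> {1..\<theta>} \<Longrightarrow> S (K i) = K' i" "i \<in> {1..\<theta>} \<Longrightarrow> S (K' i) = K i"
  using S_K_mult[of i "\<one>\<^bsub>V\<^esub>"] by (simp_all add: S_one)

text \<open>
  As \<open>S\<close> is only known to be linear, multiplicativity is first shown for products with a group-like
  factor, and then carried to all of \<open>V\<^sup>0\<close> by torsion induction.
\<close>

lemma S_hom: "S \<in> alg_hom laurent V V"
proof (rule lin_map_alg_homI[OF S_lin _ S_one])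
  fix x y assume "x \<in> carrier V" and y: "y \<in> carrier V"
  then show "S (x \<otimes>\<^bsub>V\<^esub> y) = S x \<otimes>\<^bsub>V\<^esub> S y"
  proof (induction x rule: torsion_induct)
    case (torsion a x)
    have "a \<odot>\<^bsub>V\<^esub> S (x \<otimes>\<^bsub>V\<^esub> y) = a \<odot>\<^bsub>V\<^esub> (S x \<otimes>\<^bsub>V\<^esub> S y)"
      using torsion by (simp add: V.smult_mult_left S_simps)
    then show ?case
      by (rule smult_eq_0[OF torsion(1,2)[simplified], rotated 2]) (use torsion in \<open>simp_all add: S_simps\<close>)
  next
    case (K i x)
    then show ?case by (simp add: V.M.m_assoc S_K_mult S_simps)
  next
    case (K' i x)
    then show ?case by (simp add: V.M.m_assoc S_K_mult S_simps)
  qed (simp_all add: S_simps S_one V.M.l_distr V.smult_mult_left)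
qed

text \<open>
  Apply \<open>S\<close> to \<open>Hel_rel\<close> and evaluate; \<open>S\<close> inverts \<open>K ^ (2 * n)\<close>.
\<close>

lemma S_Hel:
  assumes n: "n \<ge> 1" and i: "i \<in> {1..\<theta>}"
  shows "K i [^]\<^bsub>V\<^esub> (2 * n) \<otimes>\<^bsub>V\<^esub> S (Hel n i) \<oplus>\<^bsub>V\<^esub> Hel n i = \<zero>\<^bsub>V\<^esub>"
proof (rule ev_inj)
  have H: "Hel n i \<in> carrier V" using assms by simp
  have "S (qdiff n \<odot>\<^bsub>V\<^esub> Hel n i \<oplus>\<^bsub>V\<^esub> \<one>\<^bsub>V\<^esub>) = K' i [^]\<^bsub>V\<^esub> (2 * n)"
    unfolding Hel_rel[OF assms]
    using i by (simp add: alg_hom_pow[OF S_hom V.M.monoid_axioms V.M.monoid_axioms] S_K)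
  then have S: "qdiff n \<odot>\<^bsub>V\<^esub> S (Hel n i) \<oplus>\<^bsub>V\<^esub> \<one>\<^bsub>V\<^esub> = K' i [^]\<^bsub>V\<^esub> (2 * n)"
    using H by (simp add: S_simps S_one)
  fix p :: "nat \<Rightarrow> nat \<times> nat"
  define x where "x = qv ^ (2 * snd (p i) * n)"
  have "ev p (qdiff n \<odot>\<^bsub>V\<^esub> S (Hel n i) \<oplus>\<^bsub>V\<^esub> \<one>\<^bsub>V\<^esub>) = inverse x"
    unfolding S using i by (simp add: ev_simps Kival_even x_def power_inverse)
  then have s: "ev p (S (Hel n i)) * qdiff n = inverse x - 1"
    using H by (simp add: ev_simps S_simps mult.commute)
  have h: "ev p (Hel n i) * qdiff n = x - 1" using ev_Hel[OF assms] by (simp add: x_def)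
  have "(x * ev p (S (Hel n i)) + ev p (Hel n i)) * qdiff n = x * (inverse x - 1) + (x - 1)"
    by (simp only: distrib_right mult.assoc s h)
  also have "\<dots> = 0" by (simp add: x_def right_diff_distrib)
  finally have "x * ev p (S (Hel n i)) + ev p (Hel n i) = 0" using n by simp
  moreover have z: "ev p \<zero>\<^bsub>V\<^esub> = 0"
    using lin_map_zero[OF alg_hom_lin_map[OF ev_hom] V.is_module comm_alg.axioms(1)[OF Lr.regular_alg_comm_alg, THEN assoc_algebra.is_module]] by simp
  ultimately show "ev p (K i [^]\<^bsub>V\<^esub> (2 * n) \<otimes>\<^bsub>V\<^esub> S (Hel n i) \<oplus>\<^bsub>V\<^esub> Hel n i) = ev p \<zero>\<^bsub>V\<^esub>"
    using H i by (simp add: ev_simps S_simps Kval_even x_def)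
qed (use assms in \<open>simp_all add: S_simps\<close>)

end

section \<open>Cyclotomic polynomials\<close>

text \<open>
  Integral polynomials are compared with complex ones, where roots are available.
\<close>

abbreviation ipoly :: "int poly \<Rightarrow> complex poly" where "ipoly \<equiv> map_poly of_int"

lemma ipoly_simps [simp]:
  "ipoly (p + q) = ipoly p + ipoly q" "ipoly (p - q) = ipoly p - ipoly q"
  "ipoly (p * q) = ipoly p * ipoly q" "ipoly (smult a p) = smult (of_int a) (ipoly p)"
  "ipoly (monom a n) = monom (of_int a) n" "ipoly 1 = 1" "ipoly 0 = 0" "degree (ipoly p) = degree p"
  "coeff (ipoly p) n = of_int (coeff p n)" "ipoly p = ipoly q \<longleftrightarrow> p = q"
proof -
  show c: "coeff (ipoly p) n = of_int (coeff p n)" for p n by (simp add: coeff_map_poly)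
  show "ipoly (p + q) = ipoly p + ipoly q" "ipoly (p - q) = ipoly p - ipoly q"
    "ipoly (smult a p) = smult (of_int a) (ipoly p)" "ipoly (monom a n) = monom (of_int a) n"
    "ipoly (p * q) = ipoly p * ipoly q"
    by (rule poly_eqI; simp add: c coeff_mult)+
  show "ipoly 1 = 1" "ipoly 0 = 0" by (simp_all add: map_poly_1)
  show "degree (ipoly p) = degree p" by (rule degree_map_poly) simp
  show "ipoly p = ipoly q \<longleftrightarrow> p = q"
    by (auto simp: poly_eq_iff c)
qed

lemma ipoly_prod: "ipoly (prod P A) = (\<Prod>a\<in>A. ipoly (P a))"
  by (induction A rule: infinite_finite_induct) simp_all

definition cycc :: "nat \<Rightarrow> complex poly"
  where "cycc n = (\<Prod>k\<in>{k\<in>{1..n}. coprime k n}. [:- cis (2 * pi * real k / real n), 1:])"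

lemma lead_coeff_cycc: "lead_coeff (cycc n) = 1"
  by (simp add: cycc_def lead_coeff_prod)

lemma unity_prod:
  assumes n: "n \<ge> 1"
  shows "(\<Prod>k\<in>{1..n}. [:- cis (2 * pi * real k / real n), 1:]) = monom 1 n - 1"
proof (rule ccontr)
  let ?P = "\<Prod>k\<in>{1..n}. [:- cis (2 * pi * real k / real n), 1:]" and ?Q = "monom 1 n - (1 :: complex poly)"
  assume "?P \<noteq> ?Q"
  then have nz: "?P - ?Q \<noteq> 0" by simp
  have deg: "degree ?P = n" by (subst degree_prod_eq_sum_degree) simp_all
  have lc: "lead_coeff ?P = 1" by (simp add: lead_coeff_prod)
  have "coeff ?P n = 1" using lc deg by simp
  moreover have "coeff ?Q n = 1" using n by simp
  moreover have "degree ?Q \<le> n" by (intro degree_diff_le degree_monom_le) simp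
  moreover have "coeff (?P - ?Q) k = 0" if "k > n" for k
    using that deg \<open>degree ?Q \<le> n\<close> by (simp add: coeff_eq_0 del: coeff_diff) (simp add: coeff_eq_0)
  ultimately have "coeff (?P - ?Q) k = 0" if "k \<ge> n" for k
    using that by (cases "k = n") auto
  then have d: "degree (?P - ?Q) < n"
    using nz by (metis leading_coeff_0_iff not_le)
  have sub: "{z. z ^ n = 1} \<subseteq> {z. poly (?P - ?Q) z = 0}"
  proof
    fix z :: complex assume "z \<in> {z. z ^ n = 1}"
    then have z: "z ^ n = 1" by simp
    obtain k where k: "k < n" "z = cis (2 * pi * real k / real n)"
      using bij_betw_roots_unity[of n] n z by (auto simp: bij_betw_def image_iff set_eq_iff)
    have "\<exists>k\<in>{1..n}. z = cis (2 * pi * real k / real n)"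
    proof (cases "k = 0")
      case True
      then show ?thesis using k n by (intro bexI[of _ n]) auto
    next
      case False
      then show ?thesis using k by (intro bexI[of _ k]) auto
    qed
    then have "poly ?P z = 0" by (auto simp: poly_prod prod_zero_iff)
    then show "z \<in> {z. poly (?P - ?Q) z = 0}" using z by (simp add: poly_monom)
  qed
  have "n = card {z::complex. z ^ n = 1}" using n by (simp add: card_roots_unity_eq)
  also have "\<dots> \<le> card {z. poly (?P - ?Q) z = 0}"
    by (rule card_mono[OF poly_roots_finite[OF nz] sub])
  also have "\<dots> \<le> degree (?P - ?Q)" by (rule card_poly_roots_bound[OF nz])
  finally show False using d by simp
qed

text \<open>
  The \<open>n\<close>-th roots of unity grouped by their orders, which are the divisors of \<open>n\<close>.
\<close>

lemma prod_cycc: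
  assumes n: "n \<ge> 1"
  shows "(\<Prod>d\<in>{d. d dvd n}. cycc d) = monom 1 n - 1"
proof -
  have fin: "finite {d. d dvd n}" using n by simp
  define g where "g k = n div gcd k n" for k
  let ?h = "\<lambda>k. [:- cis (2 * pi * real k / real n), 1:]"
  have "(\<Prod>k\<in>{1..n}. ?h k) = (\<Prod>d\<in>{d. d dvd n}. \<Prod>k\<in>{k\<in>{1..n}. g k = d}. ?h k)"
  proof (rule prod.group[symmetric])
    have "g k dvd n" for k unfolding g_def by (metis gcd_dvd2 dvd_mult_div_cancel dvd_triv_right)
    then show "g ` {1..n} \<subseteq> {d. d dvd n}" by auto
  qed (use fin in auto)
  also have "\<dots> = (\<Prod>d\<in>{d. d dvd n}. cycc d)"
  proof (rule prod.cong)
    fix d assume "d \<in> {d. d dvd n}"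
    then obtain e where e: "n = d * e" by auto
    then have de: "d \<ge> 1" "e \<ge> 1" using n by auto
    show "(\<Prod>k\<in>{k\<in>{1..n}. g k = d}. ?h k) = cycc d"
      unfolding cycc_def
    proof (rule prod.reindex_bij_witness[of _ "\<lambda>j. j * e" "\<lambda>k. k div e"])
      fix k assume "k \<in> {k\<in>{1..n}. g k = d}"
      then have k: "1 \<le> k" "k \<le> n" "n div gcd k n = d" by (auto simp: g_def)
      have "n = gcd k n * d" using k(3) by (metis dvd_mult_div_cancel gcd_dvd2)
      then have ge: "gcd k n = e" using e de by (metis mult.commute mult_cancel1 not_one_le_zero)
      then obtain j where j: "k = j * e" by (metis dvd_def gcd_dvd1 mult.commute)
      have "gcd (j * e) (d * e) = e" using ge e j by simp
      then have "gcd j d = 1" using de by (simp add: gcd_mult_distrib_nat[symmetric] mult.commute[of _ e])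
      then show "k div e \<in> {k \<in> {1..d}. coprime k d}" "k div e * e = k"
        "[:- cis (2 * pi * real (k div e) / real d), 1:] = ?h k"
        using j k e de by (auto simp: coprime_iff_gcd_eq_1 mult.assoc)
    next
      fix j assume "j \<in> {k \<in> {1..d}. coprime k d}"
      then have j: "1 \<le> j" "j \<le> d" "gcd j d = 1" by (auto simp: coprime_iff_gcd_eq_1)
      have "gcd (j * e) n = e" using j e by (simp add: gcd_mult_distrib_nat[symmetric] mult.commute[of _ e])
      then have "g (j * e) = d" using e de by (simp add: g_def)
      then show "j * e div e = j" "j * e \<in> {k\<in>{1..n}. g k = d}"
        using j e de by auto
    qed
  qed simp
  finally show ?thesis using unity_prod[OF n] by simp
qed

text \<open>
  By induction the product of the \<open>cycc d\<close> over the proper divisors \<open>d\<close> is integral and monic, and the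
  quotient in a division by a monic integral polynomial is integral.
\<close>

lemma cycc_integral: "n \<ge> 1 \<Longrightarrow> \<exists>p. ipoly p = cycc n"
proof (induction n rule: less_induct)
  case (less n)
  have "\<forall>d\<in>{d. d dvd n} - {n}. \<exists>p. ipoly p = cycc d"
  proof
    fix d assume "d \<in> {d. d dvd n} - {n}"
    then have "d < n" "d \<ge> 1" using less.prems by (auto dest: dvd_imp_le intro: Suc_leI dvd_pos_nat)
    then show "\<exists>p. ipoly p = cycc d" by (rule less.IH)
  qed
  then obtain P where P: "\<And>d. d \<in> {d. d dvd n} - {n} \<Longrightarrow> ipoly (P d) = cycc d" by metis
  define Q where "Q = (\<Prod>d\<in>{d. d dvd n} - {n}. P d)"
  have fin: "finite {d. d dvd n}" using less.prems by simp
  have Q: "ipoly Q = (\<Prod>d\<in>{d. d dvd n} - {n}. cycc d)"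
    unfolding Q_def ipoly_prod by (rule prod.cong) (use P in auto)
  have XQ: "monom 1 n - 1 = cycc n * ipoly Q"
    unfolding Q prod_cycc[OF less.prems, symmetric] using fin by (subst prod.remove[of _ n]) auto
  have "lead_coeff (ipoly Q) = 1" unfolding Q by (simp add: lead_coeff_prod lead_coeff_cycc)
  then have lc: "lead_coeff Q = 1" by simp
  then have Q0: "Q \<noteq> 0" by auto
  obtain q r where qr: "pseudo_divmod (monom 1 n - 1) Q = (q, r)" by force
  have 1: "monom 1 n - 1 = Q * q + r" and 2: "r = 0 \<or> degree r < degree Q"
    using pseudo_divmod[OF Q0 qr] lc by simp_all
  have "ipoly (monom 1 n - 1) = ipoly Q * ipoly q + ipoly r" unfolding 1 by simp
  then have "ipoly Q * (cycc n - ipoly q) = ipoly r" using XQ by (simp add: algebra_simps)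
  moreover have "cycc n - ipoly q = 0"
  proof (rule ccontr)
    assume nz: "cycc n - ipoly q \<noteq> 0"
    have "ipoly Q \<noteq> 0" using Q0 ipoly_simps(10)[of Q 0] by simp
    then have "degree (ipoly r) \<ge> degree (ipoly Q)" "ipoly r \<noteq> 0"
      unfolding calculation[symmetric] using nz by (simp_all add: degree_mult_eq)
    then show False using 2 by auto
  qed
  ultimately show ?case by (intro exI[of _ q]) simp
qed

lemma cyclotomic: "n \<ge> 1 \<Longrightarrow> ipoly (cyclotomic n) = cycc n"
proof -
  assume "n \<ge> 1"
  then obtain p where p: "ipoly p = cycc n" using cycc_integral by blast
  have "cyclotomic n = p"
    unfolding cyclotomic_def cycc_def[symmetric] p[symmetric] ipoly_simps(10) by (rule the_equality) auto
  then show ?thesis using p by simp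
qed

lemma cyclotomic_props:
  assumes "n \<ge> 1"
  shows "lead_coeff (cyclotomic n) = 1" "poly (ipoly (cyclotomic n)) (cis (2 * pi / real n)) = 0"
    "poly (cyclotomic n) 0 \<noteq> 0"
proof -
  have "of_int (lead_coeff (cyclotomic n)) = lead_coeff (ipoly (cyclotomic n))" by simp
  also have "\<dots> = 1" unfolding cyclotomic[OF assms] by (rule lead_coeff_cycc)
  finally show "lead_coeff (cyclotomic n) = 1" by (simp only: of_int_eq_1_iff)
  have "1 \<in> {k\<in>{1..n}. coprime k n}" using assms by simp
  then show "poly (ipoly (cyclotomic n)) (cis (2 * pi / real n)) = 0"
    unfolding cyclotomic[OF assms] cycc_def poly_prod
    by (intro prod_zero bexI[of _ 1]) simp_all
  have "of_int (poly (cyclotomic n) 0) = poly (ipoly (cyclotomic n)) 0"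
    by (simp add: poly_0_coeff_0)
  also have "\<dots> \<noteq> 0" unfolding cyclotomic[OF assms] cycc_def poly_prod by (simp add: prod_zero_iff)
  finally show "poly (cyclotomic n) 0 \<noteq> 0" by simp
qed

section \<open>Evaluating Laurent polynomials at a complex number\<close>

text \<open>
  For \<open>z \<noteq> 0\<close> the value does not depend on the representation of \<open>a\<close> as a fraction.
\<close>

definition evL :: "complex \<Rightarrow> qfun \<Rightarrow> complex"
  where "evL z a = (THE w. \<exists>p n. a = to_fract p / qv ^ n \<and> w = poly (ipoly p) z / z ^ n)"

lemma evL_eq:
  assumes z: "z \<noteq> 0"
  shows "evL z (to_fract p / qv ^ n) = poly (ipoly p) z / z ^ n"
  unfolding evL_def
proof (rule the_equality)
  fix w assume "\<exists>q m. to_fract p / qv ^ n = to_fract q / qv ^ m \<and> w = poly (ipoly q) z / z ^ m"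
  then obtain q m where eq: "to_fract p / qv ^ n = to_fract q / qv ^ m" and w: "w = poly (ipoly q) z / z ^ m" by blast
  have "to_fract p * qv ^ m = to_fract q * qv ^ n" using eq by (simp add: field_simps)
  then have "p * monom 1 m = q * monom 1 n"
    by (simp add: qv_power flip: to_fract_mult)
  then have "ipoly (p * monom 1 m) = ipoly (q * monom 1 n)" by simp
  then have "poly (ipoly p * monom 1 m) z = poly (ipoly q * monom 1 n) z" by simp
  then show "w = poly (ipoly p) z / z ^ n" using z by (simp add: w poly_monom frac_eq_eq mult.commute)
qed blast

lemma evL_simps:
  assumes z: "z \<noteq> 0"
  shows "evL z 1 = 1" "evL z 0 = 0" "evL z qv = z"
    and "a \<in> L \<Longrightarrow> b \<in> L \<Longrightarrow> evL z (a + b) = evL z a + evL z b"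
    and "a \<in> L \<Longrightarrow> b \<in> L \<Longrightarrow> evL z (a * b) = evL z a * evL z b"
proof -
  note E = evL_eq[OF z]
  show "evL z 1 = 1" "evL z 0 = 0" "evL z qv = z"
    using E[of 1 0] E[of 0 0] E[of "monom 1 1" 0] qv_power[of 1] by (simp_all add: poly_monom)
  assume "a \<in> L" "b \<in> L"
  then obtain p n q m where ab: "a = to_fract p / qv ^ n" "b = to_fract q / qv ^ m"
    unfolding L_iff by blast
  have s: "a + b = to_fract (p * monom 1 m + q * monom 1 n) / qv ^ (n + m)"
    by (simp add: ab field_simps power_add flip: qv_power)
  have "evL z (a + b) = poly (ipoly (p * monom 1 m + q * monom 1 n)) z / z ^ (n + m)"
    unfolding s by (rule E)
  then show "evL z (a + b) = evL z a + evL z b"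
    using z by (simp add: ab E poly_monom field_simps power_add)
  have "a * b = to_fract (p * q) / qv ^ (n + m)" by (simp add: ab power_add)
  then have "evL z (a * b) = poly (ipoly (p * q)) z / z ^ (n + m)" by (simp only: E)
  then show "evL z (a * b) = evL z a * evL z b" by (simp add: ab E power_add)
qed

section \<open>The field \<open>B\<close> inside the complex numbers\<close>

text \<open>
  The field \<open>B\<close> is abstract; it is embedded in the complex numbers by \<open>jC\<close>, with \<open>f qv\<close> mapped to the
  primitive root of unity \<open>\<zeta>\<close>. Vanishing in \<open>B\<close> thereby becomes vanishing of complex numbers.
\<close>

locale root_of_unity =
  fixes l :: nat and B :: "('b, 'l) ring_scheme" (structure) and \<iota> :: "qfun set \<Rightarrow> 'b"
  assumes l: "l \<ge> 1"
    and B: "is_fraction_field (laurent Quot cyc_ideal l) B \<iota>"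
    and xi: "spec l \<iota> qv [^]\<^bsub>B\<^esub> (2 :: nat) \<noteq> \<one>\<^bsub>B\<^esub>"
begin

abbreviation n where "n \<equiv> lprime l"
abbreviation \<Phi> where "\<Phi> \<equiv> cyclotomic (lprime l)"
definition \<zeta> :: complex where "\<zeta> = cis (2 * pi / real n)"
abbreviation f where "f \<equiv> spec l \<iota>"

lemma n: "n \<ge> 1" using l by (simp add: lprime_def)

lemma \<zeta>_nz [simp]: "\<zeta> \<noteq> 0" by (simp add: \<zeta>_def)

lemmas ev_\<zeta> = evL_simps[OF \<zeta>_nz]

sublocale Bf: field B
  using B by (simp add: is_fraction_field_def)

lemma I_ideal: "ideal (cyc_ideal l) laurent"
  unfolding cyc_ideal_def by (rule Lr.genideal_ideal) simp

lemma I_iff: "a \<in> cyc_ideal l \<longleftrightarrow> (\<exists>c\<in>L. a = c * to_fract \<Phi>)"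
  unfolding cyc_ideal_def
  using Lr.cgenideal_eq_genideal[of "to_fract \<Phi>"] by (auto simp: cgenideal_def)

lemma f_hom: "f \<in> ring_hom laurent B"
proof -
  interpret I: ideal "cyc_ideal l" laurent by (rule I_ideal)
  have "\<iota> \<in> ring_hom (laurent Quot cyc_ideal l) B" using B by (simp add: is_fraction_field_def)
  from ring_hom_trans[OF I.rcos_ring_hom this] show ?thesis
    by (simp add: spec_def[abs_def] o_def)
qed

lemmas f_simps = ring_hom_memE[OF f_hom, simplified]

lemma f_0 [simp]: "f 0 = \<zero>"
  using ring_hom_zero[OF f_hom Lr.ring_axioms Bf.ring_axioms] by simp

lemma f_minus: "a \<in> L \<Longrightarrow> f (- a) = \<ominus> f a"
  using f_simps(3)[of "- a" a] f_simps(1) by (intro Bf.minus_equality[symmetric]) simp_all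

lemma f_zero_iff:
  assumes "a \<in> L" shows "f a = \<zero> \<longleftrightarrow> a \<in> cyc_ideal l"
proof -
  interpret I: ideal "cyc_ideal l" laurent by (rule I_ideal)
  let ?c = "\<lambda>a. cyc_ideal l +>\<^bsub>laurent\<^esub> a"
  have inj: "inj_on \<iota> (carrier (laurent Quot cyc_ideal l))" using B by (simp add: is_fraction_field_def)
  have c: "?c b \<in> carrier (laurent Quot cyc_ideal l)" if "b \<in> L" for b
    using ring_hom_memE(1)[OF I.rcos_ring_hom that] .
  have "f a = \<zero> \<longleftrightarrow> f a = f 0" by simp
  also have "\<dots> \<longleftrightarrow> ?c a = ?c 0"
    unfolding spec_def using inj_on_eq_iff[OF inj c[OF assms] c[OF L_zero]] .
  also have "\<dots> \<longleftrightarrow> a \<in> cyc_ideal l"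
    using Lr.quotient_eq_iff_same_a_r_cos[OF I_ideal, of a 0] assms by simp
  finally show ?thesis .
qed

lemma f_mult_zero: "a \<in> L \<Longrightarrow> b \<in> L \<Longrightarrow> f (a * b) = \<zero> \<longleftrightarrow> f a = \<zero> \<or> f b = \<zero>"
  by (simp add: f_simps Bf.integral_iff)

lemma f_qv_pow: "f (qv ^ k) \<noteq> \<zero>"
proof
  assume "f (qv ^ k) = \<zero>"
  then have "f (qv ^ k * inverse qv ^ k) = \<zero>" by (subst f_mult_zero) auto
  then show False using f_simps(4) Bf.zero_not_one by (simp flip: power_mult_distrib)
qed

lemma f_fract_zero: "f (to_fract p / qv ^ k) = \<zero> \<longleftrightarrow> f (to_fract p) = \<zero>"
proof -
  have "f (to_fract p) = f (to_fract p / qv ^ k * qv ^ k)" by simp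
  also have "\<dots> = \<zero> \<longleftrightarrow> f (to_fract p / qv ^ k) = \<zero>"
    by (subst f_mult_zero) (auto simp: f_qv_pow)
  finally show ?thesis by simp
qed

text \<open>
  A power of \<open>qv\<close> in a denominator is harmless, since \<open>\<Phi>\<close> does not vanish at \<open>0\<close>.
\<close>

lemma f_poly_zero_imp:
  assumes "f (to_fract q) = \<zero>"
  shows "\<Phi> dvd q"
proof -
  obtain c where c: "c \<in> L" "to_fract q = c * to_fract \<Phi>"
    using assms f_zero_iff[of "to_fract q"] I_iff by auto
  obtain g k where g: "c = to_fract g / qv ^ k" using c(1) L_iff by blast
  have "to_fract q * qv ^ k = to_fract g * to_fract \<Phi>" using c(2) g by (simp add: field_simps)
  then have eq: "q * monom 1 k = g * \<Phi>" by (simp add: qv_power flip: to_fract_mult)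
  show ?thesis
  proof (cases "q = 0")
    case False
    then have nz: "g * \<Phi> \<noteq> 0" unfolding eq[symmetric] by simp
    have X: "monom 1 k = [:-0, 1::int:] ^ k" by (simp add: monom_altdef)
    have "[:-0, 1::int:] ^ k dvd g * \<Phi>" unfolding eq[symmetric] X by simp
    then have "k \<le> order 0 (g * \<Phi>)" using nz order_divides by blast
    also have "order 0 (g * \<Phi>) = order 0 g"
      using nz order_0I[OF cyclotomic_props(3)[OF n]] by (simp add: order_mult)
    finally have "[:-0, 1::int:] ^ k dvd g" using order_divides by blast
    then obtain g' where "g = monom 1 k * g'" unfolding X[symmetric] by (elim dvdE)
    then have "monom 1 k * q = monom 1 k * (\<Phi> * g')" using eq by (simp add: mult_ac)
    then show ?thesis by (simp add: monom_eq_0_iff)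
  qed simp
qed

text \<open>
  By division with remainder \<open>p\<close> may be taken of degree less than \<open>\<Phi>\<close>, and of minimal degree among the
  counterexamples. In the pseudo-division \<open>smult c \<Phi> = p * q + s\<close> the remainder then vanishes in \<open>B\<close>, and so
  does \<open>q\<close>, because \<open>B\<close> is a field. Hence \<open>\<Phi>\<close> divides \<open>q\<close>, which makes \<open>p\<close> constant.
\<close>

lemma f_poly_zero: "poly (ipoly p) \<zeta> = 0 \<Longrightarrow> f (to_fract p) = \<zero>"
proof (induction "degree p" arbitrary: p rule: less_induct)
  case less
  have lc: "lead_coeff \<Phi> = 1" by (rule cyclotomic_props(1)[OF n])
  then have \<Phi>0: "\<Phi> \<noteq> 0" by auto
  have \<Phi>\<zeta>: "poly (ipoly \<Phi>) \<zeta> = 0" unfolding \<zeta>_def by (rule cyclotomic_props(2)[OF n])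
  have f\<Phi>: "f (to_fract \<Phi>) = \<zero>" using f_zero_iff[of "to_fract \<Phi>"] I_iff by (auto intro: bexI[of _ 1])
  show ?case
  proof (cases "degree p \<ge> degree \<Phi> \<and> p \<noteq> 0")
    case True
    obtain q r where qr: "pseudo_divmod p \<Phi> = (q, r)" by force
    have p: "p = \<Phi> * q + r" and r: "r = 0 \<or> degree r < degree \<Phi>"
      using pseudo_divmod[OF \<Phi>0 qr] lc by simp_all
    have "poly (ipoly p) \<zeta> = poly (ipoly \<Phi>) \<zeta> * poly (ipoly q) \<zeta> + poly (ipoly r) \<zeta>"
      unfolding p by simp
    then have "poly (ipoly r) \<zeta> = 0" using less.prems \<Phi>\<zeta> by simp
    then have "f (to_fract r) = \<zero>" using r less.hyps[of r] True by (cases "r = 0") auto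
    then show ?thesis unfolding p by (simp add: f_simps f\<Phi>)
  next
    case False
    show ?thesis
    proof (rule ccontr)
      assume fp: "f (to_fract p) \<noteq> \<zero>"
      then have p0: "p \<noteq> 0" by auto
      with False have dp: "degree p < degree \<Phi>" by simp
      obtain q s where qs: "pseudo_divmod \<Phi> p = (q, s)" by force
      define c where "c = lead_coeff p ^ (Suc (degree \<Phi>) - degree p)"
      have c0: "c \<noteq> 0" using p0 by (simp add: c_def)
      have cp: "smult c \<Phi> = p * q + s" and s: "s = 0 \<or> degree s < degree p"
        using pseudo_divmod[OF p0 qs] by (simp_all add: c_def)
      have "poly (ipoly (smult c \<Phi>)) \<zeta> = poly (ipoly p) \<zeta> * poly (ipoly q) \<zeta> + poly (ipoly s) \<zeta>"
        unfolding cp by simp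
      then have "poly (ipoly s) \<zeta> = 0" using less.prems \<Phi>\<zeta> by simp
      then have fs: "f (to_fract s) = \<zero>" using s less.hyps[of s] by (cases "s = 0") auto
      have "smult c \<Phi> = [:c:] * \<Phi>" by simp
      then have "f (to_fract (smult c \<Phi>)) = f (to_fract [:c:] * to_fract \<Phi>)" by (simp only: to_fract_mult)
      then have "f (to_fract (smult c \<Phi>)) = \<zero>" by (simp add: f_simps f\<Phi>)
      moreover have "f (to_fract (smult c \<Phi>)) = f (to_fract p * to_fract q)"
        unfolding cp using fs by (simp add: f_simps)
      ultimately have "f (to_fract q) = \<zero>" using fp by (simp add: f_mult_zero)
      then have dq: "\<Phi> dvd q" by (rule f_poly_zero_imp)
      have q0: "q \<noteq> 0"
      proof
        assume "q = 0"
        then have "degree (smult c \<Phi>) = degree s" using cp by simp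
        then show False using s dp c0 by (auto simp: degree_smult_eq)
      qed
      have "degree (p * q) = degree \<Phi>"
      proof -
        have "p * q = smult c \<Phi> - s" using cp by simp
        moreover have "degree s < degree (smult c \<Phi>) \<or> s = 0" using s dp c0 by (auto simp: degree_smult_eq)
        ultimately show ?thesis using c0 degree_add_eq_left[of "- s" "smult c \<Phi>"]
          by (auto simp: degree_smult_eq)
      qed
      then have "degree p + degree q = degree \<Phi>" using p0 q0 by (simp add: degree_mult_eq)
      then have "degree p = 0" using dvd_imp_degree_le[OF dq q0] by simp
      then obtain a where "p = [:a:]" by (rule degree_eq_zeroE)
      then have "p = 0" using less.prems by (simp add: map_poly_pCons)
      then show False using p0 by simp
    qed
  qed
qed

lemma f_evL:
  assumes "a \<in> L"
  shows "f a = \<zero> \<longleftrightarrow> evL \<zeta> a = 0"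
proof
  obtain p k where a: "a = to_fract p / qv ^ k" using assms L_iff by blast
  show "f a = \<zero>" if "evL \<zeta> a = 0"
    using that f_poly_zero[of p] by (simp add: a evL_eq f_fract_zero)
  assume "f a = \<zero>"
  then obtain c where c: "c \<in> L" "a = c * to_fract \<Phi>" using f_zero_iff[OF assms] I_iff by auto
  have "evL \<zeta> (to_fract \<Phi>) = poly (ipoly \<Phi>) \<zeta>" using evL_eq[OF \<zeta>_nz, of \<Phi> 0] by simp
  also have "\<dots> = 0" unfolding \<zeta>_def by (rule cyclotomic_props(2)[OF n])
  finally show "evL \<zeta> a = 0" by (simp add: c ev_\<zeta>)
qed

text \<open>
  The embedding of \<open>B\<close>, on fractions of images of Laurent polynomials.
\<close>

definition jC :: "'b \<Rightarrow> complex" where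
  "jC x = (THE w. \<exists>a\<in>L. \<exists>b\<in>L. f b \<noteq> \<zero> \<and> x = f a \<otimes> inv (f b) \<and> w = evL \<zeta> a / evL \<zeta> b)"

lemma B_rep:
  assumes "x \<in> carrier B"
  obtains a b where "a \<in> L" "b \<in> L" "f b \<noteq> \<zero>" "x = f a \<otimes> inv (f b)"
proof -
  interpret I: ideal "cyc_ideal l" laurent by (rule I_ideal)
  have c: "carrier (laurent Quot cyc_ideal l) = (\<lambda>a. cyc_ideal l +>\<^bsub>laurent\<^esub> a) ` L"
    by (auto simp: FactRing_def A_RCOSETS_def')
  have "\<exists>a\<in>carrier (laurent Quot cyc_ideal l). \<exists>b\<in>carrier (laurent Quot cyc_ideal l) - {\<zero>\<^bsub>laurent Quot cyc_ideal l\<^esub>}.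
      x = \<iota> a \<otimes> inv (\<iota> b)"
    using B assms unfolding is_fraction_field_def by blast
  then obtain a b where ab: "a \<in> L" "b \<in> L" "cyc_ideal l +>\<^bsub>laurent\<^esub> b \<noteq> \<zero>\<^bsub>laurent Quot cyc_ideal l\<^esub>"
    "x = f a \<otimes> inv (f b)" unfolding c spec_def by blast
  have "b \<notin> cyc_ideal l" using ab(3) Lr.a_rcos_zero[OF I_ideal] by (auto simp: FactRing_def)
  then show ?thesis using that ab f_zero_iff by blast
qed

text \<open>
  Rearrangements for the arithmetic of fractions in \<open>jC_hom\<close>.
\<close>

lemma four_comm:
  assumes "w \<in> carrier B" "x \<in> carrier B" "y \<in> carrier B" "z \<in> carrier B"
  shows "w \<otimes> x \<otimes> (y \<otimes> z) = w \<otimes> y \<otimes> (z \<otimes> x)" "w \<otimes> x \<otimes> (y \<otimes> z) = y \<otimes> w \<otimes> (z \<otimes> x)"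
  using assms by (simp_all add: Bf.m_ac)

lemma jC_eq:
  assumes "a \<in> L" "b \<in> L" "f b \<noteq> \<zero>"
  shows "jC (f a \<otimes> inv (f b)) = evL \<zeta> a / evL \<zeta> b"
  unfolding jC_def
proof (rule the_equality)
  fix w assume "\<exists>a'\<in>L. \<exists>b'\<in>L. f b' \<noteq> \<zero> \<and> f a \<otimes> inv (f b) = f a' \<otimes> inv (f b') \<and> w = evL \<zeta> a' / evL \<zeta> b'"
  then obtain a' b' where ab': "a' \<in> L" "b' \<in> L" "f b' \<noteq> \<zero>" "f a \<otimes> inv (f b) = f a' \<otimes> inv (f b')"
    and w: "w = evL \<zeta> a' / evL \<zeta> b'" by blast
  have c: "f a \<in> carrier B" "f b \<in> carrier B" "f a' \<in> carrier B" "f b' \<in> carrier B"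
    using assms ab' f_simps by auto
  have i: "inv (f b) \<in> carrier B" "inv (f b') \<in> carrier B" "f b \<otimes> inv (f b) = \<one>" "f b' \<otimes> inv (f b') = \<one>"
    using assms ab' c by (auto simp: Bf.field_Units)
  have "f a \<otimes> f b' = (f a \<otimes> inv (f b)) \<otimes> (f b \<otimes> f b')"
    using c i by (metis Bf.m_assoc Bf.m_comm Bf.m_closed Bf.r_one)
  also have "\<dots> = f a' \<otimes> f b \<otimes> (f b' \<otimes> inv (f b'))"
    unfolding ab'(4) using c i by (intro four_comm)
  finally have "f a \<otimes> f b' = f a' \<otimes> f b" using c i by simp
  then have "f (a * b') = f (a' * b)" using assms ab' by (simp add: f_simps)
  then have "f (a * b' + - (a' * b)) = \<zero>"
    using assms ab' f_simps(3)[of "a * b'" "- (a' * b)"] f_simps(1)[of "a' * b"]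
    by (simp add: f_minus Bf.r_neg del: add_uminus_conv_diff)
  then have "evL \<zeta> (a * b' + - (a' * b)) = 0" using assms ab' by (subst f_evL[symmetric]) auto
  moreover have "evL \<zeta> (- (a' * b)) = - (evL \<zeta> a' * evL \<zeta> b)"
  proof -
    have "evL \<zeta> (- (a' * b)) + evL \<zeta> (a' * b) = evL \<zeta> (- (a' * b) + a' * b)"
      using assms ab' by (subst ev_\<zeta>(4)) auto
    then show ?thesis using assms ab' by (simp add: ev_\<zeta> add_eq_0_iff)
  qed
  ultimately have "evL \<zeta> a * evL \<zeta> b' = evL \<zeta> a' * evL \<zeta> b"
    using assms ab' ev_\<zeta>(4)[of "a * b'" "- (a' * b)"] by (simp add: ev_\<zeta>(5))
  moreover have "evL \<zeta> b \<noteq> 0" "evL \<zeta> b' \<noteq> 0" using assms ab' f_evL by auto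
  ultimately show "w = evL \<zeta> a / evL \<zeta> b" unfolding w by (simp add: field_simps)
qed (use assms in blast)

lemma jC_f: "a \<in> L \<Longrightarrow> jC (f a) = evL \<zeta> a"
  using jC_eq[of a 1] f_simps by (simp add: ev_\<zeta>)

lemma f_unit: "a \<in> L \<Longrightarrow> f a \<noteq> \<zero> \<Longrightarrow> inv (f a) \<in> carrier B \<and> f a \<otimes> inv (f a) = \<one>"
  using f_simps(1)[of a] by (simp add: Bf.field_Units)

lemma jC_hom:
  assumes "x \<in> carrier B" "y \<in> carrier B"
  shows "jC (x \<oplus> y) = jC x + jC y" "jC (x \<otimes> y) = jC x * jC y"
proof -
  obtain a b where ab: "a \<in> L" "b \<in> L" "f b \<noteq> \<zero>" "x = f a \<otimes> inv (f b)" using B_rep[OF assms(1)] .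
  obtain a' b' where ab': "a' \<in> L" "b' \<in> L" "f b' \<noteq> \<zero>" "y = f a' \<otimes> inv (f b')" using B_rep[OF assms(2)] .
  note u = f_unit[OF ab(2,3)] f_unit[OF ab'(2,3)]
  have c: "f a \<in> carrier B" "f b \<in> carrier B" "f a' \<in> carrier B" "f b' \<in> carrier B"
    using ab ab' f_simps by auto
  have bb: "f (b * b') \<noteq> \<zero>" using ab ab' by (simp add: f_mult_zero)
  have "(inv (f b) \<otimes> inv (f b')) \<otimes> (f b \<otimes> f b') = (f b \<otimes> inv (f b)) \<otimes> (f b' \<otimes> inv (f b'))"
    using c u by (intro four_comm) auto
  also have "\<dots> = \<one>" using u by simp
  finally have ib: "inv (f (b * b')) = inv (f b) \<otimes> inv (f b')"
    using c u ab ab' by (simp add: f_simps Bf.comm_inv_char Bf.inv_char Bf.m_comm)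
  have "x \<otimes> y = f (a * a') \<otimes> inv (f (b * b'))"
    unfolding ib ab(4) ab'(4) using c u ab ab' by (simp add: f_simps Bf.m_ac)
  then show "jC (x \<otimes> y) = jC x * jC y"
    using ab ab' bb by (simp add: jC_eq ev_\<zeta>)
  have u': "inv (f b) \<otimes> f b = \<one>" "inv (f b') \<otimes> f b' = \<one>" using u c by (simp_all add: Bf.m_comm)
  have 1: "f a \<otimes> f b' \<otimes> (inv (f b) \<otimes> inv (f b')) = x"
    using four_comm(1)[of "f a" "f b'" "inv (f b)" "inv (f b')"] c u u' by (simp add: ab(4))
  have 2: "f a' \<otimes> f b \<otimes> (inv (f b') \<otimes> inv (f b)) = y"
    using four_comm(1)[of "f a'" "f b" "inv (f b')" "inv (f b)"] c u u' by (simp add: ab'(4))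
  have "f (a * b' + a' * b) \<otimes> inv (f (b * b'))
    = f a \<otimes> f b' \<otimes> (inv (f b) \<otimes> inv (f b')) \<oplus> f a' \<otimes> f b \<otimes> (inv (f b) \<otimes> inv (f b'))"
    unfolding ib using c u ab ab' by (simp add: f_simps Bf.l_distr)
  also have "\<dots> = x \<oplus> y" using 1 2 u by (simp add: Bf.m_comm[of "inv (f b)"])
  finally have e: "x \<oplus> y = f (a * b' + a' * b) \<otimes> inv (f (b * b'))" ..
  have "evL \<zeta> b \<noteq> 0" "evL \<zeta> b' \<noteq> 0" using ab ab' f_evL by auto
  then show "jC (x \<oplus> y) = jC x + jC y"
    unfolding e using ab ab' bb by (simp add: jC_eq ev_\<zeta> field_simps)
qed

lemma jC_one [simp]: "jC \<one> = 1" using jC_f[of 1] f_simps(4) by (simp add: ev_\<zeta>)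

lemma jC_zero_iff:
  assumes "x \<in> carrier B" shows "jC x = 0 \<longleftrightarrow> x = \<zero>"
proof -
  obtain a b where ab: "a \<in> L" "b \<in> L" "f b \<noteq> \<zero>" "x = f a \<otimes> inv (f b)" using B_rep[OF assms] .
  note u = f_unit[OF ab(2,3)]
  have "inv (f b) \<noteq> \<zero>" using u f_simps(1)[OF ab(2)] by (metis Bf.r_null Bf.zero_not_one)
  then have "x = \<zero> \<longleftrightarrow> f a = \<zero>" using ab u f_simps(1)[OF ab(1)] by (simp add: Bf.integral_iff)
  also have "\<dots> \<longleftrightarrow> evL \<zeta> a = 0" by (rule f_evL[OF ab(1)])
  also have "\<dots> \<longleftrightarrow> jC x = 0" using ab f_evL[of b] by (simp add: jC_eq)
  finally show ?thesis by simp
qed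

end

section \<open>Quantum numbers at the root of unity\<close>

context root_of_unity
begin

lemma \<zeta>_pow: "\<zeta> ^ s = cis (2 * pi * real s / real n)"
  by (simp add: \<zeta>_def DeMoivre mult_ac)

lemma \<zeta>_n: "\<zeta> ^ n = 1"
  using n by (simp add: \<zeta>_pow)

lemma \<zeta>_eq_1_iff: "\<zeta> ^ s = 1 \<longleftrightarrow> n dvd s"
proof
  assume s: "\<zeta> ^ s = 1"
  have "\<zeta> ^ s = \<zeta> ^ (n * (s div n)) * \<zeta> ^ (s mod n)" by (simp flip: power_add)
  then have 1: "\<zeta> ^ (s mod n) = \<zeta> ^ 0" using s \<zeta>_n by (simp add: power_mult)
  have inj: "inj_on (\<lambda>k. cis (2 * pi * real k / real n)) {..<n}"
    using bij_betw_roots_unity[of n] n by (simp add: bij_betw_def)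
  have "s mod n = 0"
    by (rule inj_onD[OF inj 1[unfolded \<zeta>_pow]]) (use n in auto)
  then show "n dvd s" by auto
next
  assume "n dvd s" then show "\<zeta> ^ s = 1" by (auto elim!: dvdE simp: power_mult \<zeta>_n)
qed

lemma n_dvd_double: "n dvd 2 * s \<longleftrightarrow> l dvd s"
  by (auto simp: lprime_def coprime_dvd_mult_right_iff)

lemma evL_pow: "a \<in> L \<Longrightarrow> evL \<zeta> (a ^ k) = evL \<zeta> a ^ k"
  by (induction k) (simp_all add: ev_\<zeta>)

lemma evL_minus: "a \<in> L \<Longrightarrow> evL \<zeta> (- a) = - evL \<zeta> a"
  using ev_\<zeta>(4)[of "- a" a] by (simp add: ev_\<zeta> eq_neg_iff_add_eq_0)

lemma evL_diff: "a \<in> L \<Longrightarrow> b \<in> L \<Longrightarrow> evL \<zeta> (a - b) = evL \<zeta> a - evL \<zeta> b"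
  using ev_\<zeta>(4)[of a "- b"] by (simp add: evL_minus)

lemma evL_inv: "evL \<zeta> (inverse qv) = inverse \<zeta>"
proof -
  have "\<zeta> * evL \<zeta> (inverse qv) = 1"
    using ev_\<zeta>(5)[of qv "inverse qv"] by (simp add: ev_\<zeta>(1,3))
  then show ?thesis by (simp add: inverse_unique)
qed

lemma evL_sum: "(\<And>x. x \<in> A \<Longrightarrow> u x \<in> L) \<Longrightarrow> evL \<zeta> (sum u A) = (\<Sum>x\<in>A. evL \<zeta> (u x))"
  by (induction A rule: infinite_finite_induct) (simp_all add: ev_\<zeta>)

lemma evL_prod: "(\<And>x. x \<in> A \<Longrightarrow> u x \<in> L) \<Longrightarrow> evL \<zeta> (prod u A) = (\<Prod>x\<in>A. evL \<zeta> (u x))"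
  by (induction A rule: infinite_finite_induct) (simp_all add: ev_\<zeta>)

lemmas evL_more = ev_\<zeta> evL_pow evL_minus evL_diff evL_inv evL_sum evL_prod

lemma evL_qdiff: "evL \<zeta> (qdiff s) = 0 \<longleftrightarrow> l dvd s"
proof -
  have "evL \<zeta> (qdiff s) = \<zeta> ^ s - inverse \<zeta> ^ s"
    by (simp add: qdiff_def evL_more)
  also have "\<dots> = (\<zeta> ^ (2 * s) - 1) / \<zeta> ^ s"
    by (simp add: mult_2 power_add right_diff_distrib diff_divide_distrib inverse_eq_divide power_one_over)
  finally have "evL \<zeta> (qdiff s) = (\<zeta> ^ (2 * s) - 1) / \<zeta> ^ s" .
  then show ?thesis using \<zeta>_eq_1_iff[of "2 * s"] n_dvd_double by simp
qed

text \<open>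
  The hypothesis on \<open>\<xi>\<^sup>2\<close> excludes \<open>l = 1\<close>, which makes \<open>qdiff 1\<close> invertible.
\<close>

lemma l2: "l \<ge> 2"
proof (rule ccontr)
  assume "\<not> l \<ge> 2"
  then have "l = 1" using l by simp
  then have "n dvd 2" by (simp add: lprime_def)
  then have "\<zeta> ^ 2 = 1" using \<zeta>_eq_1_iff by blast
  then have "evL \<zeta> (qv ^ 2 - 1) = 0" by (simp add: evL_more)
  then have z: "f (qv ^ 2 - 1) = \<zero>" by (subst f_evL) auto
  have "f (qv ^ 2) = f ((qv ^ 2 - 1) + 1)" by simp
  also have "\<dots> = f (qv ^ 2 - 1) \<oplus> f 1" by (rule f_simps(3)) simp_all
  also have "\<dots> = \<one>" using z f_simps(4) by simp
  finally have "f (qv ^ 2) = \<one>" .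
  moreover have "f (qv ^ 2) = f qv [^] (2::nat)"
    using f_simps(1)[of qv] by (simp add: power2_eq_square f_simps numeral_2_eq_2)
  ultimately show False using xi by simp
qed

lemma \<zeta>_2l: "\<zeta> ^ (2 * l) = 1"
  using \<zeta>_eq_1_iff[of "2 * l"] n_dvd_double by simp

lemma \<zeta>_l_sq: "\<zeta> ^ l * \<zeta> ^ l = 1"
  using \<zeta>_2l by (simp add: mult_2 power_add)

lemma f_qdiff_1: "f (qdiff 1) \<noteq> \<zero>"
  using evL_qdiff[of 1] l2 by (simp add: f_evL del: qdiff_1)

lemma f_qint: "\<not> l dvd s \<Longrightarrow> f (qint s) \<noteq> \<zero>"
proof
  assume s: "\<not> l dvd s" and "f (qint s) = \<zero>"
  then have "f (qdiff 1 * qint s) = \<zero>" by (subst f_mult_zero) auto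
  then show False using s evL_qdiff[of s] unfolding qint_Suc_qdiff by (simp add: f_evL)
qed

lemma f_pcoef: "f (pcoef l l) \<noteq> \<zero>"
proof
  assume "f (pcoef l l) = \<zero>"
  then have "evL \<zeta> (pcoef l l) = 0" using l by (subst (asm) f_evL) auto
  then have "evL \<zeta> (pcoef l l * (\<Prod>r\<in>{1..l}. - (qv ^ (r - 1)))) = 0"
    using l by (subst ev_\<zeta>) auto
  then have "evL \<zeta> (- (\<Prod>r\<in>{1..<l}. qdiff r)) = 0" unfolding pcoef_top[OF l] .
  then have "(\<Prod>r\<in>{1..<l}. evL \<zeta> (qdiff r)) = 0" by (simp add: evL_minus evL_prod)
  then show False using evL_qdiff by (auto simp: prod_zero_iff dest: dvd_imp_le)
qed

text \<open>
  The first factor in \<open>qbinom_top\<close> specializes to \<open>q\<close> up to sign, and the characteristic is \<open>0\<close>; the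
  other factors are \<open>qdiff (l * q - r)\<close> with \<open>l * q - r\<close> not divisible by \<open>l\<close>.
\<close>

lemma f_qbinom:
  assumes q: "q \<ge> 1"
  shows "f (qbinom (l * q) l) \<noteq> \<zero>"
proof
  assume "f (qbinom (l * q) l) = \<zero>"
  then have "evL \<zeta> (qbinom (l * q) l) = 0" by (subst (asm) f_evL) auto
  then have "evL \<zeta> (qbinom (l * q) l * (\<Prod>r\<in>{1..<l}. qdiff r)) = 0" by (simp add: ev_\<zeta>)
  then have "(\<Sum>k<q. (inverse \<zeta> ^ l) ^ (q - Suc k) * (\<zeta> ^ l) ^ k) * (\<Prod>r\<in>{1..<l}. evL \<zeta> (qdiff (l * q - r))) = 0"
    unfolding qbinom_top[OF q l] by (simp add: evL_more)
  moreover have "(\<Sum>k<q. (inverse \<zeta> ^ l) ^ (q - Suc k) * (\<zeta> ^ l) ^ k) = of_nat q * (\<zeta> ^ l) ^ (q - 1)"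
  proof -
    have i: "inverse \<zeta> ^ l = \<zeta> ^ l" using \<zeta>_l_sq by (simp add: power_inverse inverse_unique)
    have "(\<Sum>k<q. (inverse \<zeta> ^ l) ^ (q - Suc k) * (\<zeta> ^ l) ^ k) = (\<Sum>k<q. (\<zeta> ^ l) ^ (q - 1))"
      unfolding i by (rule sum.cong) (auto simp flip: power_add)
    then show ?thesis by simp
  qed
  moreover have "of_nat q * (\<zeta> ^ l) ^ (q - 1) \<noteq> (0::complex)" using q by simp
  moreover have "(\<Prod>r\<in>{1..<l}. evL \<zeta> (qdiff (l * q - r))) \<noteq> 0"
  proof -
    have "\<not> l dvd l * q - r" if r: "r \<in> {1..<l}" for r
    proof
      assume "l dvd l * q - r"
      moreover have "r \<le> l * q" using r q by (metis atLeastLessThan_iff less_imp_le mult.right_neutral mult_le_mono2 order_trans)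
      ultimately have "l dvd r" by (metis dvd_diffD1 dvd_triv_left)
      then show False using r by (auto dest: dvd_imp_le)
    qed
    then show ?thesis by (simp add: prod_zero_iff evL_qdiff)
  qed
  ultimately show False by simp
qed

lemma f_of_nat: "f (of_nat k) = [k] \<cdot> \<one>"
  by (induction k) (simp_all add: f_simps Bf.add.nat_pow_Suc Bf.a_comm)

lemma f_l: "f (of_nat l) \<noteq> \<zero>"
proof -
  have "evL \<zeta> (of_nat k) = of_nat k" for k by (induction k) (simp_all add: ev_\<zeta>)
  then show ?thesis using l by (simp add: f_evL)
qed

text \<open>
  The functions through which the algebra \<open>B \<Gamma> \<otimes> U(h)\<close> is compared with \<open>V\<^sup>0\<close>: along an arithmetic
  progression of step \<open>lprime l\<close> only the polynomial factor varies, and the values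
  \<open>(-1) ^ s * \<zeta> ^ m\<close> exhaust the \<open>2 * l\<close>-th roots of unity.
\<close>

definition gval :: "nat \<times> nat \<Rightarrow> nat \<times> nat \<Rightarrow> complex"
  where "gval y q = ((-1) ^ fst q * \<zeta> ^ snd q) ^ fst y * (\<zeta> ^ l * of_nat (snd q) / of_nat l) ^ snd y"

text \<open>
  For even \<open>l\<close> the powers of \<open>\<zeta>\<close> are already all \<open>2 * l\<close>-th roots of unity; for odd \<open>l\<close> they are those of
  order dividing \<open>l\<close>, and the sign supplies the others.
\<close>

lemma all_roots:
  assumes "z ^ (2 * l) = 1"
  shows "\<exists>s m. z = (-1) ^ s * \<zeta> ^ m"
proof -
  have rt: "\<exists>m. w = \<zeta> ^ m" if "w ^ n = 1" for w
    using bij_betw_roots_unity[of n] n that by (auto simp: bij_betw_def image_iff set_eq_iff \<zeta>_pow)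
  show ?thesis
  proof (cases "even l")
    case True
    then have "z ^ n = 1" using assms by (simp add: lprime_def)
    then obtain m where "z = \<zeta> ^ m" using rt by blast
    then have "z = (-1) ^ 0 * \<zeta> ^ m" by simp
      then show ?thesis by blast
  next
    case False
    then have nl: "n = l" by (simp add: lprime_def)
    have "(z ^ l) ^ 2 = 1" using assms by (simp add: power_mult[symmetric] mult.commute)
    then consider "z ^ l = 1" | "z ^ l = - 1" by (auto simp: power2_eq_1_iff)
    then show ?thesis
    proof cases
      case 1
      then obtain m where "z = \<zeta> ^ m" using rt nl by metis
      then have "z = (-1) ^ 0 * \<zeta> ^ m" by simp
      then show ?thesis by blast
    next
      case 2
      then have "(- z) ^ l = 1" using False by simp
      then obtain m where "- z = \<zeta> ^ m" using rt nl by metis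
      from this[symmetric] have "z = (-1) ^ 1 * \<zeta> ^ m" by simp
      then show ?thesis by blast
    qed
  qed
qed

text \<open>
  Fix a root of unity \<open>w = (-1) ^ s * \<zeta> ^ m\<close> and let \<open>m\<close> grow in steps of \<open>n\<close>: a polynomial in \<open>m\<close> with
  infinitely many zeros vanishes. Its coefficients are polynomials of degree less than \<open>2 * l\<close> in \<open>w\<close>
  which vanish at all \<open>2 * l\<close> roots.
\<close>

lemma indep_gval: "indep_funs gval ({..<2 * l} \<times> UNIV)"
  unfolding indep_funs_def
proof (intro allI impI ballI)
  fix A c j assume A: "finite A" "A \<subseteq> {..<2 * l} \<times> UNIV"
    and eq: "\<forall>q. (\<Sum>y\<in>A. c y * gval y q) = 0" and j: "j \<in> A"
  define \<gamma> :: complex where "\<gamma> = \<zeta> ^ l / of_nat l"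
  have \<gamma>: "\<gamma> \<noteq> 0" using l by (simp add: \<gamma>_def)
  have step: "(\<Sum>y\<in>{y\<in>A. snd y = b}. c y * w ^ fst y) = 0" if w: "w ^ (2 * l) = 1" for w b
  proof -
    obtain s m where sm: "w = (-1) ^ s * \<zeta> ^ m" using all_roots[OF w] by blast
    define P where "P = (\<Sum>y\<in>A. monom (c y * w ^ fst y * \<gamma> ^ snd y) (snd y))"
    have "poly P (of_nat (m + n * k)) = 0" for k
    proof -
      have "\<zeta> ^ (m + n * k) = \<zeta> ^ m" by (simp add: power_add power_mult \<zeta>_n)
      then have "gval y (s, m + n * k) = w ^ fst y * \<gamma> ^ snd y * of_nat (m + n * k) ^ snd y" for y
        by (simp add: gval_def sm \<gamma>_def power_mult_distrib power_divide)
      then show ?thesis using eq[rule_format, of "(s, m + n * k)"]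
        by (simp add: P_def poly_sum poly_monom mult.assoc)
    qed
    then have "range (\<lambda>k. of_nat (m + n * k) :: complex) \<subseteq> {x. poly P x = 0}" by auto
    moreover have "infinite (range (\<lambda>k. of_nat (m + n * k) :: complex))"
      by (rule range_inj_infinite) (use n in \<open>auto simp: inj_def simp flip: of_nat_add of_nat_mult\<close>)
    ultimately have "P = 0" using poly_roots_finite finite_subset by blast
    then have "coeff P b = 0" by simp
    moreover have "coeff P b = (\<Sum>y\<in>A. if snd y = b then c y * w ^ fst y * \<gamma> ^ b else 0)"
      unfolding P_def coeff_sum by (rule sum.cong) auto
    moreover have "\<dots> = (\<Sum>y\<in>{y\<in>A. snd y = b}. c y * w ^ fst y) * \<gamma> ^ b"
      using A by (simp add: sum.inter_filter[symmetric] sum_distrib_right)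
    ultimately show ?thesis using \<gamma> by simp
  qed
  define R where "R = (\<Sum>y\<in>{y\<in>A. snd y = snd j}. monom (c y) (fst y))"
  have R: "poly R w = 0" if "w ^ (2 * l) = 1" for w
    using step[OF that, of "snd j"] by (simp add: R_def poly_sum poly_monom)
  have "R = 0"
  proof (rule ccontr)
    assume "R \<noteq> 0"
    have "degree R \<le> 2 * l - 1"
      unfolding R_def
    proof (rule degree_sum_le)
      fix y assume "y \<in> {y\<in>A. snd y = snd j}"
      then have "fst y < 2 * l" using A by auto
      then show "degree (monom (c y) (fst y)) \<le> 2 * l - 1"
        using degree_monom_le[of "c y" "fst y"] by linarith
    qed (use A in auto)
    moreover have "card {w::complex. w ^ (2 * l) = 1} \<le> card {w. poly R w = 0}"
      using R by (intro card_mono poly_roots_finite \<open>R \<noteq> 0\<close>) auto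
    moreover have "card {w. poly R w = 0} \<le> degree R" by (rule card_poly_roots_bound[OF \<open>R \<noteq> 0\<close>])
    moreover have "card {w::complex. w ^ (2 * l) = 1} = 2 * l" using l by (intro card_roots_unity_eq) simp
    ultimately show False using l by simp
  qed
  then have "coeff R (fst j) = 0" by simp
  moreover have "coeff R (fst j) = (\<Sum>y\<in>{y\<in>A. snd y = snd j}. if y = j then c j else 0)"
    unfolding R_def coeff_sum by (rule sum.cong) (auto simp: prod_eq_iff)
  moreover have "\<dots> = c j" using A j by simp
  ultimately show "c j = 0" by simp
qed

end

section \<open>The Hopf algebra \<open>B \<Gamma> \<otimes> U(h)\<close> by generators\<close>

lemma (in Group.monoid) pow_mod:
  assumes "x \<in> carrier G" "x [^] (N::nat) = \<one>"
  shows "x [^] (k mod N) = x [^] k"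
proof -
  have "x [^] k = x [^] (N * (k div N) + k mod N)" by simp
  also have "\<dots> = (x [^] N) [^] (k div N) \<otimes> x [^] (k mod N)"
    using assms(1) by (simp only: nat_pow_mult[symmetric] nat_pow_pow)
  finally show ?thesis using assms by simp
qed

\<comment> \<open>The index set must keep the form \<open>{1..\<theta>}\<close>, in which it occurs in the definitions.\<close>
declare One_nat_def [simp del]

text \<open>
  The generators \<open>G i\<close> and \<open>t i\<close>, the relation \<open>G i ^ (2 * l) = 1\<close> and the values of the structure maps on
  generators are all that is needed of \<open>B \<Gamma> \<otimes> U(h)\<close>.
\<close>

locale GamU_alg = B: cring B for B (structure) +
  fixes \<theta> l :: nat
  assumes l: "l \<ge> 1"
begin

abbreviation I where "I \<equiv> {1..\<theta>}"
abbreviation \<Gamma> where "\<Gamma> \<equiv> Gam \<theta> l"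
abbreviation LL where "LL \<equiv> abelian_lie B {1..\<theta>}"

lemma Gam_sel:
  "carrier \<Gamma> = (\<Pi>\<^sub>E i\<in>I. {0..<2 * int l})"
  "a \<otimes>\<^bsub>\<Gamma>\<^esub> b = (\<lambda>i\<in>I. (a i + b i) mod (2 * int l))"
  "\<one>\<^bsub>\<Gamma>\<^esub> = (\<lambda>i\<in>I. 0)"
  using l by (auto simp: Gam_def product_group_def integer_mod_group_def)

lemma Gam_comm: "comm_group \<Gamma>"
proof -
  interpret G: group \<Gamma> unfolding Gam_def by (rule product_group) simp
  show ?thesis by (rule G.group_comm_groupI) (auto simp: Gam_sel add.commute)
qed

sublocale GA: group_alg B \<Gamma>
  by (intro group_alg.intro B.is_cring Gam_comm)

lemma LL_sel [simp]:
  "carrier LL = I \<rightarrow>\<^sub>E carrier B" "zero LL = (\<lambda>i\<in>I. \<zero>)" "add LL = (\<lambda>x y. \<lambda>i\<in>I. x i \<oplus> y i)"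
  "module.smult LL = (\<lambda>a x. \<lambda>i\<in>I. a \<otimes> x i)" "monoid.mult LL = (\<lambda>x y. \<lambda>i\<in>I. \<zero>)"
  by (simp_all add: abelian_lie_def)

lemma LL_module: "Module.module B LL"
proof (rule moduleI)
  show "abelian_group LL"
  proof (rule abelian_groupI)
    fix x assume x: "x \<in> carrier LL"
    then have "(\<lambda>i\<in>I. \<ominus> x i) \<in> carrier LL" by (auto simp: PiE_iff)
    moreover have "(\<lambda>i\<in>I. \<ominus> x i) \<oplus>\<^bsub>LL\<^esub> x = \<zero>\<^bsub>LL\<^esub>"
      using x by (auto simp: PiE_iff fun_eq_iff B.l_neg)
    ultimately show "\<exists>y\<in>carrier LL. y \<oplus>\<^bsub>LL\<^esub> x = \<zero>\<^bsub>LL\<^esub>" by blast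
  qed (auto simp: PiE_iff fun_eq_iff B.a_ac extensional_def)
qed (auto simp: B.is_cring PiE_iff fun_eq_iff extensional_def B.l_distr B.r_distr B.m_assoc)

sublocale EA: abelian_env B LL
  by (intro abelian_env.intro LL_module abelian_env_axioms.intro) simp

abbreviation GH where "GH \<equiv> group_hopf B \<Gamma>"
abbreviation UH where "UH \<equiv> env_hopf B LL"

sublocale TH: tensor_hopf_alg B GH UH
  by (intro tensor_hopf_alg.intro tensor_hopf_alg_axioms.intro GA.group_hopf_comm EA.env_hopf_comm)
     (simp_all add: GA.group_comult GA.group_counit GA.group_antipode EA.env_comult EA.env_counit EA.env_antipode)

\<comment> \<open>The two factors stay folded, as in the definition of their tensor product.\<close>
declare GA.group_hopf_sel [simp del] EA.env_hopf_sel [simp del]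

abbreviation T where "T \<equiv> tensor B GH UH"

sublocale TC: comm_alg B T
  by (rule TH.T_comm)

abbreviation G where "G i \<equiv> g_elt \<theta> l B i"
abbreviation t where "t i \<equiv> t_elt \<theta> l B i"
abbreviation gg where "gg i \<equiv> Gam_gen \<theta> i"
abbreviation tt where "tt i \<equiv> env_incl B LL (lie_basis B I i)"

lemma G_eq: "G i = TH.\<iota> (basis_elt B (gg i))"
  by (simp add: g_elt_def Let_def)

lemma t_eq: "t i = TH.\<iota>' (tt i)"
  by (simp add: t_elt_def Let_def)

lemma gg_closed [simp]: "i \<in> I \<Longrightarrow> gg i \<in> carrier \<Gamma>"
  using l by (auto simp: Gam_gen_def Gam_sel)

lemma lb_closed [simp]: "lie_basis B I i \<in> carrier LL"
  by (auto simp: lie_basis_def)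

lemma tt_closed [simp]: "tt i \<in> carrier UH"
  using lin_mapD(1)[OF EA.incl_lin_map lb_closed] by (simp add: EA.env_hopf_sel)

lemma bas_closed [simp]: "a \<in> carrier \<Gamma> \<Longrightarrow> basis_elt B a \<in> carrier GH"
  by (simp add: GA.A.closed GA.group_hopf_sel)

lemma Gt_closed [simp]: "i \<in> I \<Longrightarrow> G i \<in> carrier T" "t i \<in> carrier T"
  unfolding G_eq t_eq by (rule TH.T.tens_closed; simp)+

lemmas \<iota>_hom = TH.T.incl_left
lemmas \<iota>'_hom = TH.T.incl_right

lemma lie_expand:
  assumes x: "x \<in> carrier LL"
  shows "x = (\<Oplus>\<^bsub>LL\<^esub>i\<in>I. x i \<odot>\<^bsub>LL\<^esub> lie_basis B I i)"
proof -
  have xi: "x i \<in> carrier B" if "i \<in> I" for i using x that by auto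
  have "(\<Oplus>\<^bsub>LL\<^esub>i\<in>A. x i \<odot>\<^bsub>LL\<^esub> lie_basis B I i) = (\<lambda>j\<in>I. if j \<in> A then x j else \<zero>)"
    if "finite A" "A \<subseteq> I" for A
    using that
  proof (induction A rule: finite_induct)
    case (insert i A)
    have c: "(\<lambda>i. x i \<odot>\<^bsub>LL\<^esub> lie_basis B I i) \<in> A \<rightarrow> carrier LL" "x i \<odot>\<^bsub>LL\<^esub> lie_basis B I i \<in> carrier LL"
      using insert xi lb_closed by (auto intro!: EA.L.smult_closed simp del: LL_sel)
    have IH: "(\<Oplus>\<^bsub>LL\<^esub>i\<in>A. x i \<odot>\<^bsub>LL\<^esub> lie_basis B I i) = (\<lambda>j\<in>I. if j \<in> A then x j else \<zero>)"
      using insert by blast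
    have "(\<Oplus>\<^bsub>LL\<^esub>i\<in>insert i A. x i \<odot>\<^bsub>LL\<^esub> lie_basis B I i)
      = x i \<odot>\<^bsub>LL\<^esub> lie_basis B I i \<oplus>\<^bsub>LL\<^esub> (\<lambda>j\<in>I. if j \<in> A then x j else \<zero>)"
      unfolding EA.L.M.finsum_insert[OF insert(1,2) c] IH ..
    also have "\<dots> = (\<lambda>j\<in>I. if j \<in> insert i A then x j else \<zero>)"
      using insert xi by (auto simp: fun_eq_iff lie_basis_def)
    finally show ?case .
  qed (auto simp: fun_eq_iff)
  from this[of I] show ?thesis using x by (auto simp: PiE_iff extensional_def fun_eq_iff)
qed

lemma lin_expand:
  assumes P: "Module.module B P" and h: "h \<in> lin_map B LL P" and x: "x \<in> carrier LL"
  shows "h x = (\<Oplus>\<^bsub>P\<^esub>i\<in>I. x i \<odot>\<^bsub>P\<^esub> h (lie_basis B I i))"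
proof -
  interpret P: Module.module B P by fact
  have xi: "x i \<in> carrier B" if "i \<in> I" for i using x that by auto
  have "h x = h (\<Oplus>\<^bsub>LL\<^esub>i\<in>I. x i \<odot>\<^bsub>LL\<^esub> lie_basis B I i)" using lie_expand[OF x] by simp
  also have "\<dots> = (\<Oplus>\<^bsub>P\<^esub>i\<in>I. h (x i \<odot>\<^bsub>LL\<^esub> lie_basis B I i))"
    by (rule lin_map_finsum[OF h LL_module P]) (use xi lb_closed in \<open>auto intro!: EA.L.smult_closed simp del: LL_sel\<close>)
  also have "\<dots> = (\<Oplus>\<^bsub>P\<^esub>i\<in>I. x i \<odot>\<^bsub>P\<^esub> h (lie_basis B I i))"
    by (rule P.finsum_cong') (use xi lin_mapD(3)[OF h _ lb_closed] lin_mapD(1)[OF h lb_closed] in auto)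
  finally show ?thesis .
qed

text \<open>
  The generators \<open>G i\<close> and \<open>t i\<close> generate: every group element is reached by increasing one exponent at
  a time, and every element of the Lie algebra is a combination of the basis.
\<close>

lemma T_subalgebra:
  assumes S: "S \<subseteq> carrier T"
    and one: "\<one>\<^bsub>T\<^esub> \<in> S"
    and add: "\<And>x y. x \<in> S \<Longrightarrow> y \<in> S \<Longrightarrow> x \<oplus>\<^bsub>T\<^esub> y \<in> S"
    and smult: "\<And>a x. a \<in> carrier B \<Longrightarrow> x \<in> S \<Longrightarrow> a \<odot>\<^bsub>T\<^esub> x \<in> S"
    and mult: "\<And>x y. x \<in> S \<Longrightarrow> y \<in> S \<Longrightarrow> x \<otimes>\<^bsub>T\<^esub> y \<in> S"
    and G: "\<And>i. i \<in> I \<Longrightarrow> G i \<in> S" and t: "\<And>i. i \<in> I \<Longrightarrow> t i \<in> S"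
  shows "S = carrier T"
proof -
  note D = alg_homD[OF \<iota>_hom] and D' = alg_homD[OF \<iota>'_hom]
  have zero_S: "\<zero>\<^bsub>T\<^esub> \<in> S" using smult[OF B.zero_closed one] by simp
  have sum: "(\<Oplus>\<^bsub>T\<^esub>j\<in>X. w j) \<in> S" if "finite X" "\<And>j. j \<in> X \<Longrightarrow> w j \<in> S" for X :: "nat set" and w
    using that
  proof (induction X rule: finite_induct)
    case (insert x F)
    then have "w \<in> F \<rightarrow> carrier T" "w x \<in> carrier T" using S by auto
    then show ?case using insert add by simp
  qed (simp add: zero_S)
  have b: "TH.\<iota> (basis_elt B a) \<in> S" if "a \<in> carrier \<Gamma>" for a
    using that
  proof (induction "\<Sum>i\<in>I. nat (a i)" arbitrary: a rule: less_induct)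
    case less
    show ?case
    proof (cases "a = \<one>\<^bsub>\<Gamma>\<^esub>")
      case True
      then have "TH.\<iota> (basis_elt B a) = \<one>\<^bsub>T\<^esub>"
        by (simp add: TH.T.tens_one GA.A.one_A GA.group_hopf_sel(2))
      then show ?thesis using one by simp
    next
      case False
      have a: "a \<in> (\<Pi>\<^sub>E i\<in>I. {0..<2 * int l})" using less.prems by (simp add: Gam_sel)
      have "\<exists>i\<in>I. a i \<noteq> 0"
      proof (rule ccontr)
        assume "\<not> (\<exists>i\<in>I. a i \<noteq> 0)"
        then have "a = \<one>\<^bsub>\<Gamma>\<^esub>" using a by (auto simp: Gam_sel PiE_iff extensional_def fun_eq_iff)
        then show False using False by simp
      qed
      then obtain i where i: "i \<in> I" "a i \<noteq> 0" by blast
      have ai: "0 < a i" "a i < 2 * int l" using i a by (force simp: PiE_iff)+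
      let ?b = "a(i := a i - 1)"
      have b: "?b \<in> carrier \<Gamma>"
        unfolding Gam_sel
      proof (rule PiE_I)
        show "?b k \<in> {0..<2 * int l}" if "k \<in> I" for k
          using PiE_mem[OF a that] ai by (cases "k = i") auto
        show "?b k = undefined" if "k \<notin> I" for k
          using PiE_arb[OF a that] that i by auto
      qed
      have "(\<Sum>k\<in>I. nat (?b k)) < (\<Sum>k\<in>I. nat (a k))"
        by (rule sum_strict_mono_ex1) (use i ai in auto)
      then have IH: "TH.\<iota> (basis_elt B ?b) \<in> S" using less.hyps b by blast
      have "gg i \<otimes>\<^bsub>\<Gamma>\<^esub> ?b = a"
        using a i ai by (auto simp: Gam_sel Gam_gen_def PiE_iff extensional_def fun_eq_iff)
      then have "basis_elt B a = basis_elt B (gg i) \<otimes>\<^bsub>GA.A.A\<^esub> basis_elt B ?b"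
        using i b by (simp add: GA.A.basis_mult)
      also have "\<dots> = basis_elt B (gg i) \<otimes>\<^bsub>GH\<^esub> basis_elt B ?b"
        by (simp add: group_hopf_def Let_def)
      finally have "TH.\<iota> (basis_elt B a) = G i \<otimes>\<^bsub>T\<^esub> TH.\<iota> (basis_elt B ?b)"
        using i b D(3)[of "basis_elt B (gg i)" "basis_elt B ?b"] by (simp add: G_eq)
      then show ?thesis using mult[OF G[OF i(1)] IH] by simp
    qed
  qed
  have left: "TH.\<iota> x \<in> S" if "x \<in> carrier GA.A.A" for x
    using that
  proof (induction x rule: GA.A.monoid_algebra_induct)
    case zero
    have "TH.\<iota> \<zero>\<^bsub>GH\<^esub> = \<zero>\<^bsub>T\<^esub>"
      by (rule lin_map_zero[OF alg_hom_lin_map[OF \<iota>_hom] TH.H.is_module TH.T.TA.is_module])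
    then show ?case using zero_S by (simp add: group_hopf_def Let_def)
  next
    case (add f g)
    have "TH.\<iota> (f \<oplus>\<^bsub>GH\<^esub> g) = TH.\<iota> f \<oplus>\<^bsub>T\<^esub> TH.\<iota> g" using add by (intro D(2)) (simp_all add: GA.group_hopf_sel)
    then show ?case using add assms(3) by (simp add: group_hopf_def Let_def)
  next
    case (smult a x)
    have "TH.\<iota> (a \<odot>\<^bsub>GH\<^esub> basis_elt B x) = a \<odot>\<^bsub>T\<^esub> TH.\<iota> (basis_elt B x)" using smult by (intro D(5)) (simp_all add: GA.group_hopf_sel)
    then show ?case using smult assms(4) b by (simp add: group_hopf_def Let_def)
  qed
  have inc: "TH.\<iota>' (env_incl B LL x) \<in> S" if x: "x \<in> carrier LL" for x
  proof -
    have lm: "(\<lambda>x. TH.\<iota>' (env_incl B LL x)) \<in> lin_map B LL T"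
      by (rule lin_map_comp[OF EA.incl_lin_map]) (use alg_hom_lin_map[OF \<iota>'_hom] in \<open>simp add: env_hopf_def Let_def\<close>)
    have "TH.\<iota>' (env_incl B LL x) = (\<Oplus>\<^bsub>T\<^esub>i\<in>I. x i \<odot>\<^bsub>T\<^esub> t i)"
      unfolding t_eq by (rule lin_expand[OF TH.T.TA.is_module lm x])
    also have "\<dots> \<in> S" by (rule sum) (use x t in \<open>auto intro!: smult\<close>)
    finally show ?thesis .
  qed
  have ops: "x \<otimes>\<^bsub>UH\<^esub> y = x \<otimes>\<^bsub>EA.U\<^esub> y" "x \<oplus>\<^bsub>UH\<^esub> y = x \<oplus>\<^bsub>EA.U\<^esub> y" "a \<odot>\<^bsub>UH\<^esub> y = a \<odot>\<^bsub>EA.U\<^esub> y" for a x y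
    by (simp_all add: env_hopf_def Let_def)
  have right: "TH.\<iota>' y \<in> S" if "y \<in> carrier EA.F.Q.Q" for y
    using that
  proof (induction y rule: EA.F.induct)
    case one
    show ?case using D'(4) assms(2) unfolding EA.U_eq by (simp only: EA.env_hopf_sel(2))
  next
    case (add u w)
    then show ?case using D'(2)[of u w] assms(3) unfolding EA.U_eq ops EA.env_hopf_sel by simp
  next
    case (smult a u)
    then show ?case using D'(5)[of a u] assms(4) unfolding EA.U_eq ops EA.env_hopf_sel by simp
  next
    case (gen x u)
    have "env_incl B LL x \<in> carrier EA.U" using lin_mapD(1)[OF EA.incl_lin_map] gen by simp
    then show ?case using gen D'(3)[of "env_incl B LL x" u] mult inc
      unfolding EA.U_eq EA.gen_eq ops EA.env_hopf_sel by simp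
  qed
  have "z \<in> S" if "z \<in> carrier T" for z
    using that
  proof (induction z rule: TH.T.tensor_induct)
    case (tens x y)
    have "tens B GH UH x y = TH.\<iota> x \<otimes>\<^bsub>T\<^esub> TH.\<iota>' y"
      using tens by (simp add: TH.T.tens_mult)
    then show ?case using mult left[of x] right[of y] tens unfolding EA.U_eq EA.env_hopf_sel GA.group_hopf_sel by simp
  qed (use add in blast)
  then show ?thesis using S by blast
qed

lemma T_hom_eqI:
  assumes P: "assoc_algebra B P" and \<phi>: "\<phi> \<in> alg_hom B T P" and \<psi>: "\<psi> \<in> alg_hom B T P"
    and eq: "\<And>i. i \<in> I \<Longrightarrow> \<phi> (G i) = \<psi> (G i)" "\<And>i. i \<in> I \<Longrightarrow> \<phi> (t i) = \<psi> (t i)"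
    and x: "x \<in> carrier T"
  shows "\<phi> x = \<psi> x"
proof -
  have "{x \<in> carrier T. \<phi> x = \<psi> x} = carrier T"
    by (rule T_subalgebra) (auto simp: alg_homD[OF \<phi>] alg_homD[OF \<psi>] eq)
  then show ?thesis using x by blast
qed

text \<open>
  The universal property: elements \<open>\<kappa> i\<close> of order dividing \<open>2 * l\<close> and arbitrary \<open>\<eta> i\<close> in a commutative
  algebra define a homomorphism. Exponents in \<open>\<Gamma>\<close> are representatives modulo \<open>2 * l\<close>, whence \<open>pow_mod\<close>.
\<close>

lemma T_lift:
  assumes P: "comm_alg B P" and \<kappa>: "\<And>i. i \<in> I \<Longrightarrow> \<kappa> i \<in> carrier P" and \<eta>: "\<And>i. i \<in> I \<Longrightarrow> \<eta> i \<in> carrier P"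
    and pow: "\<And>i. i \<in> I \<Longrightarrow> \<kappa> i [^]\<^bsub>P\<^esub> (2 * l) = \<one>\<^bsub>P\<^esub>"
  obtains \<Psi> where "\<Psi> \<in> alg_hom B T P"
    "\<And>i. i \<in> I \<Longrightarrow> \<Psi> (G i) = \<kappa> i" "\<And>i. i \<in> I \<Longrightarrow> \<Psi> (t i) = \<eta> i"
proof -
  interpret P: comm_alg B P by fact
  define \<phi>0 where "\<phi>0 a = finprod P (\<lambda>i. \<kappa> i [^]\<^bsub>P\<^esub> nat (a i)) I" for a :: "nat \<Rightarrow> int"
  have c: "(\<lambda>i. \<kappa> i [^]\<^bsub>P\<^esub> u i) \<in> I \<rightarrow> carrier P" for u :: "nat \<Rightarrow> nat" using \<kappa> by auto
  have \<phi>0c: "\<phi>0 \<in> carrier \<Gamma> \<rightarrow> carrier P" unfolding \<phi>0_def using c by (auto intro!: P.M.finprod_closed)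
  have \<phi>0m: "\<phi>0 (a \<otimes>\<^bsub>\<Gamma>\<^esub> b) = \<phi>0 a \<otimes>\<^bsub>P\<^esub> \<phi>0 b" if ab: "a \<in> carrier \<Gamma>" "b \<in> carrier \<Gamma>" for a b
  proof -
    have "\<phi>0 (a \<otimes>\<^bsub>\<Gamma>\<^esub> b) = finprod P (\<lambda>i. \<kappa> i [^]\<^bsub>P\<^esub> nat (a i) \<otimes>\<^bsub>P\<^esub> \<kappa> i [^]\<^bsub>P\<^esub> nat (b i)) I"
      unfolding \<phi>0_def
    proof (rule P.M.finprod_cong')
      fix i assume i: "i \<in> I"
      have ge: "0 \<le> a i" "0 \<le> b i" using ab i by (force simp: Gam_sel PiE_iff)+
      have "nat ((a i + b i) mod (2 * int l)) = (nat (a i) + nat (b i)) mod (2 * l)"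
        using ge by (simp add: nat_mod_distrib nat_add_distrib nat_mult_distrib)
      then show "\<kappa> i [^]\<^bsub>P\<^esub> nat ((a \<otimes>\<^bsub>\<Gamma>\<^esub> b) i) = \<kappa> i [^]\<^bsub>P\<^esub> nat (a i) \<otimes>\<^bsub>P\<^esub> \<kappa> i [^]\<^bsub>P\<^esub> nat (b i)"
        using i \<kappa>[OF i] P.M.pow_mod[OF \<kappa>[OF i] pow[OF i]] by (simp add: Gam_sel P.M.nat_pow_mult)
    qed (use \<kappa> in auto)
    then show ?thesis unfolding \<phi>0_def using c by (simp add: P.M.finprod_multf)
  qed
  have \<phi>01: "\<phi>0 \<one>\<^bsub>\<Gamma>\<^esub> = \<one>\<^bsub>P\<^esub>" unfolding \<phi>0_def by (rule P.M.finprod_one_eqI) (simp add: Gam_sel)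
  have \<kappa>1: "\<kappa> i [^]\<^bsub>P\<^esub> (1::nat) = \<kappa> i" if "i \<in> I" for i using \<kappa>[OF that] P.M.nat_pow_Suc[of "\<kappa> i" 0] by (simp add: One_nat_def)
  have \<phi>0g: "\<phi>0 (gg i) = \<kappa> i" if i: "i \<in> I" for i
  proof -
    have "\<phi>0 (gg i) = finprod P (\<lambda>j. if i = j then \<kappa> j else \<one>\<^bsub>P\<^esub>) I"
      unfolding \<phi>0_def
    proof (rule P.M.finprod_cong')
      fix j assume j: "j \<in> I"
      show "\<kappa> j [^]\<^bsub>P\<^esub> nat (gg i j) = (if i = j then \<kappa> j else \<one>\<^bsub>P\<^esub>)"
      proof (cases "j = i")
        case True
        then have "nat (gg i j) = 1" using j by (simp add: Gam_gen_def)
        then show ?thesis using True \<kappa>1[OF j] by (simp only: simp_thms if_True)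
      qed (use j in \<open>simp add: Gam_gen_def\<close>)
    qed (use \<kappa> in auto)
    also have "\<dots> = \<kappa> i" by (rule P.M.finprod_singleton) (use i \<kappa> in auto)
    finally show ?thesis .
  qed
  have \<phi>: "lin_ext B P \<phi>0 \<in> alg_hom B GH P"
    using GA.A.lin_ext_alg_hom[OF P.assoc_algebra_axioms \<phi>0c \<phi>0m \<phi>01] by (simp add: GA.group_hopf_sel)
  define g where "g x = (\<Oplus>\<^bsub>P\<^esub>i\<in>I. x i \<odot>\<^bsub>P\<^esub> \<eta> i)" for x :: "nat \<Rightarrow> 'a"
  have gl: "g \<in> lin_map B LL P"
  proof (rule lin_mapI)
    have cl: "(\<lambda>i. x i \<odot>\<^bsub>P\<^esub> \<eta> i) \<in> I \<rightarrow> carrier P" if "x \<in> carrier LL" for x using that \<eta> by auto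
    show "g x \<in> carrier P" if "x \<in> carrier LL" for x unfolding g_def using cl[OF that] by (rule P.M.finsum_closed)
    show "g (x \<oplus>\<^bsub>LL\<^esub> y) = g x \<oplus>\<^bsub>P\<^esub> g y" if xy: "x \<in> carrier LL" "y \<in> carrier LL" for x y
    proof -
      have "g (x \<oplus>\<^bsub>LL\<^esub> y) = (\<Oplus>\<^bsub>P\<^esub>i\<in>I. x i \<odot>\<^bsub>P\<^esub> \<eta> i \<oplus>\<^bsub>P\<^esub> y i \<odot>\<^bsub>P\<^esub> \<eta> i)"
        unfolding g_def by (rule P.M.finsum_cong') (use xy \<eta> in \<open>auto simp: P.smult_l_distr PiE_iff\<close>)
      then show ?thesis unfolding g_def using P.M.finsum_addf[OF cl[OF xy(1)] cl[OF xy(2)]] by simp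
    qed
    show "g (a \<odot>\<^bsub>LL\<^esub> x) = a \<odot>\<^bsub>P\<^esub> g x" if ax: "a \<in> carrier B" "x \<in> carrier LL" for a x
    proof -
      have "g (a \<odot>\<^bsub>LL\<^esub> x) = (\<Oplus>\<^bsub>P\<^esub>i\<in>I. a \<odot>\<^bsub>P\<^esub> (x i \<odot>\<^bsub>P\<^esub> \<eta> i))"
        unfolding g_def by (rule P.M.finsum_cong') (use ax \<eta> in \<open>auto simp: P.smult_assoc1 PiE_iff\<close>)
      then show ?thesis unfolding g_def using P.finsum_smult_ldistr[OF _ ax(1) cl[OF ax(2)]] by simp
    qed
  qed
  have gb: "g (lie_basis B I i) = \<eta> i" if i: "i \<in> I" for i
  proof -
    have "g (lie_basis B I i) = (\<Oplus>\<^bsub>P\<^esub>j\<in>I. if i = j then \<eta> j else \<zero>\<^bsub>P\<^esub>)"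
      unfolding g_def by (rule P.M.finsum_cong') (use \<eta> in \<open>auto simp: lie_basis_def\<close>)
    also have "\<dots> = \<eta> i" by (rule P.M.finsum_singleton) (use i \<eta> in auto)
    finally show ?thesis .
  qed
  define \<psi> where "\<psi> = coset_lift B P (word_prod P g)"
  note \<psi> = EA.env_lift[OF P gl refl, folded \<psi>_def]
  have \<psi>h: "\<psi> \<in> alg_hom B UH P" using \<psi>(1) by (simp only: EA.env_hopf_sel)
  let ?h = "\<lambda>(x, y). lin_ext B P \<phi>0 x \<otimes>\<^bsub>P\<^esub> \<psi> y"
  note \<Psi> = TH.T.lift_coproduct[OF P \<phi> \<psi>h, where h = ?h, OF prod.case]
  show ?thesis
  proof (rule that)
    show "coset_lift B P ?h \<in> alg_hom B T P" by (rule \<Psi>(1))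
    fix i assume i: "i \<in> I"
    have "coset_lift B P ?h (G i) = lin_ext B P \<phi>0 (basis_elt B (gg i)) \<otimes>\<^bsub>P\<^esub> \<psi> \<one>\<^bsub>UH\<^esub>"
      unfolding G_eq by (rule \<Psi>(2)) (use i in \<open>simp_all\<close>)
    also have "\<dots> = \<kappa> i"
      using i \<kappa> alg_homD(4)[OF \<psi>h] by (simp add: GA.A.lin_ext_basis[OF P.is_module \<phi>0c] \<phi>0g)
    finally show "coset_lift B P ?h (G i) = \<kappa> i" .
    have "coset_lift B P ?h (t i) = lin_ext B P \<phi>0 \<one>\<^bsub>GH\<^esub> \<otimes>\<^bsub>P\<^esub> \<psi> (tt i)"
      unfolding t_eq by (rule \<Psi>(2)) (use i in \<open>simp_all\<close>)
    also have "\<dots> = \<eta> i"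
      using i \<eta> alg_homD(4)[OF \<phi>] \<psi>(2)[OF lb_closed] gb by simp
    finally show "coset_lift B P ?h (t i) = \<eta> i" .
  qed
qed

lemma gg_pow: "i \<in> I \<Longrightarrow> basis_elt B (gg i) [^]\<^bsub>GA.A.A\<^esub> (k::nat) = basis_elt B (\<lambda>j\<in>I. if j = i then int k mod (2 * int l) else 0)"
proof (induction k)
  case 0
  then show ?case by (auto simp: GA.A.one_A Gam_sel intro!: arg_cong[of _ _ "basis_elt B"])
next
  case (Suc k)
  let ?a = "\<lambda>k. \<lambda>j\<in>I. if j = i then int k mod (2 * int l) else 0"
  have a: "?a k \<in> carrier \<Gamma>" using l by (auto simp: Gam_sel)
  have "?a k \<otimes>\<^bsub>\<Gamma>\<^esub> gg i = ?a (Suc k)"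
    using Suc.prems l by (auto simp: Gam_sel Gam_gen_def fun_eq_iff mod_simps add.commute)
  then show ?case
    by (simp only: GA.A.A.M.nat_pow_Suc Suc.IH[OF Suc.prems] GA.A.basis_mult[OF a gg_closed[OF Suc.prems]])
qed

lemma G_pow:
  assumes i: "i \<in> I"
  shows "G i [^]\<^bsub>T\<^esub> (2 * l) = \<one>\<^bsub>T\<^esub>"
proof -
  have "basis_elt B (gg i) [^]\<^bsub>GH\<^esub> (2 * l) = basis_elt B (gg i) [^]\<^bsub>GA.A.A\<^esub> (2 * l)"
    by (simp add: nat_pow_def group_hopf_def Let_def)
  also have "\<dots> = \<one>\<^bsub>GH\<^esub>"
    unfolding gg_pow[OF i] GA.group_hopf_sel(2) by (auto simp: GA.A.one_A Gam_sel intro!: arg_cong[of _ _ "basis_elt B"])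
  finally have p: "basis_elt B (gg i) [^]\<^bsub>GH\<^esub> (2 * l) = \<one>\<^bsub>GH\<^esub>" .
  have "G i [^]\<^bsub>T\<^esub> (2 * l) = TH.\<iota> (basis_elt B (gg i) [^]\<^bsub>GH\<^esub> (2 * l))"
    unfolding G_eq
    by (rule alg_hom_pow[OF \<iota>_hom TH.H.M.monoid_axioms TH.T.TA.M.monoid_axioms, symmetric]) (use i in simp)
  then show ?thesis unfolding p using alg_homD(4)[OF \<iota>_hom] by simp
qed

abbreviation Tbas where "Tbas i \<equiv> \<lambda>y::nat \<times> nat. G i [^]\<^bsub>T\<^esub> fst y \<otimes>\<^bsub>T\<^esub> t i [^]\<^bsub>T\<^esub> snd y"
abbreviation TJ :: "(nat \<times> nat) set" where "TJ \<equiv> {..<2 * l} \<times> UNIV"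
abbreviation Tmono where "Tmono c \<equiv> finprod T (\<lambda>i. Tbas i (c i)) I"
abbreviation TP :: "(nat \<Rightarrow> nat \<times> nat) set" where "TP \<equiv> PiE I (\<lambda>_. TJ)"

lemma Tbas_closed: "i \<in> I \<Longrightarrow> Tbas i \<in> TJ \<rightarrow> carrier T"
  by auto

lemma Tmono_closed: "Tmono \<in> TP \<rightarrow> carrier T"
  by (auto intro!: TC.M.finprod_closed)

lemma Tbas_stab:
  assumes i: "i \<in> I"
  shows "G i \<in> stab B T (Tbas i) TJ" "t i \<in> stab B T (Tbas i) TJ"
proof -
  note u = Tbas_closed[OF i]
  show "G i \<in> stab B T (Tbas i) TJ"
  proof (rule TC.stabI[OF u])
    fix y assume y: "y \<in> TJ"
    define y' where "y' = (if Suc (fst y) = 2 * l then 0 else Suc (fst y), snd y)"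
    have y': "y' \<in> TJ" using y l by (auto simp: y'_def)
    have "G i \<otimes>\<^bsub>T\<^esub> Tbas i y = G i [^]\<^bsub>T\<^esub> Suc (fst y) \<otimes>\<^bsub>T\<^esub> t i [^]\<^bsub>T\<^esub> snd y"
      using i by (simp add: TC.M.m_ac)
    also have "\<dots> = Tbas i y'"
    proof (cases "Suc (fst y) = 2 * l")
      case True
      then have p: "G i [^]\<^bsub>T\<^esub> Suc (fst y) = \<one>\<^bsub>T\<^esub>" using G_pow[OF i] by (simp only:)
      show ?thesis unfolding p y'_def using True by (simp add: TH.T.TA.M.nat_pow_0)
    qed (simp only: y'_def if_False fst_conv snd_conv)
    finally show "G i \<otimes>\<^bsub>T\<^esub> Tbas i y \<in> lin_span B T (Tbas i) TJ"
      using TH.T.TA.span_base[OF u y'] by simp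
  qed (use i in simp)
  show "t i \<in> stab B T (Tbas i) TJ"
  proof (rule TC.stabI[OF u])
    fix y assume y: "y \<in> TJ"
    have y': "(fst y, Suc (snd y)) \<in> TJ" using y by auto
    have "t i \<otimes>\<^bsub>T\<^esub> Tbas i y = Tbas i (fst y, Suc (snd y))"
      using i by (simp add: TC.M.m_ac)
    then show "t i \<otimes>\<^bsub>T\<^esub> Tbas i y \<in> lin_span B T (Tbas i) TJ"
      using TH.T.TA.span_base[OF u y'] by simp
  qed simp
qed

text \<open>
  The monomials span, by the stabilizer argument; multiplication by \<open>G i\<close> closes up at the exponent
  \<open>2 * l\<close>.
\<close>

lemma T_span: "x \<in> carrier T \<Longrightarrow> x \<in> lin_span B T Tmono TP"
proof -
  assume x: "x \<in> carrier T"
  note u = Tmono_closed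
  have st: "y \<in> stab B T Tmono TP" if "i \<in> I" "y \<in> stab B T (Tbas i) TJ" for i y
    using TC.stab_products[where bas = Tbas, OF _ Tbas_closed that(1) that(2)] by blast
  have all: "stab B T Tmono TP = carrier T"
    by (rule T_subalgebra[OF TC.stab_subset[OF u] TC.stab_one[OF u] TC.stab_add[OF u] TC.stab_smult[OF u] TC.stab_mult[OF u]])
       (simp_all only: st[OF _ Tbas_stab(1)] st[OF _ Tbas_stab(2)])
  have z: "(\<lambda>i\<in>I. (0::nat, 0::nat)) \<in> TP" using l by auto
  have "Tmono (\<lambda>i\<in>I. (0::nat, 0::nat)) = \<one>\<^bsub>T\<^esub>"
    by (rule TC.M.finprod_one_eqI) simp
  then have one: "\<one>\<^bsub>T\<^esub> \<in> lin_span B T Tmono TP" using TH.T.TA.span_base[OF u z] by (simp only:)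
  have "x \<in> stab B T Tmono TP" using x by (simp only: all)
  then have "x \<otimes>\<^bsub>T\<^esub> \<one>\<^bsub>T\<^esub> \<in> lin_span B T Tmono TP" using one unfolding stab_def by blast
  then show ?thesis using x by (simp only: TH.T.TA.M.r_one)
qed

abbreviation TT where "TT \<equiv> tensor B T T"

lemma comult_gens:
  assumes i: "i \<in> I"
  shows "comult (GamU \<theta> l B) (G i) = tens B T T (G i) (G i)"
    and "comult (GamU \<theta> l B) (t i) = tens B T T (t i) \<one>\<^bsub>T\<^esub> \<oplus>\<^bsub>TT\<^esub> tens B T T \<one>\<^bsub>T\<^esub> (t i)"
proof -
  have b: "basis_elt B (gg i) \<in> carrier GH" using i by simp
  have "comult (GamU \<theta> l B) (G i) = TH.\<alpha> (comult GH (basis_elt B (gg i)))"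
    unfolding G_eq by (rule TH.tensor_comult(2)[OF b])
  also have "comult GH (basis_elt B (gg i)) = tens B GH GH (basis_elt B (gg i)) (basis_elt B (gg i))"
  proof -
    have "tens B GH GH = tens B GA.A.A GA.A.A" by (simp add: group_hopf_def Let_def)
    then show ?thesis using GA.group_comult(2)[OF gg_closed[OF i]] by simp
  qed
  also have "TH.\<alpha> \<dots> = tens B T T (G i) (G i)"
    unfolding G_eq by (rule TH.\<alpha>(2)[OF b b])
  finally show "comult (GamU \<theta> l B) (G i) = tens B T T (G i) (G i)" .
  have tc: "tt i \<in> carrier UH" "\<one>\<^bsub>UH\<^esub> \<in> carrier UH" by (simp_all)
  have tp: "tens B UH UH x y \<in> carrier (tensor B UH UH)" if "x \<in> carrier UH" "y \<in> carrier UH" for x y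
    using that by (rule TH.HH'.tens_closed)
  have one: "TH.\<iota>' \<one>\<^bsub>UH\<^esub> = \<one>\<^bsub>T\<^esub>" by (rule alg_homD(4)[OF \<iota>'_hom])
  have "comult (GamU \<theta> l B) (t i) = TH.\<beta> (comult UH (tt i))"
    unfolding t_eq by (rule TH.tensor_comult(3)[OF tc(1)])
  also have "comult UH (tt i) = tens B UH UH (tt i) \<one>\<^bsub>UH\<^esub> \<oplus>\<^bsub>tensor B UH UH\<^esub> tens B UH UH \<one>\<^bsub>UH\<^esub> (tt i)"
  proof -
    have "tens B UH UH = tens B EA.U EA.U" "tensor B UH UH = tensor B EA.U EA.U"
      by (simp_all add: env_hopf_def Let_def)
    then show ?thesis using EA.env_comult(2)[OF lb_closed[of i]] by (simp add: EA.env_hopf_sel(2))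
  qed
  also have "TH.\<beta> \<dots> = TH.\<beta> (tens B UH UH (tt i) \<one>\<^bsub>UH\<^esub>) \<oplus>\<^bsub>TT\<^esub> TH.\<beta> (tens B UH UH \<one>\<^bsub>UH\<^esub> (tt i))"
    by (rule alg_homD(2)[OF TH.\<beta>(1) tp[OF tc] tp[OF tc(2,1)]])
  also have "\<dots> = tens B T T (t i) \<one>\<^bsub>T\<^esub> \<oplus>\<^bsub>TT\<^esub> tens B T T \<one>\<^bsub>T\<^esub> (t i)"
    unfolding TH.\<beta>(2)[OF tc] TH.\<beta>(2)[OF tc(2,1)] t_eq one ..
  finally show "comult (GamU \<theta> l B) (t i) = tens B T T (t i) \<one>\<^bsub>T\<^esub> \<oplus>\<^bsub>TT\<^esub> tens B T T \<one>\<^bsub>T\<^esub> (t i)" .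
qed

lemma counit_gens:
  assumes i: "i \<in> I"
  shows "counit (GamU \<theta> l B) (G i) = \<one>" "counit (GamU \<theta> l B) (t i) = \<zero>"
  unfolding G_eq t_eq
  using i TH.tensor_counit(2)[OF bas_closed[OF gg_closed[OF i]]] TH.tensor_counit(3)[OF tt_closed[of i]]
    GA.group_counit(2)[OF gg_closed[OF i]] EA.env_counit(2)[OF lb_closed[of i]] by simp_all

lemma antipode_gens:
  assumes i: "i \<in> I"
  shows "antipode (GamU \<theta> l B) (G i) \<in> carrier T" "G i \<otimes>\<^bsub>T\<^esub> antipode (GamU \<theta> l B) (G i) = \<one>\<^bsub>T\<^esub>"
    "antipode (GamU \<theta> l B) (t i) = \<ominus>\<^bsub>T\<^esub> t i"
proof -
  interpret Gm: comm_group \<Gamma> by (rule Gam_comm)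
  have g: "gg i \<in> carrier \<Gamma>" "inv\<^bsub>\<Gamma>\<^esub> gg i \<in> carrier \<Gamma>" using i by simp_all
  have e: "antipode (GamU \<theta> l B) (G i) = TH.\<iota> (basis_elt B (inv\<^bsub>\<Gamma>\<^esub> gg i))"
    unfolding G_eq TH.tensor_antipode(2)[OF bas_closed[OF g(1)]] GA.group_antipode(2)[OF g(1)] ..
  show "antipode (GamU \<theta> l B) (G i) \<in> carrier T"
    unfolding e by (rule alg_homD(1)[OF \<iota>_hom bas_closed[OF g(2)]])
  have "basis_elt B (gg i) \<otimes>\<^bsub>GH\<^esub> basis_elt B (inv\<^bsub>\<Gamma>\<^esub> gg i) = basis_elt B (gg i) \<otimes>\<^bsub>GA.A.A\<^esub> basis_elt B (inv\<^bsub>\<Gamma>\<^esub> gg i)"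
    by (simp add: group_hopf_def Let_def)
  also have "\<dots> = \<one>\<^bsub>GH\<^esub>" using g by (simp add: GA.A.basis_mult GA.A.one_A GA.group_hopf_sel(2))
  finally have m: "basis_elt B (gg i) \<otimes>\<^bsub>GH\<^esub> basis_elt B (inv\<^bsub>\<Gamma>\<^esub> gg i) = \<one>\<^bsub>GH\<^esub>" .
  show "G i \<otimes>\<^bsub>T\<^esub> antipode (GamU \<theta> l B) (G i) = \<one>\<^bsub>T\<^esub>"
    unfolding e unfolding G_eq
    using alg_homD(3)[OF \<iota>_hom bas_closed[OF g(1)] bas_closed[OF g(2)]] alg_homD(4)[OF \<iota>_hom] unfolding m by simp
  have "antipode UH (tt i) = \<ominus>\<^bsub>UH\<^esub> tt i"
    using EA.env_antipode(2)[OF lb_closed[of i]] by (simp add: env_hopf_def Let_def a_inv_def m_inv_def)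
  then show "antipode (GamU \<theta> l B) (t i) = \<ominus>\<^bsub>T\<^esub> t i"
    unfolding t_eq TH.tensor_antipode(3)[OF tt_closed]
    using lin_map_minus[OF alg_hom_lin_map[OF \<iota>'_hom] TH.H'.is_module TH.T.TA.is_module tt_closed[of i]] by simp
qed

end

section \<open>The isomorphism\<close>

lemma finsum_restrict_scalars [simp]: "finsum (restrict_scalars f M) = finsum M"
  by (simp add: finsum_def finprod_def restrict_scalars_def fun_eq_iff)

lemma qbinom_Suc_self: "qbinom (Suc t) t = qint (Suc t)"
proof -
  have "qint (Suc 0) = 1"
    using qdiff_Suc_nonzero[of 0] by (simp add: qint_qdiff One_nat_def del: qdiff_1)
  moreover have "qfact 0 = 1" by (simp add: qfact_def)
  moreover have "qfact t \<noteq> 0" by (simp add: qfact_def)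
  ultimately show ?thesis by (simp add: qbinom_def qfact_Suc)
qed

text \<open>
  The complex numbers as an algebra along a map \<open>h\<close>, the target of the evaluations of \<open>V\<^sup>0 \<otimes> B\<close>.
\<close>

definition complex_alg :: "('b \<Rightarrow> complex) \<Rightarrow> ('b, complex) module"
  where "complex_alg h =
    \<lparr>carrier = UNIV, monoid.mult = (*), one = 1, zero = 0, add = (+), module.smult = (\<lambda>b x. h b * x)\<rparr>"

lemma complex_alg_sel [simp]:
  "carrier (complex_alg h) = UNIV" "monoid.mult (complex_alg h) = (*)" "one (complex_alg h) = 1"
  "zero (complex_alg h) = 0" "add (complex_alg h) = (+)" "module.smult (complex_alg h) = (\<lambda>b x. h b * x)"
  by (simp_all add: complex_alg_def)

lemma complex_alg_cring: "cring (complex_alg h)"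
  by (rule cringI; (rule abelian_groupI comm_monoidI)?)
     (auto simp: algebra_simps intro: exI[of _ "- _"])

locale specialization = root_of_unity l B \<iota> + V0_hopf_alg \<theta> d e S + Ga: GamU_alg B \<theta> l
  for l and B (structure) and \<iota> and \<theta> and d and e and S
begin

sublocale X: scalar_ext laurent B V f
  by (intro scalar_ext.intro scalar_ext_axioms.intro Lr.is_cring Bf.is_cring V_comm_alg f_hom)

\<comment> \<open>From here on \<open>W\<close> is used as a \<open>B\<close>-algebra only, not as a tensor product over \<open>laurent\<close>.\<close>
declare X.W_sel [simp del]

abbreviation W where "W \<equiv> X.W"
abbreviation j where "j \<equiv> X.j"
abbreviation I where "I \<equiv> {1..\<theta>}"
abbreviation \<kappa> where "\<kappa> i \<equiv> V0B_elt \<theta> B f (Kgen i)"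
abbreviation \<eta> where "\<eta> i \<equiv> h_elt \<theta> B f l i"
abbreviation c where "c \<equiv> inv ([l] \<cdot> \<one>)"

lemma j_closed [simp]: "x \<in> carrier V \<Longrightarrow> j x \<in> carrier W"
  using alg_homD(1)[OF X.j_alg_hom] by simp

lemmas j_simps = alg_homD(2-5)[OF X.j_alg_hom, unfolded restrict_scalars_sel]

lemma j_pow: "x \<in> carrier V \<Longrightarrow> j (x [^]\<^bsub>V\<^esub> (m::nat)) = j x [^]\<^bsub>W\<^esub> m"
  by (induction m) (simp_all add: j_simps X.W.M.nat_pow_Suc V.M.nat_pow_Suc)

lemma rs_module: "Module.module laurent (restrict_scalars f W)"
  using restrict_scalars_comm_alg[OF X.W_comm_alg Lr.is_cring f_hom]
  by (simp add: comm_alg_def assoc_algebra_def)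

lemma j_finsum:
  assumes "finite A" "u \<in> A \<rightarrow> carrier V"
  shows "j (finsum V u A) = (\<Oplus>\<^bsub>W\<^esub>a\<in>A. j (u a))"
  using lin_map_finsum[OF alg_hom_lin_map[OF X.j_alg_hom] V.is_module rs_module assms] by simp

lemma \<kappa>_eq: "\<kappa> i = j (K i)"
  by (simp add: V0B_elt_def)

lemma c: "c \<in> carrier B" "f (of_nat l) \<otimes> c = \<one>"
  using f_unit[OF _ f_l] by (simp_all add: f_of_nat)

lemma \<eta>_eq:
  assumes i: "i \<in> I"
  shows "\<eta> i = c \<odot>\<^bsub>W\<^esub> j (Hel l i)"
proof -
  have u: "(\<lambda>s. pcoef l s \<odot>\<^bsub>V\<^esub> (k i s \<otimes>\<^bsub>V\<^esub> K i [^]\<^bsub>V\<^esub> phi l s)) \<in> {1..l} \<rightarrow> carrier V"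
    using i by (auto intro!: V.M.m_closed V.smult_closed)
  have s: "(\<Oplus>\<^bsub>W\<^esub>s\<in>{1..l}. j (pcoef l s \<odot>\<^bsub>V\<^esub> (k i s \<otimes>\<^bsub>V\<^esub> K i [^]\<^bsub>V\<^esub> phi l s)))
    = (\<Oplus>\<^bsub>W\<^esub>s\<in>{1..l}. f (pcoef l s) \<odot>\<^bsub>W\<^esub> (j (k i s) \<otimes>\<^bsub>W\<^esub> j (K i) [^]\<^bsub>W\<^esub> phi l s))"
    by (rule X.W.M.finsum_cong') (use i in \<open>auto simp: j_simps j_pow f_simps intro!: X.W.M.m_closed X.W.smult_closed\<close>)
  show ?thesis
    using i V.M.finsum_closed[OF u]
    by (simp add: h_elt_def V0B_elt_def Let_def Hel_def j_simps j_pow j_finsum[OF _ u] s)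
qed

lemma H_closed: "i \<in> I \<Longrightarrow> Hel l i \<in> carrier V"
  using l by simp

lemma \<kappa>\<eta>_closed [simp]: "i \<in> I \<Longrightarrow> \<kappa> i \<in> carrier W" "i \<in> I \<Longrightarrow> \<eta> i \<in> carrier W"
  using c H_closed by (simp_all add: \<kappa>_eq \<eta>_eq)

text \<open>
  Since \<open>f (qdiff l) = 0\<close>, the relation \<open>Hel_rel\<close> becomes \<open>1 = K ^ (2 * l)\<close>.
\<close>

lemma \<kappa>_pow:
  assumes i: "i \<in> I"
  shows "\<kappa> i [^]\<^bsub>W\<^esub> (2 * l) = \<one>\<^bsub>W\<^esub>"
proof -
  have z: "f (qdiff l) = \<zero>" using evL_qdiff[of l] by (simp add: f_evL)
  have "j (K i [^]\<^bsub>V\<^esub> (2 * l)) = f (qdiff l) \<odot>\<^bsub>W\<^esub> j (Hel l i) \<oplus>\<^bsub>W\<^esub> \<one>\<^bsub>W\<^esub>"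
    using H_closed[OF i] by (simp add: Hel_rel[OF l i, symmetric] j_simps)
  then show ?thesis using H_closed[OF i] i by (simp add: z j_pow \<kappa>_eq)
qed

text \<open>
  The form of \<open>ev_Hel\<close> that survives specialization, with \<open>qdiff l\<close> cancelled.
\<close>

lemma ev_Hel_sum:
  assumes i: "i \<in> I"
  shows "ev p (Hel l i) = qv ^ l * (\<Sum>k<snd (p i). (qv ^ (2 * l)) ^ k)"
proof -
  have q: "qdiff l * qv ^ l = qv ^ (2 * l) - 1"
    by (simp add: qdiff_def left_diff_distrib mult_2 power_add flip: power_mult_distrib)
  have "(qv ^ l * (\<Sum>k<snd (p i). (qv ^ (2 * l)) ^ k)) * qdiff l
      = (qdiff l * qv ^ l) * (\<Sum>k<snd (p i). (qv ^ (2 * l)) ^ k)"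
    by (simp only: mult_ac)
  also have "\<dots> = (qv ^ (2 * l)) ^ snd (p i) - 1"
    unfolding q by (rule power_diff_1_eq[symmetric])
  also have "\<dots> = ev p (Hel l i) * qdiff l"
    unfolding ev_Hel[OF l i] by (simp add: mult_ac flip: power_mult)
  finally show ?thesis using l by simp
qed

abbreviation CB where "CB \<equiv> complex_alg jC"

lemma CB_comm_alg: "comm_alg B CB"
proof -
  interpret C: cring CB by (rule complex_alg_cring)
  have "assoc_algebra B CB"
    by (intro assoc_algebra.intro moduleI assoc_algebra_axioms.intro Bf.is_cring C.is_abelian_group C.ring_axioms)
       (simp_all add: jC_hom algebra_simps)
  then show ?thesis by (rule comm_algI) simp
qed

interpretation CB: comm_alg B CB
  by (rule CB_comm_alg)

lemma pow_CB [simp]: "x [^]\<^bsub>CB\<^esub> (m::nat) = x ^ m"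
  by (induction m) (simp_all add: CB.M.nat_pow_Suc)

text \<open>
  Evaluation at a point, followed by the specialization of \<open>qv\<close> to \<open>\<zeta>\<close>.
\<close>

definition EB :: "(nat \<Rightarrow> nat \<times> nat) \<Rightarrow> _ \<Rightarrow> complex"
  where "EB p = coset_lift laurent (restrict_scalars f CB) (\<lambda>(x, b). jC b * evL \<zeta> (ev p x))"

lemma EB:
  shows EB_hom: "EB p \<in> alg_hom B W CB"
    and EB_j: "x \<in> carrier V \<Longrightarrow> EB p (j x) = evL \<zeta> (ev p x)"
proof -
  have \<phi>: "(\<lambda>x. evL \<zeta> (ev p x)) \<in> alg_hom laurent V (restrict_scalars f CB)"
    by (rule alg_homI) (simp_all add: ev_simps evL_more jC_f)
  show "EB p \<in> alg_hom B W CB"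
    unfolding EB_def by (rule X.base_change_lift(1)[OF CB_comm_alg \<phi>]) simp
  show "x \<in> carrier V \<Longrightarrow> EB p (j x) = evL \<zeta> (ev p x)"
    unfolding EB_def by (rule X.base_change_lift(2)[OF CB_comm_alg \<phi>]) simp_all
qed

lemma jC_c: "jC c = 1 / of_nat l"
proof -
  have e: "evL \<zeta> (of_nat k) = of_nat k" for k by (induction k) (simp_all add: ev_\<zeta>)
  have "of_nat l * jC c = jC (f (of_nat l) \<otimes> c)"
    using c(1) by (simp add: jC_hom jC_f f_simps e)
  then have "of_nat l * jC c = 1" unfolding c(2) by simp
  then show ?thesis using l by (simp add: field_simps)
qed

lemma EB_gens:
  assumes i: "i \<in> I"
  shows "EB p (\<kappa> i) = (-1) ^ fst (p i) * \<zeta> ^ snd (p i)"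
    and "EB p (\<eta> i) = \<zeta> ^ l * of_nat (snd (p i)) / of_nat l"
proof -
  have m: "evL \<zeta> (-1) = -1" using evL_minus[of 1] by (simp add: ev_\<zeta>)
  show "EB p (\<kappa> i) = (-1) ^ fst (p i) * \<zeta> ^ snd (p i)"
    using i by (simp add: \<kappa>_eq EB_j Kval_def evL_more m)
  have "EB p (j (Hel l i)) = \<zeta> ^ l * (\<Sum>k<snd (p i). (\<zeta> ^ (2 * l)) ^ k)"
    using H_closed[OF i] by (simp add: EB_j ev_Hel_sum[OF i] evL_more del: power_mult)
  also have "\<dots> = \<zeta> ^ l * of_nat (snd (p i))" unfolding \<zeta>_2l by simp
  finally show "EB p (\<eta> i) = \<zeta> ^ l * of_nat (snd (p i)) / of_nat l"
    using c H_closed[OF i] alg_homD(5)[OF EB_hom] by (simp add: \<eta>_eq[OF i] jC_c)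
qed

lemma exists_\<Psi>:
  obtains \<Psi> where "\<Psi> \<in> alg_hom B Ga.T W"
    "\<And>i. i \<in> I \<Longrightarrow> \<Psi> (Ga.G i) = \<kappa> i" "\<And>i. i \<in> I \<Longrightarrow> \<Psi> (Ga.t i) = \<eta> i"
  by (rule Ga.T_lift[OF X.W_comm_alg, of \<kappa> \<eta>]) (simp_all only: \<kappa>\<eta>_closed \<kappa>_pow)

context
  fixes \<Psi>
  assumes \<Psi>: "\<Psi> \<in> alg_hom B Ga.T W"
    and \<Psi>_G: "\<And>i. i \<in> I \<Longrightarrow> \<Psi> (Ga.G i) = \<kappa> i"
    and \<Psi>_t: "\<And>i. i \<in> I \<Longrightarrow> \<Psi> (Ga.t i) = \<eta> i"
begin

lemmas \<Psi>_simps = alg_homD[OF \<Psi>]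

lemma CB_hom_prods:
  assumes \<chi>: "\<chi> \<in> alg_hom B Ga.T CB" and A: "finite A" "u \<in> A \<rightarrow> carrier Ga.T"
  shows "\<chi> (finsum Ga.T u A) = (\<Sum>a\<in>A. \<chi> (u a))" "\<chi> (finprod Ga.T u A) = (\<Prod>a\<in>A. \<chi> (u a))"
proof -
  note D = alg_homD[OF \<chi>]
  have z: "\<chi> \<zero>\<^bsub>Ga.T\<^esub> = 0"
    using lin_map_zero[OF alg_hom_lin_map[OF \<chi>] Ga.TH.T.TA.is_module CB.is_module] by simp
  show "\<chi> (finsum Ga.T u A) = (\<Sum>a\<in>A. \<chi> (u a))"
    using A by (induction A rule: finite_induct) (auto simp: z D Pi_iff Ga.TH.T.TA.M.finsum_closed)
  show "\<chi> (finprod Ga.T u A) = (\<Prod>a\<in>A. \<chi> (u a))"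
    using A by (induction A rule: finite_induct) (auto simp: D Pi_iff Ga.TC.M.finprod_closed)
qed

lemma \<chi>_mono:
  assumes b: "b \<in> Ga.TP"
  shows "EB p (\<Psi> (Ga.Tmono b)) = (\<Prod>i\<in>I. gval (b i) (p i))"
proof -
  have \<chi>: "(\<lambda>x. EB p (\<Psi> x)) \<in> alg_hom B Ga.T CB" by (rule alg_hom_comp[OF \<Psi> EB_hom])
  note D = alg_homD[OF \<chi>]
    and P = alg_hom_pow[OF \<chi> Ga.TH.T.TA.M.monoid_axioms CB.M.monoid_axioms, unfolded pow_CB]
  have "EB p (\<Psi> (Ga.Tmono b)) = (\<Prod>i\<in>I. EB p (\<Psi> (Ga.Tbas i (b i))))"
    by (rule CB_hom_prods(2)[OF \<chi>]) (use b in auto)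
  also have "\<dots> = (\<Prod>i\<in>I. gval (b i) (p i))"
  proof (rule prod.cong)
    fix i assume i: "i \<in> I"
    have "EB p (\<Psi> (Ga.Tbas i (b i))) = EB p (\<kappa> i) ^ fst (b i) * EB p (\<eta> i) ^ snd (b i)"
      using i D(3)[of "Ga.G i [^]\<^bsub>Ga.T\<^esub> fst (b i)" "Ga.t i [^]\<^bsub>Ga.T\<^esub> snd (b i)"] by (simp add: P \<Psi>_G \<Psi>_t)
    then show "EB p (\<Psi> (Ga.Tbas i (b i))) = gval (b i) (p i)"
      using i by (simp only: EB_gens gval_def)
  qed simp
  finally show ?thesis .
qed

text \<open>
  The complex values of the images of the monomials are the functions \<open>gval\<close>, which are independent.
\<close>

lemma \<Psi>_inj0:
  assumes x: "x \<in> carrier Ga.T" and 0: "\<Psi> x = \<zero>\<^bsub>W\<^esub>"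
  shows "x = \<zero>\<^bsub>Ga.T\<^esub>"
proof -
  obtain A a where A: "finite A" "A \<subseteq> Ga.TP" "a \<in> Ga.TP \<rightarrow> carrier B"
    and xe: "x = (\<Oplus>\<^bsub>Ga.T\<^esub>b\<in>A. a b \<odot>\<^bsub>Ga.T\<^esub> Ga.Tmono b)"
    using Ga.TH.T.TA.span_expand[OF Ga.Tmono_closed Ga.T_span[OF x]] by blast
  have ac: "a b \<in> carrier B" if "b \<in> A" for b using A that by blast
  have mc: "Ga.Tmono b \<in> carrier Ga.T" if "b \<in> A" for b
    using A(2) that Ga.Tmono_closed by blast
  have "(\<Sum>b\<in>A. jC (a b) * (\<Prod>i\<in>I. gval (b i) (p i))) = 0" for p
  proof -
    have \<chi>: "(\<lambda>x. EB p (\<Psi> x)) \<in> alg_hom B Ga.T CB" by (rule alg_hom_comp[OF \<Psi> EB_hom])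
    have "EB p (\<Psi> x) = (\<Sum>b\<in>A. EB p (\<Psi> (a b \<odot>\<^bsub>Ga.T\<^esub> Ga.Tmono b)))"
      unfolding xe by (rule CB_hom_prods(1)[OF \<chi> A(1)]) (use ac mc in auto)
    also have "\<dots> = (\<Sum>b\<in>A. jC (a b) * (\<Prod>i\<in>I. gval (b i) (p i)))"
    proof (rule sum.cong)
      fix b assume b: "b \<in> A"
      then have "b \<in> Ga.TP" using A(2) by blast
      from \<chi>_mono[OF this] alg_homD(5)[OF \<chi> ac[OF b] mc[OF b]]
      show "EB p (\<Psi> (a b \<odot>\<^bsub>Ga.T\<^esub> Ga.Tmono b)) = jC (a b) * (\<Prod>i\<in>I. gval (b i) (p i))" by simp
    qed simp
    finally show ?thesis
      using 0 lin_map_zero[OF alg_hom_lin_map[OF EB_hom] X.W.is_module CB.is_module] by simp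
  qed
  then have "jC (a b) = 0" if "b \<in> A" for b
    by (intro indep_funsD[OF indep_funs_PiE[OF indep_gval finite_atLeastAtMost] A(1,2) _ that, where c = "\<lambda>b. jC (a b)"])
  then have "a b = \<zero>" if "b \<in> A" for b using jC_zero_iff ac that by blast
  then show ?thesis
    unfolding xe by (intro Ga.TH.T.TA.M.add.finprod_one_eqI) (simp add: mc)
qed

lemma \<Psi>_inj: "inj_on \<Psi> (carrier Ga.T)"
proof (rule inj_onI)
  fix x y assume xy: "x \<in> carrier Ga.T" "y \<in> carrier Ga.T" and eq: "\<Psi> x = \<Psi> y"
  have "\<Psi> (x \<ominus>\<^bsub>Ga.T\<^esub> y) = \<Psi> x \<ominus>\<^bsub>W\<^esub> \<Psi> y"
    by (rule lin_map_diff[OF alg_hom_lin_map[OF \<Psi>] Ga.TH.T.TA.is_module X.W.is_module xy])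
  also have "\<dots> = \<zero>\<^bsub>W\<^esub>"
    unfolding eq a_minus_def using \<Psi>_simps(1)[OF xy(2)] by (rule X.W.M.r_neg)
  finally have "x \<ominus>\<^bsub>Ga.T\<^esub> y = \<zero>\<^bsub>Ga.T\<^esub>" using xy by (intro \<Psi>_inj0) simp_all
  moreover have "(x \<ominus>\<^bsub>Ga.T\<^esub> y) \<oplus>\<^bsub>Ga.T\<^esub> y = x"
    using xy by (simp add: a_minus_def Ga.TH.T.TA.M.a_assoc Ga.TH.T.TA.M.l_neg)
  ultimately show "x = y" using xy by simp
qed

abbreviation R where "R \<equiv> \<Psi> ` carrier Ga.T"

lemma R_closed:
  shows R_sub: "y \<in> R \<Longrightarrow> y \<in> carrier W"
    and R_one: "\<one>\<^bsub>W\<^esub> \<in> R"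
    and R_add: "y \<in> R \<Longrightarrow> z \<in> R \<Longrightarrow> y \<oplus>\<^bsub>W\<^esub> z \<in> R"
    and R_mult: "y \<in> R \<Longrightarrow> z \<in> R \<Longrightarrow> y \<otimes>\<^bsub>W\<^esub> z \<in> R"
    and R_smult: "b \<in> carrier B \<Longrightarrow> y \<in> R \<Longrightarrow> b \<odot>\<^bsub>W\<^esub> y \<in> R"
proof -
  show "y \<in> R \<Longrightarrow> y \<in> carrier W" using \<Psi>_simps(1) by auto
  show "\<one>\<^bsub>W\<^esub> \<in> R" using \<Psi>_simps(4) by (intro image_eqI[of _ \<Psi> "\<one>\<^bsub>Ga.T\<^esub>"]) simp_all
  show "y \<oplus>\<^bsub>W\<^esub> z \<in> R" if "y \<in> R" "z \<in> R"
    using that by (auto simp: \<Psi>_simps(2)[symmetric])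
  show "y \<otimes>\<^bsub>W\<^esub> z \<in> R" if "y \<in> R" "z \<in> R"
    using that by (auto simp: \<Psi>_simps(3)[symmetric])
  show "b \<odot>\<^bsub>W\<^esub> y \<in> R" if "b \<in> carrier B" "y \<in> R"
    using that by (auto simp: \<Psi>_simps(5)[symmetric])
qed

text \<open>
  The part of \<open>V\<^sup>0\<close> that is mapped into the image of \<open>\<Psi>\<close>. It is a subalgebra, and it is closed under
  division by Laurent polynomials with nonzero specialization.
\<close>

definition Q where "Q = {y \<in> carrier V. j y \<in> R}"

lemma
  shows Q_sub: "y \<in> Q \<Longrightarrow> y \<in> carrier V"
    and Q_one: "\<one>\<^bsub>V\<^esub> \<in> Q"
    and Q_add: "y \<in> Q \<Longrightarrow> z \<in> Q \<Longrightarrow> y \<oplus>\<^bsub>V\<^esub> z \<in> Q"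
    and Q_mult: "y \<in> Q \<Longrightarrow> z \<in> Q \<Longrightarrow> y \<otimes>\<^bsub>V\<^esub> z \<in> Q"
    and Q_smult: "a \<in> L \<Longrightarrow> y \<in> Q \<Longrightarrow> a \<odot>\<^bsub>V\<^esub> y \<in> Q"
  by (simp_all add: Q_def j_simps R_closed f_simps)

lemma Q_minus: "y \<in> Q \<Longrightarrow> z \<in> Q \<Longrightarrow> y \<ominus>\<^bsub>V\<^esub> z \<in> Q"
proof -
  assume y: "y \<in> Q" and z: "z \<in> Q"
  have zc: "z \<in> carrier V" by (rule Q_sub[OF z])
  have "(-1) \<odot>\<^bsub>V\<^esub> z = \<ominus>\<^bsub>V\<^esub> z"
    using V.smult_l_minus[of 1 z] V.smult_one[OF zc] zc by simp
  then show ?thesis using Q_add[OF y Q_smult[OF _ z, of "-1"]] by (simp add: a_minus_def)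
qed

lemma Q_pow: "y \<in> Q \<Longrightarrow> y [^]\<^bsub>V\<^esub> (m::nat) \<in> Q"
  by (induction m) (simp_all add: V.M.nat_pow_Suc Q_one Q_mult)

lemma Q_finsum:
  assumes "finite A" "\<And>a. a \<in> A \<Longrightarrow> u a \<in> Q"
  shows "(\<Oplus>\<^bsub>V\<^esub>a\<in>A. u a) \<in> Q"
  using assms
proof (induction A rule: finite_induct)
  case empty
  have "0 \<odot>\<^bsub>V\<^esub> \<one>\<^bsub>V\<^esub> = \<zero>\<^bsub>V\<^esub>" using V.smult_l_null[OF V.M.one_closed] by simp
  then show ?case using Q_smult[OF L_zero Q_one] by simp
next
  case (insert a A)
  then have "u \<in> A \<rightarrow> carrier V" "u a \<in> carrier V" using Q_sub by auto
  then show ?case using insert by (simp add: Q_add)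
qed

lemma Q_div:
  assumes a: "a \<in> L" "f a \<noteq> \<zero>" and y: "y \<in> carrier V" "a \<odot>\<^bsub>V\<^esub> y \<in> Q"
  shows "y \<in> Q"
proof -
  note u = f_unit[OF a]
  have "inv (f a) \<odot>\<^bsub>W\<^esub> (f a \<odot>\<^bsub>W\<^esub> j y) \<in> R"
    using R_smult[OF conjunct1[OF u], of "f a \<odot>\<^bsub>W\<^esub> j y"] y a by (simp add: Q_def j_simps)
  moreover have "inv (f a) \<odot>\<^bsub>W\<^esub> (f a \<odot>\<^bsub>W\<^esub> j y) = j y"
    using u f_simps(1)[OF a(1)] y(1) Bf.m_comm[of "inv (f a)" "f a"]
    by (simp add: X.W.smult_assoc1[symmetric] X.W.smult_one)
  ultimately show ?thesis using y by (simp add: Q_def)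
qed

text \<open>
  The inverse of \<open>K\<close> is specialized to \<open>\<kappa> ^ (2 * l - 1)\<close>.
\<close>

lemma Q_K:
  assumes i: "i \<in> I"
  shows "K i \<in> Q" "K' i \<in> Q"
proof -
  have "\<kappa> i \<in> R" using i \<Psi>_G[OF i, symmetric] by (intro image_eqI[of _ \<Psi> "Ga.G i"]) simp_all
  then show K: "K i \<in> Q" using i by (simp add: Q_def \<kappa>_eq)
  have c: "j (K i) \<in> carrier W" "j (K' i) \<in> carrier W" using i by simp_all
  have 1: "j (K i) \<otimes>\<^bsub>W\<^esub> j (K' i) = \<one>\<^bsub>W\<^esub>"
    using i rel_inv[OF i] by (simp add: j_simps[symmetric])
  have e: "2 * l = Suc (2 * l - 1)" using l by simp
  have "j (K' i) = (j (K i) [^]\<^bsub>W\<^esub> (2 * l)) \<otimes>\<^bsub>W\<^esub> j (K' i)"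
    using \<kappa>_pow[OF i] c by (simp add: \<kappa>_eq)
  also have "\<dots> = (j (K i) [^]\<^bsub>W\<^esub> (2 * l - 1) \<otimes>\<^bsub>W\<^esub> j (K i)) \<otimes>\<^bsub>W\<^esub> j (K' i)"
    by (subst e) (simp only: X.W.M.nat_pow_Suc)
  also have "\<dots> = j (K i) [^]\<^bsub>W\<^esub> (2 * l - 1)"
    using c 1 by (simp add: X.W.M.m_assoc)
  also have "\<dots> = j (K i [^]\<^bsub>V\<^esub> (2 * l - 1))" using i by (simp add: j_pow)
  finally show "K' i \<in> Q" using i Q_pow[OF K, of "2 * l - 1"] by (simp add: Q_def)
qed

lemma Q_Hel:
  assumes i: "i \<in> I"
  shows "Hel l i \<in> Q"
proof -
  have "\<eta> i \<in> R" using i \<Psi>_t[OF i, symmetric] by (intro image_eqI[of _ \<Psi> "Ga.t i"]) simp_all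
  then have "f (of_nat l) \<odot>\<^bsub>W\<^esub> \<eta> i \<in> R" by (rule R_smult[rotated]) (simp add: f_simps)
  moreover have "f (of_nat l) \<odot>\<^bsub>W\<^esub> \<eta> i = j (Hel l i)"
    using c H_closed[OF i] by (simp add: \<eta>_eq[OF i] f_simps X.W.smult_assoc1[symmetric] X.W.smult_one)
  ultimately show ?thesis using H_closed[OF i] by (simp add: Q_def)
qed

text \<open>
  In \<open>Hel l i\<close> the generator \<open>k l\<close> occurs with the coefficient \<open>pcoef l l\<close>, and \<open>phi l l = 0\<close>. All the
  other terms are already known to be in \<open>Q\<close>.
\<close>

lemma Q_k_l:
  assumes i: "i \<in> I" and k: "\<And>t. t < l \<Longrightarrow> k i t \<in> Q"
  shows "k i l \<in> Q"
proof -
  let ?u = "\<lambda>s. pcoef l s \<odot>\<^bsub>V\<^esub> (k i s \<otimes>\<^bsub>V\<^esub> K i [^]\<^bsub>V\<^esub> phi l s)"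
  have uc: "?u s \<in> carrier V" if "s \<ge> 1" for s using i that l by (intro V.smult_closed V.M.m_closed) auto
  let ?s = "\<Oplus>\<^bsub>V\<^esub>s\<in>{1..<l}. ?u s"
  have s: "?s \<in> Q"
    by (rule Q_finsum) (use k i in \<open>auto intro!: Q_smult Q_mult Q_pow Q_K\<close>)
  have inv: "K i [^]\<^bsub>V\<^esub> l \<otimes>\<^bsub>V\<^esub> K' i [^]\<^bsub>V\<^esub> l = \<one>\<^bsub>V\<^esub>"
    using i by (simp add: V.M.nat_pow_distrib[symmetric] rel_inv)
  have e: "{1..l} = insert l {1..<l}" using l by auto
  have "(\<Oplus>\<^bsub>V\<^esub>s\<in>{1..l}. ?u s) = Hel l i \<otimes>\<^bsub>V\<^esub> K' i [^]\<^bsub>V\<^esub> l"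
    using i uc inv unfolding Hel_def by (simp add: V.M.m_assoc V.M.finsum_closed Pi_iff)
  also have "\<dots> \<in> Q" using i by (intro Q_mult Q_Hel Q_pow Q_K)
  finally have "(\<Oplus>\<^bsub>V\<^esub>s\<in>{1..l}. ?u s) \<in> Q" .
  moreover have "(\<Oplus>\<^bsub>V\<^esub>s\<in>{1..l}. ?u s) = ?u l \<oplus>\<^bsub>V\<^esub> ?s"
    unfolding e using uc l by (subst V.M.finsum_insert) (auto simp: Pi_iff)
  ultimately have "(?u l \<oplus>\<^bsub>V\<^esub> ?s) \<ominus>\<^bsub>V\<^esub> ?s \<in> Q" using Q_minus[OF _ s] by simp
  moreover have "(?u l \<oplus>\<^bsub>V\<^esub> ?s) \<ominus>\<^bsub>V\<^esub> ?s = ?u l"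
    using uc[OF l] Q_sub[OF s] by (simp only: a_minus_def V.M.a_assoc V.M.r_neg V.M.r_zero V.M.a_inv_closed)
  moreover have "?u l = pcoef l l \<odot>\<^bsub>V\<^esub> k i l" using i by (simp add: phi_def)
  ultimately show ?thesis
    using i f_pcoef l by (intro Q_div[of "pcoef l l" "k i l"]) simp_all
qed

text \<open>
  If \<open>l\<close> does not divide \<open>t\<close>, then \<open>k t\<close> comes from \<open>k (t - 1)\<close> by \<open>k_step\<close>, because \<open>qint t\<close> is invertible.
  For \<open>t = l * q\<close> with \<open>q > 1\<close> the product relation of \<open>k l\<close> and \<open>k (l * (q - 1))\<close> has the invertible
  coefficient \<open>qbinom (l * q) l\<close>.
\<close>

lemma Q_k:
  assumes i: "i \<in> I"
  shows "k i t \<in> Q"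
proof (induction t rule: less_induct)
  case (less t)
  have k1: "k i 1 \<in> Q"
  proof (rule Q_div[of "qdiff 1"])
    show "qdiff 1 \<odot>\<^bsub>V\<^esub> k i 1 \<in> Q" unfolding rel_one[OF i] by (intro Q_minus Q_K i)
  qed (use i f_qdiff_1 in simp_all)
  consider "t = 0" | "t > 0" "\<not> l dvd t" | "t = l" | q where "q > 1" "t = l * q"
    using l by (metis dvdE gr0I less_one linorder_neqE_nat mult.right_neutral mult_0_right)
  then show ?case
  proof cases
    case 1
    then show ?thesis using i by (simp add: rel_zero Q_one)
  next
    case 2
    then obtain u where u: "t = Suc u" by (cases t) auto
    have ku: "k i u \<in> Q" using less u by simp
    show ?thesis
    proof (rule Q_div[of "qbinom (Suc u) u"])
      show "f (qbinom (Suc u) u) \<noteq> \<zero>" unfolding qbinom_Suc_self using f_qint 2 u by simp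
      show "qbinom (Suc u) u \<odot>\<^bsub>V\<^esub> k i t \<in> Q"
        unfolding u k_step[OF i] using k1 ku i by (intro Q_minus Q_smult Q_mult Q_K) simp_all
    qed (use i in simp_all)
  next
    case 3
    then show ?thesis using Q_k_l[OF i] less by simp
  next
    case 4
    then have e: "l + l * (q - 1) = t" using l by (cases q) auto
    have lt: "l < t" "l * (q - 1) < t" using 4 l by auto
    show ?thesis
    proof (rule Q_div[of "qbinom t l"])
      show "f (qbinom t l) \<noteq> \<zero>" using f_qbinom[of q] 4 by simp
      have "(\<Oplus>\<^bsub>V\<^esub>j\<in>{0..l * (q - 1)}. ((-1) ^ j * qv ^ (l * (l * (q - 1) - j)) * qbinom (l + j - 1) j) \<odot>\<^bsub>V\<^esub>
         (K i [^]\<^bsub>V\<^esub> j \<otimes>\<^bsub>V\<^esub> k i l \<otimes>\<^bsub>V\<^esub> k i (l * (q - 1) - j))) \<in> Q"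
        using i lt by (intro Q_finsum Q_smult Q_mult Q_pow Q_K less) simp_all
      then show "qbinom t l \<odot>\<^bsub>V\<^esub> k i t \<in> Q"
        using rel_mult[OF i l, of "l * (q - 1)"] unfolding e by (simp only:)
    qed (use i in simp_all)
  qed
qed

lemma \<Psi>_surj: "R = carrier W"
proof -
  have Q: "Q = carrier V"
    by (rule V_subalgebra[OF _ Q_one Q_add Q_smult Q_mult Q_K Q_k]) (auto simp: Q_def)
  have "z \<in> R" if "z \<in> carrier W" for z
    using that
  proof (induction z rule: X.W_induct)
    case (smult b x)
    then have "j x \<in> R" using Q by (auto simp: Q_def)
    then show ?case using smult by (intro R_smult)
  qed (rule R_add)
  then show ?thesis using R_sub by blast
qed

text \<open>
  Two homomorphisms on \<open>B \<Gamma> \<otimes> U(h)\<close> are compared on generators. By \<open>d_Hel\<close> the only deviation of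
  \<open>Hel\<close> from a primitive element is the factor \<open>K ^ (2 * l)\<close>, which is \<open>1\<close> after specialization.
\<close>

lemma \<Psi>_comult:
  assumes x: "x \<in> carrier Ga.T"
  shows "X.ext_comult d (\<Psi> x) = tensor_map B W W \<Psi> \<Psi> (comult (GamU \<theta> l B) x)"
proof (rule Ga.T_hom_eqI[OF X.WW.assoc_alg _ _ _ _ x])
  note C = X.ext_comult[OF d_hom] and C' = Ga.TH.tensor_comult
    and M = Ga.TH.TT.tensor_map_alg_hom[OF X.W.assoc_algebra_axioms X.W.assoc_algebra_axioms \<Psi> \<Psi>]
    and E = X.ext_tensor_map
  show "(\<lambda>x. X.ext_comult d (\<Psi> x)) \<in> alg_hom B Ga.T X.WW" by (rule alg_hom_comp[OF \<Psi> C(1)])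
  show "(\<lambda>x. tensor_map B W W \<Psi> \<Psi> (comult (GamU \<theta> l B) x)) \<in> alg_hom B Ga.T X.WW"
    by (rule alg_hom_comp[OF C'(1) M(1)])
  fix i assume i: "i \<in> I"
  have K: "K i \<in> carrier V" using i by simp
  have H: "Hel l i \<in> carrier V" by (rule H_closed[OF i])
  have one: "\<Psi> \<one>\<^bsub>Ga.T\<^esub> = \<one>\<^bsub>W\<^esub>" by (rule \<Psi>_simps(4))
  have tc: "Ga.G i \<in> carrier Ga.T" "Ga.t i \<in> carrier Ga.T" "\<one>\<^bsub>Ga.T\<^esub> \<in> carrier Ga.T"
    using Ga.Gt_closed i by simp_all
  show "X.ext_comult d (\<Psi> (Ga.G i)) = tensor_map B W W \<Psi> \<Psi> (comult (GamU \<theta> l B) (Ga.G i))"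
    unfolding \<Psi>_G[OF i] Ga.comult_gens(1)[OF i] M(2)[OF tc(1) tc(1)] \<kappa>_eq C(2)[OF K] d_K[OF i] E(2)[OF K K] ..
  have tt: "tens laurent V V (Hel l i) \<one>\<^bsub>V\<^esub> \<in> carrier VV"
    "tens laurent V V (K i [^]\<^bsub>V\<^esub> (2 * l)) (Hel l i) \<in> carrier VV"
    using H K by (simp_all add: VT.tens_closed)
  have "X.ext_comult d (j (Hel l i)) = tens B W W (j (Hel l i)) \<one>\<^bsub>W\<^esub> \<oplus>\<^bsub>X.WW\<^esub> tens B W W \<one>\<^bsub>W\<^esub> (j (Hel l i))"
    unfolding C(2)[OF H] d_Hel[OF l i]
    using alg_homD(2)[OF E(1) tt] H K E(2)[OF H V.M.one_closed] E(2)[OF V.M.nat_pow_closed[OF K] H] \<kappa>_pow[OF i]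
    by (simp add: j_simps(3) j_pow \<kappa>_eq)
  moreover have "X.ext_comult d (\<Psi> (Ga.t i)) = c \<odot>\<^bsub>X.WW\<^esub> X.ext_comult d (j (Hel l i))"
    unfolding \<Psi>_t[OF i] \<eta>_eq[OF i] using alg_homD(5)[OF C(1) c(1)] H by simp
  moreover have "\<dots> = tens B W W (\<eta> i) \<one>\<^bsub>W\<^esub> \<oplus>\<^bsub>X.WW\<^esub> tens B W W \<one>\<^bsub>W\<^esub> (\<eta> i)" if
    "X.ext_comult d (j (Hel l i)) = tens B W W (j (Hel l i)) \<one>\<^bsub>W\<^esub> \<oplus>\<^bsub>X.WW\<^esub> tens B W W \<one>\<^bsub>W\<^esub> (j (Hel l i))"
    unfolding that \<eta>_eq[OF i] using c(1) H
    by (simp add: X.WW.tens_ops X.WW.tens_closed X.WW.TA.smult_r_distr)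
  moreover have "tensor_map B W W \<Psi> \<Psi> (comult (GamU \<theta> l B) (Ga.t i))
    = tens B W W (\<eta> i) \<one>\<^bsub>W\<^esub> \<oplus>\<^bsub>X.WW\<^esub> tens B W W \<one>\<^bsub>W\<^esub> (\<eta> i)"
    unfolding Ga.comult_gens(2)[OF i]
      alg_homD(2)[OF M(1) Ga.TH.TT.tens_closed[OF tc(2,3)] Ga.TH.TT.tens_closed[OF tc(3,2)]]
      M(2)[OF tc(2,3)] M(2)[OF tc(3,2)] \<Psi>_t[OF i] one ..
  ultimately show "X.ext_comult d (\<Psi> (Ga.t i)) = tensor_map B W W \<Psi> \<Psi> (comult (GamU \<theta> l B) (Ga.t i))"
    by simp
qed

lemma \<Psi>_counit:
  assumes x: "x \<in> carrier Ga.T"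
  shows "X.ext_counit e (\<Psi> x) = counit (GamU \<theta> l B) x"
proof (rule Ga.T_hom_eqI[OF _ _ _ _ _ x])
  note C = X.ext_counit[OF e_hom]
  interpret RA: comm_alg B "regular_alg B" by (rule Bf.regular_alg_comm_alg)
  show "assoc_algebra B (regular_alg B)" by (rule RA.assoc_algebra_axioms)
  show "(\<lambda>x. X.ext_counit e (\<Psi> x)) \<in> alg_hom B Ga.T (regular_alg B)" by (rule alg_hom_comp[OF \<Psi> C(1)])
  show "counit (GamU \<theta> l B) \<in> alg_hom B Ga.T (regular_alg B)" by (rule Ga.TH.tensor_counit(1))
  fix i assume i: "i \<in> I"
  have K: "K i \<in> carrier V" using i by simp
  have H: "Hel l i \<in> carrier V" by (rule H_closed[OF i])
  show "X.ext_counit e (\<Psi> (Ga.G i)) = counit (GamU \<theta> l B) (Ga.G i)"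
    unfolding \<Psi>_G[OF i] Ga.counit_gens(1)[OF i] \<kappa>_eq C(2)[OF K] e_K(1)[OF i] by (rule f_simps(4))
  show "X.ext_counit e (\<Psi> (Ga.t i)) = counit (GamU \<theta> l B) (Ga.t i)"
    unfolding \<Psi>_t[OF i] Ga.counit_gens(2)[OF i] \<eta>_eq[OF i]
    using alg_homD(5)[OF C(1) c(1)] H C(2)[OF H] e_Hel[OF l i] c(1) by simp
qed

text \<open>
  The same comparison on generators; \<open>S_Hel\<close> loses its factor \<open>K ^ (2 * l)\<close> in the same way.
\<close>

lemma \<Psi>_antipode:
  assumes x: "x \<in> carrier Ga.T"
  shows "X.ext_antipode S (\<Psi> x) = \<Psi> (antipode (GamU \<theta> l B) x)"
proof (rule Ga.T_hom_eqI[OF X.W.assoc_algebra_axioms _ _ _ _ x])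
  note C = X.ext_antipode[OF S_hom]
  show "(\<lambda>x. X.ext_antipode S (\<Psi> x)) \<in> alg_hom B Ga.T W" by (rule alg_hom_comp[OF \<Psi> C(1)])
  show "(\<lambda>x. \<Psi> (antipode (GamU \<theta> l B) x)) \<in> alg_hom B Ga.T W"
    by (rule alg_hom_comp[OF Ga.TH.tensor_antipode(1) \<Psi>])
  fix i assume i: "i \<in> I"
  have K: "K i \<in> carrier V" "K' i \<in> carrier V" using i by simp_all
  have H: "Hel l i \<in> carrier V" by (rule H_closed[OF i])
  have SH: "S (Hel l i) \<in> carrier V" by (rule S_simps(1)[OF H])
  have tc: "Ga.G i \<in> carrier Ga.T" "Ga.t i \<in> carrier Ga.T" using Ga.Gt_closed i by simp_all
  note A = Ga.antipode_gens[OF i]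
  let ?a = "\<Psi> (antipode (GamU \<theta> l B) (Ga.G i))"
  have ac: "?a \<in> carrier W" by (rule \<Psi>_simps(1)[OF A(1)])
  have "j (K i) \<otimes>\<^bsub>W\<^esub> ?a = \<one>\<^bsub>W\<^esub>"
    using \<Psi>_simps(3)[OF tc(1) A(1)] unfolding A(2) \<Psi>_simps(4) \<Psi>_G[OF i] \<kappa>_eq by simp
  moreover have "j (K' i) \<otimes>\<^bsub>W\<^esub> j (K i) = \<one>\<^bsub>W\<^esub>"
    using K rel_inv[OF i] V.M.m_comm[OF K(2,1)] by (simp add: j_simps[symmetric])
  ultimately have "?a = j (K' i)"
    using ac K X.W.M.inv_unique by (metis j_closed)
  then show "X.ext_antipode S (\<Psi> (Ga.G i)) = \<Psi> (antipode (GamU \<theta> l B) (Ga.G i))"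
    unfolding \<Psi>_G[OF i] \<kappa>_eq C(2)[OF K(1)] S_K(1)[OF i] by simp
  have "j (K i [^]\<^bsub>V\<^esub> (2 * l) \<otimes>\<^bsub>V\<^esub> S (Hel l i) \<oplus>\<^bsub>V\<^esub> Hel l i) = j \<zero>\<^bsub>V\<^esub>"
    unfolding S_Hel[OF l i] ..
  then have "\<kappa> i [^]\<^bsub>W\<^esub> (2 * l) \<otimes>\<^bsub>W\<^esub> j (S (Hel l i)) \<oplus>\<^bsub>W\<^esub> j (Hel l i) = \<zero>\<^bsub>W\<^esub>"
    using H SH K lin_map_zero[OF alg_hom_lin_map[OF X.j_alg_hom] V.is_module rs_module]
    by (simp add: j_simps j_pow \<kappa>_eq)
  then have "j (S (Hel l i)) \<oplus>\<^bsub>W\<^esub> j (Hel l i) = \<zero>\<^bsub>W\<^esub>"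
    using \<kappa>_pow[OF i] SH by simp
  then have s: "j (S (Hel l i)) = \<ominus>\<^bsub>W\<^esub> j (Hel l i)"
    using H SH X.W.M.minus_equality by simp
  have "\<Psi> (antipode (GamU \<theta> l B) (Ga.t i)) = \<ominus>\<^bsub>W\<^esub> \<eta> i"
    unfolding A(3) lin_map_minus[OF alg_hom_lin_map[OF \<Psi>] Ga.TH.T.TA.is_module X.W.is_module tc(2)] \<Psi>_t[OF i] ..
  also have "\<dots> = c \<odot>\<^bsub>W\<^esub> j (S (Hel l i))"
    unfolding \<eta>_eq[OF i] s using c(1) H by (simp add: X.W.smult_r_minus)
  also have "\<dots> = X.ext_antipode S (\<Psi> (Ga.t i))"
    unfolding \<Psi>_t[OF i] \<eta>_eq[OF i] using alg_homD(5)[OF C(1) c(1)] H C(2)[OF H] by simp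
  finally show "X.ext_antipode S (\<Psi> (Ga.t i)) = \<Psi> (antipode (GamU \<theta> l B) (Ga.t i))" by simp
qed

lemma \<Psi>_hopf_iso: "\<Psi> \<in> hopf_iso B (GamU \<theta> l B) (V0B_hopf \<theta> d e S B f)"
  unfolding X.base_change_hopf_eq hopf_iso_def bij_betw_def
  using \<Psi> \<Psi>_inj \<Psi>_surj \<Psi>_comult \<Psi>_counit \<Psi>_antipode by simp

end

lemma alg_hom_V0B: "alg_hom B P (V0B_hopf \<theta> d e S B f) = alg_hom B P W"
  unfolding X.base_change_hopf_eq by simp

end

theorem theorem3p10:
  fixes \<theta> l :: nat
    and B :: "('b, 'l) ring_scheme"
    and \<iota> :: "qfun set \<Rightarrow> 'b"
    and d :: "(V0_gen list \<Rightarrow> qfun) set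
        \<Rightarrow> ((V0_gen list \<Rightarrow> qfun) set \<times> (V0_gen list \<Rightarrow> qfun) set \<Rightarrow> qfun) set"
    and e :: "(V0_gen list \<Rightarrow> qfun) set \<Rightarrow> qfun"
    and S :: "(V0_gen list \<Rightarrow> qfun) set \<Rightarrow> (V0_gen list \<Rightarrow> qfun) set"
  assumes theta: "\<theta> \<ge> 1"
    and l: "l \<ge> 1"
    and B: "is_fraction_field (laurent Quot cyc_ideal l) B \<iota>"
    and xi: "spec l \<iota> qv [^]\<^bsub>B\<^esub> (2 :: nat) \<noteq> \<one>\<^bsub>B\<^esub>"
    and hopf: "hopf_algebra laurent (V0_hopf \<theta> d e S)"
    and d_K: "\<And>i. i \<in> {1..\<theta>} \<Longrightarrow> d (V0_elt \<theta> (Kgen i))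
        = tens laurent (V0 \<theta>) (V0 \<theta>) (V0_elt \<theta> (Kgen i)) (V0_elt \<theta> (Kgen i))"
    and d_Kinv: "\<And>i. i \<in> {1..\<theta>} \<Longrightarrow> d (V0_elt \<theta> (Kinv i))
        = tens laurent (V0 \<theta>) (V0 \<theta>) (V0_elt \<theta> (Kinv i)) (V0_elt \<theta> (Kinv i))"
  shows "\<exists>\<Psi> \<in> hopf_iso B (GamU \<theta> l B) (V0B_hopf \<theta> d e S B (spec l \<iota>)).
      (\<forall>i\<in>{1..\<theta>}. \<Psi> (g_elt \<theta> l B i) = V0B_elt \<theta> B (spec l \<iota>) (Kgen i)
               \<and> \<Psi> (t_elt \<theta> l B i) = h_elt \<theta> B (spec l \<iota>) l i)
      \<and> (\<forall>\<Phi> \<in> alg_hom B (GamU \<theta> l B) (V0B_hopf \<theta> d e S B (spec l \<iota>)).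
           (\<forall>i\<in>{1..\<theta>}. \<Phi> (g_elt \<theta> l B i) = V0B_elt \<theta> B (spec l \<iota>) (Kgen i)
                    \<and> \<Phi> (t_elt \<theta> l B i) = h_elt \<theta> B (spec l \<iota>) l i)
           \<longrightarrow> (\<forall>x\<in>carrier (GamU \<theta> l B). \<Phi> x = \<Psi> x))"
proof -
  interpret root_of_unity l B \<iota> by (rule root_of_unity.intro[OF l B xi])
  interpret specialization l B \<iota> \<theta> d e S
    by (intro specialization.intro root_of_unity_axioms V0_hopf_alg.intro GamU_alg.intro
        GamU_alg_axioms.intro Bf.is_cring l hopf d_K d_Kinv)
  obtain \<Psi> where \<Psi>: "\<Psi> \<in> alg_hom B Ga.T W"
    "\<And>i. i \<in> {1..\<theta>} \<Longrightarrow> \<Psi> (Ga.G i) = \<kappa> i" "\<And>i. i \<in> {1..\<theta>} \<Longrightarrow> \<Psi> (Ga.t i) = \<eta> i"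
    using exists_\<Psi> by blast
  show ?thesis
  proof (intro bexI[of _ \<Psi>] conjI ballI impI)
    show "\<Psi> \<in> hopf_iso B (GamU \<theta> l B) (V0B_hopf \<theta> d e S B f)" by (rule \<Psi>_hopf_iso[OF \<Psi>])
    fix \<Phi> x
    assume \<Phi>: "\<Phi> \<in> alg_hom B (GamU \<theta> l B) (V0B_hopf \<theta> d e S B f)"
      and g: "\<forall>i\<in>{1..\<theta>}. \<Phi> (Ga.G i) = \<kappa> i \<and> \<Phi> (Ga.t i) = \<eta> i"
      and x: "x \<in> carrier (GamU \<theta> l B)"
    have "\<Phi> \<in> alg_hom B Ga.T W" using \<Phi> unfolding alg_hom_V0B by simp
    then show "\<Phi> x = \<Psi> x"
      using Ga.T_hom_eqI[OF X.W.assoc_algebra_axioms _ \<Psi>(1)] g \<Psi>(2,3) x by simp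
  qed (use \<Psi> in auto)
qed

end
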